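(* Let $g$ be a Lipschitz driver. Let $\xi\in\mathcal{S}^2$ be an optional process which is right upper semicontinuous, and let $(\xi^n)_{n\in\mathbb{N}}$ be a nonincreasing sequence of RCLL optional processes with $\xi^n\ge\xi$, $E[\sup_{t\in[0,T]}(\xi^n_t)^2]<\infty$, $\xi^n\downarrow\xi$ and $\|\xi^n-\xi\|_{\mathcal{S}^2}\to0$. For each $n$ let $(Y^n,Z^n,l^n,A^n)$ be the solution of the RCLL reflected BSDE with driver $g$ and barrier $\xi^n$, and let $Y=\lim_{n\to\infty}Y^n$ be the (decreasing) limit of $(Y^n)$, the convergence holding in $L^2(\Omega\times[0,T],\mathcal{F}_T\otimes\mathcal{B}([0,T]),P\otimes dt)$. Then for each $S\in\mathcal{T}_0$ $$Y_S=\operatorname*{ess\,sup}_{\tau\in\mathcal{T}_S}\mathcal{E}^g_{S,\tau}(\xi_\tau)\quad\text{a.s.}$$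
   Context: Setting. $T>0$ is fixed; $(E,\mathcal{E})$ is a measurable space with a $\sigma$-finite positive measure $\mu$; $(\Omega,\mathcal{F},P,\mathbb{F}=(\mathcal{F}_t)_{t\ge0})$ is a filtered probability space whose filtration is complete, right continuous and quasi-left continuous, supporting a Brownian motion $W$ and an independent Poisson random measure $N$ with intensity $dt\otimes\mu(de)$; $\tilde N$ is the compensated measure. $\mathcal{T}_0$ is the set of stopping times with values in $[0,T]$ a.s., and for $S\in\mathcal{T}_0$, $\mathcal{T}_S$ is the set of stopping times $\tau$ with $S\le\tau\le T$ a.s. Spaces. $L^2_\mu$: measurable $\ell:E\to\mathbb{R}$ with $\|\ell\|_\mu^2=\int_E|\ell(e)|^2\mu(de)<\infty$. $\mathbb{H}^2$: predictable $\phi$ with $E\int_0^T\phi_t^2dt<\infty$. $\mathbb{H}^2_\mu$: predictable $\phi_t(\omega,e)$ with $E\int_0^T\|\phi_t\|_\mu^2dt<\infty$. $\mathbb{D}^2$: adapted RCLL processes with $E[\sup_{t\le T}|\phi_t|^2]<\infty$. $\mathcal{S}^2$: real-valued optional processes with $\|\phi\|_{\mathcal{S}^2}^2=E[\operatorname{ess\,sup}_{\tau\in\mathcal{T}_0}|\phi_\tau|^2]<\infty$. $\mathcal{S}^2_{pi}$: real-valued predictable increasing processes $A$ with $A_0=0$, $E(A_T^2)<\infty$. Right upper semicontinuous means: for all $\tau\in\mathcal{T}_0$ and stopping times $\tau_n\downarrow\tau$, $\xi_\tau\ge\limsup_n\xi_{\tau_n}$ a.s. Lipschitz driver: $g:\Omega\times[0,T]\times\mathbb{R}^2\times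 L^2_\mu\to\mathbb{R}$, measurable w.r.t. $\mathcal{P}\otimes\mathcal{B}(\mathbb{R}^2)\otimes\mathcal{B}(L^2_\mu)$ ($\mathcal{P}$ the predictable $\sigma$-algebra), with $g(\cdot,0,0,0)\in\mathbb{H}^2$, and with a constant $K\ge0$ such that $dP\otimes dt$-a.e. $|g(t,y_1,z_1,k_1)-g(t,y_2,z_2,k_2)|\le K(|y_1-y_2|+|z_1-z_2|+\|k_1-k_2\|_\mu)$ for all arguments. RCLL reflected BSDE with driver $g$ and barrier $\xi^n$: $(Y^n,Z^n,l^n,A^n)\in\mathbb{D}^2\times\mathbb{H}^2\times\mathbb{H}^2_\mu\times\mathcal{S}^2_{pi}$ with $A^n$ RCLL, such that a.s. for all $t\in[0,T]$, $Y^n_t=\xi^n_T+\int_t^Tg(s,Y^n_s,Z^n_s,l^n_s)ds-\int_t^TZ^n_sdW_s-\int_t^T\int_El^n_s(e)\tilde N(ds,de)+A^n_T-A^n_t$, $Y^n_t\ge\xi^n_t$, and $\int_0^T(Y^n_{t-}-\xi^n_{t-})dA^n_t=0$. It is known that such a solution exists and that $Y^n\ge Y^{n+1}$. Conditional $g$-expectation: for $\zeta\in L^2(\mathcal{F}_T)$, $\mathcal{E}^g_{t,T}(\zeta):=X_t$, where $(X,Z,l)$ is the unique (in $\mathbb{D}^2\times\mathbb{H}^2\times\mathbb{H}^2_\mu$) solution, which is taken to exist, of $X_t=\zeta+\int_t^Tg(s,X_s,Z_s,l_s)ds-\int_t^TZ_sdW_s-\int_t^T\int_El_s(e)\tilde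 N(ds,de)$. It is extended as usual to a terminal stopping time $\tau\in\mathcal{T}_0$, $\zeta\in L^2(\mathcal{F}_\tau)$, and a stopping time $S\le\tau$: $\mathcal{E}^g_{S,\tau}(\zeta)$ is the value at $S$ of the solution of the BSDE with terminal time $\tau$ and terminal value $\zeta$.
   Formalization: For a general Lipschitz driver with jumps the claim can fail, so it is additionally assumed that, for the driver g, solutions of the RCLL reflected BSDE are monotone in the barrier for all pairs of RCLL barriers, not only that Y^n ≥ Y^{n+1} for the given sequence. *)

theory Defs
  imports "HOL-Probability.Probability"
begin

section \<open>Stochastic basis with a Brownian motion and a Poisson random measure\<close>

text \<open>
  Processes are functions \<open>X t \<omega>\<close> of time and outcome, considered on \<open>[0, hor]\<close>; random fields
  are functions \<open>l t \<omega> e\<close>. The filtration is indexed by all reals, as in the library, but only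
  its members with index \<open>t \<ge> 0\<close> matter. Path properties (RCLL, increasing) are required for
  every outcome; since the filtration is complete this is no restriction up to
  indistinguishability.
\<close>

record ('w, 'e) basis =
  prb :: "'w measure"
  flt :: "real \<Rightarrow> 'w measure"
  bm :: "real \<Rightarrow> 'w \<Rightarrow> real"
  prm :: "'w \<Rightarrow> (real \<times> 'e) measure"
  mark :: "'e measure"
  hor :: real

subsection \<open>Stopping times\<close>

text \<open>Finite stopping times; values are in \<open>[0, \<infinity>)\<close> and those used below are a.s. at most \<open>hor\<close>.\<close>

definition stop :: "('w, 'e) basis \<Rightarrow> ('w \<Rightarrow> real) \<Rightarrow> bool" where
  "stop B \<tau> \<longleftrightarrow> stopping_time (flt B) \<tau> \<and> (\<forall>\<omega>\<in>space (prb B). 0 \<le> \<tau> \<omega>)"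

definition stop_from :: "('w, 'e) basis \<Rightarrow> ('w \<Rightarrow> real) \<Rightarrow> ('w \<Rightarrow> real) set" where
  "stop_from B S = {\<tau>. stop B \<tau> \<and> (AE \<omega> in prb B. S \<omega> \<le> \<tau> \<omega> \<and> \<tau> \<omega> \<le> hor B)}"

definition stop_times :: "('w, 'e) basis \<Rightarrow> ('w \<Rightarrow> real) set" where
  "stop_times B = {\<tau>. stop B \<tau> \<and> (AE \<omega> in prb B. \<tau> \<omega> \<le> hor B)}"

text \<open>
  A filtration is quasi-left continuous if \<open>F\<^sub>\<tau> = F\<^sub>\<tau>\<^sub>-\<close> at every predictable (announceable)
  time \<open>\<tau>\<close>. Finite times suffice: apply the condition to \<open>min \<tau> n\<close>.
\<close>

definition predictable_time :: "('w, 'e) basis \<Rightarrow> ('w \<Rightarrow> real) \<Rightarrow> bool" where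
  "predictable_time B \<tau> \<longleftrightarrow> stop B \<tau> \<and>
     (\<exists>\<sigma>. (\<forall>n::nat. stop B (\<sigma> n)) \<and>
          (AE \<omega> in prb B. incseq (\<lambda>n. \<sigma> n \<omega>) \<and> (0 < \<tau> \<omega> \<longrightarrow> (\<forall>n. \<sigma> n \<omega> < \<tau> \<omega>)) \<and>
                         (\<lambda>n. \<sigma> n \<omega>) \<longlonglongrightarrow> \<tau> \<omega>))"

definition sets_before :: "('w, 'e) basis \<Rightarrow> ('w \<Rightarrow> real) \<Rightarrow> 'w set set" where
  "sets_before B \<tau> = sigma_sets (space (prb B))
     (sets (flt B 0) \<union> {{\<omega> \<in> A. t < \<tau> \<omega>} |A t. 0 \<le> t \<and> A \<in> sets (flt B t)})"

definition quasi_left_continuous :: "('w, 'e) basis \<Rightarrow> bool" where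
  "quasi_left_continuous B \<longleftrightarrow>
     (\<forall>\<tau>. predictable_time B \<tau> \<longrightarrow>
        sets (filtration.pre_sigma (space (prb B)) (flt B) \<tau>) = sets_before B \<tau>)"

definition usual_filtration :: "('w, 'e) basis \<Rightarrow> bool" where
  "usual_filtration B \<longleftrightarrow>
     filtration (space (prb B)) (flt B) \<and>
     (\<forall>t. sets (flt B t) \<subseteq> sets (prb B)) \<and>
     (\<forall>A\<in>null_sets (prb B). \<forall>A'\<subseteq>A. A' \<in> sets (flt B 0)) \<and>
     (\<forall>t\<ge>0. sets (flt B t) = (\<Inter>s\<in>{t<..}. sets (flt B s))) \<and>
     quasi_left_continuous B"

subsection \<open>The driving noises\<close>

definition brownian :: "('w, 'e) basis \<Rightarrow> bool" where
  "brownian B \<longleftrightarrow>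
     (\<forall>t\<ge>0. bm B t \<in> borel_measurable (flt B t)) \<and>
     (AE \<omega> in prb B. bm B 0 \<omega> = 0 \<and> continuous_on {0..} (\<lambda>t. bm B t \<omega>)) \<and>
     (\<forall>s t. 0 \<le> s \<and> s < t \<longrightarrow>
        distributed (prb B) lborel (\<lambda>\<omega>. bm B t \<omega> - bm B s \<omega>) (normal_density 0 (sqrt (t - s))) \<and>
        prob_space.indep_set (prb B) (sets (flt B s))
          {(\<lambda>\<omega>. bm B t \<omega> - bm B s \<omega>) -` D \<inter> space (prb B) |D. D \<in> sets borel})"

definition marked_sets :: "('w, 'e) basis \<Rightarrow> (real \<times> 'e) set set" where
  "marked_sets B = sets (borel \<Otimes>\<^sub>M mark B)"

text \<open>The intensity \<open>dt \<otimes> \<mu>(de)\<close> lives on \<open>(0, \<infinity>) \<times> E\<close>.\<close>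

definition intensity :: "('w, 'e) basis \<Rightarrow> (real \<times> 'e) set \<Rightarrow> ennreal" where
  "intensity B C = emeasure (lborel \<Otimes>\<^sub>M mark B) (C \<inter> {0<..} \<times> space (mark B))"

definition prm_events :: "('w, 'e) basis \<Rightarrow> real set \<Rightarrow> 'w set set" where
  "prm_events B I = sigma_sets (space (prb B))
     {{\<omega> \<in> space (prb B). emeasure (prm B \<omega>) C \<in> D} |C D.
        C \<in> marked_sets B \<and> C \<subseteq> I \<times> space (mark B) \<and> D \<in> sets borel}"

definition poisson_measure :: "('w, 'e) basis \<Rightarrow> bool" where
  "poisson_measure B \<longleftrightarrow>
     (\<forall>\<omega>\<in>space (prb B). sets (prm B \<omega>) = marked_sets B) \<and>
     (\<forall>C\<in>marked_sets B. (\<lambda>\<omega>. emeasure (prm B \<omega>) C) \<in> borel_measurable (prb B)) \<and>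
     (\<forall>t\<ge>0. prm_events B {..t} \<subseteq> sets (flt B t)) \<and>
     (\<forall>C\<in>marked_sets B. intensity B C < \<infinity> \<longrightarrow>
        (\<forall>k. measure (prb B) {\<omega> \<in> space (prb B). emeasure (prm B \<omega>) C = of_nat k}
              = enn2real (intensity B C) ^ k / fact k * exp (- enn2real (intensity B C)))) \<and>
     (\<forall>(J::nat set) C. finite J \<and> (\<forall>j\<in>J. C j \<in> marked_sets B) \<and> disjoint_family_on C J \<longrightarrow>
        prob_space.indep_vars (prb B) (\<lambda>_. borel) (\<lambda>j \<omega>. emeasure (prm B \<omega>) (C j)) J) \<and>
     (\<forall>s\<ge>0. prob_space.indep_set (prb B) (sets (flt B s)) (prm_events B {s<..}))"

definition jump_basis :: "('w, 'e) basis \<Rightarrow> bool" where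
  "jump_basis B \<longleftrightarrow>
     0 < hor B \<and> prob_space (prb B) \<and> sigma_finite_measure (mark B) \<and>
     usual_filtration B \<and> brownian B \<and> poisson_measure B \<and>
     prob_space.indep_set (prb B)
       (sigma_sets (space (prb B)) {bm B t -` D \<inter> space (prb B) |t D. 0 \<le> t \<and> D \<in> sets borel})
       (prm_events B UNIV)"

section \<open>Spaces of processes\<close>

definition adapted :: "('w, 'e) basis \<Rightarrow> (real \<Rightarrow> 'w \<Rightarrow> real) \<Rightarrow> bool" where
  "adapted B X \<longleftrightarrow> (\<forall>t\<in>{0..hor B}. X t \<in> borel_measurable (flt B t))"

definition rcll :: "real \<Rightarrow> (real \<Rightarrow> real) \<Rightarrow> bool" where
  "rcll b x \<longleftrightarrow> (\<forall>t\<in>{0..<b}. (x \<longlongrightarrow> x t) (at_right t)) \<and> (\<forall>t\<in>{0<..b}. \<exists>L. (x \<longlongrightarrow> L) (at_left t))"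

definition rcll_paths :: "('w, 'e) basis \<Rightarrow> (real \<Rightarrow> 'w \<Rightarrow> real) \<Rightarrow> bool" where
  "rcll_paths B X \<longleftrightarrow> (\<forall>\<omega>\<in>space (prb B). rcll (hor B) (\<lambda>t. X t \<omega>))"

text \<open>\<open>dt \<otimes> P\<close> on \<open>[0, hor] \<times> \<Omega>\<close>, and the predictable and optional sigma-algebras there.\<close>

definition dtP :: "('w, 'e) basis \<Rightarrow> (real \<times> 'w) measure" where
  "dtP B = restrict_space lborel {0..hor B} \<Otimes>\<^sub>M prb B"

definition pred_sigma :: "('w, 'e) basis \<Rightarrow> (real \<times> 'w) measure" where
  "pred_sigma B = sigma ({0..hor B} \<times> space (prb B))
     ({{0} \<times> A |A. A \<in> sets (flt B 0)} \<union>
      {{s<..t} \<times> A |s t A. 0 \<le> s \<and> s \<le> t \<and> t \<le> hor B \<and> A \<in> sets (flt B s)})"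

definition opt_sigma :: "('w, 'e) basis \<Rightarrow> (real \<times> 'w) measure" where
  "opt_sigma B = sigma ({0..hor B} \<times> space (prb B))
     {{(t, \<omega>) \<in> {0..hor B} \<times> space (prb B). X t \<omega> \<in> D} |X D.
        adapted B X \<and> rcll_paths B X \<and> D \<in> sets borel}"

definition predictable :: "('w, 'e) basis \<Rightarrow> (real \<Rightarrow> 'w \<Rightarrow> real) \<Rightarrow> bool" where
  "predictable B X \<longleftrightarrow> (\<lambda>(t, \<omega>). X t \<omega>) \<in> borel_measurable (pred_sigma B)"

definition optional :: "('w, 'e) basis \<Rightarrow> (real \<Rightarrow> 'w \<Rightarrow> real) \<Rightarrow> bool" where
  "optional B X \<longleftrightarrow> (\<lambda>(t, \<omega>). X t \<omega>) \<in> borel_measurable (opt_sigma B)"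

definition predictable_field :: "('w, 'e) basis \<Rightarrow> (real \<Rightarrow> 'w \<Rightarrow> 'e \<Rightarrow> real) \<Rightarrow> bool" where
  "predictable_field B l \<longleftrightarrow>
     (\<lambda>((t, \<omega>), e). l t \<omega> e) \<in> borel_measurable (pred_sigma B \<Otimes>\<^sub>M mark B)"

text \<open>\<open>L2mu\<close> consists of functions, not classes; \<open>norm_mu\<close> is a seminorm on it.\<close>

definition L2mu :: "('w, 'e) basis \<Rightarrow> ('e \<Rightarrow> real) set" where
  "L2mu B = {k \<in> borel_measurable (mark B). (\<integral>\<^sup>+ e. ennreal ((k e)\<^sup>2) \<partial>mark B) < \<infinity>}"

definition norm_mu :: "('w, 'e) basis \<Rightarrow> ('e \<Rightarrow> real) \<Rightarrow> real" where
  "norm_mu B k = sqrt (\<integral>e. (k e)\<^sup>2 \<partial>mark B)"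

text \<open>The Borel sigma-algebra of the seminorm topology of \<open>L2mu\<close>.\<close>

definition borel_L2mu :: "('w, 'e) basis \<Rightarrow> ('e \<Rightarrow> real) measure" where
  "borel_L2mu B = sigma (L2mu B)
     {U. U \<subseteq> L2mu B \<and>
         (\<forall>k\<in>U. \<exists>\<epsilon>>0. \<forall>k'\<in>L2mu B. norm_mu B (\<lambda>e. k' e - k e) < \<epsilon> \<longrightarrow> k' \<in> U)}"

definition H2 :: "('w, 'e) basis \<Rightarrow> (real \<Rightarrow> 'w \<Rightarrow> real) set" where
  "H2 B = {\<phi>. predictable B \<phi> \<and> (\<integral>\<^sup>+ (t, \<omega>). ennreal ((\<phi> t \<omega>)\<^sup>2) \<partial>dtP B) < \<infinity>}"

definition H2mu :: "('w, 'e) basis \<Rightarrow> (real \<Rightarrow> 'w \<Rightarrow> 'e \<Rightarrow> real) set" where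
  "H2mu B = {l. predictable_field B l \<and>
     (\<integral>\<^sup>+ (t, \<omega>). (\<integral>\<^sup>+ e. ennreal ((l t \<omega> e)\<^sup>2) \<partial>mark B) \<partial>dtP B) < \<infinity>}"

definition sup_sq :: "('w, 'e) basis \<Rightarrow> (real \<Rightarrow> 'w \<Rightarrow> real) \<Rightarrow> ennreal" where
  "sup_sq B X = (\<integral>\<^sup>+ \<omega>. (SUP t\<in>{0..hor B}. ennreal ((X t \<omega>)\<^sup>2)) \<partial>prb B)"

definition D2 :: "('w, 'e) basis \<Rightarrow> (real \<Rightarrow> 'w \<Rightarrow> real) set" where
  "D2 B = {X. adapted B X \<and> rcll_paths B X \<and> sup_sq B X < \<infinity>}"

text \<open>
  Essential supremum of a family of random variables (the library constant \<open>esssup\<close> is the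
  essential supremum of a single function). It is determined up to almost sure equality.
\<close>

definition is_ess_sup ::
  "'w measure \<Rightarrow> ('w \<Rightarrow> 'b) set \<Rightarrow>
     ('w \<Rightarrow> 'b :: {complete_linorder, linorder_topology, second_countable_topology}) \<Rightarrow> bool" where
  "is_ess_sup M \<Phi> Z \<longleftrightarrow> Z \<in> borel_measurable M \<and> (\<forall>f\<in>\<Phi>. AE \<omega> in M. f \<omega> \<le> Z \<omega>) \<and>
     (\<forall>Z'\<in>borel_measurable M. (\<forall>f\<in>\<Phi>. AE \<omega> in M. f \<omega> \<le> Z' \<omega>) \<longrightarrow> (AE \<omega> in M. Z \<omega> \<le> Z' \<omega>))"

definition ess_sup ::
  "'w measure \<Rightarrow> ('w \<Rightarrow> 'b) set \<Rightarrow>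
     'w \<Rightarrow> 'b :: {complete_linorder, linorder_topology, second_countable_topology}" where
  "ess_sup M \<Phi> = (SOME Z. is_ess_sup M \<Phi> Z)"

definition S2_norm_sq :: "('w, 'e) basis \<Rightarrow> (real \<Rightarrow> 'w \<Rightarrow> real) \<Rightarrow> ennreal" where
  "S2_norm_sq B \<phi> =
     (\<integral>\<^sup>+ \<omega>. ess_sup (prb B) {\<lambda>\<omega>. ennreal (\<bar>\<phi> (\<tau> \<omega>) \<omega>\<bar>\<^sup>2) |\<tau>. \<tau> \<in> stop_times B} \<omega> \<partial>prb B)"

definition S2 :: "('w, 'e) basis \<Rightarrow> (real \<Rightarrow> 'w \<Rightarrow> real) set" where
  "S2 B = {\<phi>. optional B \<phi> \<and> S2_norm_sq B \<phi> < \<infinity>}"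

definition S2pi :: "('w, 'e) basis \<Rightarrow> (real \<Rightarrow> 'w \<Rightarrow> real) set" where
  "S2pi B = {A. predictable B A \<and>
     (\<forall>\<omega>\<in>space (prb B). A 0 \<omega> = 0 \<and> mono_on {0..hor B} (\<lambda>t. A t \<omega>)) \<and>
     (\<integral>\<^sup>+ \<omega>. ennreal ((A (hor B) \<omega>)\<^sup>2) \<partial>prb B) < \<infinity>}"

definition right_usc :: "('w, 'e) basis \<Rightarrow> (real \<Rightarrow> 'w \<Rightarrow> real) \<Rightarrow> bool" where
  "right_usc B \<xi> \<longleftrightarrow>
     (\<forall>\<tau>\<in>stop_times B. \<forall>\<sigma>.
        (\<forall>n::nat. \<sigma> n \<in> stop_times B) \<and>
        (AE \<omega> in prb B. decseq (\<lambda>n. \<sigma> n \<omega>) \<and> (\<lambda>n. \<sigma> n \<omega>) \<longlonglongrightarrow> \<tau> \<omega>) \<longrightarrow>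
        (AE \<omega> in prb B. limsup (\<lambda>n. ereal (\<xi> (\<sigma> n \<omega>) \<omega>)) \<le> ereal (\<xi> (\<tau> \<omega>) \<omega>)))"

section \<open>Stochastic integrals\<close>

text \<open>
  The integral process of an integrand in \<open>H2\<close> (resp. \<open>H2mu\<close>) is the adapted RCLL process whose
  values are the \<open>L\<^sup>2(P)\<close>-limits of the elementary integrals of simple predictable integrands that
  approximate it in \<open>H2\<close> (resp. \<open>H2mu\<close>). It is determined up to indistinguishability.
  A simple integrand is a list of triples \<open>(h, s, u)\<close>, standing for the sum of
  \<open>h 1\<^bsub>(s,u]\<^esub>\<close>, resp. of quadruples \<open>(h, s, u, C)\<close>, standing for the sum of \<open>h 1\<^bsub>(s,u] \<times> C\<^esub>\<close>.
\<close>

definition step_coeff :: "('w, 'e) basis \<Rightarrow> ('w \<Rightarrow> real) \<Rightarrow> real \<Rightarrow> real \<Rightarrow> bool" where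
  "step_coeff B h s u \<longleftrightarrow> 0 \<le> s \<and> s \<le> u \<and> u \<le> hor B \<and>
     h \<in> borel_measurable (flt B s) \<and> bounded (h ` space (prb B))"

definition step_fun :: "(('w \<Rightarrow> real) \<times> real \<times> real) list \<Rightarrow> real \<Rightarrow> 'w \<Rightarrow> real" where
  "step_fun c t \<omega> = (\<Sum>(h, s, u)\<leftarrow>c. h \<omega> * indicator {s<..u} t)"

definition step_int ::
  "('w, 'e) basis \<Rightarrow> (('w \<Rightarrow> real) \<times> real \<times> real) list \<Rightarrow> real \<Rightarrow> 'w \<Rightarrow> real" where
  "step_int B c t \<omega> = (\<Sum>(h, s, u)\<leftarrow>c. h \<omega> * (bm B (min u t) \<omega> - bm B (min s t) \<omega>))"

definition is_ito_integral ::
  "('w, 'e) basis \<Rightarrow> (real \<Rightarrow> 'w \<Rightarrow> real) \<Rightarrow> (real \<Rightarrow> 'w \<Rightarrow> real) \<Rightarrow> bool" where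
  "is_ito_integral B Z I \<longleftrightarrow> adapted B I \<and> rcll_paths B I \<and>
     (\<exists>c. (\<forall>n::nat. \<forall>(h, s, u)\<in>set (c n). step_coeff B h s u) \<and>
          (\<lambda>n. \<integral>\<^sup>+ (t, \<omega>). ennreal ((step_fun (c n) t \<omega> - Z t \<omega>)\<^sup>2) \<partial>dtP B) \<longlonglongrightarrow> 0 \<and>
          (\<forall>t\<in>{0..hor B}.
             (\<lambda>n. \<integral>\<^sup>+ \<omega>. ennreal ((step_int B (c n) t \<omega> - I t \<omega>)\<^sup>2) \<partial>prb B) \<longlonglongrightarrow> 0))"

definition ito_integral ::
  "('w, 'e) basis \<Rightarrow> (real \<Rightarrow> 'w \<Rightarrow> real) \<Rightarrow> real \<Rightarrow> 'w \<Rightarrow> real" where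
  "ito_integral B Z = (SOME I. is_ito_integral B Z I)"

definition step_field ::
  "(('w \<Rightarrow> real) \<times> real \<times> real \<times> 'e set) list \<Rightarrow> real \<Rightarrow> 'w \<Rightarrow> 'e \<Rightarrow> real" where
  "step_field c t \<omega> e = (\<Sum>(h, s, u, C)\<leftarrow>c. h \<omega> * indicator {s<..u} t * indicator C e)"

definition step_jump_int ::
  "('w, 'e) basis \<Rightarrow> (('w \<Rightarrow> real) \<times> real \<times> real \<times> 'e set) list \<Rightarrow> real \<Rightarrow> 'w \<Rightarrow> real" where
  "step_jump_int B c t \<omega> =
     (\<Sum>(h, s, u, C)\<leftarrow>c. h \<omega> *
        (measure (prm B \<omega>) ({min s t<..min u t} \<times> C) - (min u t - min s t) * measure (mark B) C))"

definition is_jump_integral ::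
  "('w, 'e) basis \<Rightarrow> (real \<Rightarrow> 'w \<Rightarrow> 'e \<Rightarrow> real) \<Rightarrow> (real \<Rightarrow> 'w \<Rightarrow> real) \<Rightarrow> bool" where
  "is_jump_integral B l I \<longleftrightarrow> adapted B I \<and> rcll_paths B I \<and>
     (\<exists>c. (\<forall>n::nat. \<forall>(h, s, u, C)\<in>set (c n). step_coeff B h s u \<and>
              C \<in> sets (mark B) \<and> emeasure (mark B) C < \<infinity>) \<and>
          (\<lambda>n. \<integral>\<^sup>+ (t, \<omega>). (\<integral>\<^sup>+ e. ennreal ((step_field (c n) t \<omega> e - l t \<omega> e)\<^sup>2) \<partial>mark B) \<partial>dtP B)
             \<longlonglongrightarrow> 0 \<and>
          (\<forall>t\<in>{0..hor B}.
             (\<lambda>n. \<integral>\<^sup>+ \<omega>. ennreal ((step_jump_int B (c n) t \<omega> - I t \<omega>)\<^sup>2) \<partial>prb B) \<longlonglongrightarrow> 0))"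

definition jump_integral ::
  "('w, 'e) basis \<Rightarrow> (real \<Rightarrow> 'w \<Rightarrow> 'e \<Rightarrow> real) \<Rightarrow> real \<Rightarrow> 'w \<Rightarrow> real" where
  "jump_integral B l = (SOME I. is_jump_integral B l I)"

section \<open>Backward equations\<close>

type_synonym ('w, 'e) driver = "real \<Rightarrow> 'w \<Rightarrow> real \<Rightarrow> real \<Rightarrow> ('e \<Rightarrow> real) \<Rightarrow> real"

definition lipschitz_driver :: "('w, 'e) basis \<Rightarrow> ('w, 'e) driver \<Rightarrow> bool" where
  "lipschitz_driver B g \<longleftrightarrow>
     (\<lambda>((t, \<omega>), (y, z), k). g t \<omega> y z k)
        \<in> borel_measurable (pred_sigma B \<Otimes>\<^sub>M (borel \<Otimes>\<^sub>M borel) \<Otimes>\<^sub>M borel_L2mu B) \<and>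
     (\<lambda>t \<omega>. g t \<omega> 0 0 (\<lambda>_. 0)) \<in> H2 B \<and>
     (\<exists>K\<ge>0. AE (t, \<omega>) in dtP B. \<forall>y1 y2 z1 z2. \<forall>k1\<in>L2mu B. \<forall>k2\<in>L2mu B.
        \<bar>g t \<omega> y1 z1 k1 - g t \<omega> y2 z2 k2\<bar>
          \<le> K * (\<bar>y1 - y2\<bar> + \<bar>z1 - z2\<bar> + norm_mu B (\<lambda>e. k1 e - k2 e)))"

text \<open>
  The time integral is taken with respect to the completed Lebesgue measure because \<open>l s \<omega>\<close>
  belongs to \<open>L2mu\<close>, where \<open>g\<close> is measurable, only for almost every \<open>s\<close>.
\<close>

definition drift ::
  "('w, 'e) driver \<Rightarrow> (real \<Rightarrow> 'w \<Rightarrow> real) \<Rightarrow> (real \<Rightarrow> 'w \<Rightarrow> real) \<Rightarrow> (real \<Rightarrow> 'w \<Rightarrow> 'e \<Rightarrow> real) \<Rightarrow>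
     real \<Rightarrow> real \<Rightarrow> 'w \<Rightarrow> real" where
  "drift g Y Z l a b \<omega> = (LINT s:{a..b}|lebesgue. g s \<omega> (Y s \<omega>) (Z s \<omega>) (l s \<omega>))"

definition bsde_solution ::
  "('w, 'e) basis \<Rightarrow> ('w, 'e) driver \<Rightarrow> ('w \<Rightarrow> real) \<Rightarrow> ('w \<Rightarrow> real) \<Rightarrow>
     (real \<Rightarrow> 'w \<Rightarrow> real) \<Rightarrow> (real \<Rightarrow> 'w \<Rightarrow> real) \<Rightarrow> (real \<Rightarrow> 'w \<Rightarrow> 'e \<Rightarrow> real) \<Rightarrow> bool" where
  "bsde_solution B g \<tau> \<zeta> X Z l \<longleftrightarrow> X \<in> D2 B \<and> Z \<in> H2 B \<and> l \<in> H2mu B \<and>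
     (AE \<omega> in prb B. \<forall>t\<in>{0..\<tau> \<omega>}.
        X t \<omega> = \<zeta> \<omega> + drift g X Z l t (\<tau> \<omega>) \<omega>
          - (ito_integral B Z (\<tau> \<omega>) \<omega> - ito_integral B Z t \<omega>)
          - (jump_integral B l (\<tau> \<omega>) \<omega> - jump_integral B l t \<omega>))"

text \<open>The process values on \<open>[0, \<tau>]\<close> are unique up to indistinguishability, so the choice is harmless.\<close>

definition g_expectation ::
  "('w, 'e) basis \<Rightarrow> ('w, 'e) driver \<Rightarrow> ('w \<Rightarrow> real) \<Rightarrow> ('w \<Rightarrow> real) \<Rightarrow> ('w \<Rightarrow> real) \<Rightarrow> 'w \<Rightarrow> real" where
  "g_expectation B g S \<tau> \<zeta> \<omega> = (SOME X. \<exists>Z l. bsde_solution B g \<tau> \<zeta> X Z l) (S \<omega>) \<omega>"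

text \<open>
  Lebesgue-Stieltjes measure of an increasing RCLL path \<open>a\<close> on \<open>[0, b]\<close>, which is extended
  constantly outside. There is no mass at \<open>0\<close> when \<open>a 0 = 0\<close>, so integrals are over \<open>(0, b]\<close>.
\<close>

definition stieltjes :: "real \<Rightarrow> (real \<Rightarrow> real) \<Rightarrow> real measure" where
  "stieltjes b a = interval_measure (\<lambda>s. a (max 0 (min b s)))"

definition reflected_solution ::
  "('w, 'e) basis \<Rightarrow> ('w, 'e) driver \<Rightarrow> (real \<Rightarrow> 'w \<Rightarrow> real) \<Rightarrow>
     (real \<Rightarrow> 'w \<Rightarrow> real) \<Rightarrow> (real \<Rightarrow> 'w \<Rightarrow> real) \<Rightarrow> (real \<Rightarrow> 'w \<Rightarrow> 'e \<Rightarrow> real) \<Rightarrow>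
     (real \<Rightarrow> 'w \<Rightarrow> real) \<Rightarrow> bool" where
  "reflected_solution B g \<xi> Y Z l A \<longleftrightarrow>
     Y \<in> D2 B \<and> Z \<in> H2 B \<and> l \<in> H2mu B \<and> A \<in> S2pi B \<and> rcll_paths B A \<and>
     (AE \<omega> in prb B.
        (\<forall>t\<in>{0..hor B}.
           Y t \<omega> = \<xi> (hor B) \<omega> + drift g Y Z l t (hor B) \<omega>
             - (ito_integral B Z (hor B) \<omega> - ito_integral B Z t \<omega>)
             - (jump_integral B l (hor B) \<omega> - jump_integral B l t \<omega>)
             + A (hor B) \<omega> - A t \<omega> \<and>
           \<xi> t \<omega> \<le> Y t \<omega>) \<and>
        (LINT t:{0<..hor B}|stieltjes (hor B) (\<lambda>t. A t \<omega>).
           Lim (at_left t) (\<lambda>s. Y s \<omega>) - Lim (at_left t) (\<lambda>s. \<xi> s \<omega>)) = 0)"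

definition rcll_barrier :: "('w, 'e) basis \<Rightarrow> (real \<Rightarrow> 'w \<Rightarrow> real) \<Rightarrow> bool" where
  "rcll_barrier B \<xi> \<longleftrightarrow> optional B \<xi> \<and> rcll_paths B \<xi> \<and> sup_sq B \<xi> < \<infinity>"

section \<open>Standing facts about the driver\<close>

definition bsde_solvable :: "('w, 'e) basis \<Rightarrow> ('w, 'e) driver \<Rightarrow> bool" where
  "bsde_solvable B g \<longleftrightarrow>
     (\<forall>\<zeta>\<in>borel_measurable (flt B (hor B)). (\<integral>\<^sup>+ \<omega>. ennreal ((\<zeta> \<omega>)\<^sup>2) \<partial>prb B) < \<infinity> \<longrightarrow>
        (\<exists>X Z l. bsde_solution B g (\<lambda>_. hor B) \<zeta> X Z l))"

text \<open>
  Monotone dependence of the RCLL reflected solution on the barrier. With jumps the Lipschitz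
  property of \<open>g\<close> alone does not imply it.
\<close>

definition reflected_monotone :: "('w, 'e) basis \<Rightarrow> ('w, 'e) driver \<Rightarrow> bool" where
  "reflected_monotone B g \<longleftrightarrow>
     (\<forall>\<xi> \<xi>' Y Y' Z Z' l l' A A'.
        rcll_barrier B \<xi> \<and> rcll_barrier B \<xi>' \<and>
        (AE \<omega> in prb B. \<forall>t\<in>{0..hor B}. \<xi>' t \<omega> \<le> \<xi> t \<omega>) \<and>
        reflected_solution B g \<xi> Y Z l A \<and> reflected_solution B g \<xi>' Y' Z' l' A' \<longrightarrow>
        (AE \<omega> in prb B. \<forall>t\<in>{0..hor B}. Y' t \<omega> \<le> Y t \<omega>))"

end

theory Submission imports Defs begin

text \<open>
The value of the optimal stopping problem is squeezed between two comparisons with the reflected solutions \<open>Y\<^sup>n\<close>.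

\<^bold>\<open>Upper bound.\<close> Up to any stopping time \<open>\<tau>\<close> the process \<open>Y\<^sup>n\<close> solves the equation with an additional increasing process,
and at \<open>\<tau>\<close> it lies above \<open>\<xi>\<^sup>n \<ge> \<xi>\<close>; hence it lies above the conditional expectation of \<open>\<xi>\<^sub>\<tau>\<close> (\<open>comparison\<close>), and so does the
limit \<open>Y\<close>. The comparison is derived from monotonicity of reflected solutions in their barriers. A process that solves the equation with
an increasing process reflects at itself, so the larger process can serve as its own barrier, and the minimum of both as a barrier of
the smaller one. This needs solutions on all of \<open>[0, T]\<close>. Beyond \<open>\<tau>\<close> both processes are therefore continued without noise by
subtracting one common process \<open>Dec\<close>, which grows so fast, by a Gronwall argument (\<open>exponential_majorant\<close>), that what remains after
the drift is removed is still increasing (\<open>extended_equation\<close>).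

\<^bold>\<open>Lower bound.\<close> Start at \<open>S\<close> and stop when \<open>Y\<^sup>n\<close> is within \<open>1/(n+1)\<close> of its barrier. Before that time the increasing process is
flat by the Skorokhod condition (\<open>skorokhod_flat\<close>), so \<open>Y\<^sup>n\<close> solves the equation without reflection. At that time it differs from
\<open>\<xi>\<close> by at most \<open>1/(n+1)\<close> plus \<open>\<xi>\<^sup>n - \<xi>\<close>, which is small in \<open>L\<^sup>2\<close> uniformly over all stopping times. By stability of the equation
(\<open>global_stability\<close>) its value at \<open>S\<close> is then close in \<open>L\<^sup>2\<close> to the conditional expectation of \<open>\<xi>\<close> at that time, and along
a subsequence the expectations converge to \<open>Y\<^sub>S\<close> almost surely.

\<^bold>\<open>Stability and existence.\<close> Stability rests on an energy estimate between two stopping times within a short interval of time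
(\<open>local_stability\<close>), which uses only the isometry of the stochastic integral, orthogonality of its increments to the past, and the
Lipschitz condition; finitely many short intervals cover \<open>[0, T]\<close>. The same estimate makes a correction of the terminal value
contract, which extends solvability from the deterministic terminal time to terminal stopping times (\<open>solvable_at_stop\<close>), and it
gives uniqueness, so that the conditional expectation is the value of any solution (\<open>g_expectation_eq\<close>).

\<^bold>\<open>The stochastic integral.\<close> The Brownian motion and the compensated Poisson measure are treated as one noise, over the marks
enlarged by a point that stands for the Brownian motion. All that enters is that the increments of this noise are orthogonal to the
past and have deterministic conditional covariances; the two parts are orthogonal since over short intervals the expected product
of their increments is of smaller order than the length (\<open>noise_covar_bound\<close>). Step fields are dense among square integrable
predictable fields (\<open>step_fields_dense\<close>), the isometry and a maximal inequality give an integral with RCLL paths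
(\<open>integral_exists\<close>), and approximation on grids shows that stopping the integral amounts to cutting off the integrand
(\<open>is_int_stopped\<close>).

The driver depends on an integrand through its values in \<open>L\<^sup>2\<close> of the marks. Off a null set these are limits of countably valued
maps (\<open>strong_approx\<close>), so the driver along a solution is measurable up to a null set, and its time integral makes sense.

Conventions: \<open>Bor\<close>, \<open>ind\<close> and \<open>M \<otimes> N\<close> abbreviate measurability into the Borel sets, indicators and product measures, \<open>---->\<close>
is convergence of sequences, and \<open>\<E>\<close> is the expectation under the measure of the basis.
\<close>

abbreviation (input) seq_limit ("((_)/ ----> (_))" [60,60] 60) where
 "f ----> l \<equiv> (f \<longlongrightarrow> l) sequentially"

abbreviation (input) pair_meas (infixr "\<otimes>" 80) where "M \<otimes> N \<equiv> pair_measure M N"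

abbreviation (input) equivalent (infixr "<->" 25) where "A <-> B \<equiv> A = (B :: bool)"

abbreviation (input) "ind \<equiv> indicator"

abbreviation (input) "Bor M \<equiv> borel_measurable M"

section \<open>Square integrable functions\<close>

text \<open>The squared \<open>L\<^sup>2\<close> norm with values in \<open>[0, \<infinity>]\<close>, so that it can be manipulated before square
 integrability is known.\<close>

definition L2n :: "'a measure => ('a => real) => ennreal" where
 "L2n M f = (\<integral>\<^sup>+ x. ennreal ((f x)^2) \<partial>M)"

definition sqi :: "'a measure => ('a => real) => bool" where
 "sqi M f <-> f : Bor M & L2n M f < \<infinity>"

lemma sqi_measurable [measurable_dest]: "sqi M f ==> f : Bor M"
 by (simp add: sqi_def)

lemma sqi_integrable_square: "sqi M f ==> integrable M (%x. (f x)^2)"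
 by (intro integrableI_bounded) (auto simp: sqi_def L2n_def)

lemma L2n_eq_integral: "sqi M f ==> L2n M f = ennreal (\<integral>x. (f x)^2 \<partial>M)"
 unfolding L2n_def by (intro nn_integral_eq_integral sqi_integrable_square) auto

lemma sqiI: "f : Bor M ==> integrable M (%x. (f x)^2) ==> sqi M f"
 unfolding sqi_def L2n_def by (auto simp: integrable_iff_bounded)

lemma L2n_mono: "(!!x. x : space M ==> abs (f x) <= abs (g x)) ==> L2n M f <= L2n M g"
 unfolding L2n_def by (intro nn_integral_mono ennreal_leI) (simp add: abs_le_square_iff)

lemma L2n_mono_AE: "(AE x in M. abs (f x) <= abs (g x)) ==> L2n M f <= L2n M g"
 unfolding L2n_def by (intro nn_integral_mono_AE) (auto elim!: eventually_mono simp: abs_le_square_iff intro!: ennreal_leI)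

lemma L2n_cong_AE: "(AE x in M. abs (f x) = abs (g x)) ==> L2n M f = L2n M g"
 unfolding L2n_def by (intro nn_integral_cong_AE) (auto elim!: eventually_mono, metis power2_abs)

lemma L2n_scale: "f : Bor M ==> L2n M (%x. c * f x) = ennreal (c^2) * L2n M f"
 unfolding L2n_def by (simp add: power_mult_distrib ennreal_mult nn_integral_cmult)

lemma L2n_minus [simp]: "L2n M (%x. - f x) = L2n M f"
 unfolding L2n_def by simp

lemma L2n_commute: "L2n M (%x. f x - g x) = L2n M (%x. g x - f x)"
 unfolding L2n_def by (simp add: power2_commute)

lemma square_add_le: "(a + b)^2 <= 2 * a^2 + 2 * (b::real)^2"
 using sum_squares_bound[of a b] by (simp add: power2_sum)

lemma L2n_add_le:
 assumes [measurable]: "f : Bor M" "g : Bor M"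
 shows "L2n M (%x. f x + g x) <= 2 * L2n M f + 2 * L2n M g"
proof -
 have "L2n M (%x. f x + g x) <= (\<integral>\<^sup>+x. 2 * ennreal ((f x)^2) + 2 * ennreal ((g x)^2) \<partial>M)"
  unfolding L2n_def
 proof (rule nn_integral_mono)
  fix x
  have "ennreal ((f x + g x)^2) <= ennreal (2 * (f x)^2 + 2 * (g x)^2)"
   by (intro ennreal_leI square_add_le)
  thus "ennreal ((f x + g x)^2) <= 2 * ennreal ((f x)^2) + 2 * ennreal ((g x)^2)"
   by (simp add: ennreal_mult)
 qed
 also have "... = 2 * L2n M f + 2 * L2n M g"
  unfolding L2n_def by (simp add: nn_integral_add nn_integral_cmult)
 finally show ?thesis .
qed

lemma L2n_diff_le:
 assumes [measurable]: "f : Bor M" "g : Bor M"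
 shows "L2n M (%x. f x - g x) <= 2 * L2n M f + 2 * L2n M g"
 using L2n_add_le[of f M "%x. - g x"] by simp

lemma L2n_triangle:
 assumes [measurable]: "f : Bor M" "g : Bor M" "h : Bor M"
 shows "L2n M (%x. f x - h x) <= 2 * L2n M (%x. f x - g x) + 2 * L2n M (%x. g x - h x)"
 using L2n_add_le[of "%x. f x - g x" M "%x. g x - h x"] by simp

lemma sqi_add [intro]: "sqi M f ==> sqi M g ==> sqi M (%x. f x + g x)"
 unfolding sqi_def
 by (auto intro!: le_less_trans[OF L2n_add_le] simp: ennreal_add_less_top ennreal_mult_less_top)

lemma sqi_scale [intro]: "sqi M f ==> sqi M (%x. c * f x)"
 unfolding sqi_def by (auto simp: L2n_scale ennreal_mult_less_top)

lemma sqi_minus [intro]: "sqi M f ==> sqi M (%x. - f x)"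
 unfolding sqi_def by auto

lemma sqi_diff [intro]: "sqi M f ==> sqi M g ==> sqi M (%x. f x - g x)"
 using sqi_add[of M f "%x. - g x"] by (simp add: sqi_minus)

lemma sqi_zero [intro, simp]: "sqi M (%x. 0)"
 by (simp add: sqi_def L2n_def)

lemma sqi_sum_list: "(!!x. x : set xs ==> sqi M (f x)) ==> sqi M (%w. \<Sum>x\<leftarrow>xs. f x w)"
 by (induct xs) auto

lemma sqi_bound:
 "sqi M g ==> f : Bor M ==> (!!x. x : space M ==> abs (f x) <= abs (g x)) ==> sqi M f"
 unfolding sqi_def using L2n_mono[of M f g] by auto

lemma sqi_bound_AE:
 "sqi M g ==> f : Bor M ==> AE x in M. abs (f x) <= abs (g x) ==> sqi M f"
 unfolding sqi_def using L2n_mono_AE[of f g M] by auto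

lemma sqi_abs: "sqi M f ==> sqi M (%x. abs (f x))"
 by (auto simp: sqi_def L2n_def)

lemma sqi_const: "finite_measure M ==> sqi M (%x. c)"
 using finite_measure.emeasure_finite[of M "space M"]
 by (simp add: sqi_def L2n_def ennreal_mult_less_top less_top)

lemma sqi_mult_bounded:
 assumes g: "sqi M g" and h: "h : Bor M" "!!x. x : space M ==> abs (h x) <= c"
 shows "sqi M (%x. h x * g x)"
proof (rule sqi_bound[OF sqi_scale[OF g, of c]])
 show "(%x. h x * g x) : Bor M" using g h by measurable
 fix x assume "x : space M"
 with h(2)[OF this] show "abs (h x * g x) <= abs (c * g x)"
  by (auto simp: abs_mult intro!: mult_right_mono)
qed

lemma sqi_mult_indicator: "sqi M g ==> A : sets M ==> sqi M (%x. ind A x * g x)"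
 by (rule sqi_mult_bounded[where c = 1]) (auto simp: indicator_def)

lemma sqi_prod:
 assumes [measurable]: "sqi M f" "sqi M g"
 shows "integrable M (%x. f x * g x)"
proof (rule Bochner_Integration.integrable_bound)
 show "integrable M (%x. (f x)^2 + (g x)^2)"
  using assms by (intro Bochner_Integration.integrable_add sqi_integrable_square)
 show "(%x. f x * g x) : Bor M" by measurable
 have "abs (a * b) <= a^2 + (b::real)^2" for a b
 proof -
  have "2 * (abs a * abs b) <= a^2 + b^2" using sum_squares_bound[of "abs a" "abs b"] by simp
  moreover have "0 <= abs a * abs b" by simp
  ultimately show ?thesis unfolding abs_mult by linarith
 qed
 thus "AE x in M. norm (f x * g x) <= norm ((f x)^2 + (g x)^2)"
  by auto
qed

lemma sqi_integrable: "finite_measure M ==> sqi M f ==> integrable M f"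
 using sqi_prod[of M f "%x. 1"] sqi_const[of M 1] by simp

lemma Cauchy_Schwarz_sqi:
 assumes [measurable]: "sqi M f" "sqi M g"
 shows "abs (\<integral>x. f x * g x \<partial>M) <= sqrt (\<integral>x. (f x)^2 \<partial>M) * sqrt (\<integral>x. (g x)^2 \<partial>M)"
proof -
 have "(\<integral>\<^sup>+x. ennreal (abs (f x)) * ennreal (abs (g x)) \<partial>M)^2
   <= (\<integral>\<^sup>+x. ennreal (abs (f x)) ^ 2 \<partial>M) * (\<integral>\<^sup>+x. ennreal (abs (g x)) ^ 2 \<partial>M)"
  by (rule Cauchy_Schwarz_nn_integral) auto
 also have "... = ennreal (\<integral>x. (f x)^2 \<partial>M) * ennreal (\<integral>x. (g x)^2 \<partial>M)"
  using L2n_eq_integral[OF assms(1)] L2n_eq_integral[OF assms(2)]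
  by (simp add: L2n_def ennreal_power)
 also have "(\<integral>\<^sup>+x. ennreal (abs (f x)) * ennreal (abs (g x)) \<partial>M) = ennreal (\<integral>x. abs (f x * g x) \<partial>M)"
  by (subst nn_integral_eq_integral[symmetric])
    (auto simp: ennreal_mult[symmetric] abs_mult[symmetric] intro!: integrable_abs sqi_prod assms)
 finally have "(\<integral>x. abs (f x * g x) \<partial>M)^2 <= (\<integral>x. (f x)^2 \<partial>M) * (\<integral>x. (g x)^2 \<partial>M)"
  by (simp add: ennreal_power ennreal_mult[symmetric])
 hence "(\<integral>x. abs (f x * g x) \<partial>M) <= sqrt ((\<integral>x. (f x)^2 \<partial>M) * (\<integral>x. (g x)^2 \<partial>M))"
  by (rule real_le_rsqrt)
 hence "(\<integral>x. abs (f x * g x) \<partial>M) <= sqrt (\<integral>x. (f x)^2 \<partial>M) * sqrt (\<integral>x. (g x)^2 \<partial>M)"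
  by (simp only: real_sqrt_mult)
 moreover have "abs (\<integral>x. f x * g x \<partial>M) <= (\<integral>x. abs (f x * g x) \<partial>M)"
  by (rule integral_abs_bound)
 ultimately show ?thesis by (rule order_trans[rotated])
qed

lemma L2_ip_tendsto:
 assumes f: "!!n. sqi M (f n)" "sqi M f'" and g: "sqi M g"
  and lim: "(%n. L2n M (%x. f n x - f' x)) ----> 0"
 shows "(%n. \<integral>x. f n x * g x \<partial>M) ----> (\<integral>x. f' x * g x \<partial>M)"
proof -
 have d: "sqi M (%x. f n x - f' x)" for n using f by auto
 have "(%n. \<integral>x. (f n x - f' x)^2 \<partial>M) ----> 0"
  using lim unfolding L2n_eq_integral[OF d]
  by (subst (asm) ennreal_0[symmetric], subst (asm) tendsto_ennreal_iff) auto
 hence "(%n. sqrt (\<integral>x. (f n x - f' x)^2 \<partial>M) * sqrt (\<integral>x. (g x)^2 \<partial>M)) ----> sqrt 0 * sqrt (\<integral>x. (g x)^2 \<partial>M)"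
  by (intro tendsto_intros)
 hence *: "(%n. sqrt (\<integral>x. (f n x - f' x)^2 \<partial>M) * sqrt (\<integral>x. (g x)^2 \<partial>M)) ----> 0" by simp
 have "(%n. (\<integral>x. f n x * g x \<partial>M) - (\<integral>x. f' x * g x \<partial>M)) ----> 0"
 proof (rule Lim_null_comparison[OF _ *], rule always_eventually, rule allI)
  fix n
  have "(\<integral>x. f n x * g x \<partial>M) - (\<integral>x. f' x * g x \<partial>M) = (\<integral>x. (f n x - f' x) * g x \<partial>M)"
   using sqi_prod[OF f(1) g] sqi_prod[OF f(2) g] by (simp add: left_diff_distrib)
  thus "norm ((\<integral>x. f n x * g x \<partial>M) - (\<integral>x. f' x * g x \<partial>M))
    <= sqrt (\<integral>x. (f n x - f' x)^2 \<partial>M) * sqrt (\<integral>x. (g x)^2 \<partial>M)"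
   using Cauchy_Schwarz_sqi[OF d g] by simp
 qed
 thus ?thesis by (simp add: LIM_zero_iff)
qed

lemma L2_norm_tendsto:
 assumes f: "!!n. sqi M (f n)" "sqi M f'"
  and lim: "(%n. L2n M (%x. f n x - f' x)) ----> 0"
 shows "(%n. L2n M (f n)) ----> L2n M f'"
proof -
 have d: "sqi M (%x. f n x - f' x)" for n using f by auto
 have 1: "(%n. \<integral>x. (f n x - f' x)^2 \<partial>M) ----> 0"
  using lim unfolding L2n_eq_integral[OF d]
  by (subst (asm) ennreal_0[symmetric], subst (asm) tendsto_ennreal_iff) auto
 have 2: "(%n. \<integral>x. f n x * f' x \<partial>M) ----> (\<integral>x. f' x * f' x \<partial>M)"
  by (rule L2_ip_tendsto[OF f f(2) lim])
 have "(%n. (\<integral>x. (f n x - f' x)^2 \<partial>M) + 2 * (\<integral>x. f n x * f' x \<partial>M) - (\<integral>x. (f' x)^2 \<partial>M))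
    ----> 0 + 2 * (\<integral>x. f' x * f' x \<partial>M) - (\<integral>x. (f' x)^2 \<partial>M)"
  by (intro tendsto_intros 1 2)
 moreover have "(\<integral>x. (f n x - f' x)^2 \<partial>M) + 2 * (\<integral>x. f n x * f' x \<partial>M) - (\<integral>x. (f' x)^2 \<partial>M)
   = (\<integral>x. (f n x)^2 \<partial>M)" for n
 proof -
  have "(\<integral>x. (f n x)^2 \<partial>M) = (\<integral>x. (f n x - f' x)^2 + 2 * (f n x * f' x) - (f' x)^2 \<partial>M)"
   by (rule Bochner_Integration.integral_cong) (auto simp: power2_eq_square algebra_simps)
  thus ?thesis
   using sqi_integrable_square[OF d] sqi_integrable_square[OF f(2)] sqi_prod[OF f] by simp
 qed
 ultimately have "(%n. \<integral>x. (f n x)^2 \<partial>M) ----> (\<integral>x. (f' x)^2 \<partial>M)"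
  by (simp add: power2_eq_square)
 thus ?thesis
  unfolding L2n_eq_integral[OF f(1)] L2n_eq_integral[OF f(2)] by (rule tendsto_ennrealI)
qed

lemma L2n_zero_iff:
 assumes "f : Bor M"
 shows "L2n M f = 0 <-> (AE x in M. f x = 0)"
 unfolding L2n_def using assms by (subst nn_integral_0_iff_AE) auto

lemma L2n_Fatou:
 assumes [measurable]: "!!n. f n : Bor M"
  and lim: "AE x in M. (%n. f n x) ----> g x"
  and le: "\<forall>\<^sub>F n in sequentially. L2n M (f n) <= c"
 shows "L2n M g <= c"
proof -
 have "L2n M g = (\<integral>\<^sup>+x. liminf (%n. ennreal ((f n x)^2)) \<partial>M)"
  unfolding L2n_def
 proof (rule nn_integral_cong_AE, use lim in eventually_elim)
  fix x assume "(%n. f n x) ----> g x"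
  hence "(%n. ennreal ((f n x)^2)) ----> ennreal ((g x)^2)"
   by (intro tendsto_ennrealI tendsto_intros)
  from lim_imp_Liminf[OF _ this] show "ennreal ((g x)^2) = liminf (%n. ennreal ((f n x)^2))"
   by simp
 qed
 also have "... <= liminf (%n. L2n M (f n))"
  unfolding L2n_def by (rule nn_integral_liminf) auto
 also have "... <= limsup (%n. L2n M (f n))" by (rule Liminf_le_Limsup) simp
 also have "... <= c" by (rule Limsup_bounded[OF le])
 finally show ?thesis .
qed

lemma L2n_AE_subseq:
 assumes [measurable]: "!!n. f n : Bor M"
  and lim: "(%n. L2n M (f n)) ----> 0"
  and fin: "!!n. L2n M (f n) < \<infinity>"
 shows "\<exists>r::nat=>nat. strict_mono r & (AE x in M. (%n. f (r n) x) ----> 0)"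
proof -
 have "integrable M (%x. (f n x)^2)" for n
  using fin[of n] by (intro sqi_integrable_square) (simp add: sqi_def)
 moreover have "(%n. \<integral>x. norm ((f n x)^2) \<partial>M) ----> 0"
 proof -
  have "sqi M (f n)" for n using fin[of n] by (simp add: sqi_def)
  from lim[unfolded L2n_eq_integral[OF this]] show ?thesis
   by (subst (asm) ennreal_0[symmetric], subst (asm) tendsto_ennreal_iff) auto
 qed
 ultimately obtain r :: "nat => nat" where r: "strict_mono r" "AE x in M. (%n. (f (r n) x)^2) ----> 0"
  using tendsto_L1_AE_subseq[of M "%n x. (f n x)^2"] by blast
 from r(2) have "AE x in M. (%n. f (r n) x) ----> 0"
 proof eventually_elim
  fix x assume "(%n. (f (r n) x)^2) ----> 0"
  hence "(%n. sqrt ((f (r n) x)^2)) ----> sqrt 0" by (rule tendsto_real_sqrt)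
  thus "(%n. f (r n) x) ----> 0" by (simp add: tendsto_rabs_zero_iff)
 qed
 with r(1) show ?thesis by auto
qed

lemma null_le:
 fixes f g :: "nat => ennreal"
 shows "g ----> 0 ==> (!!n. f n <= g n) ==> f ----> 0"
 by (rule tendsto_sandwich[OF _ _ tendsto_const]) auto

lemma L2n_eventually_less:
 assumes "(%n. L2n M (%x. f n x - g x)) ----> 0" "0 < \<epsilon>"
 obtains n where "L2n M (%x. f n x - g x) < ennreal \<epsilon>"
 using order_tendstoD(2)[OF assms(1), of "ennreal \<epsilon>"] assms(2) by (auto simp: eventually_sequentially)

lemma sqi_limit:
 assumes f: "!!n. sqi M (f n)" "g : Bor M" and lim: "(%n. L2n M (%x. f n x - g x)) ----> 0"
 shows "sqi M g"
proof -
 obtain n where "L2n M (%x. f n x - g x) < ennreal 1" by (rule L2n_eventually_less[OF lim zero_less_one])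
 hence "sqi M (%x. f n x - g x)" using f sqi_measurable[OF f(1)] by (auto simp: sqi_def intro: less_trans)
 from sqi_diff[OF f(1)[of n] this] show ?thesis by simp
qed

text \<open>Squared distances decaying like \<open>4\<^sup>-\<^sup>n\<close> are distances decaying like \<open>2\<^sup>-\<^sup>n\<close>; they add up to at most twice
 the first one.\<close>

lemma L2n_geometric_Cauchy:
 assumes [measurable]: "!!n. f n : Bor M" and c: "c >= 0"
  and d: "!!n. L2n M (%x. f (Suc n) x - f n x) <= ennreal (c * (1/4) ^ n)"
 shows "L2n M (%x. f (n + k) x - f n x) <= ennreal (4 * c * (1/4) ^ n)"
proof (induct k arbitrary: n)
 case 0 show ?case by (simp add: L2n_def)
next
 case (Suc k)
 have "L2n M (%x. f (n + Suc k) x - f n x)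
   <= 2 * L2n M (%x. f (Suc n + k) x - f (Suc n) x) + 2 * L2n M (%x. f (Suc n) x - f n x)"
  using L2n_triangle[of "f (n + Suc k)" M "f (Suc n)" "f n"] by simp
 also have "... <= 2 * ennreal (4 * c * (1/4) ^ Suc n) + 2 * ennreal (c * (1/4) ^ n)"
  by (intro add_mono mult_left_mono Suc d) auto
 also have "... = ennreal (2 * (4 * c * (1/4) ^ Suc n) + 2 * (c * (1/4) ^ n))"
  using c by (subst ennreal_plus) (auto simp only: ennreal_mult' intro!: mult_nonneg_nonneg, simp_all add: ennreal_mult)
 also have "... = ennreal (4 * c * (1/4) ^ n)"
  by (intro arg_cong[where f = ennreal]) (simp add: field_simps)
 finally show ?case .
qed

lemma summable_geometric_root:
 assumes "!!k. (d k)^2 <= C * (1/2) ^ k"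
 shows "summable (%k. d k :: real)"
proof (rule summable_comparison_test)
 have C: "0 <= C" using assms[of 0] order_trans[OF zero_le_power2] by fastforce
 have "abs (d k) <= sqrt C * sqrt (1/2) ^ k" for k
 proof -
  have "abs (d k) = sqrt ((d k)^2)" by simp
  also have "... <= sqrt (C * (1/2) ^ k)" using assms by (rule real_sqrt_le_mono)
  finally show ?thesis by (simp add: real_sqrt_mult real_sqrt_power)
 qed
 thus "\<exists>N. \<forall>n\<ge>N. norm (d n) <= sqrt C * sqrt (1/2) ^ n" by auto
 show "summable (%k. sqrt C * sqrt (1/2) ^ k)"
  by (intro summable_mult summable_geometric) auto
qed

lemma L2n_geometric_AE:
 assumes M[measurable]: "!!n. f n : Bor M" and c: "c >= 0"
  and d: "!!n. L2n M (%x. f (Suc n) x - f n x) <= ennreal (c * (1/4) ^ n)"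
  and conv: "AE x in M. (%n. f n x) ----> g x"
 shows "(%n. L2n M (%x. f n x - g x)) ----> 0"
proof (rule null_le)
 show "(%n. ennreal (4 * c * (1/4) ^ n)) ----> 0"
  using tendsto_ennrealI[OF tendsto_mult[OF tendsto_const LIMSEQ_power_zero[of "1/4::real"]], of "4 * c"] by simp
 fix n
 have "L2n M (%x. g x - f n x) <= ennreal (4 * c * (1/4) ^ n)"
 proof (rule L2n_Fatou[where f = "%k x. f (n + k) x - f n x"])
  show "AE x in M. (%k. f (n + k) x - f n x) ----> g x - f n x"
   using conv
  proof eventually_elim
   case (elim x)
   from LIMSEQ_ignore_initial_segment[OF this, of n] show ?case
    by (intro tendsto_diff tendsto_const) (simp add: add.commute)
  qed
 qed (auto intro!: always_eventually L2n_geometric_Cauchy[OF M c d])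
 thus "L2n M (%x. f n x - g x) <= ennreal (4 * c * (1/4) ^ n)" by (subst L2n_commute)
qed

text \<open>Completeness of \<open>L\<^sup>2\<close> in the form used below: the limit stays measurable with respect to the sub-sigma-algebra
 of the approximations.\<close>

lemma L2_geometric_limit:
 assumes F: "!!n. f n : Bor F" and sub: "sets F <= sets M" "space F = space M"
  and c: "c >= 0"
  and d: "!!n. L2n M (%x. f (Suc n) x - f n x) <= ennreal (c * (1/4) ^ n)"
 shows "\<exists>g. g : Bor F & (%n. L2n M (%x. f n x - g x)) ----> 0"
proof -
 have M[measurable]: "f n : Bor M" for n
  using F[of n] sub by (auto simp: measurable_def)
 define s where "s x = (\<Sum>n. ennreal (2 ^ n * (f (Suc n) x - f n x)^2))" for x
 have "(\<integral>\<^sup>+x. s x \<partial>M) = (\<Sum>n. ennreal (2 ^ n) * L2n M (%x. f (Suc n) x - f n x))"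
  unfolding s_def by (subst nn_integral_suminf) (auto simp: ennreal_mult nn_integral_cmult L2n_def)
 also have "... <= (\<Sum>n. ennreal (c * (1/2) ^ n))"
 proof (intro suminf_le summableI)
  fix n
  have "ennreal (2 ^ n) * L2n M (%x. f (Suc n) x - f n x) <= ennreal (2 ^ n) * ennreal (c * (1/4) ^ n)"
   by (intro mult_left_mono d) auto
  also have "... = ennreal (2 ^ n * (c * (1/4) ^ n))" using c by (simp add: ennreal_mult)
  also have "2 ^ n * (c * (1/4) ^ n) = c * (2 * (1/4)) ^ n" by (subst power_mult_distrib) simp
  finally show "ennreal (2 ^ n) * L2n M (%x. f (Suc n) x - f n x) <= ennreal (c * (1/2) ^ n)"
   by simp
 qed
 also have "... = ennreal (\<Sum>n. c * (1/2) ^ n)"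
  using c by (intro suminf_ennreal2) (auto intro!: summable_mult summable_geometric)
 also have "... < \<infinity>" by simp
 finally have "AE x in M. s x \<noteq> \<infinity>"
  by (intro nn_integral_PInf_AE) (auto simp: s_def)
 hence conv: "AE x in M. (%n. f n x) ----> lim (%n. f n x)"
 proof eventually_elim
  fix x assume x: "s x \<noteq> \<infinity>"
  have "(f (Suc n) x - f n x)^2 <= enn2real (s x) * (1/2) ^ n" for n
  proof -
   have "ennreal (2 ^ n * (f (Suc n) x - f n x)^2) = (\<Sum>k\<in>{n}. ennreal (2 ^ k * (f (Suc k) x - f k x)^2))" by simp
   also have "... <= s x" unfolding s_def by (rule sum_le_suminf) auto
   also have "... = ennreal (enn2real (s x))" using x by (simp add: less_top)
   finally show ?thesis by (simp add: field_simps)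
  qed
  hence "summable (%n. f (Suc n) x - f n x)" by (rule summable_geometric_root)
  hence "convergent (%n. f n x - f 0 x)"
   by (simp add: summable_iff_convergent sum_lessThan_telescope[of "%n. f n x"])
  thus "(%n. f n x) ----> lim (%n. f n x)" by (simp add: convergent_diff_const_right_iff convergent_LIMSEQ_iff)
 qed
 have "(%x. lim (%n. f n x)) : Bor F" using F by (rule borel_measurable_lim_metric)
 with L2n_geometric_AE[OF M c d conv] show ?thesis by blast
qed

section \<open>RCLL paths\<close>

lemma rcll_const [simp]: "rcll b (%t. c)"
 by (auto simp: rcll_def)

lemma rcll_right: "rcll b x ==> 0 <= t ==> t < b ==> (x \<longlongrightarrow> x t) (at_right t)"
 by (auto simp: rcll_def)

lemma rcll_left: "rcll b x ==> 0 < t ==> t <= b ==> \<exists>L. (x \<longlongrightarrow> L) (at_left t)"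
 by (auto simp: rcll_def)

lemma rcll_combine:
 assumes x: "rcll b x" and y: "rcll b y" and h: "continuous_on UNIV (%p. h (fst p) (snd p))"
 shows "rcll b (%t. h (x t) (y t) :: real)"
proof -
 have *: "((%t. h (x t) (y t)) \<longlongrightarrow> h p q) G" if "(x \<longlongrightarrow> p) G" "(y \<longlongrightarrow> q) G" for p q :: real and G :: "real filter"
 proof -
  have "isCont (%p. h (fst p) (snd p)) (p, q)"
   using h by (simp add: continuous_on_eq_continuous_at)
  hence "((%t. h (fst (x t, y t)) (snd (x t, y t))) \<longlongrightarrow> h (fst (p, q)) (snd (p, q))) G"
   by (rule isCont_tendsto_compose) (intro tendsto_Pair that)
  thus ?thesis by simp
 qed
 show ?thesis
  unfolding rcll_def
 proof (intro conjI ballI)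
  fix t assume "t : {0..<b}" thus "((%t. h (x t) (y t)) \<longlongrightarrow> h (x t) (y t)) (at_right t)"
   using x y by (intro *) (auto simp: rcll_def)
 next
  fix t assume "t : {0<..b}"
  moreover from this obtain p where "(x \<longlongrightarrow> p) (at_left t)" using rcll_left[OF x] by fastforce
  moreover from calculation obtain q where "(y \<longlongrightarrow> q) (at_left t)" using rcll_left[OF y] by fastforce
  ultimately show "\<exists>L. ((%t. h (x t) (y t)) \<longlongrightarrow> L) (at_left t)" using * by blast
 qed
qed

lemma rcll_add: "rcll b x ==> rcll b y ==> rcll b (%t. x t + y t)"
 by (rule rcll_combine[where h = "%p q. p + q"]) (auto intro!: continuous_intros)

lemma rcll_diff: "rcll b x ==> rcll b y ==> rcll b (%t. x t - y t)"
 by (rule rcll_combine[where h = "%p q. p - q"]) (auto intro!: continuous_intros)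

lemma rcll_mult: "rcll b x ==> rcll b y ==> rcll b (%t. x t * y t)"
 by (rule rcll_combine[where h = "%p q. p * q"]) (auto intro!: continuous_intros)

lemma rcll_min: "rcll b x ==> rcll b y ==> rcll b (%t. min (x t) (y t))"
 by (rule rcll_combine[where h = min]) (auto intro!: continuous_intros)

lemma rcll_continuous:
 assumes x: "continuous_on {0..b} x"
 shows "rcll b x"
 unfolding rcll_def
proof (intro conjI ballI)
 fix t assume t: "t : {0..<b}"
 from x t have "(x \<longlongrightarrow> x t) (at t within {0..b})" by (auto simp: continuous_on_def)
 hence "(x \<longlongrightarrow> x t) (at t within {t<..<b})"
  by (rule tendsto_within_subset) (use t in auto)
 thus "(x \<longlongrightarrow> x t) (at_right t)"
  using t by (simp add: at_within_nhd[of t "{..<b}" "{t<..<b}" "{t<..}"] set_eq_iff)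
next
 fix t assume t: "t : {0<..b}"
 from x t have "(x \<longlongrightarrow> x t) (at t within {0..b})" by (auto simp: continuous_on_def)
 hence "(x \<longlongrightarrow> x t) (at t within {0<..<t})"
  by (rule tendsto_within_subset) (use t in auto)
 hence "(x \<longlongrightarrow> x t) (at_left t)"
  by (subst (asm) at_within_nhd[of t "{0<..}" _ "{..<t}"]) (use t in auto)
 thus "\<exists>L. (x \<longlongrightarrow> L) (at_left t)" by auto
qed

lemma rcll_stopped:
 assumes x: "rcll b x" and c: "0 <= c" and b: "0 <= b"
 shows "rcll b (%t. x (min t c))"
 unfolding rcll_def
proof (intro conjI ballI)
 fix t assume t: "t : {0..<b}"
 show "((%t. x (min t c)) \<longlongrightarrow> x (min t c)) (at_right t)"
 proof (cases "t < c")
  case True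
  have "\<forall>\<^sub>F s in at_right t. s : {t<..<c}" by (rule eventually_at_right_real[OF True])
  hence "\<forall>\<^sub>F s in at_right t. x s = x (min s c)"
   by eventually_elim (simp add: min_def)
  moreover have "(x \<longlongrightarrow> x (min t c)) (at_right t)"
   using rcll_right[OF x, of t] t True by (simp add: min_def)
  ultimately show ?thesis by (rule Lim_transform_eventually[rotated])
 next
  case False
  have "\<forall>\<^sub>F s in at_right t. s : {t<..<t+1}" by (rule eventually_at_right_real) simp
  hence "\<forall>\<^sub>F s in at_right t. x c = x (min s c)"
   by eventually_elim (use False in "simp add: min_def")
  hence "((%t. x (min t c)) \<longlongrightarrow> x c) (at_right t)"
   by (rule Lim_transform_eventually[OF tendsto_const])
  moreover have "min t c = c" using False by simp
  ultimately show ?thesis by simp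
 qed
next
 fix t assume t: "t : {0<..b}"
 show "\<exists>L. ((%t. x (min t c)) \<longlongrightarrow> L) (at_left t)"
 proof (cases "t <= c")
  case True
  obtain L where L: "(x \<longlongrightarrow> L) (at_left t)" using rcll_left[OF x] t by auto
  have "\<forall>\<^sub>F s in at_left t. s : {t-1<..<t}" by (rule eventually_at_left_real) simp
  hence "\<forall>\<^sub>F s in at_left t. x s = x (min s c)"
   by eventually_elim (use True in "simp add: min_def")
  from Lim_transform_eventually[OF L this] show ?thesis by auto
 next
  case False
  hence "\<forall>\<^sub>F s in at_left t. s : {c<..<t}" by (intro eventually_at_left_real) simp
  hence "\<forall>\<^sub>F s in at_left t. x c = x (min s c)"
   by eventually_elim (simp add: min_def)
  from Lim_transform_eventually[OF tendsto_const this] show ?thesis by auto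
 qed
qed

text \<open>Right approximation on the grid of mesh \<open>b / N\<close>.\<close>

definition rgrid :: "real => nat => real => real" where
 "rgrid b N t = (if t < b then b * (real_of_int \<lfloor>t * real N / b\<rfloor> + 1) / real N else b)"

lemma rgrid_eq:
 assumes "0 <= t" "t <= b" "0 < b" "0 < N"
 shows "rgrid b N t = min b (b * (real_of_int \<lfloor>t * real N / b\<rfloor> + 1) / real N)"
proof (cases "t < b")
 case True
 have "t * real N / b < real N" using assms True by (simp add: field_simps)
 hence "\<lfloor>t * real N / b\<rfloor> < int N" by linarith
 hence "real_of_int \<lfloor>t * real N / b\<rfloor> + 1 <= real N" by linarith
 from mult_left_mono[OF this, of b] show ?thesis
  using assms True by (simp add: rgrid_def min_def field_simps)
next
 case False
 thus ?thesis using assms by (simp add: rgrid_def min_def field_simps)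
qed

lemma rgrid_bounds:
 assumes "0 <= t" "t < b" "0 < N"
 shows "t < rgrid b N t" "rgrid b N t <= t + b / N" "rgrid b N t <= b"
proof -
 let ?f = "real_of_int \<lfloor>t * real N / b\<rfloor>"
 have b: "0 < b" using assms by simp
 have 1: "?f <= t * real N / b" "t * real N / b < ?f + 1" by linarith+
 show "t < rgrid b N t" using 1(2) assms b by (simp add: rgrid_def field_simps)
 show "rgrid b N t <= t + b / N"
  using mult_left_mono[OF 1(1), of b] assms b by (simp add: rgrid_def field_simps)
 have "t * real N / b < real N" using assms b by (simp add: field_simps)
 hence "\<lfloor>t * real N / b\<rfloor> < int N" by linarith
 hence "?f + 1 <= real N" by linarith
 from mult_left_mono[OF this, of b] show "rgrid b N t <= b" using assms b by (simp add: rgrid_def field_simps)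
qed

lemma rgrid_LIMSEQ:
 assumes "0 <= t" "t < b"
 shows "filterlim (%N. rgrid b (Suc N) t) (at_right t) sequentially"
proof -
 have 1: "\<forall>\<^sub>F N in sequentially. rgrid b (Suc N) t : {t<..} & rgrid b (Suc N) t \<noteq> t"
 proof (intro always_eventually allI)
  fix N show "rgrid b (Suc N) t : {t<..} & rgrid b (Suc N) t \<noteq> t"
   using rgrid_bounds(1)[OF assms, of "Suc N"] by simp
 qed
 have 2: "(%N. rgrid b (Suc N) t) ----> t"
 proof (rule tendsto_sandwich[where f = "%_. t" and h = "%N. t + b / real (Suc N)"])
  have "(%N. t + b * inverse (real (Suc N))) ----> t + b * 0"
   by (intro tendsto_intros LIMSEQ_inverse_real_of_nat)
  thus "(%N. t + b / real (Suc N)) ----> t" by (simp add: divide_inverse)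
  show "\<forall>\<^sub>F n in sequentially. rgrid b (Suc n) t <= t + b / real (Suc n)"
   by (intro always_eventually allI rgrid_bounds assms) simp
  show "\<forall>\<^sub>F n in sequentially. t <= rgrid b (Suc n) t"
   by (intro always_eventually allI less_imp_le rgrid_bounds assms) simp
 qed simp
 from 1 2 show ?thesis by (simp add: filterlim_at)
qed

lemma rcll_rgrid:
 assumes "rcll b x" "0 <= t" "t <= b"
 shows "(%N. x (rgrid b (Suc N) t)) ----> x t"
proof (cases "t < b")
 case True
 with rgrid_LIMSEQ[of t b] rcll_right[OF assms(1), of t] assms show ?thesis
  by (auto intro: filterlim_compose)
next
 case False
 with assms show ?thesis by (simp add: rgrid_def)
qed

text \<open>The approximations on the grid take countably many values of time, for which substitution is harmless, and
 right continuity passes to the limit.\<close>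

lemma rcll_substitution:
 assumes X: "!!s. s : {0..b} ==> X s : Bor M" and r: "!!x. x : space M ==> rcll b (%s. X s x)"
  and \<theta>: "\<theta> : Bor M" "!!x. x : space M ==> \<theta> x : {0..b}" and b: "0 < b"
 shows "(%x. X (\<theta> x) x) : Bor M"
proof (rule borel_measurable_LIMSEQ_real)
 fix x assume x: "x : space M"
 show "(%N. X (rgrid b (Suc N) (\<theta> x)) x) ----> X (\<theta> x) x" using rcll_rgrid[OF r[OF x]] \<theta>(2)[OF x] by simp
next
 fix N
 note \<theta>(1) [measurable]
 let ?u = "%i::int. max 0 (min b (b * (real_of_int i + 1) / real (Suc N)))" and ?k = "%x. \<lfloor>\<theta> x * real (Suc N) / b\<rfloor>"
 have "(%x. X (?u (?k x)) x) : Bor M"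
 proof (rule measurable_compose_countable[where f = "%i. X (?u i)" and g = ?k])
  show "X (?u i) : Bor M" for i using b by (intro X) auto
  show "?k : measurable M (count_space UNIV)" by measurable
 qed
 moreover have "?u (?k x) = rgrid b (Suc N) (\<theta> x)" if "x : space M" for x
 proof -
  have "0 <= ?k x" using \<theta>(2)[OF that] b by simp
  hence "0 <= b * (real_of_int (?k x) + 1) / real (Suc N)" using b by simp
  thus ?thesis using rgrid_eq[of "\<theta> x" b "Suc N"] \<theta>(2)[OF that] b by (simp del: of_nat_Suc)
 qed
 ultimately show "(%x. X (rgrid b (Suc N) (\<theta> x)) x) : Bor M" by (subst measurable_cong) (auto intro: sym)
qed

text \<open>A countable set of times that determines an RCLL path.\<close>

definition rtimes :: "real => real set" where
 "rtimes b = insert b ({0..b} Int \<rat>)"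

lemma countable_rtimes: "countable (rtimes b)"
 unfolding rtimes_def by (intro countable_insert countable_Int2 countable_rat)

lemma rtimes_subset: "0 <= b ==> rtimes b <= {0..b}"
 by (auto simp: rtimes_def)

lemma rtimes_dense:
 assumes "0 <= t" "t < b" "\<forall>\<^sub>F s in at_right t. P s"
 shows "\<exists>s\<in>rtimes b. t < s & P s"
proof -
 obtain d where d: "t < d" "!!s. t < s ==> s < d ==> P s"
  using assms(3) unfolding eventually_at_right_field by auto
 obtain q where q: "q : \<rat>" "t < q" "q < min d b"
  using Rats_dense_in_real[of t "min d b"] d(1) assms(2) by auto
 thus ?thesis using d(2) assms by (intro bexI[of _ q]) (auto simp: rtimes_def)
qed

lemma rcll_le_dense:
 assumes x: "rcll b x" and le: "!!s. s : rtimes b ==> x s <= c" and t: "t : {0..b}"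
 shows "x t <= c"
proof (cases "t = b")
 case True thus ?thesis using le[of b] by (simp add: rtimes_def)
next
 case False
 hence t: "0 <= t" "t < b" using t by auto
 show ?thesis
 proof (rule ccontr)
  assume "\<not> x t <= c"
  hence "\<forall>\<^sub>F s in at_right t. c < x s"
   using rcll_right[OF x t] by (intro order_tendstoD(1)) auto
  from rtimes_dense[OF t this] le show False by force
 qed
qed

lemma rcll_abs: "rcll b x ==> rcll b (%t. abs (x t))"
 using rcll_combine[of b x x "%p q. abs p"] by (simp add: continuous_intros)

lemma rcll_eq_dense:
 assumes x: "rcll b x" and y: "rcll b y" and eq: "!!s. s : rtimes b ==> x s = y s" and t: "t : {0..b}"
 shows "x t = y t"
 using rcll_le_dense[OF rcll_abs[OF rcll_diff[OF x y]], of 0 t] eq t by auto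

lemma rcll_uniform_limit:
 assumes x: "!!n::nat. rcll b (x n)" and lim: "uniform_limit {0..b} x y sequentially"
 shows "rcll b y"
 unfolding rcll_def
proof (intro conjI ballI)
 fix t assume t: "t : {0..<b}"
 have ev: "\<forall>\<^sub>F s in at_right t. s : {0..b}"
  using eventually_at_right_real[of t b] t by (auto elim: eventually_mono)
 show "(y \<longlongrightarrow> y t) (at_right t)"
 proof (rule swap_uniform_limit'[where S = "{0..b}" and f = x and g = "%n. x n t" and F = sequentially])
  show "\<forall>\<^sub>F n in sequentially. (x n \<longlongrightarrow> x n t) (at_right t)"
   using t by (intro always_eventually allI rcll_right[OF x]) auto
  show "(%n. x n t) ----> y t"
   using t by (intro tendsto_uniform_limitI[OF lim]) auto
 qed (use ev lim in auto)
next
 fix t assume t: "t : {0<..b}"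
 have ev: "\<forall>\<^sub>F s in at_left t. s : {0..b}"
  using eventually_at_left_real[of 0 t] t by (auto elim: eventually_mono)
 have nt: "\<not> trivial_limit (at_left t)" by (simp add: trivial_limit_at_left_real)
 have "\<forall>n. \<exists>L. (x n \<longlongrightarrow> L) (at_left t)" using t by (intro allI rcll_left[OF x]) auto
 then obtain L where L: "!!n. (x n \<longlongrightarrow> L n) (at_left t)" by metis
 have "Cauchy L"
 proof (rule metric_CauchyI)
  fix e :: real assume e: "0 < e"
  hence "\<forall>\<^sub>F n in sequentially. \<forall>s\<in>{0..b}. dist (x n s) (y s) < e / 4"
   using lim by (intro uniform_limitD) auto
  then obtain N where N: "!!n s. n >= N ==> s : {0..b} ==> dist (x n s) (y s) < e / 4"
   unfolding eventually_sequentially by blast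
  show "\<exists>M. \<forall>m\<ge>M. \<forall>n\<ge>M. dist (L m) (L n) < e"
  proof (intro exI allI impI)
   fix m n assume mn: "N <= m" "N <= n"
   have "((%s. dist (x m s) (x n s)) \<longlongrightarrow> dist (L m) (L n)) (at_left t)"
    by (intro tendsto_dist L)
   moreover have "\<forall>\<^sub>F s in at_left t. dist (x m s) (x n s) <= e / 2"
    using ev
   proof eventually_elim
    fix s assume "s : {0..b}"
    from N[OF mn(1) this] N[OF mn(2) this] show "dist (x m s) (x n s) <= e / 2"
     using dist_triangle2[of "x m s" "x n s" "y s"] by (simp add: dist_commute)
   qed
   ultimately have "dist (L m) (L n) <= e / 2" by (rule tendsto_upperbound[OF _ _ nt])
   thus "dist (L m) (L n) < e" using e by simp
  qed
 qed
 then obtain l where l: "L ----> l" by (auto simp: Cauchy_convergent_iff convergent_def)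
 have "(y \<longlongrightarrow> l) (at_left t)"
  by (rule swap_uniform_limit'[where S = "{0..b}" and f = x and g = L and F = sequentially])
    (use ev lim l L in auto)
 thus "\<exists>L. (y \<longlongrightarrow> L) (at_left t)" by auto
qed

lemma rcll_bounded:
 assumes x: "rcll b x"
 shows "\<exists>K. \<forall>t\<in>{0..b}. abs (x t) <= K"
proof -
 let ?z = "%s. if s : {0..b} then x s else 0"
 have tb: "\<exists>K. \<forall>\<^sub>F s in G. abs (?z s) <= K" if "(\<exists>L. (x \<longlongrightarrow> L) G) \<or> (\<forall>\<^sub>F s in G. s \<notin> {0..b})" for G
  using that
 proof
  assume "\<exists>L. (x \<longlongrightarrow> L) G"
  then obtain L where "\<forall>\<^sub>F s in G. dist (x s) L < 1" using tendstoD[OF _ zero_less_one] by blast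
  thus ?thesis by (intro exI[of _ "abs L + 1"]) (auto elim!: eventually_mono simp: dist_real_def)
 qed (auto intro!: exI[of _ 0] elim!: eventually_mono)
 have "\<exists>K U. open U & l : U & (\<forall>s\<in>U. abs (?z s) <= K)" if l: "l : {0..b}" for l
 proof -
  have "\<exists>K. \<forall>\<^sub>F s in at_left l. abs (?z s) <= K" "\<exists>K. \<forall>\<^sub>F s in at_right l. abs (?z s) <= K"
   using rcll_left[OF x, of l] rcll_right[OF x, of l] l
   by (intro tb; cases "l = 0"; cases "l = b"; auto simp: eventually_at_filter intro!: always_eventually)+
  then obtain K1 K2 where "\<forall>\<^sub>F s in at_left l. abs (?z s) <= K1" "\<forall>\<^sub>F s in at_right l. abs (?z s) <= K2" by blast
  hence "\<forall>\<^sub>F s in at l. abs (?z s) <= max (max K1 K2) (abs (?z l))"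
   unfolding eventually_at_split by (auto elim!: eventually_mono simp: le_max_iff_disj)
  hence "\<forall>\<^sub>F s in nhds l. abs (?z s) <= max (max K1 K2) (abs (?z l))"
   unfolding eventually_at_filter by (rule eventually_mono) auto
  thus ?thesis unfolding eventually_nhds by blast
 qed
 then obtain K U where KU: "!!l. l : {0..b} ==> open (U l) & l : U l & (\<forall>s\<in>U l. abs (?z s) <= K l)" by metis
 obtain C where C: "C <= {0..b}" "finite C" "{0..b} <= (\<Union>l\<in>C. U l)"
  by (rule compactE_image[OF compact_Icc, of "{0..b}" U 0 b]) (use KU in auto)
 have "abs (x t) <= Max (K ` C)" if t: "t : {0..b}" for t
 proof -
  obtain l where l: "l : C" "t : U l" using C(3) t by blast
  hence "abs (x t) <= K l" using KU[of l] C(1) t by fastforce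
  also have "... <= Max (K ` C)" using l C(2) by simp
  finally show ?thesis .
 qed
 thus ?thesis by blast
qed

section \<open>Stopping times\<close>

locale jbasis =
 fixes B :: "('w, 'e) basis"
 assumes jump_basis: "jump_basis B"
begin

abbreviation P :: "'w measure" where "P \<equiv> prb B"
abbreviation F :: "real => 'w measure" where "F \<equiv> flt B"
abbreviation T :: real where "T \<equiv> hor B"
abbreviation \<Omega> :: "'w set" where "\<Omega> \<equiv> space (prb B)"

abbreviation Ex_P :: "('w => real) => real" (binder "\<E>" 10) where "Ex_P f \<equiv> lebesgue_integral P f"

lemma T_pos: "0 < T" and T_nonneg: "0 <= T"
 using jump_basis by (auto simp: jump_basis_def)

sublocale prob_space P
 using jump_basis by (simp add: jump_basis_def)

sublocale filtration \<Omega> F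
 using jump_basis by (simp add: jump_basis_def usual_filtration_def)

lemma subalg: "sets (F t) <= sets P"
 using jump_basis by (auto simp: jump_basis_def usual_filtration_def)

lemma F_imp_P: "f : measurable (F t) N ==> f : measurable P N"
 using subalg[of t] by (auto simp: measurable_def space_F)

lemma F_mono: "s <= t ==> f : measurable (F s) N ==> f : measurable (F t) N"
 using sets_F_mono[of s t] by (auto simp: measurable_def space_F)

lemma null_in_F:
 assumes "N : null_sets P" "A <= N" "0 <= t"
 shows "A : sets (F t)"
proof -
 have "A : sets (F 0)"
  using jump_basis assms unfolding jump_basis_def usual_filtration_def by blast
 thus ?thesis using sets_F_mono[OF assms(3)] by blast
qed

lemma AE_null:
 assumes "AE w in P. Q w"
 obtains N where "N : null_sets P" "!!w. w : \<Omega> ==> w \<notin> N ==> Q w" "N : sets (F 0)"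
proof -
 from assms obtain N where N: "N : null_sets P" "{w\<in>\<Omega>. \<not> Q w} <= N"
  unfolding eventually_ae_filter by auto
 with null_in_F[OF N(1), of N 0] that show ?thesis by auto
qed

text \<open>This is where completeness of the filtration enters: null modifications remain adapted.\<close>

lemma F_measurable_AE:
 assumes f: "f : Bor (F t)" and t: "0 <= t" and eq: "AE w in P. f w = g w"
 shows "g : Bor (F t)"
proof -
 obtain N where N: "N : null_sets P" "!!w. w : \<Omega> ==> w \<notin> N ==> f w = g w"
  using AE_null[OF eq] by metis
 show ?thesis
 proof (rule measurableI)
  fix D :: "'a set" assume D: "D : sets borel"
  have "g -` D Int space (F t) = ((f -` D Int space (F t)) - N) \<union> (g -` D Int \<Omega> Int N)"
   using N(2) by (auto simp: space_F)
  also have "... : sets (F t)"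
   using null_in_F[OF N(1) _ t] measurable_sets[OF f D] by (intro sets.Un sets.Diff) auto
  finally show "g -` D Int space (F t) : sets (F t)" .
 qed auto
qed

text \<open>Stopping times bounded by \<open>T\<close> everywhere; a stopping time that is at most \<open>T\<close> almost surely
 is replaced by its minimum with \<open>T\<close>.\<close>

definition bst :: "('w => real) => bool" where
 "bst \<tau> <-> stopping_time F \<tau> & (\<forall>w\<in>\<Omega>. 0 <= \<tau> w & \<tau> w <= T)"

lemma bst_stopping: "bst \<tau> ==> stopping_time F \<tau>" by (simp add: bst_def)
lemma bst_ge: "bst \<tau> ==> w : \<Omega> ==> 0 <= \<tau> w" by (simp add: bst_def)
lemma bst_le: "bst \<tau> ==> w : \<Omega> ==> \<tau> w <= T" by (simp add: bst_def)

lemma bst_const: "0 <= c ==> c <= T ==> bst (%_. c)"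
 by (auto simp: bst_def stopping_time_const)

lemma bst_min: "bst \<sigma> ==> bst \<tau> ==> bst (%w. min (\<sigma> w) (\<tau> w))"
 by (auto simp: bst_def stopping_time_min)

lemma bst_max: "bst \<sigma> ==> bst \<tau> ==> bst (%w. max (\<sigma> w) (\<tau> w))"
 by (auto simp: bst_def stopping_time_max)

lemma stop_le_sets: "stopping_time F \<tau> ==> {w\<in>\<Omega>. \<tau> w <= t} : sets (F t)"
 using stopping_timeD[of F \<tau> t] by (simp add: pred_def space_F)

lemma stop_less_sets: "stopping_time F \<tau> ==> {w\<in>\<Omega>. \<tau> w < t} : sets (F t)"
 using stopping_time_less_const[of \<tau> t] by (simp add: pred_def space_F)

lemma stop_ge_sets: "stopping_time F \<tau> ==> {w\<in>\<Omega>. t <= \<tau> w} : sets (F t)"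
proof -
 assume "stopping_time F \<tau>"
 from sets.Diff[OF sets.top stop_less_sets[OF this, of t]]
 have "space (F t) - {w\<in>\<Omega>. \<tau> w < t} : sets (F t)" .
 also have "space (F t) - {w\<in>\<Omega>. \<tau> w < t} = {w\<in>\<Omega>. t <= \<tau> w}" by (auto simp: space_F)
 finally show ?thesis .
qed

lemma stop_measurable: "stopping_time F \<tau> ==> \<tau> : Bor P"
 using subalg by (intro measurable_stopping_time[of F]) (auto simp: space_F)

lemma bst_measurable: "bst \<tau> ==> \<tau> : Bor P"
 by (simp add: bst_def stop_measurable)

lemma min_stop_measurable: "stopping_time F \<tau> ==> (%w. min t (\<tau> w)) : Bor (F t)"
proof (rule borel_measurableI_le)
 fix y assume \<tau>: "stopping_time F \<tau>"
 show "{w : space (F t). min t (\<tau> w) <= y} : sets (F t)"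
 proof (cases "t <= y")
  case True
  hence "{w : space (F t). min t (\<tau> w) <= y} = space (F t)" by auto
  thus ?thesis by simp
 next
  case False
  hence "{w : space (F t). min t (\<tau> w) <= y} = {w\<in>\<Omega>. \<tau> w <= y}" by (auto simp: space_F)
  with stop_le_sets[OF \<tau>, of y] sets_F_mono[of y t] False show ?thesis by auto
 qed
qed

lemma right_continuous_filtration:
 assumes "0 <= t" "!!s. t < s ==> A : sets (F s)"
 shows "A : sets (F t)"
proof -
 have "sets (F t) = (\<Inter>s\<in>{t<..}. sets (F s))"
  using jump_basis assms(1) by (simp add: jump_basis_def usual_filtration_def)
 with assms(2) show ?thesis by auto
qed

text \<open>By right continuity of the filtration strict inequalities suffice.\<close>

lemma stopping_timeI_less:
 assumes less: "!!t. 0 < t ==> {w\<in>\<Omega>. \<tau> w < t} : sets (F t)" and nn: "!!w. w : \<Omega> ==> 0 <= \<tau> w"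
 shows "stopping_time F \<tau>"
proof (rule stopping_timeI)
 fix t
 have "{w\<in>\<Omega>. \<tau> w <= t} : sets (F t)"
 proof (cases "0 <= t")
  case True
  show ?thesis
  proof (rule right_continuous_filtration[OF True])
   fix s assume s: "t < s"
   have *: "{w\<in>\<Omega>. \<tau> w < t + (s - t) / (Suc n)} : sets (F s)" for n
   proof -
    have "t + (s - t) / (Suc n) <= s"
     using s divide_left_mono[of 1 "real (Suc n)" "s - t"] by simp
    moreover have "0 < t + (s - t) / (Suc n)" using True s by (intro add_nonneg_pos) auto
    ultimately show ?thesis using less sets_F_mono by blast
   qed
   have "{w\<in>\<Omega>. \<tau> w <= t} = (\<Inter>n. {w\<in>\<Omega>. \<tau> w < t + (s - t) / (Suc n)})"
   proof (intro equalityI subsetI)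
    fix w assume "w : {w\<in>\<Omega>. \<tau> w <= t}"
    hence "w : \<Omega>" "\<tau> w <= t" by auto
    moreover have "t < t + (s - t) / (Suc n)" for n using s by simp
    ultimately show "w : (\<Inter>n. {w\<in>\<Omega>. \<tau> w < t + (s - t) / (Suc n)})"
     using le_less_trans by blast
   next
    fix w assume w: "w : (\<Inter>n. {w\<in>\<Omega>. \<tau> w < t + (s - t) / (Suc n)})"
    have "(%n. t + (s - t) * inverse (Suc n)) ----> t + (s - t) * 0"
     by (intro tendsto_intros LIMSEQ_inverse_real_of_nat)
    hence "\<tau> w <= t + (s - t) * 0"
     by (rule LIMSEQ_le_const) (use w in "auto simp: divide_inverse intro!: exI[of _ 0] less_imp_le")
    thus "w : {w\<in>\<Omega>. \<tau> w <= t}" using w by auto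
   qed
   thus "{w\<in>\<Omega>. \<tau> w <= t} : sets (F s)" using * by auto
  qed
 next
  case False
  hence "{w\<in>\<Omega>. \<tau> w <= t} = {}" using nn by force
  thus ?thesis by (metis sets.empty_sets)
 qed
 thus "Measurable.pred (F t) (%w. \<tau> w <= t)" by (simp add: pred_def space_F)
qed

lemma pre_sigma_sub: "stopping_time F \<tau> ==> (!!w. w : \<Omega> ==> \<tau> w <= T) ==> sets (pre_sigma \<tau>) <= sets (F T)"
proof
 fix A assume \<tau>: "stopping_time F \<tau>" "!!w. w : \<Omega> ==> \<tau> w <= T" and A: "A : sets (pre_sigma \<tau>)"
 have "A <= \<Omega>" using sets.sets_into_space[OF A] by (simp add: space_pre_sigma)
 hence "A = {w\<in>A. \<tau> w <= T}" using \<tau>(2) by auto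
 with sets_pre_sigmaD[OF \<tau>(1) A, of T] show "A : sets (F T)" by simp
qed

lemma pre_sigma_imp_FT: "bst \<tau> ==> f : measurable (pre_sigma \<tau>) N ==> f : measurable (F T) N"
 using pre_sigma_sub[of \<tau>] by (auto simp: measurable_def space_F space_pre_sigma bst_def)

lemma pre_sigma_imp_P: "bst \<tau> ==> f : measurable (pre_sigma \<tau>) N ==> f : measurable P N"
 by (rule F_imp_P[OF pre_sigma_imp_FT])

lemma pre_sigma_mono:
 assumes "bst \<sigma>" "bst \<tau>" "!!w. w : \<Omega> ==> \<sigma> w <= \<tau> w" "f : measurable (pre_sigma \<sigma>) N"
 shows "f : measurable (pre_sigma \<tau>) N"
 using mono_pre_sigma[of \<sigma> \<tau>] assms by (auto simp: measurable_def space_pre_sigma bst_def)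

text \<open>Restricting a stopping time to a set of its past reduces integrals over that set to expectations at stopping times.\<close>

lemma bst_restrict:
 assumes \<tau>: "bst \<tau>" and A: "A : sets (pre_sigma \<tau>)"
 shows "bst (%w. if w : A then \<tau> w else T)"
 unfolding bst_def
proof (intro conjI ballI)
 show "stopping_time F (%w. if w : A then \<tau> w else T)"
 proof (rule stopping_timeI)
  fix t
  have "A <= \<Omega>" using sets.sets_into_space[OF A] by (simp add: space_pre_sigma)
  hence "{w\<in>\<Omega>. (if w : A then \<tau> w else T) <= t} = (if T <= t then space (F t) else {w\<in>A. \<tau> w <= t})"
   using bst_le[OF \<tau>] by (force simp: space_F)
  also have "... : sets (F t)"
   using sets_pre_sigmaD[OF bst_stopping[OF \<tau>] A] by auto
  finally show "Measurable.pred (F t) (%w. (if w : A then \<tau> w else T) <= t)"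
   by (simp add: pred_def space_F)
 qed
qed (use \<tau> T_nonneg in "auto simp: bst_def")

section \<open>Adapted RCLL processes\<close>

text \<open>Adapted processes with RCLL paths.\<close>

definition arc :: "(real => 'w => real) => bool" where
 "arc X <-> adapted B X & rcll_paths B X"

lemma arcD: "arc X ==> t : {0..T} ==> X t : Bor (F t)"
 "arc X ==> w : \<Omega> ==> rcll T (%t. X t w)"
 by (auto simp: arc_def adapted_def rcll_paths_def)

lemma arc_measurable_P: "arc X ==> t : {0..T} ==> X t : Bor P"
 using arcD(1) F_imp_P by blast

lemma arcI: "(!!t. t : {0..T} ==> X t : Bor (F t)) ==>
  (!!w. w : \<Omega> ==> rcll T (%t. X t w)) ==> arc X"
 by (auto simp: arc_def adapted_def rcll_paths_def)

lemma rcll_subinterval: "rcll b x ==> t <= b ==> rcll t x"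
 by (auto simp: rcll_def)

lemma arc_stopped_measurable:
 assumes X: "arc X" and \<tau>: "stopping_time F \<tau>" "!!w. w : \<Omega> ==> 0 <= \<tau> w" and t: "t : {0..T}"
 shows "(%w. X (min t (\<tau> w)) w) : Bor (F t)"
proof (cases "t = 0")
 case True
 have "(%w. X (min t (\<tau> w)) w) : Bor (F t) <-> X 0 : Bor (F t)"
  by (rule measurable_cong) (use \<tau>(2) True in "auto simp: space_F")
 thus ?thesis using arcD(1)[OF X t] True by simp
next
 case False
 hence t': "0 < t" "t <= T" using t by auto
 show ?thesis
 proof (rule rcll_substitution[OF _ _ min_stop_measurable[OF \<tau>(1)] _ t'(1)])
  show "X s : Bor (F t)" if "s : {0..t}" for s using that t' by (intro F_mono[OF _ arcD(1)[OF X]]) auto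
  show "rcll t (%s. X s w)" if "w : space (F t)" for w
   using that t' by (intro rcll_subinterval[OF arcD(2)[OF X]]) (auto simp: space_F)
 qed (use \<tau>(2) t' in "auto simp: space_F")
qed

lemma arc_at_stop_pre_sigma:
 assumes X: "arc X" and \<tau>: "bst \<tau>"
 shows "(%w. X (\<tau> w) w) : Bor (pre_sigma \<tau>)"
proof (rule measurableI)
 fix D :: "real set" assume D: "D : sets borel"
 show "(%w. X (\<tau> w) w) -` D Int space (pre_sigma \<tau>) : sets (pre_sigma \<tau>)"
 proof (rule sets_pre_sigmaI[OF bst_stopping[OF \<tau>]])
  fix t
  show "{w : (%w. X (\<tau> w) w) -` D Int space (pre_sigma \<tau>). \<tau> w <= t} : sets (F t)" (is "?A : _")
  proof (cases "0 <= t")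
   case True
   let ?s = "min t T"
   have s: "?s : {0..T}" using True T_nonneg by auto
   have "?A = ((%w. X (min ?s (\<tau> w)) w) -` D Int space (F ?s)) Int {w\<in>\<Omega>. \<tau> w <= ?s}"
   proof (intro set_eqI)
    fix w
    have "min ?s (\<tau> w) = \<tau> w" if "w : \<Omega>" "\<tau> w <= t"
     using that bst_le[OF \<tau>, of w] by (simp add: min_def)
    thus "w : ?A <-> w : ((%w. X (min ?s (\<tau> w)) w) -` D Int space (F ?s)) Int {w\<in>\<Omega>. \<tau> w <= ?s}"
     using bst_le[OF \<tau>] by (auto simp: space_pre_sigma space_F)
   qed
   moreover have "(%w. X (min ?s (\<tau> w)) w) -` D Int space (F ?s) : sets (F ?s)"
    by (rule measurable_sets[OF arc_stopped_measurable[OF X bst_stopping[OF \<tau>] _ s] D])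
      (use bst_ge[OF \<tau>] in auto)
   ultimately have "?A : sets (F ?s)"
    using stop_le_sets[OF bst_stopping[OF \<tau>], of ?s] by auto
   thus ?thesis using sets_F_mono[of ?s t] by auto
  next
   case False
   hence "?A = {}" using \<tau> by (force simp: space_pre_sigma bst_def)
   thus ?thesis by (metis sets.empty_sets)
  qed
 qed
qed auto

lemma arc_at_stop_P: "arc X ==> bst \<tau> ==> (%w. X (\<tau> w) w) : Bor P"
 using arc_at_stop_pre_sigma pre_sigma_imp_P by blast

lemma arc_stopped:
 assumes X: "arc X" and \<tau>: "bst \<tau>"
 shows "arc (%t w. X (min t (\<tau> w)) w)"
 using \<tau> by (intro arcI arc_stopped_measurable[OF X] rcll_stopped[OF arcD(2)[OF X]])
   (auto simp: bst_def T_nonneg)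

lemma arc_add: "arc X ==> arc Y ==> arc (%t w. X t w + Y t w)"
 by (intro arcI rcll_add borel_measurable_add) (auto intro: arcD)

lemma arc_diff: "arc X ==> arc Y ==> arc (%t w. X t w - Y t w)"
 by (intro arcI rcll_diff borel_measurable_diff) (auto intro: arcD)

lemma arc_min: "arc X ==> arc Y ==> arc (%t w. min (X t w) (Y t w))"
 by (intro arcI rcll_min borel_measurable_min) (auto intro: arcD)

lemma arc_zero: "arc (%t w. 0)"
 by (intro arcI) auto

text \<open>By right continuity two modifications of each other agree at all times off one null set.\<close>

lemma arc_AE_eq:
 assumes X: "arc X" and Y: "arc Y" and eq: "!!t. t : {0..T} ==> AE w in P. X t w = Y t w"
 shows "AE w in P. \<forall>t\<in>{0..T}. X t w = Y t w"
proof -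
 have "AE w in P. \<forall>t\<in>rtimes T. X t w = Y t w"
  using rtimes_subset[OF T_nonneg] by (subst AE_ball_countable[OF countable_rtimes]) (auto intro: eq)
 thus ?thesis
  using AE_space
 proof eventually_elim
  fix w assume eq: "\<forall>t\<in>rtimes T. X t w = Y t w" and w: "w : \<Omega>"
  show "\<forall>t\<in>{0..T}. X t w = Y t w"
   using rcll_eq_dense[OF arcD(2)[OF X w] arcD(2)[OF Y w]] eq by auto
 qed
qed

section \<open>Joint measurability\<close>

abbreviation tm :: "real measure" where "tm \<equiv> restrict_space lborel {0..T}"

lemma space_dtP: "space (dtP B) = {0..T} \<times> \<Omega>"
 by (simp add: dtP_def space_pair_measure space_restrict_space)

lemma time_measurable: "fst : Bor (dtP B)"
 unfolding dtP_def by (rule measurable_compose[OF measurable_fst measurable_restrict_space1]) simp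

lemma Int_restrict_space: "A : sets M ==> A Int S : sets (restrict_space M S)"
 by (subst Int_commute) (simp add: sets_restrict_space)

sublocale tm: finite_measure tm
 by (rule finite_measureI) (simp add: emeasure_restrict_space space_restrict_space T_nonneg)

sublocale tmP: pair_sigma_finite tm P ..

sublocale dtP: finite_measure "dtP B"
proof
 have "emeasure (dtP B) (space (dtP B)) = emeasure tm (space tm) * emeasure P \<Omega>"
  unfolding dtP_def space_pair_measure using sets.top[of tm]
  by (intro emeasure_pair_measure_Times) auto
 thus "emeasure (dtP B) (space (dtP B)) \<noteq> \<infinity>"
  using tm.emeasure_finite[of "space tm"] by (simp add: emeasure_space_1)
qed

lemma arc_dtP:
 assumes X: "arc X"
 shows "(%(t, w). X t w) : Bor (dtP B)"
 unfolding case_prod_beta'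
proof (rule rcll_substitution[where X = "%s x. X s (snd x)" and b = T, OF _ _ time_measurable _ T_pos])
 show "(%x. X s (snd x)) : Bor (dtP B)" if "s : {0..T}" for s
  unfolding dtP_def by (rule measurable_compose[OF measurable_snd arc_measurable_P[OF X that]])
 show "rcll T (%s. X s (snd x))" if "x : space (dtP B)" for x
  using that by (intro arcD(2)[OF X]) (auto simp: space_dtP)
qed (auto simp: space_dtP)

section \<open>Predictable processes\<close>

definition pred_gen :: "(real \<times> 'w) set set" where
 "pred_gen = {{0} \<times> A |A. A : sets (F 0)} \<union>
   {{s<..t} \<times> A |s t A. 0 <= s & s <= t & t <= T & A : sets (F s)}"

lemma F_space: "A : sets (F s) ==> A <= \<Omega>"
 using sets.sets_into_space[of A "F s"] by (simp add: space_F)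

lemma pred_gen_Pow: "pred_gen <= Pow ({0..T} \<times> \<Omega>)"
 using F_space T_nonneg by (fastforce simp: pred_gen_def)

lemma pred_sigma_eq: "pred_sigma B = sigma ({0..T} \<times> \<Omega>) pred_gen"
 by (simp add: pred_sigma_def pred_gen_def)

lemma space_pred_sigma: "space (pred_sigma B) = {0..T} \<times> \<Omega>"
 unfolding pred_sigma_eq by (rule space_measure_of[OF pred_gen_Pow])

lemma sets_pred_sigma: "sets (pred_sigma B) = sigma_sets ({0..T} \<times> \<Omega>) pred_gen"
 unfolding pred_sigma_eq by (rule sets_measure_of[OF pred_gen_Pow])

lemma pred_gen_pred: "A : pred_gen ==> A : sets (pred_sigma B)"
 unfolding sets_pred_sigma by (rule sigma_sets.Basic)

lemma interval_pred: "0 <= s ==> A : sets (F s) ==> ({s<..} Int {0..T}) \<times> A : sets (pred_sigma B)"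
proof (cases "s <= T")
 case True
 assume s: "0 <= s" "A : sets (F s)"
 have "({s<..} Int {0..T}) \<times> A = {s<..T} \<times> A" using s by auto
 also have "... : sets (pred_sigma B)" using s True by (intro pred_gen_pred) (auto simp: pred_gen_def)
 finally show ?thesis .
next
 case False
 hence e: "({s<..} Int {0..T}) \<times> A = {}" by auto
 show ?thesis unfolding e by simp
qed

text \<open>Restricted to \<open>[0, t]\<close>, predictable rectangles are measurable with respect to \<open>F\<^sub>t\<close>.\<close>

lemma progressive:
 assumes t: "0 <= t" "t <= T"
 shows "(%(s, w). (s, w)) : measurable (restrict_space borel {0..t} \<otimes> F t) (pred_sigma B)"
 unfolding pred_sigma_eq
proof (rule measurable_measure_of[OF pred_gen_Pow])
 show "(%(s, w). (s, w)) : space (restrict_space borel {0..t} \<otimes> F t) \<rightarrow> {0..T} \<times> \<Omega>"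
  using t by (auto simp: space_pair_measure space_restrict_space space_F)
next
 fix y assume "y : pred_gen"
 then consider A where "y = {0} \<times> A" "A : sets (F 0)"
  | s u A where "y = {s<..u} \<times> A" "0 <= s" "s <= u" "u <= T" "A : sets (F s)"
  by (auto simp: pred_gen_def)
 thus "(%(s, w). (s, w)) -` y Int space (restrict_space borel {0..t} \<otimes> F t)
   : sets (restrict_space borel {0..t} \<otimes> F t)"
 proof cases
  case 1
  have "(%(s, w). (s, w)) -` y Int space (restrict_space borel {0..t} \<otimes> F t) = ({0} Int {0..t}) \<times> A"
   using 1 F_space[OF 1(2)] by (auto simp: space_pair_measure space_restrict_space space_F)
  moreover have "{0} Int {0..t} : sets (restrict_space borel {0..t})" by (intro Int_restrict_space) simp
  moreover have "A : sets (F t)" using 1(2) sets_F_mono[OF t(1)] by blast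
  ultimately show ?thesis by (simp only: pair_measureI)
 next
  case 2
  have eq: "(%(s, w). (s, w)) -` y Int space (restrict_space borel {0..t} \<otimes> F t) = ({s<..u} Int {0..t}) \<times> A"
   using 2 F_space[OF 2(5)] by (auto simp: space_pair_measure space_restrict_space space_F)
  show ?thesis
  proof (cases "s <= t")
   case True
   have "A : sets (F t)" using 2(5) sets_F_mono[OF True] by blast
   moreover have "{s<..u} Int {0..t} : sets (restrict_space borel {0..t})" by (intro Int_restrict_space) simp
   ultimately show ?thesis unfolding eq by (simp only: pair_measureI)
  next
   case False
   hence e: "({s<..u} Int {0..t}) \<times> A = {}" by auto
   show ?thesis unfolding eq e by simp
  qed
 qed
qed

lemma predictable_progressive:
 assumes "predictable B X" "0 <= t" "t <= T"
 shows "(%(s, w). X s w) : Bor (restrict_space borel {0..t} \<otimes> F t)"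
 using measurable_compose[OF progressive[OF assms(2,3)] assms(1)[unfolded predictable_def]]
 by (simp add: case_prod_beta')

lemma pred_dtP: "(%x. x) : measurable (dtP B) (pred_sigma B)"
proof -
 have s: "sets (dtP B) = sets (restrict_space borel {0..T} \<otimes> P)"
  unfolding dtP_def by (intro sets_pair_measure_cong sets_restrict_space_cong) auto
 have "(%x. (fst x, snd x)) : measurable (restrict_space borel {0..T} \<otimes> P) (restrict_space borel {0..T} \<otimes> F T)"
 proof (rule measurable_Pair)
  have "(%x. x) : measurable P (F T)"
   using subalg[of T] sets.sets_into_space by (auto simp: measurable_def space_F Int_absorb2)
  thus "snd : measurable (restrict_space borel {0..T} \<otimes> P) (F T)"
   by (rule measurable_compose[OF measurable_snd])
 qed (rule measurable_fst)
 from measurable_compose[OF this progressive[OF T_nonneg order_refl]]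
 show ?thesis by (simp add: case_prod_beta' measurable_cong_sets[OF s refl])
qed

lemma predictable_dtP: "predictable B X ==> (%(t, w). X t w) : Bor (dtP B)"
 unfolding predictable_def by (rule measurable_compose[OF pred_dtP])

lemma predictable_adapted:
 assumes X: "predictable B X" and t: "t : {0..T}"
 shows "X t : Bor (F t)"
proof -
 have "(%w. (t, w)) : measurable (F t) (restrict_space borel {0..t} \<otimes> F t)"
  using t by (intro measurable_Pair) (auto simp: space_restrict_space intro!: measurable_const)
 from measurable_compose[OF this predictable_progressive[OF X]] t show ?thesis by simp
qed

lemma stoch_interval_pred:
 assumes \<tau>: "stopping_time F \<tau>" "!!w. w : \<Omega> ==> 0 <= \<tau> w" and A: "A : sets (pre_sigma \<tau>)"
 shows "{(t, w) : {0..T} \<times> \<Omega>. \<tau> w < t & w : A} : sets (pred_sigma B)"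
proof -
 have A': "A <= \<Omega>" using sets.sets_into_space[OF A] by (simp add: space_pre_sigma)
 have "{(t, w) : {0..T} \<times> \<Omega>. \<tau> w < t & w : A}
   = (\<Union>q\<in>\<rat> Int {0..}. ({q<..} Int {0..T}) \<times> {w\<in>A. \<tau> w <= q})" (is "?L = ?R")
 proof (intro equalityI subsetI)
  fix x assume "x : ?L"
  then obtain t w where x: "x = (t, w)" "0 <= t" "t <= T" "w : \<Omega>" "\<tau> w < t" "w : A" by auto
  obtain q where q: "q : \<rat>" "\<tau> w < q" "q < t" using Rats_dense_in_real[OF x(5)] by auto
  thus "x : ?R" using x \<tau>(2)[OF x(4)] by (auto intro!: bexI[of _ q])
 next
  fix x assume "x : ?R" thus "x : ?L" using A' by auto
 qed
 moreover have "?R : sets (pred_sigma B)"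
  by (intro sets.countable_UN'' countable_Int1 countable_rat interval_pred sets_pre_sigmaD[OF \<tau>(1) A]) auto
 ultimately show ?thesis by simp
qed

lemma predictable_slices:
 assumes G: "space G = \<Omega>" and R: "!!A. A : sets G ==> {(t, w) : {0..T} \<times> \<Omega>. R t w & w : A} : sets (pred_sigma B)"
  and h: "h : Bor G"
 shows "predictable B (%t w. if R t w then h w else (0::real))"
 unfolding predictable_def
proof (rule measurableI)
 fix D :: "real set" assume D: "D : sets borel"
 let ?I = "%A. {(t, w) : {0..T} \<times> \<Omega>. R t w & w : A}"
 have A: "h -` D Int \<Omega> : sets G" "\<Omega> : sets G" using measurable_sets[OF h D] sets.top[of G] by (simp_all add: G)
 have "(%(t, w). if R t w then h w else 0) -` D Int space (pred_sigma B)
   = ?I (h -` D Int \<Omega>) \<union> (if 0 : D then space (pred_sigma B) - ?I \<Omega> else {})"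
  by (auto simp: space_pred_sigma split: if_splits)
 also have "... : sets (pred_sigma B)" using R[OF A(1)] R[OF A(2)] by auto
 finally show "(%(t, w). if R t w then h w else 0) -` D Int space (pred_sigma B) : sets (pred_sigma B)" .
qed auto

lemma pred_after_stop:
 assumes \<tau>: "bst \<tau>" and \<eta>: "\<eta> : Bor (pre_sigma \<tau>)"
 shows "predictable B (%t w. if \<tau> w < t then \<eta> w else (0::real))"
 by (rule predictable_slices[OF space_pre_sigma stoch_interval_pred \<eta>]) (use \<tau> in "auto simp: bst_def")

lemma predictable_mult: "predictable B X ==> predictable B Y ==> predictable B (%t w. X t w * Y t w)"
 unfolding predictable_def case_prod_beta' by measurable

lemma predictable_add: "predictable B X ==> predictable B Y ==> predictable B (%t w. X t w + Y t w)"
 unfolding predictable_def case_prod_beta' by measurable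

lemma predictable_diff: "predictable B X ==> predictable B Y ==> predictable B (%t w. X t w - Y t w)"
 unfolding predictable_def case_prod_beta' by measurable

lemma predictable_const: "predictable B (%t w. c)"
 unfolding predictable_def by simp

lemma predictable_cong:
 assumes "!!t w. t : {0..T} ==> w : \<Omega> ==> X t w = Y t w" "predictable B X"
 shows "predictable B Y"
 using assms(2) unfolding predictable_def
 by (rule measurable_cong[THEN iffD1, rotated]) (auto simp: space_pred_sigma assms(1))

lemma pred_until_stop:
 assumes \<tau>: "bst \<tau>"
 shows "predictable B (%t w. if t <= \<tau> w then 1 else (0::real))"
 by (rule predictable_cong[OF _ predictable_diff[OF predictable_const[of 1] pred_after_stop[OF \<tau>, of "%_. 1"]]]) auto

lemma predictable_interval:
 assumes s: "0 <= s" "s <= u" "u <= T" and h: "h : Bor (F s)"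
 shows "predictable B (%t w. h w * ind {s<..u} t :: real)"
proof (rule predictable_cong[OF _ predictable_slices[OF space_F _ h]])
 fix A assume A: "A : sets (F s)"
 have "{(t, w) : {0..T} \<times> \<Omega>. t : {s<..u} & w : A} = {s<..u} \<times> A" using s F_space[OF A] by auto
 also have "... : sets (pred_sigma B)" using A s by (intro pred_gen_pred) (auto simp: pred_gen_def)
 finally show "{(t, w) : {0..T} \<times> \<Omega>. t : {s<..u} & w : A} : sets (pred_sigma B)" .
qed auto

lemma predictable_zero_time:
 assumes h: "h : Bor (F 0)"
 shows "predictable B (%t w. h w * ind {0} t :: real)"
proof (rule predictable_cong[OF _ predictable_slices[OF space_F _ h]])
 fix A assume A: "A : sets (F 0)"
 have "{(t, w) : {0..T} \<times> \<Omega>. t = 0 & w : A} = {0} \<times> A" using T_nonneg F_space[OF A] by auto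
 also have "... : sets (pred_sigma B)" using A by (intro pred_gen_pred) (auto simp: pred_gen_def)
 finally show "{(t, w) : {0..T} \<times> \<Omega>. t = 0 & w : A} : sets (pred_sigma B)" .
qed auto

lemma predictable_time: "predictable B (%t w. t)"
 unfolding predictable_def
proof (rule borel_measurableI_greater)
 fix c :: real
 have "\<Omega> : sets (F (max 0 c))" using sets.top[of "F (max 0 c)"] by (simp add: space_F)
 from interval_pred[OF _ this] have i: "({max 0 c<..} Int {0..T}) \<times> \<Omega> : sets (pred_sigma B)" by simp
 have "{x : space (pred_sigma B). c < (case x of (t, w) => t)}
   = (if 0 <= c then ({max 0 c<..} Int {0..T}) \<times> \<Omega> else space (pred_sigma B))" by (auto simp: space_pred_sigma)
 thus "{x : space (pred_sigma B). c < (case x of (t, w) => t)} : sets (pred_sigma B)"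
  by (cases "0 <= c") (simp_all only: if_True if_False sets.top i simp_thms)
qed

text \<open>A continuous adapted process is the limit of its left step approximations.\<close>

lemma continuous_adapted_predictable:
 assumes X: "!!t. t : {0..T} ==> X t : Bor (F t)"
  and cont: "!!w. w : \<Omega> ==> continuous_on {0..T} (%t. X t w :: real)"
 shows "predictable B X"
proof -
 have arc: "arc X" by (intro arcI X rcll_continuous cont)
 define q where "q N i = max 0 (min T (T * (real_of_int i - 1) / real (Suc N)))" for N i
 define k where "k N t = \<lceil>t * real (Suc N) / T\<rceil>" for N and t :: real
 have q: "q N (k N t) < t & abs (q N (k N t) - t) <= T / real (Suc N)" if t: "0 < t" "t <= T" for N t
 proof -
  define m where "m = real (Suc N)"
  define c where "c = real_of_int (k N t)"
  have m: "0 < m" by (simp add: m_def)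
  have "t * m / T <= c" "c - 1 < t * m / T" unfolding c_def k_def m_def by linarith+
  hence "t * m <= c * T" "(c - 1) * T < t * m" using T_pos by (simp_all add: pos_divide_le_eq pos_less_divide_eq)
  hence "t - T / m <= T * (c - 1) / m" "T * (c - 1) / m < t" using m by (auto simp: field_simps)
  thus ?thesis using t T_pos unfolding q_def m_def[symmetric] c_def[symmetric] by (auto simp: max_def min_def)
 qed
 have "predictable B (%t w. if q N (k N t) < t then X (q N (k N t)) w else 0)" for N
  unfolding predictable_def case_prod_beta'
 proof (rule measurable_compose_countable[where f = "%i x. if q N i < fst x then X (q N i) (snd x) else 0" and g = "%x. k N (fst x)"])
  show "(%x. if q N i < fst x then X (q N i) (snd x) else 0) : Bor (pred_sigma B)" for i
  proof -
   have "bst (%_. q N i)" by (rule bst_const) (auto simp: q_def T_nonneg)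
   from pred_after_stop[OF this arc_at_stop_pre_sigma[OF arc this]] show ?thesis by (simp add: predictable_def case_prod_beta')
  qed
  note predictable_time[unfolded predictable_def case_prod_beta', measurable]
  show "(%x. k N (fst x)) : measurable (pred_sigma B) (count_space UNIV)" unfolding k_def by measurable
 qed
 hence "predictable B (%t w. if 0 < t then X t w else 0)"
  unfolding predictable_def case_prod_beta'
 proof (rule borel_measurable_LIMSEQ_real[rotated])
  fix x assume "x : space (pred_sigma B)"
  then obtain t w where x: "x = (t, w)" "0 <= t" "t <= T" "w : \<Omega>" by (auto simp: space_pred_sigma)
  show "(%N. if q N (k N (fst x)) < fst x then X (q N (k N (fst x))) (snd x) else 0) ----> (if 0 < fst x then X (fst x) (snd x) else 0)"
  proof (cases "0 < t")
   case True
   have "(%N. T * inverse (real (Suc N))) ----> T * 0" by (intro tendsto_intros LIMSEQ_inverse_real_of_nat)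
   hence "(%N. T / real (Suc N)) ----> 0" by (simp add: divide_inverse)
   hence "(%N. q N (k N t) - t) ----> 0" by (rule Lim_null_comparison[rotated]) (use q[OF True x(3)] in auto)
   hence "(%N. q N (k N t)) ----> t" by (simp add: LIM_zero_iff)
   hence "(%N. X (q N (k N t)) w) ----> X t w"
    by (rule continuous_on_tendsto_compose[OF cont[OF x(4)]]) (use x T_nonneg in "auto simp: q_def")
   thus ?thesis using q[OF True x(3)] True by (simp add: x)
  qed (simp add: x q_def)
 qed
 from predictable_add[OF predictable_zero_time[OF X[of 0]] this] show ?thesis
  by (rule predictable_cong[rotated]) (auto simp: indicator_def T_nonneg)
qed

text \<open>The stopped process agrees with \<open>A\<close> up to and including \<open>\<tau>\<close>, and then keeps the value \<open>A\<^sub>\<tau>\<close>, which is known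
 when the predictable set \<open>(\<tau>, T]\<close> is entered.\<close>

lemma pred_arc_stopped_predictable:
 assumes A: "predictable B A" "arc A" and \<tau>: "bst \<tau>"
 shows "predictable B (%t w. A (min t (\<tau> w)) w)"
proof -
 have "predictable B (%t w. A t w * (if t <= \<tau> w then 1 else 0) + (if \<tau> w < t then A (\<tau> w) w else 0))"
  by (intro predictable_add predictable_mult A pred_until_stop[OF \<tau>] pred_after_stop[OF \<tau>] arc_at_stop_pre_sigma \<tau>)
 thus ?thesis by (rule predictable_cong[rotated]) (auto simp: min_def)
qed

section \<open>Time integrals of predictable processes\<close>

lemma time_integral_adapted:
 assumes \<phi>: "predictable B \<phi>" and t: "t : {0..T}"
 shows "(%w. LINT s:{0..t}|lborel. \<phi> s w) : Bor (F t)"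
proof -
 interpret s: sigma_finite_measure "restrict_space lborel {0..t}"
  by (rule sigma_finite_measure_restrict_space) (auto intro: lborel.sigma_finite_measure_axioms)
 have "(%(s, w). \<phi> s w) : Bor (restrict_space lborel {0..t} \<otimes> F t)"
  using predictable_progressive[OF \<phi>, of t] t
  by (subst measurable_cong_sets[OF sets_pair_measure_cong refl]) (auto intro!: sets_restrict_space_cong)
 from measurable_pair_swap[OF this]
 have "(%(w, s). \<phi> s w) : Bor (F t \<otimes> restrict_space lborel {0..t})" by simp
 from s.borel_measurable_lebesgue_integral[OF this]
 have "(%w. \<integral>s. \<phi> s w \<partial>restrict_space lborel {0..t}) : Bor (F t)" .
 thus ?thesis by (simp add: integral_restrict_space set_lebesgue_integral_def)
qed

lemma time_integral_continuous:
 assumes "set_integrable lborel {0..T} (f :: real => real)"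
 shows "continuous_on {0..T} (%t. LINT s:{0..t}|lborel. f s)"
proof -
 have *: "(LINT s:{0..t}|lborel. f s) = integral {0..t} f" if "t : {0..T}" for t
  by (rule set_borel_integral_eq_integral(2)[OF set_integrable_subset[OF assms]]) (use that in auto)
 have "continuous_on {0..T} (%t. integral {0..t} f)"
  by (rule indefinite_integral_continuous_1[OF set_borel_integral_eq_integral(1)[OF assms]])
 thus ?thesis by (subst continuous_on_cong[OF refl *]) auto
qed

text \<open>The integral is adapted since predictable processes are progressive, and it is continuous.\<close>

lemma time_integral_predictable:
 assumes \<phi>: "predictable B \<phi>" and int: "!!w. w : \<Omega> ==> set_integrable lborel {0..T} (%s. \<phi> s w)"
 shows "predictable B (%t w. LINT s:{0..t}|lborel. \<phi> s w)"
  "arc (%t w. LINT s:{0..t}|lborel. \<phi> s w)"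
 using continuous_adapted_predictable[OF time_integral_adapted[OF \<phi>] time_integral_continuous[OF int]]
  arcI[OF time_integral_adapted[OF \<phi>] rcll_continuous[OF time_integral_continuous[OF int]]]
 by auto

end

section \<open>Increments of square integrable martingales\<close>

lemma L2n_dominated:
 assumes [measurable]: "!!n. f n : Bor M" "g : Bor M" and w: "sqi M w"
  and le: "!!n. AE x in M. abs (f n x) <= abs (w x)" "AE x in M. abs (g x) <= abs (w x)"
  and lim: "AE x in M. (%n. f n x) ----> g x"
 shows "(%n. L2n M (%x. f n x - g x)) ----> 0"
proof -
 have [measurable]: "w : Bor M" using w by (rule sqi_measurable)
 have "(%n. \<integral>\<^sup>+x. ennreal ((f n x - g x)^2) \<partial>M) ----> (\<integral>\<^sup>+x. 0 \<partial>M)"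
 proof (rule nn_integral_dominated_convergence[where w = "%x. ennreal (4 * (w x)^2)"])
  have "(\<integral>\<^sup>+x. ennreal (4 * (w x)^2) \<partial>M) = 4 * L2n M w"
   unfolding L2n_def by (simp add: ennreal_mult nn_integral_cmult)
  thus "(\<integral>\<^sup>+x. ennreal (4 * (w x)^2) \<partial>M) < \<infinity>"
   using w by (simp add: sqi_def ennreal_mult_less_top)
  fix n show "AE x in M. ennreal ((f n x - g x)^2) <= ennreal (4 * (w x)^2)"
   using le(1)[of n] le(2)
  proof eventually_elim
   fix x assume "abs (f n x) <= abs (w x)" "abs (g x) <= abs (w x)"
   hence "abs (f n x - g x) <= abs (2 * w x)" by linarith
   hence "(f n x - g x)^2 <= (2 * w x)^2" by (simp only: abs_le_square_iff)
   thus "ennreal ((f n x - g x)^2) <= ennreal (4 * (w x)^2)"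
    by (intro ennreal_leI) (simp add: power_mult_distrib)
  qed
 next
  show "AE x in M. (%n. ennreal ((f n x - g x)^2)) ----> 0"
   using lim
  proof eventually_elim
   fix x assume "(%n. f n x) ----> g x"
   hence "(%n. ennreal ((f n x - g x)^2)) ----> ennreal ((g x - g x)^2)"
    by (intro tendsto_ennrealI tendsto_intros)
   thus "(%n. ennreal ((f n x - g x)^2)) ----> 0" by simp
  qed
 qed simp_all
 thus ?thesis by (simp add: L2n_def)
qed

lemma integral_sum_list_prod:
 assumes f: "!!x. x : set xs ==> sqi M (f x)" and g: "!!y. y : set ys ==> sqi M (g y)"
 shows "(\<integral>w. (\<Sum>x\<leftarrow>xs. f x w) * (\<Sum>y\<leftarrow>ys. g y w) \<partial>M) = (\<Sum>x\<leftarrow>xs. \<Sum>y\<leftarrow>ys. \<integral>w. f x w * g y w \<partial>M)"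
proof -
 have 1: "(\<integral>w. a w * (\<Sum>y\<leftarrow>ys. g y w) \<partial>M) = (\<Sum>y\<leftarrow>ys. \<integral>w. a w * g y w \<partial>M)" if a: "sqi M a" for a
  using g
 proof (induct ys)
  case (Cons y ys)
  have "(\<integral>w. a w * g y w + a w * (\<Sum>y\<leftarrow>ys. g y w) \<partial>M) = (\<integral>w. a w * g y w \<partial>M) + (\<integral>w. a w * (\<Sum>y\<leftarrow>ys. g y w) \<partial>M)"
   using Cons.prems by (intro Bochner_Integration.integral_add sqi_prod a sqi_sum_list) auto
  with Cons show ?case by (simp add: distrib_left)
 qed simp
 show ?thesis
  using f
 proof (induct xs)
  case (Cons x xs)
  have "(\<integral>w. f x w * (\<Sum>y\<leftarrow>ys. g y w) + (\<Sum>x\<leftarrow>xs. f x w) * (\<Sum>y\<leftarrow>ys. g y w) \<partial>M)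
   = (\<integral>w. f x w * (\<Sum>y\<leftarrow>ys. g y w) \<partial>M) + (\<integral>w. (\<Sum>x\<leftarrow>xs. f x w) * (\<Sum>y\<leftarrow>ys. g y w) \<partial>M)"
   using Cons.prems g by (intro Bochner_Integration.integral_add sqi_prod sqi_sum_list) auto
  with Cons 1[of "f x"] show ?case by (simp add: distrib_right)
 qed simp
qed

context jbasis begin

text \<open>Square integrable martingales, expressed by orthogonality of the increments to the past, the form in which the
 property is used.\<close>

definition mart :: "(real => 'w => real) => bool" where
 "mart M <-> (\<forall>t\<in>{0..T}. M t : Bor (F t) & sqi P (M t)) &
   (\<forall>s u h. 0 <= s & s <= u & u <= T & h : Bor (F s) & sqi P h -->
    (\<E> w. h w * (M u w - M s w)) = 0)"

text \<open>The conditional covariance of increments grows like \<open>\<kappa>\<close> times the elapsed time; besides the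
 martingale property this is all that the stochastic integral needs to know of the noise.\<close>

definition covar :: "(real => 'w => real) => (real => 'w => real) => real => bool" where
 "covar M N \<kappa> <->
   (\<forall>s u h K. 0 <= s & s <= u & u <= T & h : Bor (F s) & (\<forall>w\<in>\<Omega>. abs (h w) <= K) -->
    (\<E> w. h w * ((M u w - M s w) * (N u w - N s w))) = \<kappa> * (u - s) * (\<E> w. h w))"

lemma mart_sqi: "mart M ==> 0 <= t ==> t <= T ==> sqi P (M t)"
 and mart_measurable: "mart M ==> 0 <= t ==> t <= T ==> M t : Bor (F t)"
 and mart_zero: "mart M ==> 0 <= s ==> s <= u ==> u <= T ==> h : Bor (F s) ==> sqi P h ==>
    (\<E> w. h w * (M u w - M s w)) = 0"
 by (auto simp: mart_def)

definition bcoef :: "real => ('w => real) => bool" where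
 "bcoef s h <-> h : Bor (F s) & (\<exists>K. \<forall>w\<in>\<Omega>. abs (h w) <= K)"

lemma step_coeff_iff: "step_coeff B h s u <-> 0 <= s & s <= u & u <= T & bcoef s h"
 by (auto simp: step_coeff_def bcoef_def bounded_iff)

lemma bcoef_P: "bcoef s h ==> h : Bor P"
 unfolding bcoef_def by (elim conjE F_imp_P)

lemma bcoef_mono: "bcoef s h ==> s <= t ==> bcoef t h"
 unfolding bcoef_def by (metis F_mono)

lemma bcoef_sqi: "bcoef s h ==> sqi P f ==> sqi P (%w. h w * f w)"
 using sqi_mult_bounded[OF _ bcoef_P] unfolding bcoef_def by blast

lemma bcoef_mult: "bcoef s h ==> bcoef s k ==> bcoef s (%w. h w * k w)"
 unfolding bcoef_def
proof (elim conjE exE, intro conjI)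
 fix K L assume K: "\<forall>w\<in>\<Omega>. abs (h w) <= K" "\<forall>w\<in>\<Omega>. abs (k w) <= L"
 hence "abs (h w * k w) <= K * L" if "w : \<Omega>" for w
  using that by (simp add: abs_mult mult_mono')
 thus "\<exists>K. \<forall>w\<in>\<Omega>. abs (h w * k w) <= K" by blast
qed simp

lemma bcoef_scale: "bcoef s h ==> bcoef s (%w. c * h w)"
proof -
 have "bcoef s (%w. c)" by (auto simp: bcoef_def)
 thus "bcoef s h ==> ?thesis" by (rule bcoef_mult)
qed

lemma covar_D:
 "covar M N \<kappa> ==> 0 <= s ==> s <= u ==> u <= T ==> bcoef s h ==>
  (\<E> w. h w * ((M u w - M s w) * (N u w - N s w))) = \<kappa> * (u - s) * (\<E> w. h w)"
 by (auto simp: covar_def bcoef_def)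

lemma covar_commute: "covar M N \<kappa> ==> covar N M \<kappa>"
 by (simp add: covar_def mult.commute)

lemma increment_orthogonal:
 assumes M: "mart M" and N: "mart N" and h: "step_coeff B h s u" and k: "step_coeff B k s' u'" and le: "u <= s'"
 shows "(\<E> w. (h w * (M u w - M s w)) * (k w * (N u' w - N s' w))) = 0"
proof -
 have h': "0 <= s" "s <= u" "u <= T" "bcoef s h" and k': "0 <= s'" "s' <= u'" "u' <= T" "bcoef s' k"
  using h k by (auto simp: step_coeff_iff)
 let ?H = "%w. k w * (h w * (M u w - M s w))"
 have "?H : Bor (F s')"
 proof (intro borel_measurable_times borel_measurable_diff)
  show "k : Bor (F s')" using k' by (simp add: bcoef_def)
  show "h : Bor (F s')" using bcoef_mono[OF h'(4), of s'] h' le by (simp add: bcoef_def)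
  show "M u : Bor (F s')" "M s : Bor (F s')"
   using h' le by (auto intro!: F_mono[OF _ mart_measurable[OF M]])
 qed
 moreover have "sqi P ?H" using h' k' by (intro bcoef_sqi sqi_diff mart_sqi[OF M]) auto
 ultimately have "(\<E> w. ?H w * (N u' w - N s' w)) = 0"
  using k' by (intro mart_zero[OF N]) auto
 thus ?thesis by (simp add: mult_ac)
qed

lemma increment_sqi:
 "mart M ==> step_coeff B h s u ==> sqi P (%w. h w * (M u w - M s w))"
 unfolding step_coeff_iff by (intro bcoef_sqi sqi_diff mart_sqi) auto

lemma increment_split:
 assumes M: "mart M" and N: "mart N" and h: "step_coeff B h s u" and r: "s <= r" "r <= u" and X: "sqi P X"
 shows "(\<E> w. (h w * (M u w - M s w)) * X w)
  = (\<E> w. (h w * (M r w - M s w)) * X w) + (\<E> w. (h w * (M u w - M r w)) * X w)"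
  "step_coeff B h s r" "step_coeff B h r u"
proof -
 show c: "step_coeff B h s r" "step_coeff B h r u"
  using h r by (auto simp: step_coeff_iff intro: bcoef_mono)
 have "(\<E> w. (h w * (M u w - M s w)) * X w)
   = (\<E> w. (h w * (M r w - M s w)) * X w + (h w * (M u w - M r w)) * X w)"
  by (rule Bochner_Integration.integral_cong) (auto simp: algebra_simps)
 also have "... = (\<E> w. (h w * (M r w - M s w)) * X w) + (\<E> w. (h w * (M u w - M r w)) * X w)"
  by (intro Bochner_Integration.integral_add sqi_prod X increment_sqi M c)
 finally show "(\<E> w. (h w * (M u w - M s w)) * X w)
  = (\<E> w. (h w * (M r w - M s w)) * X w) + (\<E> w. (h w * (M u w - M r w)) * X w)" .
qed

lemma increment_covar_aux:
 assumes M: "mart M" and N: "mart N" and MN: "covar M N \<kappa>"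
  and h: "step_coeff B h s u" and k: "step_coeff B k s u'" and le: "u <= u'"
 shows "(\<E> w. (h w * (M u w - M s w)) * (k w * (N u' w - N s w)))
   = \<kappa> * (u - s) * (\<E> w. h w * k w)"
proof -
 have h': "0 <= s" "s <= u" "u <= T" "bcoef s h" "bcoef s k" using h k by (auto simp: step_coeff_iff)
 note sp = increment_split[OF N M k h'(2) le increment_sqi[OF M h]]
 have "(\<E> w. (h w * (M u w - M s w)) * (k w * (N u w - N s w)))
   = (\<E> w. (h w * k w) * ((M u w - M s w) * (N u w - N s w)))"
  by (simp add: mult_ac)
 also have "... = \<kappa> * (u - s) * (\<E> w. h w * k w)"
  by (intro covar_D[OF MN] bcoef_mult h')
 finally show ?thesis
  using sp(1) increment_orthogonal[OF M N h sp(3) order_refl] by (simp add: mult.commute)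
qed

lemma increment_covar_le:
 assumes M: "mart M" and N: "mart N" and MN: "covar M N \<kappa>"
  and h: "step_coeff B h s u" and k: "step_coeff B k s' u'" and le: "s <= s'"
 shows "(\<E> w. (h w * (M u w - M s w)) * (k w * (N u' w - N s' w)))
   = \<kappa> * max 0 (min u u' - max s s') * (\<E> w. h w * k w)"
proof (cases "u <= s'")
 case True
 hence "max 0 (min u u' - max s s') = 0" by auto
 thus ?thesis using increment_orthogonal[OF M N h k True] by simp
next
 case False
 hence r: "s <= s'" "s' <= u" using le by auto
 note sp = increment_split[OF M N h r increment_sqi[OF N k]]
 have k': "s' <= u'" using k by (simp add: step_coeff_iff)
 have "(\<E> w. (h w * (M u w - M s' w)) * (k w * (N u' w - N s' w)))
   = \<kappa> * (min u u' - s') * (\<E> w. h w * k w)"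
 proof (cases "u <= u'")
  case True
  thus ?thesis using increment_covar_aux[OF M N MN sp(3) k True] by simp
 next
  case False
  thus ?thesis using increment_covar_aux[OF N M covar_commute[OF MN] k sp(3)] by (simp add: mult.commute)
 qed
 moreover have "max 0 (min u u' - max s s') = min u u' - s'" using r k' by auto
 ultimately show ?thesis
  using sp(1) increment_orthogonal[OF M N sp(2) k order_refl] by simp
qed

text \<open>Only the overlap of the two intervals contributes: increments over disjoint intervals are orthogonal.\<close>

lemma increment_covar:
 assumes M: "mart M" and N: "mart N" and MN: "covar M N \<kappa>"
  and h: "step_coeff B h s u" and k: "step_coeff B k s' u'"
 shows "(\<E> w. (h w * (M u w - M s w)) * (k w * (N u' w - N s' w)))
   = \<kappa> * max 0 (min u u' - max s s') * (\<E> w. h w * k w)"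
proof (cases "s <= s'")
 case True
 thus ?thesis by (rule increment_covar_le[OF M N MN h k])
next
 case False
 thus ?thesis using increment_covar_le[OF N M covar_commute[OF MN] k h]
  by (simp add: mult.commute min.commute max.commute)
qed

text \<open>Kolmogorov's argument: decompose by the first passage along a finite set of times, and exhaust a countable set of times that
 determines the supremum.\<close>

lemma maximal_inequality:
 assumes arc: "arc M" and M: "mart M" and lam: "0 < lam"
 shows "{w\<in>\<Omega>. \<exists>t\<in>{0..T}. lam < abs (M t w)} : sets P"
  "ennreal (lam^2) * emeasure P {w\<in>\<Omega>. \<exists>t\<in>{0..T}. lam < abs (M t w)} <= L2n P (M T)"
proof -
 note m = arc_measurable_P[OF arc]
 let ?E = "%G. {w\<in>\<Omega>. \<exists>t\<in>G. lam < abs (M t w)}"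
 have Em: "?E G : sets P" if "countable G" "G <= {0..T}" for G
 proof -
  have "(\<Union>t\<in>G. {w\<in>\<Omega>. lam < abs (M t w)}) : sets P"
   using that by (intro sets.countable_UN'' borel_measurable_less borel_measurable_abs m) auto
  also have "(\<Union>t\<in>G. {w\<in>\<Omega>. lam < abs (M t w)}) = ?E G" by auto
  finally show ?thesis .
 qed
 have fin: "ennreal (lam^2) * emeasure P (?E G) <= L2n P (M T)" if G: "finite G" "G <= {0..T}" for G
 proof -
  \<comment> \<open>first passage above \<open>lam\<close> along the finite set \<open>G\<close> occurs at \<open>t\<close>\<close>
  define A where "A t = {w\<in>\<Omega>. lam < abs (M t w) & (\<forall>s\<in>G. s < t --> abs (M s w) <= lam)}" for t
  have AF: "A t : sets (F t)" if t: "t : G" for t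
  proof -
   have Ms: "M s : Bor (F t)" if "s : G" "s <= t" for s
    using that G by (intro F_mono[OF that(2) arcD(1)[OF arc]]) auto
   have "A t = {w\<in>space (F t). lam < abs (M t w) & (\<forall>s\<in>{s\<in>G. s < t}. abs (M s w) <= lam)}"
    by (auto simp: A_def space_F)
   also have "... : sets (F t)"
    using t G(1) by (intro sets.sets_Collect_conj sets.sets_Collect_finite_All borel_measurable_less borel_measurable_le
      borel_measurable_abs Ms borel_measurable_const) auto
   finally show ?thesis .
  qed
  have AP: "A t : sets P" if "t : G" for t using AF[OF that] subalg by auto
  have E: "?E G = (\<Union>t\<in>G. A t)"
  proof (intro equalityI subsetI)
   fix w assume w: "w : ?E G"
   let ?H = "{t\<in>G. lam < abs (M t w)}"
   have H: "finite ?H" "?H \<noteq> {}" using G(1) w by auto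
   have "Min ?H : ?H" using Min_in[OF H] .
   moreover have "abs (M s w) <= lam" if "s : G" "s < Min ?H" for s
   proof (rule ccontr)
    assume "\<not> ?thesis"
    hence "Min ?H <= s" using that H by (intro Min_le) auto
    with that show False by simp
   qed
   ultimately show "w : (\<Union>t\<in>G. A t)" using w by (intro UN_I[of "Min ?H"]) (auto simp: A_def)
  qed (auto simp: A_def)
  have disj: "disjoint_family_on A G"
   unfolding disjoint_family_on_def A_def by (auto, (metis linorder_neqE not_le)+)
  have piece: "ennreal (lam^2) * emeasure P (A t) <= (\<integral>\<^sup>+w. ennreal ((M T w)^2) * ind (A t) w \<partial>P)" if t: "t : G" for t
  proof -
   have t': "0 <= t" "t <= T" using t G by auto
   note AP[OF t, measurable]
   let ?I = "%w. ind (A t) w :: real"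
   have sq: "sqi P (%w. ?I w * M t w)" "sqi P (%w. ?I w * M T w)"
     "sqi P (%w. ?I w * (M T w - M t w))"
    using t' T_nonneg by (auto intro!: sqi_mult_indicator AP[OF t] mart_sqi[OF M])
   have IF: "(%w. ?I w * M t w) : Bor (F t)"
    using AF[OF t] mart_measurable[OF M t'] by measurable
   have z: "(\<E> w. (?I w * M t w) * (M T w - M t w)) = 0"
    by (rule mart_zero[OF M t' order_refl IF sq(1)])
   have iz: "integrable P (%w. (?I w * M t w) * (M T w - M t w))"
    using t' T_nonneg by (intro sqi_prod sq sqi_diff mart_sqi[OF M]) auto
   \<comment> \<open>the increment after \<open>t\<close> is orthogonal to \<open>M\<^sub>t\<close> on \<open>A t\<close>, so the second moment only grows\<close>
   have "(\<E> w. (?I w * M T w)^2)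
    = (\<E> w. (?I w * M t w)^2 + 2 * ((?I w * M t w) * (M T w - M t w)) + (?I w * (M T w - M t w))^2)"
    by (rule Bochner_Integration.integral_cong) (auto simp: indicator_def power2_eq_square algebra_simps)
   also have "... = (\<E> w. (?I w * M t w)^2) + (\<E> w. (?I w * (M T w - M t w))^2)"
    using sq[THEN sqi_integrable_square] iz z by simp
   finally have "(\<E> w. (?I w * M t w)^2) <= (\<E> w. (?I w * M T w)^2)" by simp
   hence "L2n P (%w. ?I w * M t w) <= L2n P (%w. ?I w * M T w)"
    by (simp add: L2n_eq_integral sq)
   also have "... = (\<integral>\<^sup>+w. ennreal ((M T w)^2) * ind (A t) w \<partial>P)"
    unfolding L2n_def by (intro nn_integral_cong) (auto simp: indicator_def)
   finally have le: "L2n P (%w. ?I w * M t w) <= ..." .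
   have "ennreal (lam^2) * emeasure P (A t) = (\<integral>\<^sup>+w. ennreal (lam^2) * ind (A t) w \<partial>P)"
    by (simp add: nn_integral_cmult_indicator AP[OF t])
   also have "... <= L2n P (%w. ?I w * M t w)"
    unfolding L2n_def
   proof (rule nn_integral_mono)
    fix w
    have "lam^2 <= (M t w)^2" if "w : A t"
     using that lam by (simp add: A_def abs_le_square_iff[symmetric])
    thus "ennreal (lam^2) * ind (A t) w <= ennreal ((?I w * M t w)^2)"
     by (auto simp: indicator_def intro: ennreal_leI)
   qed
   also note le
   finally show ?thesis .
  qed
  have mT [measurable]: "M T : Bor P" using m T_nonneg by auto
  have "ennreal (lam^2) * emeasure P (?E G) = (\<Sum>t\<in>G. ennreal (lam^2) * emeasure P (A t))"
   unfolding E using AP G(1) disj by (subst sum_emeasure[symmetric]) (auto simp: sum_distrib_left)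
  also have "... <= (\<Sum>t\<in>G. \<integral>\<^sup>+w. ennreal ((M T w)^2) * ind (A t) w \<partial>P)"
   by (rule sum_mono[OF piece])
  also have "... = (\<integral>\<^sup>+w. (\<Sum>t\<in>G. ennreal ((M T w)^2) * ind (A t) w) \<partial>P)"
   by (intro nn_integral_sum[symmetric] borel_measurable_times_ennreal borel_measurable_indicator AP)
     measurable
  also have "... <= L2n P (M T)"
   unfolding L2n_def
  proof (rule nn_integral_mono)
   fix w
   have "(\<Sum>t\<in>G. ennreal ((M T w)^2) * ind (A t) w) = ennreal ((M T w)^2) * ind (\<Union>t\<in>G. A t) w"
    using disj G(1) by (subst indicator_UN_disjoint) (auto simp: sum_distrib_left)
   also have "... <= ennreal ((M T w)^2)" by (simp add: indicator_def)
   finally show "(\<Sum>t\<in>G. ennreal ((M T w)^2) * ind (A t) w) <= ennreal ((M T w)^2)" .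
  qed
  finally show ?thesis .
 qed
 define e where "e = from_nat_into (rtimes T)"
 have ne: "rtimes T \<noteq> {}" by (simp add: rtimes_def)
 have re: "range e = rtimes T" unfolding e_def by (rule range_from_nat_into[OF ne countable_rtimes])
 have eT: "e n : {0..T}" for n using re rtimes_subset[OF T_nonneg] rangeI[of e n] by blast
 have eq: "?E {0..T} = (\<Union>n. ?E (e ` {..<n}))"
 proof (intro equalityI subsetI)
  fix w assume w: "w : ?E {0..T}"
  have "\<exists>s\<in>rtimes T. lam < abs (M s w)"
  proof (rule ccontr)
   assume "\<not> ?thesis"
   hence "abs (M s w) <= lam" if "s : rtimes T" for s using that by auto
   from rcll_le_dense[OF rcll_abs[OF arcD(2)[OF arc]] this] w show False by fastforce
  qed
  then obtain n where "lam < abs (M (e n) w)" unfolding re[symmetric] by auto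
  thus "w : (\<Union>n. ?E (e ` {..<n}))" using w by (auto intro!: exI[of _ "Suc n"])
 next
  fix w assume "w : (\<Union>n. ?E (e ` {..<n}))"
  then obtain n where "w : \<Omega>" "lam < abs (M (e n) w)" by auto
  thus "w : ?E {0..T}" using eT[of n] by auto
 qed
 have sub: "e ` {..<n} <= {0..T}" for n using eT by blast
 show "?E {0..T} : sets P" unfolding eq using Em[OF _ sub] by auto
 have inc: "incseq (%n. ?E (e ` {..<n}))"
  unfolding incseq_def by (intro allI impI subsetI) (auto dest: less_le_trans)
 have "(%n. emeasure P (?E (e ` {..<n}))) ----> emeasure P (\<Union>n. ?E (e ` {..<n}))"
  using Em[OF _ sub] inc by (intro Lim_emeasure_incseq) auto
 hence "(%n. ennreal (lam^2) * emeasure P (?E (e ` {..<n}))) ----> ennreal (lam^2) * emeasure P (?E {0..T})"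
  unfolding eq[symmetric] by (intro ennreal_tendsto_cmult) auto
 thus "ennreal (lam^2) * emeasure P (?E {0..T}) <= L2n P (M T)"
  by (rule LIMSEQ_le_const2) (use fin[OF _ sub] in auto)
qed

end

section \<open>Step fields and the isometry\<close>

type_synonym ('w, 'm) steps = "(('w => real) \<times> real \<times> real \<times> 'm set) list"

abbreviation unc :: "(real => 'w => 'm => real) => ((real \<times> 'w) \<times> 'm) => real" where
 "unc L \<equiv> %x. L (fst (fst x)) (snd (fst x)) (snd x)"

abbreviation sf :: "('w, 'm) steps => ((real \<times> 'w) \<times> 'm) => real" where
 "sf c \<equiv> unc (step_field c)"

lemma sum_grid_telescope:
 fixes \<phi> :: "real => real"
 assumes "0 <= \<rho>" "\<rho> <= b" "0 < b" "0 < N"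
 shows "(\<Sum>j<N. if b * real j / real N <= \<rho> then \<phi> (b * real (Suc j) / real N) - \<phi> (b * real j / real N) else 0)
   = \<phi> (rgrid b N \<rho>) - \<phi> 0"
proof -
 define J where "J = min N (nat (\<lfloor>\<rho> * real N / b\<rfloor> + 1))"
 have nn: "0 <= \<rho> * real N / b" using assms by simp
 have iff: "b * real j / real N <= \<rho> <-> j < J" if "j < N" for j
 proof -
  have "b * real j / real N <= \<rho> <-> real j <= \<rho> * real N / b"
   using assms by (simp add: pos_divide_le_eq pos_le_divide_eq mult.commute)
  also have "... <-> int j <= \<lfloor>\<rho> * real N / b\<rfloor>" by (simp add: le_floor_iff)
  also have "... <-> j < J" using that nn unfolding J_def by auto
  finally show ?thesis .
 qed
 have "(\<Sum>j<N. if b * real j / real N <= \<rho> then \<phi> (b * real (Suc j) / real N) - \<phi> (b * real j / real N) else 0)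
   = (\<Sum>j<N. if j < J then \<phi> (b * real (Suc j) / real N) - \<phi> (b * real j / real N) else 0)"
  by (intro sum.cong refl) (simp add: iff)
 also have "... = (\<Sum>j\<in>{..<N} Int {j. j < J}. \<phi> (b * real (Suc j) / real N) - \<phi> (b * real j / real N))"
  by (simp add: sum.If_cases)
 also have "{..<N} Int {j. j < J} = {..<J}" by (auto simp: J_def)
 also have "(\<Sum>j<J. \<phi> (b * real (Suc j) / real N) - \<phi> (b * real j / real N)) = \<phi> (b * real J / real N) - \<phi> (b * real 0 / real N)"
  by (rule sum_lessThan_telescope)
 also have "b * real J / real N = rgrid b N \<rho>"
 proof -
  have "real (nat (\<lfloor>\<rho> * real N / b\<rfloor> + 1)) = real_of_int \<lfloor>\<rho> * real N / b\<rfloor> + 1" using nn by simp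
  hence "real J = min (real N) (real_of_int \<lfloor>\<rho> * real N / b\<rfloor> + 1)" unfolding J_def by (simp add: of_nat_min)
  hence J: "real J = min (real N) (real_of_int \<lfloor>\<rho> * real N / b\<rfloor> + 1)" (is "_ = min _ ?F") .
  have "b * ?F / real N <= b" if "?F <= real N"
   using mult_left_mono[OF that, of b] assms by (simp add: pos_divide_le_eq)
  moreover have "b <= b * ?F / real N" if "real N <= ?F"
   using mult_left_mono[OF that, of b] assms by (simp add: pos_le_divide_eq)
  ultimately have "b * min (real N) ?F / real N = min b (b * ?F / real N)"
   using assms by (cases "real N <= ?F") (auto simp: min.absorb1 min.absorb2)
  thus ?thesis using assms by (simp add: J rgrid_eq)
 qed
 finally show ?thesis by simp
qed

text \<open>A noise indexed by sets of marks whose covariances over a time step are the measures of intersections. The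
 stochastic integral, its isometry and its behaviour under stopping are developed at this level, and applied once
 to a noise comprising both the Brownian motion and the compensated Poisson measure.\<close>

locale integrator = jbasis B for B :: "('w, 'e) basis" +
 fixes nu :: "'m measure" and xi :: "'m set => real => 'w => real"
 assumes nu: "sigma_finite_measure nu"
  and xi_arc: "!!C. C : sets nu ==> emeasure nu C < \<infinity> ==> arc (xi C)"
  and xi_mart: "!!C. C : sets nu ==> emeasure nu C < \<infinity> ==> mart (xi C)"
  and xi_covar: "!!C D. C : sets nu ==> emeasure nu C < \<infinity> ==> D : sets nu ==> emeasure nu D < \<infinity> ==>
    covar (xi C) (xi D) (measure nu (C Int D))"
begin

sublocale nu: sigma_finite_measure nu by (rule nu)

sublocale QQ: pair_sigma_finite "dtP B" nu ..

abbreviation PN :: "((real \<times> 'w) \<times> 'm) measure" where "PN \<equiv> pred_sigma B \<otimes> nu"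

abbreviation Q :: "((real \<times> 'w) \<times> 'm) measure" where "Q \<equiv> dtP B \<otimes> nu"

definition adm1 :: "('w => real) \<times> real \<times> real \<times> 'm set => bool" where
 "adm1 x <-> (case x of (h, s, u, C) => step_coeff B h s u & C : sets nu & emeasure nu C < \<infinity>)"

definition adm :: "('w, 'm) steps => bool" where
 "adm c <-> (\<forall>x\<in>set c. adm1 x)"

lemma adm1_iff [simp]: "adm1 (h, s, u, C) <-> step_coeff B h s u & C : sets nu & emeasure nu C < \<infinity>"
 by (simp add: adm1_def)

text \<open>The integral of a step field up to time \<open>t\<close>.\<close>

definition si :: "('w, 'm) steps => real => 'w => real" where
 "si c t w = (\<Sum>(h, s, u, C)\<leftarrow>c. h w * (xi C (min u t) w - xi C (min s t) w))"

lemma adm_append: "adm (c @ d) <-> adm c & adm d"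
 by (auto simp: adm_def)

lemma adm_Nil: "adm []" by (simp add: adm_def)

text \<open>The integral of a step field is this sum with \<open>f\<close> the stopped noise, and the field itself is this sum with \<open>f C r\<close>
 the indicator of the times up to \<open>r\<close> and the marks in \<open>C\<close>; operations on lists of steps are analysed for both at once.\<close>

definition eval_steps :: "('m set => real => real) => ('w, 'm) steps => 'w => real" where
 "eval_steps f c w = (\<Sum>(h, s, u, C)\<leftarrow>c. h w * (f C u - f C s))"

lemma si_eval: "si c t w = eval_steps (%C r. xi C (min r t) w) c w"
 by (simp add: si_def eval_steps_def)

lemma step_field_eval: "adm c ==> step_field c t w e = eval_steps (%C r. ind {..r} t * ind C e) c w"
 by (induct c) (auto simp: step_field_def eval_steps_def adm_def step_coeff_iff indicator_def)

definition scale :: "real => ('w, 'm) steps => ('w, 'm) steps" where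
 "scale r = map (%(h, s, u, C). (%w. r * h w, s, u, C))"

lemma adm_scale: "adm c ==> adm (scale r c)"
 by (fastforce simp: adm_def scale_def step_coeff_iff bcoef_scale)

lemma step_field_append: "step_field (c @ d) t w e = step_field c t w e + step_field d t w e"
 by (simp add: step_field_def)

lemma si_append: "si (c @ d) t w = si c t w + si d t w"
 by (simp add: si_def)

lemma step_field_scale: "step_field (scale r c) t w e = r * step_field c t w e"
 by (induct c) (auto simp: step_field_def scale_def algebra_simps)

lemma si_scale: "si (scale r c) t w = r * si c t w"
 by (induct c) (auto simp: si_def scale_def algebra_simps)

definition clip :: "real => ('w, 'm) steps => ('w, 'm) steps" where
 "clip t = map (%(h, s, u, C). (if s <= t then h else (%_. 0), min s t, min u t, C))"

lemma adm_clip: "adm c ==> 0 <= t ==> t <= T ==> adm (clip t c)"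
 by (fastforce simp: adm_def clip_def step_coeff_iff bcoef_def min_def)

lemma eval_clip: "adm c ==> eval_steps f (clip t c) w = eval_steps (%C r. f C (min r t)) c w"
 by (induct c) (auto simp: eval_steps_def clip_def adm_def step_coeff_iff min_def)

lemma si_clip: "adm c ==> t <= T ==> si c t w = si (clip t c) T w"
 by (simp add: si_eval eval_clip min.assoc min.absorb1)

lemma step_field_clip: "adm c ==> 0 <= t ==> t <= T ==> step_field (clip t c) r w e = step_field c r w e * ind {..t} r"
 by (simp add: step_field_eval adm_clip eval_clip) (simp add: eval_steps_def split_def indicator_def flip: sum_list_mult_const)

lemma si_sqi_arc: "adm c ==> arc (si c)"
proof (induct c)
 case Nil thus ?case by (simp add: si_def arc_zero)
next
 case (Cons x c)
 obtain h s u C where x: "x = (h, s, u, C)" by (cases x) auto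
 have c: "arc (si c)" "step_coeff B h s u" "arc (xi C)" using Cons xi_arc by (auto simp: adm_def x)
 hence su: "0 <= s" "s <= u" "u <= T" "h : Bor (F s)" by (auto simp: step_coeff_iff bcoef_def)
 have st: "arc (%t w. xi C (min t r) w)" if "0 <= r" "r <= T" for r
  by (rule arc_stopped[OF c(3) bst_const[OF that]])
 have 1: "arc (%t w. xi C (min t u) w - xi C (min t s) w)"
  using su by (intro arc_diff st) auto
 have "arc (%t w. h w * (xi C (min u t) w - xi C (min s t) w))"
 proof (rule arcI)
  fix w assume "w : \<Omega>"
  from rcll_mult[OF rcll_const arcD(2)[OF 1 this], of "h w"]
  show "rcll T (%t. h w * (xi C (min u t) w - xi C (min s t) w))" by (simp add: min.commute)
 next
  fix t assume t: "t : {0..T}"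
  show "(%w. h w * (xi C (min u t) w - xi C (min s t) w)) : Bor (F t)"
  proof (cases "s <= t")
   case True
   have "(%w. xi C (min t u) w - xi C (min t s) w) : Bor (F t)" by (rule arcD(1)[OF 1 t])
   moreover have "h : Bor (F t)" by (rule F_mono[OF True su(4)])
   ultimately have "(%w. h w * (xi C (min t u) w - xi C (min t s) w)) : Bor (F t)"
    by (intro borel_measurable_times)
   thus ?thesis by (simp add: min.commute)
  next
   case False
   hence "min u t = t" "min s t = t" using su by auto
   thus ?thesis by simp
  qed
 qed
 from arc_add[OF this c(1)] show ?case by (simp add: x si_def[abs_def])
qed

lemma si_summand_sqi:
 "adm1 (h, s, u, C) ==> sqi P (%w. h w * (xi C (min u T) w - xi C (min s T) w))"
 using increment_sqi[OF xi_mart] by (auto simp: step_coeff_iff min.absorb1)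

abbreviation dQ :: "(real => 'w => 'm => real) => (real => 'w => 'm => real) => ennreal" where
 "dQ L M \<equiv> L2n Q (%x. unc L x - unc M x)"

lemma space_Q: "space Q = ({0..T} \<times> \<Omega>) \<times> space nu"
 by (simp add: space_pair_measure space_dtP)

lemma snd_dtP [measurable]: "snd : measurable (dtP B) P"
 unfolding dtP_def by measurable

lemma fst_dtP [measurable]: "fst : Bor (dtP B)"
 by (rule time_measurable)

abbreviation slab :: "'m set => ((real \<times> 'w) \<times> 'm) set" where
 "slab E \<equiv> {x. snd x : E}"

lemma slab_sqi:
 assumes E: "E : sets nu" "emeasure nu E < \<infinity>"
 shows "sqi Q (ind (slab E))"
 unfolding sqi_def
proof
 note E(1)[measurable]
 show "ind (slab E) : Bor Q" by measurable
 have "L2n Q (ind (slab E)) = (\<integral>\<^sup>+x. ind (space (dtP B) \<times> E) x \<partial>Q)"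
  unfolding L2n_def by (rule nn_integral_cong) (auto simp: indicator_def space_pair_measure)
 also have "... = emeasure (dtP B) (space (dtP B)) * emeasure nu E"
  using E(1) by (simp add: nu.emeasure_pair_measure_Times)
 also have "... < \<infinity>"
  using E(2) unfolding infinity_ennreal_def ennreal_mult_less_top by (simp add: top.not_eq_extremum[symmetric])
 finally show "L2n Q (ind (slab E)) < \<infinity>" .
qed

lemma summand_Q_sqi:
 assumes "adm1 (h, s, u, C)"
 shows "sqi Q (%x. h (snd (fst x)) * ind {s<..u} (fst (fst x)) * ind C (snd x))"
proof -
 have h: "step_coeff B h s u" "C : sets nu" "emeasure nu C < \<infinity>" using assms by auto
 hence [measurable]: "h : Bor P" using bcoef_P by (auto simp: step_coeff_iff)
 obtain K where K: "!!w. w : \<Omega> ==> abs (h w) <= K" using h by (auto simp: step_coeff_iff bcoef_def)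
 have "sqi Q (%x. (h (snd (fst x)) * ind {s<..u} (fst (fst x))) * ind (slab C) x)"
 proof (rule sqi_mult_bounded[OF slab_sqi[OF h(2,3)], where c = K])
  show "abs (h (snd (fst x)) * ind {s<..u} (fst (fst x))) <= K" if "x : space Q" for x
   using that K[of "snd (fst x)"] abs_ge_zero[of "h (snd (fst x))"] by (auto simp: space_Q indicator_def intro: order_trans)
 qed measurable
 thus ?thesis by (simp add: indicator_def)
qed

text \<open>Fubini for the product of a random weight, a time set and a mark set.\<close>

lemma integral_rectangle:
 assumes H: "bcoef s H" and I: "I : sets borel" and D: "D : sets nu"
  and i: "integrable Q (%x. H (snd (fst x)) * (ind I (fst (fst x)) * ind D (snd x)))"
 shows "(\<integral>x. H (snd (fst x)) * (ind I (fst (fst x)) * ind D (snd x)) \<partial>Q)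
   = measure lborel (I Int {0..T}) * measure nu D * (\<E> w. H w)"
proof -
 note bcoef_P[OF H, measurable] and I[measurable] and D[measurable]
 obtain K where K: "!!w. w : \<Omega> ==> abs (H w) <= K" using H by (auto simp: bcoef_def)
 have iD: "integrable (dtP B) (%y. H (snd y) * ind I (fst y))"
 proof (rule dtP.integrable_const_bound[of _ K])
  show "AE y in dtP B. norm (H (snd y) * ind I (fst y)) <= K"
  proof (rule AE_I2)
   fix y assume "y : space (dtP B)"
   hence "abs (H (snd y)) <= K" using K by (auto simp: space_dtP)
   thus "norm (H (snd y) * ind I (fst y)) <= K" using abs_ge_zero[of "H (snd y)"] by (auto simp: indicator_def)
  qed
 qed measurable
 have "(\<integral>x. H (snd (fst x)) * (ind I (fst (fst x)) * ind D (snd x)) \<partial>Q)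
   = (\<integral>y. \<integral>e. (H (snd y) * ind I (fst y)) * ind D e \<partial>nu \<partial>dtP B)"
  by (subst QQ.integral_fst'[OF i, symmetric]) (simp add: mult.assoc)
 also have "... = (\<integral>y. H (snd y) * ind I (fst y) \<partial>dtP B) * measure nu D" by simp
 also have "(\<integral>y. H (snd y) * ind I (fst y) \<partial>dtP B) = (\<integral>t. (\<E> w. H w * ind I t) \<partial>tm)"
  using iD unfolding dtP_def by (subst tmP.integral_fst'[symmetric]) auto
 also have "... = (\<E> w. H w) * (\<integral>t. ind (I Int {0..T}) t \<partial>tm)"
 proof -
  have "(\<integral>t. (\<E> w. H w * ind I t) \<partial>tm) = (\<integral>t. (\<E> w. H w) * ind (I Int {0..T}) t \<partial>tm)"
   by (rule Bochner_Integration.integral_cong) (auto simp: indicator_def space_restrict_space)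
  thus ?thesis by simp
 qed
 also have "(\<integral>t. ind (I Int {0..T}) t \<partial>tm) = measure lborel (I Int {0..T})"
  by (simp add: Int_absorb1 measure_restrict_space)
 finally show ?thesis by simp
qed

text \<open>The isometry holds for step fields because it holds for pairs of steps: two weighted increments have the scalar
 product of the corresponding rectangles.\<close>

lemma step_isometry:
 assumes c: "adm c"
 shows "sqi P (si c T)" "sqi Q (sf c)" "L2n P (si c T) = L2n Q (sf c)"
proof -
 let ?a = "%(h, s, u, C) w. h w * (xi C (min u T) w - xi C (min s T) w)"
 let ?b = "%(h, s, u, C) x. h (snd (fst x)) * ind {s<..u} (fst (fst x)) * ind C (snd x) :: real"
 have a: "sqi P (?a x)" if "x : set c" for x
  using si_summand_sqi c that by (cases x) (auto simp: adm_def)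
 have b: "sqi Q (?b x)" if "x : set c" for x
  using summand_Q_sqi c that by (cases x) (auto simp: adm_def)
 have sia: "si c T = (%w. \<Sum>x\<leftarrow>c. ?a x w)" by (simp add: si_def fun_eq_iff split_def)
 have sfb: "sf c = (%x. \<Sum>y\<leftarrow>c. ?b y x)" by (simp add: step_field_def fun_eq_iff split_def)
 show s1: "sqi P (si c T)" unfolding sia by (rule sqi_sum_list[OF a])
 show s2: "sqi Q (sf c)" unfolding sfb by (rule sqi_sum_list[OF b])
 have pair: "(\<E> w. ?a x w * ?a y w) = (\<integral>z. ?b x z * ?b y z \<partial>Q)" if xy: "x : set c" "y : set c" for x y
 proof -
  obtain h s u C where x: "x = (h, s, u, C)" by (cases x) auto
  obtain k r v D where y: "y = (k, r, v, D)" by (cases y) auto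
  have hx: "step_coeff B h s u" "C : sets nu" "emeasure nu C < \<infinity>" and hy: "step_coeff B k r v" "D : sets nu" "emeasure nu D < \<infinity>"
   using c xy by (auto simp: adm_def x y)
  hence le: "0 <= s" "s <= u" "u <= T" "0 <= r" "r <= v" "v <= T" and hb: "bcoef s h" "bcoef r k" by (auto simp: step_coeff_iff)
  have I: "{s<..u} Int {r<..v} = {max s r<..min u v}" by auto
  have m: "measure lborel ({max s r<..min u v} Int {0..T}) = max 0 (min u v - max s r)"
  proof -
   have "{max s r<..min u v} Int {0..T} = {max s r<..min u v}" using le by auto
   thus ?thesis by (cases "max s r <= min u v") (auto simp: max_def)
  qed
  have bb: "bcoef (max s r) (%w. h w * k w)" by (intro bcoef_mult bcoef_mono[OF hb(1)] bcoef_mono[OF hb(2)]) auto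
  have bi: "?b x z * ?b y z = (h (snd (fst z)) * k (snd (fst z))) * (ind ({s<..u} Int {r<..v}) (fst (fst z)) * ind (C Int D) (snd z))" for z
   by (simp add: x y indicator_def)
  have "(\<E> w. ?a x w * ?a y w) = measure nu (C Int D) * max 0 (min u v - max s r) * (\<E> w. h w * k w)"
   using increment_covar[OF xi_mart[OF hx(2,3)] xi_mart[OF hy(2,3)] xi_covar[OF hx(2,3) hy(2,3)] hx(1) hy(1)] le
   by (simp add: x y min.absorb1)
  also have "... = (\<integral>z. (h (snd (fst z)) * k (snd (fst z))) * (ind ({s<..u} Int {r<..v}) (fst (fst z)) * ind (C Int D) (snd z)) \<partial>Q)"
   using hx hy sqi_prod[OF b[OF xy(1)] b[OF xy(2)]] unfolding bi I
   by (subst integral_rectangle[OF bb]) (auto simp: m)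
  finally show ?thesis by (simp only: bi)
 qed
 have "(\<E> w. (si c T w)^2) = (\<integral>z. (sf c z)^2 \<partial>Q)"
 proof -
  have "(\<E> w. (si c T w)^2) = (\<E> w. (\<Sum>x\<leftarrow>c. ?a x w) * (\<Sum>y\<leftarrow>c. ?a y w))"
   by (simp only: sia power2_eq_square)
  also have "... = (\<Sum>x\<leftarrow>c. \<Sum>y\<leftarrow>c. (\<E> w. ?a x w * ?a y w))"
   by (rule integral_sum_list_prod[OF a a])
  also have "... = (\<Sum>x\<leftarrow>c. \<Sum>y\<leftarrow>c. \<integral>z. ?b x z * ?b y z \<partial>Q)"
   by (intro arg_cong[where f = sum_list] map_cong refl pair)
  also have "... = (\<integral>z. (\<Sum>x\<leftarrow>c. ?b x z) * (\<Sum>y\<leftarrow>c. ?b y z) \<partial>Q)"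
   by (rule integral_sum_list_prod[OF b b, symmetric])
  also have "... = (\<integral>z. (sf c z)^2 \<partial>Q)"
  proof (rule Bochner_Integration.integral_cong[OF refl])
   fix z show "(\<Sum>x\<leftarrow>c. ?b x z) * (\<Sum>y\<leftarrow>c. ?b y z) = (sf c z)^2"
    using fun_cong[OF sfb, of z] by (simp only: power2_eq_square)
  qed
  finally show ?thesis .
 qed
 thus "L2n P (si c T) = L2n Q (sf c)"
  by (simp only: L2n_eq_integral[OF s1] L2n_eq_integral[OF s2])
qed

lemma step_isometry_at:
 assumes c: "adm c" and t: "0 <= t" "t <= T"
 shows "sqi P (si c t)" "L2n P (si c t) <= L2n Q (sf c)"
  "L2n P (si c t) = L2n Q (%x. sf c x * ind {..t} (fst (fst x)))"
proof -
 note iso = step_isometry[OF adm_clip[OF c t]]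
 have e: "si c t = si (clip t c) T" using si_clip[OF c t(2)] by auto
 show "sqi P (si c t)" using iso(1) by (simp add: e)
 show eq: "L2n P (si c t) = L2n Q (%x. sf c x * ind {..t} (fst (fst x)))"
  using iso(3) by (simp add: e step_field_clip[OF c t])
 show "L2n P (si c t) <= L2n Q (sf c)"
  unfolding eq by (rule L2n_mono) (simp add: indicator_def)
qed

lemma si_mart:
 assumes "adm c"
 shows "mart (si c)"
 unfolding mart_def
proof (intro conjI ballI allI impI)
 fix t assume "t : {0..T}"
 thus "si c t : Bor (F t)" "sqi P (si c t)"
  using arcD(1)[OF si_sqi_arc[OF assms]] step_isometry_at(1)[OF assms] by auto
next
 fix r t H assume *: "0 <= r & r <= t & t <= T & H : Bor (F r) & sqi P H"
 hence r: "0 <= r" "r <= t" "t <= T" and H: "H : Bor (F r)" "sqi P H" by auto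
 show "(\<E> w. H w * (si c t w - si c r w)) = 0"
  using assms
 proof (induct c)
  case Nil thus ?case by (simp add: si_def)
 next
  case (Cons x c)
  obtain h s u C where x: "x = (h, s, u, C)" by (cases x) auto
  have c: "adm c" and x1: "adm [x]" using Cons(2) by (auto simp: adm_def)
  have hx: "step_coeff B h s u" "C : sets nu" "emeasure nu C < \<infinity>" using x1 by (auto simp: adm_def x)
  hence le: "0 <= s" "s <= u" "u <= T" "bcoef s h" by (auto simp: step_coeff_iff)
  have si1: "si [x] t w = h w * (xi C (min u t) w - xi C (min s t) w)" for t w by (simp add: si_def x)
  have hH: "sqi P (%w. h w * H w)" by (rule bcoef_sqi[OF le(4) H(2)])
  have z: "(\<E> w. H w * (si [x] t w - si [x] r w)) = 0"
  proof -
   have M0: "(\<E> w. (h w * H w) * (xi C b w - xi C a w)) = 0" if "r <= a" "s <= a" "a <= b" "b <= T" for a b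
   proof (intro mart_zero[OF xi_mart[OF hx(2,3)] _ that(3,4) _ hH] borel_measurable_times)
    show "h : Bor (F a)" using bcoef_mono[OF le(4) that(2)] by (simp add: bcoef_def)
    show "H : Bor (F a)" by (rule F_mono[OF that(1) H(1)])
    show "0 <= a" using that r by simp
   qed
   show ?thesis
   proof (cases "u <= r")
    case True
    hence "si [x] t = si [x] r" using r le by (auto simp: si1 min_def fun_eq_iff)
    thus ?thesis by simp
   next
    case False
    have e: "H w * (si [x] t w - si [x] r w) = (h w * H w) * (xi C (max s (min u t)) w - xi C (max s r) w)" for w
     using r le False by (cases "s <= r"; cases "s <= t")
      (simp_all add: si1 min.absorb1 min.absorb2 max.absorb1 max.absorb2 algebra_simps)
    show ?thesis unfolding e using r le False by (intro M0) auto
   qed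
  qed
  have i: "integrable P (%w. H w * (si d t w - si d r w))" if "adm d" for d
   using r by (intro sqi_prod H sqi_diff step_isometry_at(1)[OF that]) auto
  have "(\<E> w. H w * (si (x # c) t w - si (x # c) r w))
    = (\<E> w. H w * (si [x] t w - si [x] r w) + H w * (si c t w - si c r w))"
   using si_append[of "[x]" c] by (intro Bochner_Integration.integral_cong) (auto simp: algebra_simps)
  also have "... = 0" using Cons(1)[OF c] z by (subst Bochner_Integration.integral_add[OF i[OF x1] i[OF c]]) simp
  finally show ?case .
 qed
qed

end

section \<open>Density of step fields\<close>

lemma ennreal_double: "0 <= a ==> 0 <= b ==> 2 * ennreal a + 2 * ennreal b = ennreal (2 * a + 2 * b)"
 by (subst ennreal_plus) (auto simp: ennreal_mult)

lemma quarters_le: "a <= ennreal (\<epsilon> / 4) ==> b <= ennreal (\<epsilon> / 4) ==> 0 < \<epsilon> ==> 2 * a + 2 * b <= ennreal \<epsilon>"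
 using add_mono[OF mult_left_mono[of a "ennreal (\<epsilon> / 4)" 2] mult_left_mono[of b "ennreal (\<epsilon> / 4)" 2]] ennreal_double[of "\<epsilon> / 4" "\<epsilon> / 4"]
 by simp

lemma L2n_subseq_limit:
 assumes m: "!!n. f n : Bor M" "g : Bor M"
  and l2: "(%n. L2n M (%x. f n x - g x)) ----> 0" and pt: "AE x in M. (%n. f n x) ----> h x"
 shows "AE x in M. g x = h x"
proof -
 have "\<forall>\<^sub>F n in sequentially. L2n M (%x. f n x - g x) < 1"
  using l2 by (rule order_tendstoD(2)) simp
 then obtain n0 where n0: "!!n. n >= n0 ==> L2n M (%x. f n x - g x) < 1"
  by (auto simp: eventually_sequentially)
 have fin: "L2n M (%x. f (n + n0) x - g x) < \<infinity>" for n by (rule less_trans[OF n0]) simp_all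
 have "\<exists>r::nat=>nat. strict_mono r & (AE x in M. (%n. (%k x. f (k + n0) x - g x) (r n) x) ----> 0)"
  by (rule L2n_AE_subseq[OF borel_measurable_diff[OF m] LIMSEQ_ignore_initial_segment[OF l2, of n0] fin])
 then obtain r :: "nat => nat" where r: "strict_mono r" "AE x in M. (%n. f (r n + n0) x - g x) ----> 0"
  by auto
 show ?thesis
  using r(2) pt
 proof eventually_elim
  fix x assume 1: "(%n. f (r n + n0) x - g x) ----> 0" and 2: "(%n. f n x) ----> h x"
  have "(%n. f (r n + n0) x) ----> h x"
   using LIMSEQ_subseq_LIMSEQ[OF LIMSEQ_ignore_initial_segment[OF 2, of n0] r(1)] by (simp add: o_def)
  moreover have "(%n. f (r n + n0) x) ----> g x" using 1 by (simp add: LIM_zero_iff)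
  ultimately show "g x = h x" by (rule LIMSEQ_unique[symmetric])
 qed
qed

context integrator begin

text \<open>Functions in the closure of the step fields.\<close>

definition approx :: "((real \<times> 'w) \<times> 'm => real) => bool" where
 "approx f <-> (\<forall>\<epsilon>>0. \<exists>c. adm c & L2n Q (%x. sf c x - f x) <= ennreal \<epsilon>)"

lemma approxD: "approx f ==> 0 < \<epsilon> ==> \<exists>c. adm c & L2n Q (%x. sf c x - f x) <= ennreal \<epsilon>"
 unfolding approx_def by blast

lemma step_Q: "adm c ==> sf c : Bor Q"
 using step_isometry(2) by (auto simp: sqi_def)

lemma approx_step: "adm c ==> approx (sf c)"
 unfolding approx_def by (auto simp: L2n_def)

lemma approx_limit:
 assumes f: "f : Bor Q" and g: "!!n::nat. g n : Bor Q" "!!n. approx (g n)"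
  and lim: "(%n. L2n Q (%x. g n x - f x)) ----> 0"
 shows "approx f"
 unfolding approx_def
proof (intro allI impI)
 fix \<epsilon> :: real assume \<epsilon>: "0 < \<epsilon>"
 hence "0 < \<epsilon> / 4" by simp
 from L2n_eventually_less[OF lim this] obtain n where n: "L2n Q (%x. g n x - f x) < ennreal (\<epsilon> / 4)" .
 obtain c where c: "adm c" "L2n Q (%x. sf c x - g n x) <= ennreal (\<epsilon> / 4)"
  using approxD[OF g(2) \<open>0 < \<epsilon> / 4\<close>] by blast
 have "L2n Q (%x. sf c x - f x) <= ennreal \<epsilon>"
  by (rule order_trans[OF L2n_triangle[OF step_Q[OF c(1)] g(1) f] quarters_le[OF c(2) less_imp_le[OF n] \<epsilon>]])
 with c(1) show "\<exists>c. adm c & L2n Q (%x. sf c x - f x) <= ennreal \<epsilon>" by blast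
qed

lemma approx_AE_cong:
 assumes "approx f" "AE x in Q. f x = g x"
 shows "approx g"
proof -
 have "L2n Q (%x. h x - f x) = L2n Q (%x. h x - g x)" for h
  by (rule L2n_cong_AE) (use assms(2) in "auto elim: eventually_mono")
 with assms(1) show ?thesis unfolding approx_def by simp
qed

lemma approx_zero: "approx (%x. 0)"
 using approx_step[OF adm_Nil] by (simp add: step_field_def)

lemma approx_add:
 assumes f: "f : Bor Q" "approx f" and g: "g : Bor Q" "approx g"
 shows "approx (%x. f x + g x)"
 unfolding approx_def
proof (intro allI impI)
 fix \<epsilon> :: real assume "0 < \<epsilon>"
 hence \<epsilon>: "0 < \<epsilon> / 4" by simp
 obtain c where c: "adm c" "L2n Q (%x. sf c x - f x) <= ennreal (\<epsilon> / 4)"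
  using approxD[OF f(2) \<epsilon>] by blast
 obtain d where d: "adm d" "L2n Q (%x. sf d x - g x) <= ennreal (\<epsilon> / 4)"
  using approxD[OF g(2) \<epsilon>] by blast
 have "L2n Q (%x. sf (c @ d) x - (f x + g x))
   = L2n Q (%x. (sf c x - f x) + (sf d x - g x))"
  by (simp add: step_field_append algebra_simps)
 also have "... <= 2 * L2n Q (%x. sf c x - f x) + 2 * L2n Q (%x. sf d x - g x)"
  by (intro L2n_add_le borel_measurable_diff step_Q c d f g)
 also have "... <= ennreal \<epsilon>" using \<epsilon> by (intro quarters_le c d) simp
 finally show "\<exists>c. adm c & L2n Q (%x. sf c x - (f x + g x)) <= ennreal \<epsilon>"
  using c(1) d(1) adm_append by blast
qed

lemma approx_scale:
 assumes f: "f : Bor Q" "approx f"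
 shows "approx (%x. r * f x)"
 unfolding approx_def
proof (intro allI impI)
 fix \<epsilon> :: real assume \<epsilon>: "0 < \<epsilon>"
 have pos: "0 < \<epsilon> / (r^2 + 1)" using \<epsilon> by (intro divide_pos_pos add_nonneg_pos) auto
 obtain c where c: "adm c" "L2n Q (%x. sf c x - f x) <= ennreal (\<epsilon> / (r^2 + 1))"
  using approxD[OF f(2) pos] by blast
 have "L2n Q (%x. sf (scale r c) x - r * f x) = L2n Q (%x. r * (sf c x - f x))"
  by (simp add: step_field_scale right_diff_distrib)
 also have "... = ennreal (r^2) * L2n Q (%x. sf c x - f x)"
  by (intro L2n_scale borel_measurable_diff step_Q c f)
 also have "... <= ennreal (r^2) * ennreal (\<epsilon> / (r^2 + 1))"
  by (intro mult_left_mono c) auto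
 also have "... = ennreal (r^2 * (\<epsilon> / (r^2 + 1)))" using pos by (intro ennreal_mult[symmetric]) auto
 also have "... <= ennreal \<epsilon>"
 proof (rule ennreal_leI)
  have "0 < r^2 + 1" by (intro add_nonneg_pos) auto
  thus "r^2 * (\<epsilon> / (r^2 + 1)) <= \<epsilon>" using \<epsilon> by (simp add: pos_divide_le_eq algebra_simps)
 qed
 finally show "\<exists>c. adm c & L2n Q (%x. sf c x - r * f x) <= ennreal \<epsilon>"
  using adm_scale[OF c(1)] by auto
qed

lemma approx_sum:
 assumes "finite I" "!!i. i : I ==> f i : Bor Q & approx (f i)"
 shows "approx (%x. \<Sum>i\<in>I. f i x)"
 using assms by (induct I) (auto simp: approx_zero intro!: approx_add borel_measurable_sum)

text \<open>Steps live on intervals open at the left, so time \<open>0\<close> is never charged; it is a null set anyway.\<close>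

lemma AE_time_pos: "AE x in Q. 0 < fst (fst x)"
proof (rule AE_I')
 have z: "{0::real} : sets tm" using T_nonneg by (auto simp: sets_restrict_space image_iff intro!: bexI[of _ "{0}"])
 have "emeasure tm {0} = 0" by (subst emeasure_restrict_space) (use T_nonneg in auto)
 hence "emeasure (dtP B) ({0} \<times> \<Omega>) = 0" unfolding dtP_def using z by (simp add: emeasure_pair_measure_Times)
 moreover have "{0} \<times> \<Omega> : sets (dtP B)" unfolding dtP_def using z by (intro pair_measureI) auto
 ultimately show "({0} \<times> \<Omega>) \<times> space nu : null_sets Q" by (auto simp: null_sets_def nu.emeasure_pair_measure_Times)
 show "{x : space Q. \<not> 0 < fst (fst x)} <= ({0} \<times> \<Omega>) \<times> space nu" by (auto simp: space_Q)
qed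

lemma pred_Q_id: "(%x. x) : measurable Q (PN)"
proof -
 have "(%x. (fst x, snd x)) : measurable Q (PN)"
  by (intro measurable_Pair measurable_compose[OF measurable_fst pred_dtP] measurable_snd)
 thus ?thesis by simp
qed

lemma pred_Q: "f : measurable (PN) N ==> f : measurable Q N"
 using measurable_compose[OF pred_Q_id] by auto

lemma pred_Q_sets: "G : sets (PN) ==> G : sets Q"
 using measurable_sets[OF pred_Q_id, of G] sets.sets_into_space[of G "PN"]
 by (auto simp: space_dtP space_pair_measure space_pred_sigma Int_absorb2)



lemma approx_slab:
 assumes "E : sets nu" "emeasure nu E < \<infinity>"
 shows "approx (ind (slab E))"
proof (rule approx_AE_cong[OF approx_step])
 let ?c = "[(%_. 1, 0, T, E)]"
 show "adm ?c" using assms T_nonneg by (auto simp: adm_def step_coeff_iff bcoef_def)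
 show "AE x in Q. sf ?c x = ind (slab E) x"
  using AE_time_pos AE_space by eventually_elim (auto simp: step_field_def space_Q indicator_def)
qed

lemma pred_gen_Int:
 assumes "a : pred_gen" "b : pred_gen"
 shows "a Int b : pred_gen"
proof -
 have z: "{0} \<times> A : pred_gen" if "A : sets (F 0)" for A using that by (auto simp: pred_gen_def)
 have i: "{s<..t} \<times> A : pred_gen" if "0 <= s" "s <= t" "t <= T" "A : sets (F s)" for s t A
  using that by (auto simp: pred_gen_def)
 consider A A' where "a = {0} \<times> A" "b = {0} \<times> A'" "A : sets (F 0)" "A' : sets (F 0)"
  | A s t A' where "a = {0} \<times> A & b = {s<..t} \<times> A' \<or> b = {0} \<times> A & a = {s<..t} \<times> A'" "0 <= s"
  | s t A s' t' A' where "a = {s<..t} \<times> A" "b = {s'<..t'} \<times> A'" "0 <= s" "s <= t" "t <= T" "A : sets (F s)"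
    "0 <= s'" "s' <= t'" "t' <= T" "A' : sets (F s')"
  using assms unfolding pred_gen_def by blast
 thus ?thesis
 proof cases
  case 1
  hence "a Int b = {0} \<times> (A Int A')" by auto
  thus ?thesis using z 1 by auto
 next
  case 2
  hence "a Int b = {0} \<times> {}" by auto
  thus ?thesis using z[of "{}"] by simp
 next
  case 3
  have e: "a Int b = {max s s'<..max (max s s') (min t t')} \<times> (A Int A')" unfolding 3(1,2) by auto
  show ?thesis unfolding e
  proof (rule i)
   have "A : sets (F (max s s'))" "A' : sets (F (max s s'))"
    using 3 sets_F_mono[of s "max s s'"] sets_F_mono[of s' "max s s'"] by auto
   thus "A Int A' : sets (F (max s s'))" by auto
  qed (use 3 in auto)
 qed
qed

lemma rectangles_Pow:
 "{a \<times> b | a b. a : pred_gen & b : sets nu} <= Pow (({0..T} \<times> \<Omega>) \<times> space nu)"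
proof
 fix x assume "x : {a \<times> b | a b. a : pred_gen & b : sets nu}"
 then obtain a b where x: "x = a \<times> b" "a : pred_gen" "b : sets nu" by auto
 have "a <= {0..T} \<times> \<Omega>" using x(2) pred_gen_Pow by auto
 moreover have "b <= space nu" by (rule sets.sets_into_space[OF x(3)])
 ultimately show "x : Pow (({0..T} \<times> \<Omega>) \<times> space nu)" unfolding x(1) by (simp add: Sigma_mono)
qed

lemma sets_pred_nu:
 "sets (PN) = sigma_sets (({0..T} \<times> \<Omega>) \<times> space nu) {a \<times> b | a b. a : pred_gen & b : sets nu}"
proof -
 have "sets (PN) = sets (sigma (space (pred_sigma B) \<times> space nu) {a \<times> b | a b. a : pred_gen & b : sets nu})"
 proof (rule sets_pair_eq)
  show "pred_gen <= Pow (space (pred_sigma B))" using pred_gen_Pow by (simp add: space_pred_sigma)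
  show "sets (pred_sigma B) = sigma_sets (space (pred_sigma B)) pred_gen" by (simp add: sets_pred_sigma space_pred_sigma)
  have O: "\<Omega> : sets (F 0)" using sets.top[of "F 0"] by (simp add: space_F)
  show "{{0} \<times> \<Omega>, {0<..T} \<times> \<Omega>} <= pred_gen"
   using O T_nonneg unfolding pred_gen_def by blast
  show "\<Union> {{0} \<times> \<Omega>, {0<..T} \<times> \<Omega>} = space (pred_sigma B)"
   using T_nonneg by (auto simp: space_pred_sigma)
  show "sets nu <= Pow (space nu)" by (rule sets.space_closed)
  show "sets nu = sigma_sets (space nu) (sets nu)" by (simp add: sets.sigma_sets_eq)
  show "{space nu} <= sets nu" by auto
 qed auto
 also have "... = sigma_sets (space (pred_sigma B) \<times> space nu) {a \<times> b | a b. a : pred_gen & b : sets nu}"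
  using rectangles_Pow unfolding space_pred_sigma by (rule sets_measure_of)
 finally show ?thesis by (simp add: space_pred_sigma)
qed

text \<open>Dynkin's lemma for the rectangles that generate the predictable sets; intersecting with a set of marks of finite
 measure makes complements approximable.\<close>

lemma approx_pred_set:
 assumes E: "E : sets nu" "emeasure nu E < \<infinity>" and G: "G : sets (PN)"
 shows "approx (ind (G Int slab E))"
proof -
 let ?S = "({0..T} \<times> \<Omega>) \<times> space nu" and ?G = "{a \<times> b | a b. a : pred_gen & b : sets nu}"
 have Gs: "A : sets Q" if "A : sigma_sets ?S ?G" for A
  using that pred_Q_sets unfolding sets_pred_nu[symmetric] by blast
 have [measurable]: "slab E Int space Q : sets Q"
 proof -
  note E(1)[measurable]
  have "slab E Int space Q = {x\<in>space Q. snd x : E}" by auto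
  also have "... : sets Q" by measurable
  finally show ?thesis .
 qed
 have GE: "ind (A Int slab E) : Bor Q" if "A : sigma_sets ?S ?G" for A
 proof -
  have "A Int slab E = A Int (slab E Int space Q)" using sets.sets_into_space[OF Gs[OF that]] by auto
  moreover have "A Int (slab E Int space Q) : sets Q" using Gs[OF that] by auto
  ultimately show ?thesis by simp
 qed
 have IS: "Int_stable ?G"
 proof (rule Int_stableI)
  fix x y assume "x : ?G" "y : ?G"
  then obtain a b a' b' where xy: "x = a \<times> b" "y = a' \<times> b'" "a : pred_gen" "a' : pred_gen" "b : sets nu" "b' : sets nu" by blast
  hence "x Int y = (a Int a') \<times> (b Int b')" by (simp add: Times_Int_Times)
  moreover have "a Int a' : pred_gen" "b Int b' : sets nu" using xy pred_gen_Int by auto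
  ultimately show "x Int y : ?G" by blast
 qed
 have "G : sigma_sets ?S ?G" using G unfolding sets_pred_nu .
 with IS rectangles_Pow show ?thesis
 proof (induct rule: sigma_sets_induct_disjoint)
  case (basic A)
  then obtain a b where A: "A = a \<times> b" and a: "a : pred_gen" and b: "b : sets nu" by auto
  from a consider A' where "a = {0} \<times> A'"
   | A' s t where "a = {s<..t} \<times> A'" "0 <= s" "s <= t" "t <= T" "A' : sets (F s)"
   unfolding pred_gen_def by blast
  thus ?case
  proof cases
   case 1
   have "AE x in Q. 0 = ind (A Int slab E) x"
    using AE_time_pos by eventually_elim (auto simp: A 1 indicator_def)
   thus ?thesis by (rule approx_AE_cong[OF approx_zero])
  next
   case 2
   let ?c = "[(ind A', s, t, b Int E)]"
   have "emeasure nu (b Int E) <= emeasure nu E" using E b by (intro emeasure_mono) auto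
   hence "emeasure nu (b Int E) < \<infinity>" using E(2) by (rule le_less_trans)
   moreover have "bcoef s (ind A')" using 2 by (auto simp: bcoef_def indicator_def intro!: exI[of _ 1])
   ultimately have "adm ?c" using 2 b E by (simp add: adm_def step_coeff_iff)
   moreover have "sf ?c = ind (A Int slab E)"
    by (auto simp: fun_eq_iff step_field_def A 2 indicator_def)
   ultimately show ?thesis using approx_step[of ?c] by simp
  qed
 next
  case empty
  show ?case using approx_zero by simp
 next
  case (compl A)
  have "approx (%x. ind (slab E) x + (-1) * ind (A Int slab E) x)"
   using slab_sqi[OF E] GE[OF compl(1)] compl(2)
   by (intro approx_add approx_scale approx_slab E) (auto simp: sqi_def)
  moreover have "AE x in Q. ind (slab E) x + (-1) * ind (A Int slab E) x = (ind ((?S - A) Int slab E) x :: real)"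
   by (rule AE_I2) (auto simp: space_Q indicator_def)
  ultimately show ?case by (rule approx_AE_cong)
 next
  case (union A)
  have U: "(\<Union>i. A i) : sigma_sets ?S ?G" using union(2) by (auto intro: sigma_sets.Union)
  show ?case
  proof (rule approx_limit[OF GE[OF U]])
   let ?g = "%n x. \<Sum>i<n. ind (A i Int slab E) x :: real"
   show gm: "?g n : Bor Q" for n
    using union(2) by (intro borel_measurable_sum GE) auto
   show "approx (?g n)" for n
    using union(2,3) by (intro approx_sum) (auto intro!: GE)
   have gI: "?g n x = ind ((\<Union>i<n. A i) Int slab E) x" for n x
   proof -
    have "disjoint_family_on A {..<n}" using union(1) by (auto simp: disjoint_family_on_def)
    hence "(ind (\<Union>i<n. A i) x :: real) = (\<Sum>i<n. ind (A i) x)"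
     by (intro indicator_UN_disjoint) auto
    thus ?thesis by (simp add: indicator_inter_arith sum_distrib_right)
   qed
   show "(%n. L2n Q (%x. ?g n x - ind ((\<Union>i. A i) Int slab E) x)) ----> 0"
   proof (rule L2n_dominated[OF gm GE[OF U] slab_sqi[OF E]])
    show "AE x in Q. abs (?g n x) <= abs (ind (slab E) x)" for n
     unfolding gI by (rule AE_I2) (auto simp: indicator_def)
    show "AE x in Q. abs (ind ((\<Union>i. A i) Int slab E) x :: real) <= abs (ind (slab E) x)"
     by (rule AE_I2) (auto simp: indicator_def)
    show "AE x in Q. (%n. ?g n x) ----> ind ((\<Union>i. A i) Int slab E) x"
    proof (rule AE_I2)
     fix x
     have "(%n. ind (\<Union>i<n. A i) x * ind (slab E) x) ----> (ind (\<Union>i. A i) x * ind (slab E) x :: real)"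
      by (intro tendsto_mult tendsto_const LIMSEQ_indicator_UN)
     thus "(%n. ?g n x) ----> ind ((\<Union>i. A i) Int slab E) x"
      unfolding gI by (simp add: indicator_inter_arith)
    qed
   qed

  qed
 qed
qed

definition intg :: "(real => 'w => 'm => real) => bool" where
 "intg L <-> unc L : Bor (PN) & sqi Q (unc L)"

lemma approx_slab_field:
 assumes f: "f : Bor (PN)" "sqi Q f"
  and E: "E : sets nu" "emeasure nu E < \<infinity>" and z: "!!x. x \<notin> slab E ==> f x = 0"
 shows "approx f"
proof -
 obtain s where s: "!!i. simple_function (PN) (s i)"
   "!!x. x : space (PN) ==> (%i. s i x) ----> f x"
   "!!i x. x : space (PN) ==> dist (s i x) 0 <= 2 * dist (f x) 0"
  using borel_measurable_implies_sequence_metric[OF f(1), of 0] by blast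
 have sp: "space (PN) = space Q" by (simp add: space_pair_measure space_pred_sigma space_dtP)
 have sm: "s i : Bor (PN)" for i using s(1) by (rule borel_measurable_simple_function)
 have fm: "f : Bor Q" by (rule pred_Q[OF f(1)])
 have smQ: "s i : Bor Q" for i by (rule pred_Q[OF sm])
 have ap: "approx (s i)" for i
 proof -
  let ?Y = "s i ` space Q - {0}"
  let ?G = "%y. s i -` {y} Int space Q"
  have fin: "finite ?Y" using s(1)[of i] by (auto simp: simple_function_def sp)
  have G: "?G y : sets (PN)" for y
   using measurable_sets[OF sm, of "{y}" i] by (simp add: sp)
  have GE: "?G y Int slab E = ?G y" if "y \<noteq> 0" for y
  proof -
   have "x : slab E" if "x : ?G y" for x
   proof (rule ccontr)
    assume "x \<notin> slab E"
    with z have "f x = 0" by simp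
    with s(3)[of x i] that sp \<open>y \<noteq> 0\<close> show False by auto
   qed
   thus ?thesis by auto
  qed
  have "approx (%x. \<Sum>y\<in>?Y. y * ind (?G y) x)"
  proof (rule approx_sum[OF fin], intro conjI)
   fix y assume y: "y : ?Y"
   have m: "(ind (?G y) :: _ => real) : Bor Q" using pred_Q_sets[OF G] by simp
   moreover have a: "approx (ind (?G y))" using approx_pred_set[OF E G[of y]] GE[of y] y by simp
   show "(%x. y * ind (?G y) x) : Bor Q" using m by (intro borel_measurable_times borel_measurable_const)
   show "approx (%x. y * ind (?G y) x)" by (rule approx_scale[OF m a])
  qed
  moreover have "(\<Sum>y\<in>?Y. y * ind (?G y) x) = s i x" if "x : space Q" for x
  proof -
   have "(\<Sum>y\<in>?Y. y * ind (?G y) x) = (\<Sum>y\<in>?Y. if y = s i x then s i x else 0)"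
    by (intro sum.cong refl) (use that in "auto simp: indicator_def")
   also have "... = s i x" using fin that by (auto simp: sum.delta)
   finally show ?thesis .
  qed
  hence "AE x in Q. (\<Sum>y\<in>?Y. y * ind (?G y) x) = s i x" by (intro AE_I2)
  ultimately show ?thesis by (rule approx_AE_cong)
 qed
 show ?thesis
 proof (rule approx_limit[OF fm smQ ap])
  show "(%i. L2n Q (%x. s i x - f x)) ----> 0"
  proof (rule L2n_dominated[OF smQ fm sqi_scale[OF f(2), of 2]])
   show "AE x in Q. abs (s i x) <= abs (2 * f x)" for i
    by (rule AE_I2) (use s(3) sp in "auto simp: abs_mult")
   show "AE x in Q. abs (f x) <= abs (2 * f x)" by (rule AE_I2) auto
   show "AE x in Q. (%i. s i x) ----> f x" by (rule AE_I2) (use s(2) sp in auto)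
  qed

 qed
qed

lemma step_fields_dense:
 assumes "intg L"
 shows "approx (unc L)"
proof -
 have L: "unc L : Bor (PN)" "sqi Q (unc L)" using assms by (auto simp: intg_def)
 have LQ: "unc L : Bor Q" using L(2) by (simp add: sqi_def)
 obtain E :: "nat => 'm set" where E: "range E <= sets nu" "(\<Union>i. E i) = space nu" "!!i. emeasure nu (E i) \<noteq> \<infinity>" "incseq E"
  using nu.sigma_finite_incseq by blast
 let ?f = "%k x. unc L x * ind (slab (E k)) x"
 have Es: "E k : sets nu" "emeasure nu (E k) < \<infinity>" for k using E by (auto simp: less_top)
 have fm: "?f k : Bor (PN)" for k
 proof -
  note Es(1)[measurable] L(1)[measurable]
  show ?thesis by measurable
 qed
 have fs: "sqi Q (?f k)" for k
  by (rule sqi_bound[OF L(2) pred_Q[OF fm]]) (auto simp: indicator_def)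
 have ap: "approx (?f k)" for k
  by (rule approx_slab_field[OF fm fs Es]) (auto simp: indicator_def)
 show ?thesis
 proof (rule approx_limit[OF LQ pred_Q[OF fm] ap])
  show "(%i. L2n Q (%x. ?f i x - unc L x)) ----> 0"
  proof (rule L2n_dominated[OF pred_Q[OF fm] LQ L(2)])
   show "AE x in Q. abs (?f i x) <= abs (unc L x)" for i by (rule AE_I2) (auto simp: indicator_def)
   show "AE x in Q. (%i. ?f i x) ----> unc L x"
   proof (rule AE_I2)
    fix x assume x: "x : space Q"
    hence "snd x : (\<Union>i. E i)" using E(2) by (auto simp: space_Q)
    then obtain k where "snd x : E k" by blast
    hence "\<forall>i\<ge>k. snd x : E i" using E(4) by (meson incseqD subsetD)
    hence "\<forall>\<^sub>F i in sequentially. ?f i x = unc L x"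
     unfolding eventually_sequentially by (intro exI[of _ k]) (auto simp: indicator_def)
    thus "(%i. ?f i x) ----> unc L x" by (rule tendsto_eventually)
   qed
  qed auto

 qed
qed

section \<open>The stochastic integral\<close>

text \<open>The stochastic integral is characterised rather than constructed: an adapted RCLL process that is at every time the
 limit of integrals of step fields converging to the integrand.\<close>

definition is_int :: "(real => 'w => 'm => real) => (real => 'w => real) => bool" where
 "is_int L I <-> arc I &
   (\<exists>c. (\<forall>n::nat. adm (c n)) & (%n. dQ (step_field (c n)) L) ----> 0 &
     (\<forall>t\<in>{0..T}. (%n. L2n P (%w. si (c n) t w - I t w)) ----> 0))"

lemma intg_Q: "intg L ==> sqi Q (unc L)" by (simp add: intg_def)

lemma intg_diff: "intg L ==> intg M ==> intg (%t w e. L t w e - M t w e)"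
 by (auto simp: intg_def)

lemma intg_step: "adm c ==> intg (step_field c)"
 unfolding intg_def
proof
 assume c: "adm c"
 show "sqi Q (sf c)" by (rule step_isometry(2)[OF c])
 show "sf c : Bor (PN)"
  using c
 proof (induct c)
  case Nil thus ?case by (simp add: step_field_def)
 next
  case (Cons x c)
  obtain h s u C where x: "x = (h, s, u, C)" by (cases x) auto
  have c: "adm c" "step_coeff B h s u" "C : sets nu" using Cons by (auto simp: adm_def x)
  have "(%(t, w). h w * ind {s<..u} t) : Bor (pred_sigma B)"
   using predictable_interval[of s u h] c(2) by (simp add: step_coeff_iff bcoef_def predictable_def)
  from measurable_compose[OF measurable_fst this]
  have "(%x. h (snd (fst x)) * ind {s<..u} (fst (fst x))) : Bor (PN)"
   by (simp add: case_prod_beta')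
  moreover have "(%x. ind C (snd x) :: real) : Bor (PN)"
   using c(3) by measurable
  ultimately have "(%x. (h (snd (fst x)) * ind {s<..u} (fst (fst x))) * ind C (snd x)
    + sf c x) : Bor (PN)"
   by (rule borel_measurable_add[OF borel_measurable_times Cons(1)[OF c(1)]])
  thus ?case by (simp add: step_field_def x)
 qed
qed

lemma is_int_arc: "is_int L I ==> arc I" by (simp add: is_int_def)

lemma is_int_step: "adm c ==> is_int (step_field c) (si c)"
 unfolding is_int_def by (intro conjI exI[of _ "%_. c"]) (auto simp: si_sqi_arc L2n_def)

lemma is_int_sqi:
 assumes I: "is_int L I" and t: "t : {0..T}"
 shows "sqi P (I t)"
proof -
 obtain c where c: "!!n. adm (c n)" "(%n. L2n P (%w. si (c n) t w - I t w)) ----> 0"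
  using I t unfolding is_int_def by blast
 have "sqi P (si (c n) t)" for n using t by (intro step_isometry_at(1)[OF c(1)]) auto
 from sqi_limit[OF this arc_measurable_P[OF is_int_arc[OF I] t] c(2)] show ?thesis .
qed

lemma is_int_isometry:
 assumes L: "intg L" and I: "is_int L I" and t: "t : {0..T}"
 shows "L2n P (I t) = L2n Q (%x. unc L x * ind {..t} (fst (fst x)))"
proof -
 obtain c where c: "!!n. adm (c n)" "(%n. dQ (step_field (c n)) L) ----> 0"
  "!!t. t : {0..T} ==> (%n. L2n P (%w. si (c n) t w - I t w)) ----> 0"
  using I unfolding is_int_def by blast
 have t': "0 <= t" "t <= T" using t by auto
 have 1: "(%n. L2n P (si (c n) t)) ----> L2n P (I t)"
  by (rule L2_norm_tendsto[OF step_isometry_at(1)[OF c(1) t'] is_int_sqi[OF I t] c(3)[OF t]])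
 let ?i = "%x. ind {..t} (fst (fst x)) :: real"
 have im: "?i : Bor Q" by measurable
 have s: "sqi Q (%x. f x * ?i x)" if "sqi Q f" for f
  by (rule sqi_bound[OF that]) (use that im in "auto intro!: borel_measurable_times sqi_measurable simp: indicator_def")
 have 2: "(%n. L2n Q (%x. sf (c n) x * ?i x)) ----> L2n Q (%x. unc L x * ?i x)"
 proof (rule L2_norm_tendsto[OF s[OF step_isometry(2)[OF c(1)]] s[OF intg_Q[OF L]]])
  show "(%n. L2n Q (%x. sf (c n) x * ?i x - unc L x * ?i x)) ----> 0"
   by (rule null_le[OF c(2) L2n_mono]) (simp add: indicator_def)
 qed
 show ?thesis
  using LIMSEQ_unique[OF 1 2[folded step_isometry_at(3)[OF c(1) t']]] .
qed

lemma is_int_isometry_le: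
 assumes L: "intg L" and I: "is_int L I" and t: "t : {0..T}"
 shows "L2n P (I t) <= L2n Q (unc L)"
 unfolding is_int_isometry[OF assms] by (rule L2n_mono) (simp add: indicator_def)

lemma is_int_isometry_T:
 assumes L: "intg L" and I: "is_int L I"
 shows "L2n P (I T) = L2n Q (unc L)"
 unfolding is_int_isometry[OF assms(1,2), of T, simplified, OF T_nonneg]
 by (rule L2n_cong_AE, rule AE_I2) (auto simp: space_Q indicator_def)

lemma is_int_diff:
 assumes L: "intg L" "is_int L I" and M: "intg M" "is_int M J"
 shows "is_int (%t w e. L t w e - M t w e) (%t w. I t w - J t w)"
proof -
 obtain c where c: "!!n. adm (c n)" "(%n. dQ (step_field (c n)) L) ----> 0"
  "!!t. t : {0..T} ==> (%n. L2n P (%w. si (c n) t w - I t w)) ----> 0"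
  using L(2) unfolding is_int_def by blast
 obtain d where d: "!!n. adm (d n)" "(%n. dQ (step_field (d n)) M) ----> 0"
  "!!t. t : {0..T} ==> (%n. L2n P (%w. si (d n) t w - J t w)) ----> 0"
  using M(2) unfolding is_int_def by blast
 let ?e = "%n. c n @ scale (-1) (d n)"
 have *: "(%n. L2n R (%x. f n x - f' x - (g n x - g' x))) ----> 0"
  if "(%n. L2n R (%x. f n x - f' x)) ----> 0" "(%n. L2n R (%x. g n x - g' x)) ----> 0"
   "!!n. f n : Bor R" "f' : Bor R" "!!n. g n : Bor R" "g' : Bor R"
  for R :: "'z measure" and f f' g g'
 proof (rule null_le)
  show "(%n. 2 * L2n R (%x. f n x - f' x) + 2 * L2n R (%x. g n x - g' x)) ----> 0"
   using tendsto_add[OF ennreal_tendsto_cmult[OF _ that(1), of 2] ennreal_tendsto_cmult[OF _ that(2), of 2]] by simp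
 qed (intro L2n_diff_le borel_measurable_diff that)
 show ?thesis
  unfolding is_int_def
 proof (intro conjI exI[of _ ?e] allI ballI)
  show "arc (%t w. I t w - J t w)" by (intro arc_diff is_int_arc[OF L(2)] is_int_arc[OF M(2)])
  show "adm (?e n)" for n using c(1) d(1) by (simp add: adm_append adm_scale)
  show "(%n. dQ (step_field (?e n)) (%t w e. L t w e - M t w e)) ----> 0"
   using *[OF c(2) d(2) step_Q[OF c(1)] sqi_measurable[OF intg_Q[OF L(1)]] step_Q[OF d(1)] sqi_measurable[OF intg_Q[OF M(1)]]]
   by (simp add: step_field_append step_field_scale algebra_simps)
  fix t assume t: "t : {0..T}"
  have m: "si a t : Bor P" if "adm a" for a using arc_measurable_P[OF si_sqi_arc[OF that] t] .
  show "(%n. L2n P (%w. si (?e n) t w - (I t w - J t w))) ----> 0"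
   using *[OF c(3)[OF t] d(3)[OF t] m[OF c(1)] arc_measurable_P[OF is_int_arc[OF L(2)] t] m[OF d(1)] arc_measurable_P[OF is_int_arc[OF M(2)] t]]
   by (simp add: si_append si_scale algebra_simps)
 qed
qed

lemma is_int_mart:
 assumes L: "intg L" "is_int L I"
 shows "mart I"
 unfolding mart_def
proof (intro conjI ballI allI impI)
 fix t assume t: "t : {0..T}"
 show "I t : Bor (F t)" by (rule arcD(1)[OF is_int_arc[OF L(2)] t])
 show "sqi P (I t)" by (rule is_int_sqi[OF L(2) t])
next
 fix s u h assume h: "0 <= s & s <= u & u <= T & h : Bor (F s) & sqi P h"
 obtain c where c: "!!n. adm (c n)" "!!t. t : {0..T} ==> (%n. L2n P (%w. si (c n) t w - I t w)) ----> 0"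
  using L(2) unfolding is_int_def by blast
 have lim: "(%n. (\<E> w. si (c n) t w * h w)) ----> (\<E> w. I t w * h w)" if "t : {0..T}" for t
  using that h by (intro L2_ip_tendsto c is_int_sqi[OF L(2)] step_isometry_at(1)) auto
 have "(%n. (\<E> w. si (c n) u w * h w) - (\<E> w. si (c n) s w * h w)) ----> (\<E> w. I u w * h w) - (\<E> w. I s w * h w)"
  using h by (intro tendsto_diff lim) auto
 moreover have "(\<E> w. si (c n) u w * h w) - (\<E> w. si (c n) s w * h w) = 0" for n
 proof -
  have "(\<E> w. si (c n) u w * h w) - (\<E> w. si (c n) s w * h w) = (\<E> w. si (c n) u w * h w - si (c n) s w * h w)"
   using h by (intro Bochner_Integration.integral_diff[symmetric] sqi_prod step_isometry_at(1)[OF c(1)]) auto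
  also have "... = (\<E> w. h w * (si (c n) u w - si (c n) s w))"
   by (rule Bochner_Integration.integral_cong) (auto simp: algebra_simps)
  also have "... = 0" using h by (intro mart_zero[OF si_mart[OF c(1)]]) auto
  finally show ?thesis .
 qed
 ultimately have "(\<E> w. I u w * h w) - (\<E> w. I s w * h w) = 0"
  by (simp add: LIMSEQ_const_iff)
 moreover have "(\<E> w. h w * (I u w - I s w)) = (\<E> w. I u w * h w) - (\<E> w. I s w * h w)"
 proof -
  have "(\<E> w. h w * (I u w - I s w)) = (\<E> w. I u w * h w - I s w * h w)"
   by (rule Bochner_Integration.integral_cong) (auto simp: algebra_simps)
  also have "... = (\<E> w. I u w * h w) - (\<E> w. I s w * h w)"
   using h by (intro Bochner_Integration.integral_diff sqi_prod is_int_sqi[OF L(2)]) auto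
  finally show ?thesis .
 qed
 ultimately show "(\<E> w. h w * (I u w - I s w)) = 0" by simp
qed

text \<open>By the isometry the two integrals agree at each time, and then at all times by right continuity.\<close>

lemma is_int_unique:
 assumes L: "intg L" "is_int L I" and M: "intg M" "is_int M J" and eq: "AE x in Q. unc L x = unc M x"
 shows "AE w in P. \<forall>t\<in>{0..T}. I t w = J t w"
proof (rule arc_AE_eq[OF is_int_arc[OF L(2)] is_int_arc[OF M(2)]])
 fix t assume t: "t : {0..T}"
 have "L2n P (%w. I t w - J t w) <= L2n Q (unc (%t w e. L t w e - M t w e))"
  by (rule is_int_isometry_le[OF intg_diff[OF L(1) M(1)] is_int_diff[OF L M] t])
 also have "... = 0"
  using eq sqi_measurable[OF intg_Q[OF intg_diff[OF L(1) M(1)]]] by (subst L2n_zero_iff) auto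
 finally have "L2n P (%w. I t w - J t w) = 0" by simp
 thus "AE w in P. I t w = J t w"
  using arc_measurable_P[OF is_int_arc[OF L(2)] t] arc_measurable_P[OF is_int_arc[OF M(2)] t]
  by (subst (asm) L2n_zero_iff) auto
qed

lemma is_int_cong:
 assumes I: "is_int L I" and J: "arc J" and eq: "!!t. t : {0..T} ==> AE w in P. I t w = J t w"
 shows "is_int L J"
proof -
 have "L2n P (%w. f w - I t w) = L2n P (%w. f w - J t w)" if "t : {0..T}" for f t
  by (rule L2n_cong_AE) (use eq[OF that] in "auto elim: eventually_mono")
 with I J show ?thesis unfolding is_int_def by simp
qed

text \<open>Along a fast approximating sequence the maximal inequality and the Borel-Cantelli lemma give uniform convergence of the
 paths, so the limit has RCLL paths.\<close>

theorem integral_exists: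
 assumes L: "intg L"
 shows "\<exists>I. is_int L I"
proof -
 have LQ: "unc L : Bor Q" using intg_Q[OF L] by (rule sqi_measurable)
 have "\<forall>n. \<exists>c. adm c & dQ (step_field c) L <= ennreal ((1/8) ^ n)"
  by (intro allI approxD[OF step_fields_dense[OF L]]) simp
 from choice[OF this] obtain c where c: "!!n. adm (c n)"
  "!!n. dQ (step_field (c n)) L <= ennreal ((1/8) ^ n)"
  by blast
 have cL: "(%n. dQ (step_field (c n)) L) ----> 0"
  using tendsto_ennrealI[OF LIMSEQ_power_zero[of "1/8::real"]] by (intro null_le[OF _ c(2)]) simp
 let ?d = "%n. c (Suc n) @ scale (-1) (c n)"
 have d: "adm (?d n)" for n using c(1) by (simp add: adm_append adm_scale)
 have sid: "si (?d n) t w = si (c (Suc n)) t w - si (c n) t w" for n t w by (simp add: si_append si_scale)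
 have dn: "L2n Q (sf (?d n)) <= ennreal (4 * (1/8) ^ n)" for n
 proof -
  have "L2n Q (sf (?d n)) = dQ (step_field (c (Suc n))) (step_field (c n))"
   by (simp add: step_field_append step_field_scale)
  also have "... <= 2 * dQ (step_field (c (Suc n))) L + 2 * dQ L (step_field (c n))"
   by (intro L2n_triangle step_Q c LQ)
  also have "... <= 2 * ennreal ((1/8) ^ Suc n) + 2 * ennreal ((1/8) ^ n)"
   using c(2)[of n] c(2)[of "Suc n"]
   by (intro add_mono mult_left_mono) (auto simp: L2n_commute[of Q "unc L"] simp del: power_Suc)
  also have "... = ennreal (2 * (1/8) ^ Suc n + 2 * (1/8) ^ n)"
   by (rule ennreal_double) simp_all
  also have "... <= ennreal (4 * (1/8) ^ n)" by (rule ennreal_leI) simp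
  finally show ?thesis .
 qed
 \<comment> \<open>the rate \<open>8\<^sup>-\<^sup>n\<close> leaves a summable bound for these probabilities\<close>
 define D where "D n = {w\<in>\<Omega>. \<exists>t\<in>{0..T}. (1/2) ^ n < abs (si (?d n) t w)}" for n
 have Dm: "D n : sets P" for n
  unfolding D_def by (rule maximal_inequality(1)[OF si_sqi_arc[OF d] si_mart[OF d]]) simp
 have DP: "measure P (D n) <= 4 * (1/2) ^ n" for n
 proof -
  have "ennreal (((1/2) ^ n)^2) * emeasure P (D n) <= L2n P (si (?d n) T)"
   unfolding D_def by (rule maximal_inequality(2)[OF si_sqi_arc[OF d] si_mart[OF d]]) simp
  also have "... <= ennreal (4 * (1/8) ^ n)" using dn step_isometry(3)[OF d] by simp
  finally have "((1/2) ^ n)^2 * measure P (D n) <= 4 * (1/8) ^ n"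
   by (simp add: emeasure_eq_measure ennreal_mult[symmetric])
  moreover have "((1/2::real) ^ n)^2 = (1/4) ^ n" by (simp add: power_mult_distrib[symmetric] power2_eq_square)
  ultimately have "(1/4) ^ n * measure P (D n) <= 4 * (1/8) ^ n" by simp
  hence "4 ^ n * ((1/4) ^ n * measure P (D n)) <= 4 ^ n * (4 * (1/8) ^ n)" by (rule mult_left_mono) simp
  moreover have "4 ^ n * (1/4) ^ n = (1::real)" by (simp add: power_mult_distrib[symmetric])
  moreover have "4 ^ n * (1/8) ^ n = (1/2::real) ^ n" by (simp add: power_mult_distrib[symmetric])
  ultimately show ?thesis by (simp add: mult.assoc[symmetric])
 qed
 have "AE w in P. eventually (%n. w : space P - D n) sequentially"
 proof (rule borel_cantelli_AE1[OF Dm])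
  show "summable (%n. measure P (D n))"
   by (rule summable_comparison_test[where g = "%n. 4 * (1/2) ^ n"])
     (use DP in "auto intro!: summable_mult summable_geometric")
 qed (simp add: emeasure_eq_measure)
 then obtain N where N: "N : null_sets P" "N : sets (F 0)"
  "!!w. w : \<Omega> ==> w \<notin> N ==> eventually (%n. w : space P - D n) sequentially"
  by (rule AE_null) auto
 have ul: "uniform_limit {0..T} (%n t. si (c n) t w) (%t. lim (%n. si (c n) t w)) sequentially"
  if w: "w : \<Omega>" "w \<notin> N" for w
 proof -
  have "\<forall>\<^sub>F n in sequentially. \<forall>t\<in>{0..T}. norm (si (c (Suc n)) t w - si (c n) t w) <= (1/2) ^ n"
   using N(3)[OF w] by eventually_elim (auto simp: D_def sid[symmetric] not_less)
  hence "uniform_limit {0..T} (%n t. \<Sum>i<n. si (c (Suc i)) t w - si (c i) t w) (%t. suminf (%i. si (c (Suc i)) t w - si (c i) t w)) sequentially"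
   by (rule Weierstrass_m_test_ev) (simp add: summable_geometric)
  hence "uniform_limit {0..T} (%n t. si (c n) t w - si (c 0) t w) (%t. suminf (%i. si (c (Suc i)) t w - si (c i) t w)) sequentially"
   by (subst (asm) sum_lessThan_telescope)
  from uniform_limit_add[OF this uniform_limit_const[where c = "%t. si (c 0) t w"]]
  have u: "uniform_limit {0..T} (%n t. si (c n) t w) (%t. suminf (%i. si (c (Suc i)) t w - si (c i) t w) + si (c 0) t w) sequentially"
   by simp
  have "lim (%n. si (c n) t w) = suminf (%i. si (c (Suc i)) t w - si (c i) t w) + si (c 0) t w" if "t : {0..T}" for t
   by (rule limI[OF tendsto_uniform_limitI[OF u that]])
  with u show ?thesis by (subst uniform_limit_cong'[where i = "%t. suminf (%i. si (c (Suc i)) t w - si (c i) t w) + si (c 0) t w", OF refl]) auto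
 qed
 define I where "I t w = (if w : N then 0 else lim (%n. si (c n) t w))" for t w
 have aI: "arc I"
 proof (rule arcI)
  fix t assume t: "t : {0..T}"
  have "(%w. lim (%n. si (c n) t w)) : Bor (F t)"
   by (intro borel_measurable_lim_metric arcD(1)[OF si_sqi_arc[OF c(1)] t])
  moreover have "N Int \<Omega> : sets (F t)" using null_in_F[OF N(1), of "N Int \<Omega>" t] t by auto
  ultimately show "I t : Bor (F t)"
   unfolding I_def[abs_def] by (intro measurable_If_set) (auto simp: space_F)
 next
  fix w assume w: "w : \<Omega>"
  show "rcll T (%t. I t w)"
  proof (cases "w : N")
   case False
   show ?thesis using rcll_uniform_limit[OF arcD(2)[OF si_sqi_arc[OF c(1)] w] ul[OF w False]] False by (simp add: I_def)
  qed (simp add: I_def)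
 qed
 have pt: "AE w in P. (%n. si (c n) t w) ----> I t w" if t: "t : {0..T}" for t
 proof (rule AE_I'[OF N(1)])
  show "{w : space P. \<not> (%n. si (c n) t w) ----> I t w} <= N"
   using tendsto_uniform_limitI[OF ul t] by (auto simp: I_def)
 qed
 have "is_int L I"
  unfolding is_int_def
 proof (intro conjI exI[of _ c] aI allI c(1) cL ballI)
  fix t assume t: "t : {0..T}"
  hence t': "0 <= t" "t <= T" by auto
  have mP: "si (c n) t : Bor P" for n by (rule arc_measurable_P[OF si_sqi_arc[OF c(1)] t])
  have dt: "L2n P (%w. si (c (Suc n)) t w - si (c n) t w) <= ennreal (4 * (1/4) ^ n)" for n
  proof -
   have "L2n P (si (?d n) t) <= ennreal (4 * (1/8) ^ n)"
    using step_isometry_at(2)[OF d t'] dn by (rule order_trans)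
   also have "... <= ennreal (4 * (1/4) ^ n)" by (intro ennreal_leI mult_left_mono power_mono) auto
   finally show ?thesis unfolding sid[symmetric] .
  qed
  show "(%n. L2n P (%w. si (c n) t w - I t w)) ----> 0" by (rule L2n_geometric_AE[OF mP _ dt pt[OF t]]) simp
 qed
 thus ?thesis by auto
qed

end

section \<open>Stopping the integral\<close>

context integrator begin

text \<open>Clipping to \<open>[s, u]\<close>.\<close>

definition cl :: "real => real => real => real" where
 "cl s u r = max s (min u r)"

definition piece :: "('w => real) => nat => ('w => real) \<times> real \<times> real \<times> 'm set => nat => ('w => real) \<times> real \<times> real \<times> 'm set" where
 "piece \<rho> N x j = (case x of (h, s, u, C) =>
   (%w. h w * (if T * real j / real N <= \<rho> w & T * real j / real N <= u then 1 else 0),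
   cl s u (T * real j / real N), cl s u (T * real (Suc j) / real N), C))"

text \<open>Replace the stopping time by its right approximation on the grid of mesh \<open>T / N\<close>; the stopped step field is then again
 a step field.\<close>

definition grid :: "('w => real) => nat => ('w, 'm) steps => ('w, 'm) steps" where
 "grid \<rho> N c = concat (map (%x. map (piece \<rho> N x) [0..<N]) c)"

lemma adm1_piece:
 assumes x: "adm1 x" and \<rho>: "bst \<rho>"
 shows "adm1 (piece \<rho> N x j)"
proof -
 obtain h s u C where x': "x = (h, s, u, C)" by (cases x) auto
 have h: "0 <= s" "s <= u" "u <= T" "bcoef s h" "C : sets nu" "emeasure nu C < \<infinity>"
  using x by (auto simp: x' step_coeff_iff)
 let ?r = "T * real j / real N" and ?r' = "T * real (Suc j) / real N"
 have rr: "?r <= ?r'" using T_nonneg by (intro divide_right_mono mult_left_mono) auto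
 have "bcoef (cl s u ?r) (%w. h w * (if ?r <= \<rho> w & ?r <= u then 1 else 0))"
 proof (rule bcoef_mult)
  show "bcoef (cl s u ?r) h" by (rule bcoef_mono[OF h(4)]) (simp add: cl_def)
  show "bcoef (cl s u ?r) (%w. if ?r <= \<rho> w & ?r <= u then 1 else 0)"
   unfolding bcoef_def
  proof
   show "(%w. if ?r <= \<rho> w & ?r <= u then 1 else 0 :: real) : Bor (F (cl s u ?r))"
   proof (cases "?r <= u")
    case True
    have "{w\<in>\<Omega>. ?r <= \<rho> w} : sets (F (cl s u ?r))"
     using stop_ge_sets[OF bst_stopping[OF \<rho>], of ?r] sets_F_mono[of ?r "cl s u ?r"] True by (auto simp: cl_def)
    hence "(%w. if w : {w\<in>\<Omega>. ?r <= \<rho> w} then 1 else 0 :: real) : Bor (F (cl s u ?r))"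
     by (intro measurable_If_set) (auto simp: space_F Int_absorb2)
    thus ?thesis
     by (rule measurable_cong[THEN iffD1, rotated]) (use True in "auto simp: space_F")
   qed simp
   show "\<exists>K. \<forall>w\<in>\<Omega>. abs (if ?r <= \<rho> w & ?r <= u then 1 else 0 :: real) <= K" by (intro exI[of _ 1]) auto
  qed
 qed
 moreover have "0 <= cl s u ?r" "cl s u ?r <= cl s u ?r'" "cl s u ?r' <= T" using h rr by (auto simp: cl_def)
 ultimately show ?thesis using h by (simp add: piece_def x' step_coeff_iff)
qed

lemma adm_grid: "adm c ==> bst \<rho> ==> adm (grid \<rho> N c)"
 using adm1_piece by (auto simp: adm_def grid_def)

lemma grid_sum:
 assumes le: "s <= u" "0 <= s" "u <= T" and N: "0 < N" and r: "0 <= r" "r <= T"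
 shows "(\<Sum>j<N. (if T * real j / real N <= r & T * real j / real N <= u then 1 else 0) *
    (\<phi> (cl s u (T * real (Suc j) / real N)) - \<phi> (cl s u (T * real j / real N)) :: real))
   = \<phi> (cl s u (rgrid T N r)) - \<phi> s"
proof -
 have "(\<Sum>j<N. (if T * real j / real N <= r & T * real j / real N <= u then 1 else 0) *
    (\<phi> (cl s u (T * real (Suc j) / real N)) - \<phi> (cl s u (T * real j / real N))))
   = (\<Sum>j<N. if T * real j / real N <= r then \<phi> (cl s u (T * real (Suc j) / real N)) - \<phi> (cl s u (T * real j / real N)) else 0)"
 proof (intro sum.cong refl)
  fix j
  have rr: "T * real j / real N <= T * real (Suc j) / real N" using T_nonneg by (intro divide_right_mono mult_left_mono) auto
  have "cl s u (T * real (Suc j) / real N) = cl s u (T * real j / real N)" if "\<not> T * real j / real N <= u"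
   using that rr by (simp add: cl_def)
  thus "(if T * real j / real N <= r & T * real j / real N <= u then 1 else 0) *
    (\<phi> (cl s u (T * real (Suc j) / real N)) - \<phi> (cl s u (T * real j / real N)))
   = (if T * real j / real N <= r then \<phi> (cl s u (T * real (Suc j) / real N)) - \<phi> (cl s u (T * real j / real N)) else 0)"
   by auto
 qed
 also have "... = \<phi> (cl s u (rgrid T N r)) - \<phi> (cl s u 0)"
  by (rule sum_grid_telescope[where \<phi> = "%r. \<phi> (cl s u r)", OF r T_pos N])
 also have "cl s u 0 = s" using le by (simp add: cl_def)
 finally show ?thesis .
qed

text \<open>Restricting the steps to those cells that begin before \<open>\<rho>\<close> amounts to stopping at the right approximation
 of \<open>\<rho>\<close>: the increments over these cells telescope.\<close>

lemma eval_grid: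
 assumes c: "adm c" and N: "0 < N" and r: "0 <= \<rho> w" "\<rho> w <= T"
 shows "eval_steps f (grid \<rho> N c) w = eval_steps (%C r. f C (min r (rgrid T N (\<rho> w)))) c w"
 using c
proof (induct c)
 case Nil thus ?case by (simp add: grid_def eval_steps_def)
next
 case (Cons x c)
 obtain h s u C where x: "x = (h, s, u, C)" by (cases x) auto
 have h: "0 <= s" "s <= u" "u <= T" using Cons(2) by (auto simp: x adm_def step_coeff_iff)
 let ?g = "rgrid T N (\<rho> w)"
 have "eval_steps f (map (piece \<rho> N x) [0..<N]) w
   = (\<Sum>j<N. h w * ((if T * real j / real N <= \<rho> w & T * real j / real N <= u then 1 else 0) *
    (f C (cl s u (T * real (Suc j) / real N)) - f C (cl s u (T * real j / real N)))))"
  unfolding eval_steps_def by (simp add: interv_sum_list_conv_sum_set_nat atLeast0LessThan piece_def x o_def mult.assoc)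
 also have "... = h w * (f C (cl s u ?g) - f C s)"
  unfolding sum_distrib_left[symmetric] by (subst grid_sum[OF h(2,1,3) N r]) simp
 also have "... = h w * (f C (min u ?g) - f C (min s ?g))"
  using h by (cases "s <= ?g") (auto simp: cl_def min_def max_def)
 finally show ?case using Cons by (simp add: eval_steps_def grid_def adm_def x)
qed

lemma si_grid:
 assumes "adm c" "0 < N" "0 <= \<rho> w" "\<rho> w <= T"
 shows "si (grid \<rho> N c) t w = si c (min t (rgrid T N (\<rho> w))) w"
 using eval_grid[of c N \<rho> w, OF assms] by (simp add: si_eval min.assoc min.commute min.left_commute)

lemma step_field_grid:
 assumes c: "adm c" and \<rho>: "bst \<rho>" and N: "0 < N" and w: "w : \<Omega>"
 shows "step_field (grid \<rho> N c) t w e = step_field c t w e * (if t <= rgrid T N (\<rho> w) then 1 else 0)"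
proof -
 have "0 <= \<rho> w" "\<rho> w <= T" using \<rho> w by (auto simp: bst_def)
 from eval_grid[of c N \<rho> w, OF c N this] show ?thesis
  by (simp add: step_field_eval adm_grid c \<rho>) (simp add: eval_steps_def split_def indicator_def flip: sum_list_mult_const)
qed

abbreviation upto_stop :: "(real => 'w => 'm => real) => ('w => real) => real => 'w => 'm => real" where
 "upto_stop L \<rho> \<equiv> %t w e. L t w e * (if t <= \<rho> w then 1 else 0)"

lemma intg_until:
 assumes L: "intg L" and \<rho>: "bst \<rho>"
 shows "intg (upto_stop L \<rho>)"
 unfolding intg_def
proof
 have "(%x. (if fst (fst x) <= \<rho> (snd (fst x)) then 1 else 0) :: real) : Bor (PN)"
  using measurable_compose[OF measurable_fst pred_until_stop[OF \<rho>, unfolded predictable_def]]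
  by (simp add: case_prod_beta')
 thus m: "unc (upto_stop L \<rho>) : Bor (PN)"
  using L unfolding intg_def by (intro borel_measurable_times) auto
 show "sqi Q (unc (upto_stop L \<rho>))"
  by (rule sqi_bound[OF intg_Q[OF L] pred_Q[OF m]]) auto
qed

lemma stop_step:
 assumes c: "adm c" and \<rho>: "bst \<rho>" and J: "is_int (upto_stop (step_field c) \<rho>) J"
 shows "AE w in P. \<forall>t\<in>{0..T}. J t w = si c (min t (\<rho> w)) w"
proof (rule arc_AE_eq[OF is_int_arc[OF J] arc_stopped[OF si_sqi_arc[OF c] \<rho>]])
 fix t assume t: "t : {0..T}"
 let ?g = "%n. grid \<rho> (Suc n) c"
 have g: "adm (?g n)" for n by (rule adm_grid[OF c \<rho>])
 have iu: "intg (upto_stop (step_field c) \<rho>)" by (rule intg_until[OF intg_step[OF c] \<rho>])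
 have le: "L2n P (%w. si (?g n) t w - J t w) <= dQ (step_field (?g n)) (upto_stop (step_field c) \<rho>)" for n
  using is_int_isometry_le[OF intg_diff[OF intg_step[OF g] iu] is_int_diff[OF intg_step[OF g] is_int_step[OF g] iu J] t] .
 have "(%n. dQ (step_field (?g n)) (upto_stop (step_field c) \<rho>)) ----> 0"
 proof (rule L2n_dominated[OF step_Q[OF g] sqi_measurable[OF intg_Q[OF iu]] step_isometry(2)[OF c]])
  show "AE x in Q. abs (sf (?g n) x) <= abs (sf c x)" for n
   by (rule AE_I2) (auto simp: space_Q step_field_grid[OF c \<rho>])
  show "AE x in Q. abs (unc (upto_stop (step_field c) \<rho>) x) <= abs (sf c x)"
   by (rule AE_I2) auto
  show "AE x in Q. (%n. sf (?g n) x) ----> unc (upto_stop (step_field c) \<rho>) x"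
  proof (rule AE_I2)
   fix x assume "x : space Q"
   then obtain s w e where x: "x = ((s, w), e)" and s: "0 <= s" "s <= T" and w: "w : \<Omega>" by (auto simp: space_Q)
   have r: "0 <= \<rho> w" "\<rho> w <= T" using \<rho> w by (auto simp: bst_def)
   have "\<forall>\<^sub>F n in sequentially. (s <= rgrid T (Suc n) (\<rho> w)) = (s <= \<rho> w)"
   proof (cases "\<rho> w < T")
    case False
    thus ?thesis using r by (simp add: rgrid_def)
   next
    case True
    show ?thesis
    proof (cases "s <= \<rho> w")
     case s': True
     show ?thesis
      by (rule always_eventually) (use rgrid_bounds(1)[OF r(1) True] s' in "auto intro: order_trans less_imp_le")
    next
     case s': False
     have "(%n. rgrid T (Suc n) (\<rho> w)) ----> \<rho> w"
      using rgrid_LIMSEQ[OF r(1) True] by (simp add: filterlim_at)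
     hence "\<forall>\<^sub>F n in sequentially. rgrid T (Suc n) (\<rho> w) < s"
      using s' by (intro order_tendstoD(2)) auto
     thus ?thesis using s' by (auto elim: eventually_mono)
    qed
   qed
   hence "\<forall>\<^sub>F n in sequentially. sf (?g n) x = unc (upto_stop (step_field c) \<rho>) x"
    by eventually_elim (simp add: x step_field_grid[OF c \<rho> _ w])
   thus "(%n. sf (?g n) x) ----> unc (upto_stop (step_field c) \<rho>) x"
    by (rule tendsto_eventually)
  qed
 qed
 hence l2: "(%n. L2n P (%w. si (?g n) t w - J t w)) ----> 0"
  by (rule tendsto_sandwich[OF _ _ tendsto_const, rotated 2]) (use le in auto)
 show "AE w in P. J t w = si c (min t (\<rho> w)) w"
 proof (rule L2n_subseq_limit[OF _ _ l2])
  show "si (?g n) t : Bor P" for n by (rule arc_measurable_P[OF si_sqi_arc[OF g] t])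
  show "J t : Bor P" by (rule arc_measurable_P[OF is_int_arc[OF J] t])
  show "AE w in P. (%n. si (?g n) t w) ----> si c (min t (\<rho> w)) w"
  proof (rule AE_I2)
   fix w assume w: "w : space P"
   have r: "0 <= \<rho> w" "\<rho> w <= T" using \<rho> w by (auto simp: bst_def)
   have "rcll T (%s. si c (min s t) w)"
    using t T_nonneg by (intro rcll_stopped arcD(2)[OF si_sqi_arc[OF c] w]) auto
   from rcll_rgrid[OF this r] show "(%n. si (?g n) t w) ----> si c (min t (\<rho> w)) w"
    by (simp add: si_grid[where \<rho> = \<rho> and w = w, OF c _ r] min.commute)
  qed
 qed
qed

text \<open>The maximal inequality turns convergence of the integrands into convergence in probability uniformly in time, so that it
 survives evaluation at a stopping time.\<close>

lemma is_int_sup_small: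
 assumes L: "intg L" "is_int L I" and M: "intg M" "is_int M J" and lam: "0 < lam"
 shows "{w\<in>\<Omega>. \<exists>t\<in>{0..T}. lam < abs (I t w - J t w)} : sets P"
  "ennreal (lam^2) * emeasure P {w\<in>\<Omega>. \<exists>t\<in>{0..T}. lam < abs (I t w - J t w)} <= dQ L M"
 using maximal_inequality[OF is_int_arc[OF is_int_diff[OF L M]] is_int_mart[OF intg_diff[OF L(1) M(1)] is_int_diff[OF L M]] lam]
  is_int_isometry_T[OF intg_diff[OF L(1) M(1)] is_int_diff[OF L M]] by auto

theorem is_int_stopped:
 assumes L: "intg L" "is_int L I" and \<rho>: "bst \<rho>"
 shows "is_int (upto_stop L \<rho>) (%t w. I (min t (\<rho> w)) w)"
proof -
 have iu: "intg (upto_stop L \<rho>)" by (rule intg_until[OF L(1) \<rho>])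
 obtain J where J: "is_int (upto_stop L \<rho>) J" using integral_exists[OF iu] by auto
 obtain c where c: "!!n. adm (c n)" "(%n. dQ (step_field (c n)) L) ----> 0"
  using L(2) unfolding is_int_def by blast
 have cu: "intg (upto_stop (step_field (c n)) \<rho>)" for n by (rule intg_until[OF intg_step[OF c(1)] \<rho>])
 have "\<forall>n. \<exists>J. is_int (upto_stop (step_field (c n)) \<rho>) J" by (intro allI integral_exists cu)
 from choice[OF this] obtain Jn where Jn: "!!n. is_int (upto_stop (step_field (c n)) \<rho>) (Jn n)" by auto
 have eq: "AE w in P. J t w = I (min t (\<rho> w)) w" if t: "t : {0..T}" for t
 proof -
  have small: "AE w in P. abs (J t w - I (min t (\<rho> w)) w) <= 2 * lam" if lam: "0 < lam" for lam
  proof -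
   let ?A = "%n. {w\<in>\<Omega>. \<exists>t\<in>{0..T}. lam < abs (si (c n) t w - I t w)}"
   let ?B = "%n. {w\<in>\<Omega>. \<exists>t\<in>{0..T}. lam < abs (Jn n t w - J t w)}"
   let ?N = "{w\<in>\<Omega>. \<not> (abs (J t w - I (min t (\<rho> w)) w)) <= 2 * lam}"
   let ?d = "%n. dQ (step_field (c n)) L"
   have [measurable]: "J t : Bor P" "(%w. I (min t (\<rho> w)) w) : Bor P"
    using arc_measurable_P[OF is_int_arc[OF J] t] arc_measurable_P[OF arc_stopped[OF is_int_arc[OF L(2)] \<rho>] t] by auto
   have Nm: "?N : sets P" by measurable
   note A = is_int_sup_small[OF intg_step[OF c(1)] is_int_step[OF c(1)] L lam]
   note Bb = is_int_sup_small[OF cu Jn iu J lam]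
   have sub: "AE w in P. w : ?N --> w : ?A n \<union> ?B n" for n
    using stop_step[OF c(1) \<rho> Jn[of n]] AE_space
   proof eventually_elim
    fix w assume 1: "\<forall>t\<in>{0..T}. Jn n t w = si (c n) (min t (\<rho> w)) w" and w: "w : \<Omega>"
    show "w : ?N --> w : ?A n \<union> ?B n"
    proof (rule impI, rule ccontr)
     assume N: "w : ?N" and no: "w \<notin> ?A n \<union> ?B n"
     have m: "min t (\<rho> w) : {0..T}" using t bst_ge[OF \<rho> w] by auto
     have "abs (si (c n) (min t (\<rho> w)) w - I (min t (\<rho> w)) w) <= lam" using no m w by (auto simp: not_less)
     moreover have "abs (Jn n t w - J t w) <= lam" using no t w by (auto simp: not_less)
     moreover have "Jn n t w = si (c n) (min t (\<rho> w)) w" using 1 t by auto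
     ultimately have "abs (J t w - I (min t (\<rho> w)) w) <= 2 * lam" by linarith
     with N show False by simp
    qed
   qed
   have "ennreal (lam^2) * emeasure P ?N <= 2 * ?d n" for n
   proof -
    have "emeasure P ?N <= emeasure P (?A n \<union> ?B n)"
     using sub[of n] A(1)[of n] Bb(1)[of n] by (intro emeasure_mono_AE) auto
    also have "... <= emeasure P (?A n) + emeasure P (?B n)"
     by (rule emeasure_subadditive[OF A(1) Bb(1)])
    finally have "ennreal (lam^2) * emeasure P ?N <= ennreal (lam^2) * (emeasure P (?A n) + emeasure P (?B n))"
     by (rule mult_left_mono) simp
    also have "... <= ?d n + dQ (upto_stop (step_field (c n)) \<rho>) (upto_stop L \<rho>)"
     unfolding distrib_left by (rule add_mono[OF A(2) Bb(2)])
    also have "... <= ?d n + ?d n"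
     by (intro add_left_mono L2n_mono) auto
    finally show ?thesis by (simp only: mult_2)
   qed
   hence bound: "\<exists>N. \<forall>n\<ge>N. ennreal (lam^2) * emeasure P ?N <= 2 * ?d n" by blast
   have "(%n. 2 * ?d n) ----> 2 * 0" by (intro ennreal_tendsto_cmult c(2)) simp
   hence "ennreal (lam^2) * emeasure P ?N <= 2 * 0"
    by (rule LIMSEQ_le_const[OF _ bound])
   hence "emeasure P ?N = 0" using lam by simp
   with Nm have "?N : null_sets P" by (simp add: null_sets_def)
   thus ?thesis by (rule AE_I') auto
  qed
  have "AE w in P. \<forall>n. abs (J t w - I (min t (\<rho> w)) w) <= 2 * (1 / real (Suc n))"
   by (subst AE_all_countable) (intro allI small, simp)
  thus ?thesis
  proof eventually_elim
   fix w assume *: "\<forall>n. abs (J t w - I (min t (\<rho> w)) w) <= 2 * (1 / real (Suc n))"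
   have "(%n. 2 * inverse (real (Suc n))) ----> 2 * 0" by (intro tendsto_intros LIMSEQ_inverse_real_of_nat)
   hence "abs (J t w - I (min t (\<rho> w)) w) <= 2 * 0"
    by (rule LIMSEQ_le_const) (use * in "auto simp: inverse_eq_divide")
   thus "J t w = I (min t (\<rho> w)) w" by simp
  qed
 qed
 show ?thesis
  by (rule is_int_cong[OF J arc_stopped[OF is_int_arc[OF L(2)] \<rho>] eq])
qed

end

section \<open>Moments and independence\<close>

lemma poisson_sums:
 fixes lam :: real
 shows "(%k. lam ^ k / fact k * exp (- lam)) sums 1"
  "(%k. real k * (lam ^ k / fact k * exp (- lam))) sums lam"
  "(%k. (real k)^2 * (lam ^ k / fact k * exp (- lam))) sums (lam + lam^2)"
proof -
 let ?p = "%k. lam ^ k / fact k * exp (- lam)"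
 have "(%k. lam ^ k /\<^sub>R fact k) sums exp lam" by (rule exp_converges)
 from sums_mult2[OF this, of "exp (- lam)"] show 0: "?p sums 1"
  by (simp add: exp_minus divide_inverse mult.commute)
 have shift: "real (Suc k) * ?p (Suc k) = lam * ?p k" for k
  by (simp add: fact_Suc del: of_nat_Suc)
 have "(%k. real (Suc k) * ?p (Suc k)) sums lam"
  unfolding shift using sums_mult[OF 0, of lam] by simp
 from sums_Suc[OF this] show 1: "(%k. real k * ?p k) sums lam" by simp
 have "(%k. (real (Suc k))^2 * ?p (Suc k)) sums (lam + lam^2)"
 proof -
  have "(real (Suc k))^2 * ?p (Suc k) = lam * (real k * ?p k) + lam * ?p k" for k
  proof -
   have "(real (Suc k))^2 * ?p (Suc k) = real (Suc k) * (lam * ?p k)"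
    by (simp only: shift[symmetric] power2_eq_square mult.assoc)
   moreover have "real (Suc k) * (lam * x) = lam * (real k * x) + lam * x" for x by (simp add: algebra_simps)
   from this[of "?p k"] calculation show ?thesis by (rule trans[rotated])
  qed
  thus ?thesis
   using sums_add[OF sums_mult[OF 1, of lam] sums_mult[OF 0, of lam]] by (simp add: power2_eq_square add.commute)
 qed
 from sums_Suc[OF this] show "(%k. (real k)^2 * ?p k) sums (lam + lam^2)" by simp
qed

context prob_space begin

text \<open>Integrate over the countably many values.\<close>

lemma poisson_moments:
 fixes X :: "'a => ennreal"
 assumes X [measurable]: "X : Bor M" and lam: "0 <= lam"
  and p: "!!k. prob {w\<in>space M. X w = of_nat k} = lam ^ k / fact k * exp (- lam)"
 shows "AE w in M. X w < \<infinity>"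
  "sqi M (%w. enn2real (X w) - lam)" "(\<integral>w. enn2real (X w) - lam \<partial>M) = 0"
  "(\<integral>w. (enn2real (X w) - lam)^2 \<partial>M) = lam"
proof -
 let ?p = "%k. lam ^ k / fact k * exp (- lam)"
 let ?E = "%k. {w\<in>space M. X w = of_nat k}"
 have pn: "0 <= ?p k" for k using lam by simp
 have Em [measurable]: "?E k : sets M" for k by measurable
 have dis: "disjoint_family ?E" by (auto simp: disjoint_family_on_def)
 have "emeasure M (\<Union>k. ?E k) = (\<Sum>k. emeasure M (?E k))"
  by (rule suminf_emeasure[symmetric]) (use dis Em in auto)
 also have "... = (\<Sum>k. ennreal (?p k))" by (simp add: emeasure_eq_measure p)
 also have "... = ennreal 1" by (rule suminf_ennreal_eq[OF pn poisson_sums(1)])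
 finally have "prob (\<Union>k. ?E k) = 1" by (simp add: emeasure_eq_measure)
 hence AE: "AE w in M. w : (\<Union>k. ?E k)" by (rule AE_prob_1)
 thus "AE w in M. X w < \<infinity>"
  by eventually_elim (auto simp: ennreal_of_nat_eq_real_of_nat)
 have nn: "(\<integral>\<^sup>+w. ennreal (g (enn2real (X w))) \<partial>M) = ennreal S"
  if g: "!!k. 0 <= g (real k)" and S: "(%k. g (real k) * ?p k) sums S" for g S
 proof -
  have "(\<integral>\<^sup>+w. ennreal (g (enn2real (X w))) \<partial>M) = (\<integral>\<^sup>+w. (\<Sum>k. ennreal (g (real k)) * ind (?E k) w) \<partial>M)"
   using AE
  proof (intro nn_integral_cong_AE, eventually_elim)
   fix w assume "w : (\<Union>k. ?E k)"
   then obtain k where k: "w : space M" "X w = of_nat k" by auto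
   have "(\<Sum>j. ennreal (g (real j)) * ind (?E j) w) = (\<Sum>j\<in>{k}. ennreal (g (real j)) * ind (?E j) w)"
    by (rule suminf_finite) (use k in "auto simp: indicator_def")
   also have "... = ennreal (g (real k))" using k by simp
   also have "real k = enn2real (X w)" using k by (simp add: ennreal_of_nat_eq_real_of_nat)
   finally show "ennreal (g (enn2real (X w))) = (\<Sum>k. ennreal (g (real k)) * ind (?E k) w)" by simp
  qed
  also have "... = (\<Sum>k. ennreal (g (real k)) * emeasure M (?E k))"
   by (subst nn_integral_suminf) (auto simp: nn_integral_cmult_indicator)
  also have "... = (\<Sum>k. ennreal (g (real k) * ?p k))"
   by (intro suminf_cong) (simp only: emeasure_eq_measure p ennreal_mult[OF g pn])
  also have "... = ennreal S" by (rule suminf_ennreal_eq[OF mult_nonneg_nonneg[OF g pn] S])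
  finally show ?thesis .
 qed
 let ?Y = "%w. enn2real (X w)"
 have h1: "has_bochner_integral M ?Y lam"
  by (rule has_bochner_integral_nn_integral) (use nn[of "%x. x", OF _ poisson_sums(2)] lam in auto)
 have h2: "has_bochner_integral M (%w. (?Y w)^2) (lam + lam^2)"
  by (rule has_bochner_integral_nn_integral) (use nn[of "%x. x^2", OF _ poisson_sums(3)] lam in auto)
 have h3: "has_bochner_integral M (%w. (?Y w - lam)^2) lam"
 proof -
  have h0: "has_bochner_integral M (%w. lam^2) (lam^2)"
   using has_bochner_integral_integrable[of M "%_. lam^2"] by (simp add: prob_space)
  have "has_bochner_integral M (%w. (?Y w)^2 - 2 * lam * ?Y w + lam^2) (lam + lam^2 - 2 * lam * lam + lam^2)"
   using h1 h2 by (intro has_bochner_integral_add has_bochner_integral_diff has_bochner_integral_mult_right h0)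
  thus ?thesis by (simp add: power2_diff power2_eq_square algebra_simps)
 qed
 show "sqi M (%w. ?Y w - lam)" by (rule sqiI) (use h3 in "auto simp: has_bochner_integral_iff")
 show "(\<integral>w. ?Y w - lam \<partial>M) = 0"
  using h1 by (subst Bochner_Integration.integral_diff) (auto simp: has_bochner_integral_iff prob_space)
 show "(\<integral>w. (?Y w - lam)^2 \<partial>M) = lam" using h3 by (simp add: has_bochner_integral_iff)
qed

lemma indep_set_expectation:
 fixes h D :: "'a => real"
 assumes ind: "indep_set (sets G) S" and G: "space G = space M"
  and h: "h : Bor G" "integrable M h"
  and D: "integrable M D" "!!A. A : sets borel ==> D -` A Int space M : S"
 shows "integrable M (%w. h w * D w)" "(\<integral>w. h w * D w \<partial>M) = (\<integral>w. h w \<partial>M) * (\<integral>w. D w \<partial>M)"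
proof -
 have "indep_var borel h borel D"
  unfolding indep_var_eq
 proof (intro conjI)
  show "random_variable borel h" "random_variable borel D" using h D by auto
  show "indep_set (sigma_sets (space M) {h -` A Int space M |A. A : sets borel})
    (sigma_sets (space M) {D -` A Int space M |A. A : sets borel})"
   using ind unfolding indep_set_def
  proof (rule indep_sets_mono_sets)
   fix b :: bool
   have "{h -` A Int space M |A. A : sets borel} <= sets G"
    using measurable_sets[OF h(1)] G by auto
   hence 1: "sigma_sets (space M) {h -` A Int space M |A. A : sets borel} <= sets G"
    unfolding G[symmetric] by (rule sets.sigma_sets_subset)
   have e: "{D -` A Int space M |A. A : sets borel} = sets (vimage_algebra (space M) D borel)"
    by (rule sets_vimage_algebra2[symmetric]) simp
   have "sigma_sets (space M) {D -` A Int space M |A. A : sets borel} = {D -` A Int space M |A. A : sets borel}"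
    unfolding e using sets.sigma_sets_eq[of "vimage_algebra (space M) D borel"] by simp
   hence 2: "sigma_sets (space M) {D -` A Int space M |A. A : sets borel} <= S" using D(2) by auto
   show "(case b of True => sigma_sets (space M) {h -` A Int space M |A. A : sets borel}
      | False => sigma_sets (space M) {D -` A Int space M |A. A : sets borel}) <= (case b of True => sets G | False => S)"
    using 1 2 by (cases b) auto
  qed
 qed
 from indep_var_integrable[OF this h(2) D(1)] indep_var_lebesgue_integral[OF this h(2) D(1)]
 show "integrable M (%w. h w * D w)" "(\<integral>w. h w * D w \<partial>M) = (\<integral>w. h w \<partial>M) * (\<integral>w. D w \<partial>M)" .
qed

end

context jbasis begin

section \<open>The Brownian motion\<close>

lemma brownian: "brownian B" and poisson: "poisson_measure B" and mark_sigma_finite: "sigma_finite_measure (mark B)"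
 using jump_basis by (auto simp: jump_basis_def)

lemma noise_independent:
 "indep_set (sigma_sets \<Omega> {bm B t -` D Int \<Omega> |t D. 0 <= t & D : sets borel}) (prm_events B UNIV)"
 using jump_basis by (simp add: jump_basis_def)

lemma bm_adapted: "0 <= t ==> bm B t : Bor (F t)"
 using brownian by (simp add: brownian_def)

lemma P_integrable: "sqi P f ==> integrable P f"
 by (rule sqi_integrable[OF finite_measure_axioms])

text \<open>\<open>V\<close> is only almost surely equal to a function of the future noise.\<close>

lemma past_independent:
 fixes h V D :: "'w => real"
 assumes S: "indep_set (sets (F s)) S" and h: "h : Bor (F s)" "integrable P h"
  and V: "V : Bor P" "AE w in P. V w = D w" and D: "integrable P D" "!!A. A : sets borel ==> D -` A Int \<Omega> : S"
 shows "(\<E> w. h w * V w) = (\<E> w. h w) * (\<E> w. D w)"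
proof -
 have "(\<E> w. h w * V w) = (\<E> w. h w * D w)"
  using V by (intro integral_cong_AE borel_measurable_times F_imp_P[OF h(1)] borel_measurable_integrable[OF D(1)]) (auto elim: eventually_mono)
 also have "... = (\<E> w. h w) * (\<E> w. D w)"
  by (rule indep_set_expectation(2)[OF S space_F h D])
 finally show ?thesis .
qed

lemma bm_indep: "0 <= s ==> s < t ==>
  indep_set (sets (F s)) {(%w. bm B t w - bm B s w) -` D Int \<Omega> |D. D : sets borel}"
 using brownian by (simp add: brownian_def)

lemma bm_increment:
 assumes "0 <= s" "s < t"
 shows "sqi P (%w. bm B t w - bm B s w)" "(\<E> w. bm B t w - bm B s w) = 0"
  "(\<E> w. (bm B t w - bm B s w)^2) = t - s"
proof -
 have D: "distributed P lborel (%w. bm B t w - bm B s w) (normal_density 0 (sqrt (t - s)))"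
  using brownian assms by (simp add: brownian_def)
 have pos: "0 < sqrt (t - s)" using assms by simp
 show 0: "(\<E> w. bm B t w - bm B s w) = 0"
  by (rule normal_distributed_expectation[OF pos D])
 show "(\<E> w. (bm B t w - bm B s w)^2) = t - s"
  using normal_distributed_variance[OF pos D] 0 assms by simp
 have "integrable P (%w. (bm B t w - bm B s w)^2)"
  using integrable_normal_moment[OF pos, of 0 2] by (subst distributed_integrable[OF D, symmetric]) (auto simp: normal_density_nonneg)
 thus "sqi P (%w. bm B t w - bm B s w)"
  by (rule sqiI[rotated]) (use distributed_measurable[OF D] in simp)
qed

definition bm_null :: "'w set" where
 "bm_null = (SOME N. N : null_sets P & N : sets (F 0) &
   (\<forall>w\<in>\<Omega> - N. bm B 0 w = 0 & continuous_on {0..} (%t. bm B t w)))"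

lemma bm_null: "bm_null : null_sets P" "bm_null : sets (F 0)"
 "!!w. w : \<Omega> ==> w \<notin> bm_null ==> bm B 0 w = 0 & continuous_on {0..} (%t. bm B t w)"
proof -
 have "AE w in P. bm B 0 w = 0 & continuous_on {0..} (%t. bm B t w)"
  using brownian by (simp add: brownian_def)
 then obtain N where "N : null_sets P" "N : sets (F 0)"
  "!!w. w : \<Omega> ==> w \<notin> N ==> bm B 0 w = 0 & continuous_on {0..} (%t. bm B t w)"
  by (rule AE_null) auto
 hence "\<exists>N. N : null_sets P & N : sets (F 0) &
   (\<forall>w\<in>\<Omega> - N. bm B 0 w = 0 & continuous_on {0..} (%t. bm B t w))" by auto
 from someI_ex[OF this] show "bm_null : null_sets P" "bm_null : sets (F 0)"
  "!!w. w : \<Omega> ==> w \<notin> bm_null ==> bm B 0 w = 0 & continuous_on {0..} (%t. bm B t w)"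
  unfolding bm_null_def by blast+
qed

text \<open>The Brownian motion made continuous for every outcome. The exceptional set belongs to \<open>F\<^sub>0\<close>, so the process remains
 adapted.\<close>

definition wp :: "real => 'w => real" where
 "wp t w = (if w : bm_null then 0 else bm B t w)"

lemma measurable_off_null:
 assumes f: "f : Bor (F t)" and t: "0 <= t" and N: "N : null_sets P" and eq: "!!w. w : \<Omega> ==> w \<notin> N ==> f w = g w"
 shows "g : Bor (F t)"
 by (rule F_measurable_AE[OF f t]) (rule AE_I'[OF N], use eq in auto)

lemma wp_AE: "AE w in P. \<forall>t. wp t w = bm B t w"
 by (rule AE_I'[OF bm_null(1)]) (auto simp: wp_def)

lemma wp_arc: "arc wp"
proof (rule arcI)
 fix t assume "t : {0..T}"
 thus "wp t : Bor (F t)"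
  by (intro measurable_off_null[OF bm_adapted _ bm_null(1)]) (auto simp: wp_def)
next
 fix w assume w: "w : \<Omega>"
 show "rcll T (%t. wp t w)"
 proof (cases "w : bm_null")
  case False
  hence "continuous_on {0..T} (%t. bm B t w)"
   using bm_null(3)[OF w] by (auto intro: continuous_on_subset)
  thus ?thesis using False by (simp add: wp_def rcll_continuous)
 qed (simp add: wp_def)
qed

lemma wp_0: "w : \<Omega> ==> wp 0 w = 0" using bm_null(3) by (auto simp: wp_def)

lemma wp_sqi: "0 <= t ==> t <= T ==> sqi P (wp t)"
proof (cases "t = 0")
 case True
 thus ?thesis using wp_0 by (intro sqi_bound[OF sqi_zero]) (auto intro!: arc_measurable_P[OF wp_arc] T_nonneg)
next
 case False
 assume t: "0 <= t" "t <= T"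
 have "AE w in P. abs (wp t w) <= abs (bm B t w - bm B 0 w)"
  using wp_AE AE_space by eventually_elim (use wp_0 in "metis diff_zero order_refl")
 thus ?thesis
  using t False by (intro sqi_bound_AE[OF bm_increment(1)[of 0 t]] arc_measurable_P[OF wp_arc]) auto
qed

lemma wp_increment_AE: "AE w in P. wp u w - wp s w = bm B u w - bm B s w"
 using wp_AE by eventually_elim simp

lemma bcoef_integrable: "bcoef s h ==> integrable P h"
 using bcoef_sqi[of s h "%_. 1"] sqi_const[OF finite_measure_axioms, of 1]
 by (intro P_integrable) simp

lemma wp_mart: "mart wp"
 unfolding mart_def
proof (intro conjI ballI allI impI)
 fix t assume "t : {0..T}"
 thus "wp t : Bor (F t)" "sqi P (wp t)" using arcD(1)[OF wp_arc] wp_sqi by auto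
next
 fix s u h assume h: "0 <= s & s <= u & u <= T & h : Bor (F s) & sqi P h"
 show "(\<E> w. h w * (wp u w - wp s w)) = 0"
 proof (cases "s < u")
  case True
  have "(\<E> w. h w * (wp u w - wp s w)) = (\<E> w. h w) * (\<E> w. bm B u w - bm B s w)"
   using h True by (intro past_independent[OF bm_indep[of s u] _ _ _ wp_increment_AE] borel_measurable_diff
    arc_measurable_P[OF wp_arc] P_integrable bm_increment) auto
  thus ?thesis using bm_increment(2)[of s u] h True by simp
 next
  case False
  hence "s = u" using h by auto
  thus ?thesis by simp
 qed
qed

lemma wp_covar: "covar wp wp 1"
 unfolding covar_def
proof (intro allI impI)
 fix s u :: real and h :: "'w => real" and K :: real
 assume h: "0 <= s & s <= u & u <= T & h : Bor (F s) & (\<forall>w\<in>\<Omega>. abs (h w) <= K)"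
 hence hb: "bcoef s h" by (auto simp: bcoef_def)
 show "(\<E> w. h w * ((wp u w - wp s w) * (wp u w - wp s w))) = 1 * (u - s) * (\<E> w. h w)"
 proof (cases "s < u")
  case True
  have "(\<E> w. h w * ((wp u w - wp s w) * (wp u w - wp s w))) = (\<E> w. h w) * (\<E> w. (bm B u w - bm B s w)^2)"
  proof (rule past_independent[OF bm_indep[of s u] _ bcoef_integrable[OF hb]])
   show "(%w. (wp u w - wp s w) * (wp u w - wp s w)) : Bor P"
    using h by (intro borel_measurable_times borel_measurable_diff arc_measurable_P[OF wp_arc]) auto
   show "AE w in P. (wp u w - wp s w) * (wp u w - wp s w) = (bm B u w - bm B s w)^2"
    using wp_increment_AE[of u s] by eventually_elim (simp add: power2_eq_square)
   show "integrable P (%w. (bm B u w - bm B s w)^2)"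
    using h True by (intro sqi_integrable_square bm_increment) auto
   fix A :: "real set" assume "A : sets borel"
   hence "(%x. x^2) -` A : sets (borel :: real measure)" by (rule measurable_sets_borel[rotated]) simp
   thus "(%w. (bm B u w - bm B s w)^2) -` A Int \<Omega> : {(%w. bm B u w - bm B s w) -` D Int \<Omega> |D. D : sets borel}"
    by (auto simp: vimage_def)
  qed (use h True in auto)
  also have "... = 1 * (u - s) * (\<E> w. h w)" using bm_increment(3)[of s u] h True by simp
  finally show ?thesis .
 next
  case False
  hence "s = u" using h by auto
  thus ?thesis by simp
 qed
qed

end

section \<open>The Poisson random measure\<close>

lemma rcll_cong:
 assumes x: "rcll b x" and eq: "!!t. 0 <= t ==> t <= b ==> x t = y t"
 shows "rcll b y"
 unfolding rcll_def
proof (intro conjI ballI)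
 fix t assume t: "t : {0..<b}"
 hence "\<forall>\<^sub>F s in at_right t. s : {t<..<b}" by (intro eventually_at_right_real) auto
 hence "\<forall>\<^sub>F s in at_right t. x s = y s" by eventually_elim (use t in "auto intro: eq")
 from Lim_transform_eventually[OF rcll_right[OF x, of t] this] t eq show "(y \<longlongrightarrow> y t) (at_right t)" by auto
next
 fix t assume t: "t : {0<..b}"
 hence "\<forall>\<^sub>F s in at_left t. s : {0<..<t}" by (intro eventually_at_left_real) auto
 hence ev: "\<forall>\<^sub>F s in at_left t. x s = y s" by eventually_elim (use t in "auto intro: eq")
 obtain L where "(x \<longlongrightarrow> L) (at_left t)" using rcll_left[OF x, of t] t by auto
 from Lim_transform_eventually[OF this ev] show "\<exists>L. (y \<longlongrightarrow> L) (at_left t)" by auto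
qed

context jbasis begin

sublocale mark: sigma_finite_measure "mark B" by (rule mark_sigma_finite)

text \<open>The sigma-algebra generated by the Poisson measure at times in \<open>I\<close>.\<close>

definition PE :: "real set => 'w measure" where
 "PE I = sigma \<Omega> {{w : \<Omega>. emeasure (prm B w) C : D} |C D.
    C : marked_sets B & C <= I \<times> space (mark B) & D : sets borel}"

lemma space_PE: "space (PE I) = \<Omega>"
 unfolding PE_def by (rule space_measure_of) auto

lemma sets_PE: "sets (PE I) = prm_events B I"
 unfolding PE_def prm_events_def by (rule sets_measure_of) auto

lemma prm_PE:
 assumes C: "C : marked_sets B" "C <= I \<times> space (mark B)"
 shows "(%w. emeasure (prm B w) C) : Bor (PE I)"
proof (rule measurableI)
 fix D :: "ennreal set" assume "D : sets borel"
 hence "{w : \<Omega>. emeasure (prm B w) C : D} : sets (PE I)"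
  unfolding sets_PE prm_events_def using C by (intro sigma_sets.Basic) blast
 moreover have "{w : \<Omega>. emeasure (prm B w) C : D} = (%w. emeasure (prm B w) C) -` D Int space (PE I)"
  by (auto simp: space_PE)
 ultimately show "(%w. emeasure (prm B w) C) -` D Int space (PE I) : sets (PE I)" by simp
qed auto

lemma prm_sets: "w : \<Omega> ==> sets (prm B w) = marked_sets B"
 using poisson by (simp add: poisson_measure_def)

lemma prm_measurable: "C : marked_sets B ==> (%w. emeasure (prm B w) C) : Bor P"
 using poisson by (simp add: poisson_measure_def)

lemma prm_adapted: "0 <= t ==> sets (PE {..t}) <= sets (F t)"
 using poisson by (simp add: poisson_measure_def sets_PE)

lemma prm_indep_past: "0 <= s ==> indep_set (sets (F s)) (sets (PE {s<..}))"
 using poisson by (simp add: poisson_measure_def sets_PE)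

lemma PE_preimage: "D : Bor (PE I) ==> A : sets borel ==> D -` A Int \<Omega> : sets (PE I)"
 using measurable_sets[of D "PE I" borel A] by (simp add: space_PE)

abbreviation strip :: "real => real => 'e set => (real \<times> 'e) set" where
 "strip s u C \<equiv> {s<..u} \<times> C"

lemma strip_marked: "C : sets (mark B) ==> strip s u C : marked_sets B"
 unfolding marked_sets_def by (intro pair_measureI) auto

lemma strip_intensity:
 assumes C: "C : sets (mark B)" and s: "0 <= s" "s <= u"
 shows "intensity B (strip s u C) = ennreal (u - s) * emeasure (mark B) C"
proof -
 have "strip s u C Int {0<..} \<times> space (mark B) = {s<..u} \<times> C"
  using s sets.sets_into_space[OF C] by auto
 thus ?thesis
  unfolding intensity_def using C s by (simp add: mark.emeasure_pair_measure_Times)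
qed

text \<open>The compensated random measure of a set.\<close>

definition cmp :: "(real \<times> 'e) set => 'w => real" where
 "cmp K w = enn2real (emeasure (prm B w) K) - enn2real (intensity B K)"

text \<open>The mean and the variance of the Poisson distribution; both equal the intensity.\<close>

lemma cmp_moments:
 assumes K: "K : marked_sets B" "intensity B K < \<infinity>"
 shows "AE w in P. emeasure (prm B w) K < \<infinity>" "sqi P (cmp K)" "(\<E> w. cmp K w) = 0"
  "(\<E> w. (cmp K w)^2) = enn2real (intensity B K)"
proof -
 have "prob {w : space P. emeasure (prm B w) K = of_nat k}
   = enn2real (intensity B K) ^ k / fact k * exp (- enn2real (intensity B K))" for k
  using poisson K by (simp add: poisson_measure_def)
 note m = poisson_moments[OF prm_measurable[OF K(1)] enn2real_nonneg this]
 show "AE w in P. emeasure (prm B w) K < \<infinity>" "sqi P (cmp K)" "(\<E> w. cmp K w) = 0"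
  "(\<E> w. (cmp K w)^2) = enn2real (intensity B K)"
  unfolding cmp_def[abs_def] by (fact m)+
qed

lemma cmp_integrable: "K : marked_sets B ==> intensity B K < \<infinity> ==> integrable P (cmp K)"
 by (rule sqi_integrable[OF finite_measure_axioms cmp_moments(2)])

lemma cmp_PE: "K : marked_sets B ==> K <= I \<times> space (mark B) ==> cmp K : Bor (PE I)"
 unfolding cmp_def[abs_def] using prm_PE by measurable

lemma cmp_disjoint:
 assumes K: "K : marked_sets B" "intensity B K < \<infinity>" and L: "L : marked_sets B" "intensity B L < \<infinity>"
  and d: "K Int L = {}"
 shows "(\<E> w. cmp K w * cmp L w) = 0"
proof -
 let ?C = "%j::nat. if j = 0 then K else L"
 have J: "finite {0, 1::nat}" "\<forall>j\<in>{0, 1::nat}. ?C j : marked_sets B" "disjoint_family_on ?C {0, 1}"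
  using K L d by (auto simp: disjoint_family_on_def)
 have "indep_vars (%_. borel) (%j w. emeasure (prm B w) (?C j)) {0, 1}"
 proof -
  have "\<forall>(J::nat set) C. finite J & (\<forall>j\<in>J. C j : marked_sets B) & disjoint_family_on C J -->
    indep_vars (%_. borel) (%j w. emeasure (prm B w) (C j)) J"
   using poisson by (simp add: poisson_measure_def)
  hence "finite {0, 1::nat} & (\<forall>j\<in>{0, 1::nat}. ?C j : marked_sets B) & disjoint_family_on ?C {0, 1} -->
    indep_vars (%_. borel) (%j w. emeasure (prm B w) (?C j)) {0, 1}" by (elim allE)
  thus ?thesis using J by (elim mp) (intro conjI)
 qed
 hence "indep_vars (%_. borel) (%j w. enn2real (emeasure (prm B w) (?C j)) - enn2real (intensity B (?C j))) {0, 1}"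
  by (rule indep_vars_compose2) measurable
 hence iv: "indep_vars (%_. borel) (%j. cmp (?C j)) {0, 1}" by (simp add: cmp_def[abs_def])
 have "(\<E> w. (\<Prod>j\<in>{0, 1}. cmp (?C j) w)) = (\<Prod>j\<in>{0, 1}. (\<E> w. cmp (?C j) w))"
  by (rule indep_vars_lebesgue_integral[OF _ iv]) (use cmp_integrable K L in auto)
 thus ?thesis using cmp_moments(3)[OF K] by simp
qed

lemma intensity_Un:
 assumes "K : marked_sets B" "L : marked_sets B" "K Int L = {}"
 shows "intensity B (K \<union> L) = intensity B K + intensity B L"
proof -
 let ?p = "{0<..} \<times> space (mark B) :: (real \<times> 'e) set"
 have m: "sets (lborel \<otimes> mark B) = marked_sets B" unfolding marked_sets_def by (rule sets_pair_measure_cong) auto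
 have p: "?p : marked_sets B" unfolding marked_sets_def by (intro pair_measureI) auto
 have i: "K Int ?p : marked_sets B" "L Int ?p : marked_sets B"
  using assms p unfolding marked_sets_def by (auto intro: sets.Int)
 have "emeasure (lborel \<otimes> mark B) ((K Int ?p) \<union> (L Int ?p)) = emeasure (lborel \<otimes> mark B) (K Int ?p) + emeasure (lborel \<otimes> mark B) (L Int ?p)"
  using assms(3) i by (intro plus_emeasure[symmetric]) (auto simp only: m)
 thus ?thesis unfolding intensity_def by (simp add: Int_Un_distrib2)
qed

lemma cmp_Un:
 assumes K: "K : marked_sets B" "intensity B K < \<infinity>" and L: "L : marked_sets B" "intensity B L < \<infinity>"
  and d: "K Int L = {}"
 shows "AE w in P. cmp (K \<union> L) w = cmp K w + cmp L w"
 using cmp_moments(1)[OF K] cmp_moments(1)[OF L] AE_space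
proof eventually_elim
 fix w assume f: "emeasure (prm B w) K < \<infinity>" "emeasure (prm B w) L < \<infinity>" and w: "w : \<Omega>"
 have "emeasure (prm B w) (K \<union> L) = emeasure (prm B w) K + emeasure (prm B w) L"
  using K L d by (intro plus_emeasure[symmetric]) (auto simp: prm_sets[OF w])
 thus "cmp (K \<union> L) w = cmp K w + cmp L w"
  using f K L by (simp add: cmp_def intensity_Un[OF K(1) L(1) d] enn2real_plus)
qed

lemma intensity_mono: "K <= L ==> L : marked_sets B ==> intensity B K <= intensity B L"
 unfolding intensity_def
proof (rule emeasure_mono)
 assume L: "L : marked_sets B"
 have m: "sets (lborel \<otimes> mark B) = marked_sets B" unfolding marked_sets_def by (rule sets_pair_measure_cong) auto
 have "({0<..} :: real set) \<times> space (mark B) : marked_sets B" unfolding marked_sets_def by (intro pair_measureI) auto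
 with L show "L Int {0<..} \<times> space (mark B) : sets (lborel \<otimes> mark B)"
  unfolding m unfolding marked_sets_def by (rule sets.Int)
qed auto

text \<open>Split both sets along their intersection; disjoint sets carry independent masses.\<close>

lemma cmp_covariance:
 assumes K: "K : marked_sets B" "intensity B K < \<infinity>" and L: "L : marked_sets B" "intensity B L < \<infinity>"
 shows "(\<E> w. cmp K w * cmp L w) = enn2real (intensity B (K Int L))"
proof -
 have s: "A Int C : marked_sets B" "A - C : marked_sets B" if "A : marked_sets B" "C : marked_sets B" for A C
  using that by (auto simp: marked_sets_def)
 have I: "K Int L : marked_sets B" "intensity B (K Int L) < \<infinity>" "K - L : marked_sets B" "intensity B (K - L) < \<infinity>"
  "L - K : marked_sets B" "intensity B (L - K) < \<infinity>"
  using K L s intensity_mono[of "K Int L" K] intensity_mono[of "K - L" K] intensity_mono[of "L - K" L] by (auto intro: le_less_trans)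
 have KL: "AE w in P. cmp K w = cmp (K - L) w + cmp (K Int L) w"
 proof -
  have "(K - L) \<union> (K Int L) = K" "(K - L) Int (K Int L) = {}" by auto
  thus ?thesis using cmp_Un[OF I(3,4) I(1,2)] by simp
 qed
 have LK: "AE w in P. cmp L w = cmp (L - K) w + cmp (K Int L) w"
 proof -
  have "(L - K) \<union> (K Int L) = L" "(L - K) Int (K Int L) = {}" by auto
  thus ?thesis using cmp_Un[OF I(5,6) I(1,2)] by simp
 qed
 let ?a = "cmp (K - L)" and ?b = "cmp (L - K)" and ?c = "cmp (K Int L)"
 note sq = cmp_moments(2)[OF I(1,2)] cmp_moments(2)[OF I(3,4)] cmp_moments(2)[OF I(5,6)]
 note sqKL = cmp_moments(2)[OF K] cmp_moments(2)[OF L]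
 note meas = sq[THEN sqi_measurable] sqKL[THEN sqi_measurable]
 have "(\<E> w. cmp K w * cmp L w) = (\<E> w. (?a w * ?b w + ?a w * ?c w) + (?c w * ?b w + ?c w * ?c w))"
 proof (rule integral_cong_AE)
  show "AE w in P. cmp K w * cmp L w = (?a w * ?b w + ?a w * ?c w) + (?c w * ?b w + ?c w * ?c w)"
   using KL LK by eventually_elim (simp add: algebra_simps)
 qed (use meas in measurable)
 also have "... = ((\<E> w. ?a w * ?b w) + (\<E> w. ?a w * ?c w)) + ((\<E> w. ?c w * ?b w) + (\<E> w. ?c w * ?c w))"
  using sq by (simp add: sqi_prod)
 also have "(\<E> w. ?a w * ?b w) = 0" by (rule cmp_disjoint) (use I in auto)
 also have "(\<E> w. ?a w * ?c w) = 0" by (rule cmp_disjoint) (use I in auto)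
 also have "(\<E> w. ?c w * ?b w) = 0" by (rule cmp_disjoint) (use I in auto)
 also have "(\<E> w. ?c w * ?c w) = enn2real (intensity B (K Int L))"
  using cmp_moments(4)[OF I(1,2)] by (simp add: power2_eq_square)
 finally show ?thesis by simp
qed

definition pnull :: "'e set => 'w set" where
 "pnull C = {w\<in>\<Omega>. emeasure (prm B w) (strip 0 T C) = \<infinity>}"

text \<open>The compensated number of jumps with mark in \<open>C\<close>, set to zero on the null set where it is infinite.\<close>

definition pp :: "'e set => real => 'w => real" where
 "pp C t w = (if w : pnull C then 0 else measure (prm B w) (strip 0 t C) - t * measure (mark B) C)"

context
 fixes C :: "'e set"
 assumes C: "C : sets (mark B)" "emeasure (mark B) C < \<infinity>"
begin

lemma strip_fin: "0 <= s ==> s <= u ==> intensity B (strip s u C) < \<infinity>"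
 using C by (simp add: strip_intensity ennreal_mult_less_top)

lemma strip_enn2real: "0 <= s ==> s <= u ==> enn2real (intensity B (strip s u C)) = (u - s) * measure (mark B) C"
 using C by (simp add: strip_intensity enn2real_mult measure_def)

lemma pnull: "pnull C : null_sets P"
proof -
 have "AE w in P. emeasure (prm B w) (strip 0 T C) < \<infinity>"
  by (rule cmp_moments(1)[OF strip_marked[OF C(1)] strip_fin]) (auto simp: T_nonneg)
 moreover have "pnull C : sets P"
  unfolding pnull_def using prm_measurable[OF strip_marked[OF C(1)], of 0 T] by measurable
 moreover from calculation(1) have "AE w in P. w \<notin> pnull C"
  by eventually_elim (auto simp: pnull_def)
 ultimately show ?thesis using AE_iff_null_sets by blast
qed

lemma strip_finite_path:
 assumes "w : \<Omega>" "w \<notin> pnull C" "0 <= s" "u <= T"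
 shows "emeasure (prm B w) (strip s u C) \<noteq> \<infinity>"
proof -
 have "emeasure (prm B w) (strip s u C) <= emeasure (prm B w) (strip 0 T C)"
  using assms strip_marked[OF C(1)] by (intro emeasure_mono) (auto simp: prm_sets)
 thus ?thesis using assms by (auto simp: pnull_def top_unique)
qed

lemma pp_increment_path:
 assumes w: "w : \<Omega>" "w \<notin> pnull C" and s: "0 <= s" "s <= u" "u <= T"
 shows "pp C u w - pp C s w = measure (prm B w) (strip s u C) - (u - s) * measure (mark B) C"
proof -
 have e: "strip 0 u C = strip 0 s C \<union> strip s u C" using s by auto
 have "measure (prm B w) (strip 0 u C) = measure (prm B w) (strip 0 s C) + measure (prm B w) (strip s u C)"
  unfolding e using strip_finite_path[OF w, of 0 s] strip_finite_path[OF w, of s u] s strip_marked[OF C(1)]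
  by (intro measure_Union) (auto simp: prm_sets w)
 thus ?thesis using w by (simp add: pp_def algebra_simps)
qed

lemma pp_increment:
 assumes s: "0 <= s" "s <= u" "u <= T"
 shows "AE w in P. pp C u w - pp C s w = cmp (strip s u C) w"
proof (rule AE_I'[OF pnull])
 show "{w\<in>space P. \<not> pp C u w - pp C s w = cmp (strip s u C) w} <= pnull C"
  using pp_increment_path s strip_enn2real[OF s(1,2)] by (auto simp: cmp_def measure_def)
qed

lemma pp_arc: "arc (pp C)"
proof (rule arcI)
 fix t assume t: "t : {0..T}"
 have "strip 0 t C <= {..t} \<times> space (mark B)" using sets.sets_into_space[OF C(1)] by auto
 from prm_PE[OF strip_marked[OF C(1)] this]
 have "(%w. emeasure (prm B w) (strip 0 t C)) : Bor (F t)"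
  using prm_adapted[of t] t by (auto simp: measurable_def space_PE space_F)
 hence "(%w. measure (prm B w) (strip 0 t C) - t * measure (mark B) C) : Bor (F t)"
  unfolding measure_def by measurable
 thus "pp C t : Bor (F t)"
  by (rule measurable_off_null[OF _ _ pnull]) (use t in "simp_all add: pp_def")
next
 fix w assume w: "w : \<Omega>"
 show "rcll T (%t. pp C t w)"
 proof (cases "w : pnull C")
  case True thus ?thesis by (simp add: pp_def)
 next
  case False
  let ?R = "restrict_space (prm B w) (strip 0 T C)"
  let ?D = "distr ?R borel fst"
  have sm: "strip 0 T C : sets (prm B w)" using strip_marked[OF C(1)] by (simp add: prm_sets w)
  have sp: "strip 0 T C Int space (prm B w) = strip 0 T C" using sets.sets_into_space[OF sm] by auto
  have spR: "space ?R = strip 0 T C" by (simp add: space_restrict_space sp)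
  have fm: "fst : Bor ?R"
  proof (rule measurable_restrict_space1)
   have "fst : Bor (borel \<otimes> mark B)" by simp
   thus "fst : Bor (prm B w)"
    by (subst measurable_cong_sets[OF prm_sets[OF w, unfolded marked_sets_def] refl])
  qed
  have em: "emeasure ?D {..t} = emeasure (prm B w) (strip 0 (min t T) C)" for t
  proof -
   have "emeasure ?D {..t} = emeasure ?R (fst -` {..t} Int space ?R)" by (rule emeasure_distr[OF fm]) simp
   also have "fst -` {..t} Int space ?R = strip 0 (min t T) C" unfolding spR by auto
   also have "emeasure ?R (strip 0 (min t T) C) = emeasure (prm B w) (strip 0 (min t T) C)"
    by (rule emeasure_restrict_space) (use sm sp in auto)
   finally show ?thesis .
  qed
  have "finite_measure ?D"
  proof (rule finite_measure.finite_measure_distr[OF _ fm], rule finite_measureI)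
   have "emeasure ?R (space ?R) = emeasure (prm B w) (strip 0 T C)"
    unfolding spR by (rule emeasure_restrict_space) (use sm sp in auto)
   thus "emeasure ?R (space ?R) \<noteq> \<infinity>" using strip_finite_path[OF w False, of 0 T] by simp
  qed
  then interpret D: finite_borel_measure ?D by (simp add: finite_borel_measure_def finite_borel_measure_axioms_def)
  have cdf: "cdf ?D t = measure (prm B w) (strip 0 (min t T) C)" for t
   by (simp add: cdf_def measure_def em)
  have "rcll T (cdf ?D)"
   unfolding rcll_def using D.cdf_is_right_cont D.cdf_at_left by (auto simp: continuous_within)
  moreover have "rcll T (%t. t * measure (mark B) C)" by (intro rcll_continuous continuous_intros)
  ultimately have r: "rcll T (%t. cdf ?D (min t T) - (min t T) * measure (mark B) C)"
   using rcll_stopped[OF rcll_diff T_nonneg T_nonneg] by blast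
  have r2: "rcll T (%t. measure (prm B w) (strip 0 (min t T) C) - (min t T) * measure (mark B) C)"
   using r by (simp add: cdf)
  have "rcll T (%t. pp C (min t T) w)" using r2 False by (simp add: pp_def)
  thus ?thesis by (rule rcll_cong) auto
 qed
qed

lemma pp_0: "pp C 0 w = 0"
 by (simp add: pp_def)

lemma pp_sqi: "0 <= t ==> t <= T ==> sqi P (pp C t)"
proof -
 assume t: "0 <= t" "t <= T"
 have "AE w in P. abs (pp C t w) <= abs (cmp (strip 0 t C) w)"
  using pp_increment[OF order_refl t] by eventually_elim (simp add: pp_0)
 thus ?thesis
  using t by (intro sqi_bound_AE[OF cmp_moments(2)[OF strip_marked[OF C(1)] strip_fin]] arc_measurable_P[OF pp_arc]) auto
qed

lemma strip_cmp_PE: "cmp (strip s u C) : Bor (PE {s<..})"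
 using sets.sets_into_space[OF C(1)] by (intro cmp_PE strip_marked[OF C(1)]) auto

lemma pp_mart: "mart (pp C)"
 unfolding mart_def
proof (intro conjI ballI allI impI)
 fix t assume "t : {0..T}"
 thus "pp C t : Bor (F t)" "sqi P (pp C t)" using arcD(1)[OF pp_arc] pp_sqi by auto
next
 fix s u h assume h: "0 <= s & s <= u & u <= T & h : Bor (F s) & sqi P h"
 hence su: "0 <= s" "s <= u" "u <= T" and hh: "h : Bor (F s)" "sqi P h" by auto
 note K = strip_marked[OF C(1), of s u] strip_fin[OF su(1,2)]
 have "(\<E> w. h w * (pp C u w - pp C s w)) = (\<E> w. h w) * (\<E> w. cmp (strip s u C) w)"
  using su by (intro past_independent[OF prm_indep_past[OF su(1)] hh(1) sqi_integrable[OF finite_measure_axioms hh(2)]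
    _ pp_increment cmp_integrable[OF K] PE_preimage[OF strip_cmp_PE]] borel_measurable_diff arc_measurable_P[OF pp_arc]) auto
 also have "... = 0" using cmp_moments(3)[OF K] by simp
 finally show "(\<E> w. h w * (pp C u w - pp C s w)) = 0" .
qed

end

lemma pp_covar:
 assumes C: "C : sets (mark B)" "emeasure (mark B) C < \<infinity>" and D: "D : sets (mark B)" "emeasure (mark B) D < \<infinity>"
 shows "covar (pp C) (pp D) (measure (mark B) (C Int D))"
 unfolding covar_def
proof (intro allI impI)
 fix s u :: real and h :: "'w => real" and K :: real
 assume h: "0 <= s & s <= u & u <= T & h : Bor (F s) & (\<forall>w\<in>\<Omega>. abs (h w) <= K)"
 hence su: "0 <= s" "s <= u" "u <= T" and hh: "h : Bor (F s)" by auto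
 have hb: "bcoef s h" using h by (auto simp: bcoef_def)
 note KC = strip_marked[OF C(1), of s u] strip_fin[OF C su(1,2)]
 note KD = strip_marked[OF D(1), of s u] strip_fin[OF D su(1,2)]
 let ?c = "cmp (strip s u C)" and ?d = "cmp (strip s u D)"
 have "AE w in P. (pp C u w - pp C s w) * (pp D u w - pp D s w) = ?c w * ?d w"
  using pp_increment[OF C su] pp_increment[OF D su] by eventually_elim simp
 hence "(\<E> w. h w * ((pp C u w - pp C s w) * (pp D u w - pp D s w))) = (\<E> w. h w) * (\<E> w. ?c w * ?d w)"
  using strip_cmp_PE[OF C, of s u] strip_cmp_PE[OF D, of s u] su
  by (intro past_independent[OF prm_indep_past[OF su(1)] hh(1) bcoef_integrable[OF hb]] borel_measurable_times borel_measurable_diff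
    arc_measurable_P[OF pp_arc] C D sqi_prod cmp_moments(2) KC KD PE_preimage) auto
 also have "(\<E> w. ?c w * ?d w) = enn2real (intensity B (strip s u C Int strip s u D))"
  by (rule cmp_covariance[OF KC KD])
 also have "strip s u C Int strip s u D = strip s u (C Int D)" by auto
 also have "enn2real (intensity B ...) = (u - s) * measure (mark B) (C Int D)"
 proof (rule strip_enn2real[OF _ _ su(1,2)])
  show "C Int D : sets (mark B)" using C D by auto
  show "emeasure (mark B) (C Int D) < \<infinity>" using emeasure_mono[of "C Int D" C "mark B"] C by (auto intro: le_less_trans)
 qed
 finally show "(\<E> w. h w * ((pp C u w - pp C s w) * (pp D u w - pp D s w))) = measure (mark B) (C Int D) * (u - s) * (\<E> w. h w)"
  by (simp add: mult_ac)
qed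

section \<open>Orthogonality of the two noises\<close>

text \<open>Over a short interval of length \<open>d\<close> the product of the increments has expectation of order
 \<open>d\<^bsup>3/2\<^esup>\<close> by independence; bisection makes it vanish.\<close>

lemma noise_covar_bound:
 assumes C: "C : sets (mark B)" "emeasure (mark B) C < \<infinity>"
 shows "0 <= s ==> s <= u ==> u <= T ==> h : Bor (F s) ==> \<forall>w\<in>\<Omega>. abs (h w) <= K ==>
  abs (\<E> w. (h w * (wp u w - wp s w)) * (1 * (pp C u w - pp C s w)))
   <= 2 * K * measure (mark B) C * (u - s) * sqrt ((u - s) / 2 ^ n)"
proof (induct n arbitrary: s u)
 case 0
 have K: "0 <= K"
 proof -
  obtain w where "w : \<Omega>" using not_empty by auto
  with 0(5) show ?thesis using abs_ge_zero order_trans by blast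
 qed
 show ?case
 proof (cases "s = u")
  case True thus ?thesis by simp
 next
  case False
  hence su: "0 <= s" "s < u" "s <= u" "u <= T" using 0 by auto
  note KC = strip_marked[OF C(1), of s u] strip_fin[OF C su(1,3)]
  let ?w = "%w. bm B u w - bm B s w" and ?c = "cmp (strip s u C)"
  have sw: "sqi P ?w" by (rule bm_increment(1)[OF su(1,2)])
  have sc: "sqi P ?c" by (rule cmp_moments(2)[OF KC])
  have hP: "h : Bor P" by (rule F_imp_P[OF 0(4)])
  \<comment> \<open>the product of the moduli has expectation at most \<open>sqrt d * 2 d\<close>, times the measure of \<open>C\<close>\<close>
  define G where "G = sigma \<Omega> {bm B t -` D Int \<Omega> |t D. 0 <= t & D : sets borel}"
  have sG: "space G = \<Omega>" unfolding G_def by (rule space_measure_of) auto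
  have sG': "sets G = sigma_sets \<Omega> {bm B t -` D Int \<Omega> |t D. 0 <= t & D : sets borel}"
   unfolding G_def by (rule sets_measure_of) auto
  have bG: "bm B t : Bor G" if "0 <= t" for t
  proof (rule measurableI)
   fix D :: "real set" assume "D : sets borel"
   with that show "bm B t -` D Int space G : sets G" unfolding sG sG' by (intro sigma_sets.Basic) blast
  qed auto
  have ind: "(\<E> w. abs (?w w) * abs (?c w)) = (\<E> w. abs (?w w)) * (\<E> w. abs (?c w))"
  proof (rule indep_set_expectation(2)[OF _ sG])
   show "indep_set (sets G) (sets (PE UNIV))" using noise_independent by (simp add: sG' sets_PE)
   have [measurable]: "bm B u : Bor G" "bm B s : Bor G" using bG su by auto
   show "(%w. abs (?w w)) : Bor G" by measurable
   show "integrable P (%w. abs (?w w))" "integrable P (%w. abs (?c w))"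
    using sqi_integrable[OF finite_measure_axioms sw] sqi_integrable[OF finite_measure_axioms sc] by auto
   fix A :: "real set" assume "A : sets borel"
   moreover have "(%w. abs (?c w)) : Bor (PE UNIV)"
    using cmp_PE[OF KC(1), of UNIV] sets.sets_into_space[OF C(1)] by (auto intro!: borel_measurable_abs)
   ultimately show "(%w. abs (?c w)) -` A Int \<Omega> : sets (PE UNIV)" by (intro PE_preimage)
  qed
  have wb: "(\<E> w. abs (?w w)) <= sqrt (u - s)"
  proof -
   have "abs (\<E> w. abs (?w w) * 1) <= sqrt (\<E> w. abs (?w w)^2) * sqrt (\<E> w. (1::real)^2)"
    by (rule Cauchy_Schwarz_sqi[OF sqi_abs[OF sw] sqi_const[OF finite_measure_axioms]])
   moreover have "(\<E> w. (1::real)^2) = 1" by (simp add: prob_space)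
   ultimately show ?thesis unfolding power2_abs bm_increment(3)[OF su(1,2)] by simp
  qed
  have cb: "(\<E> w. abs (?c w)) <= 2 * (measure (mark B) C * (u - s))"
  proof -
   let ?l = "enn2real (intensity B (strip s u C))"
   have i: "integrable P ?c" by (rule cmp_integrable[OF KC])
   have "(\<E> w. abs (?c w)) <= (\<E> w. ?c w + 2 * ?l)"
   proof (rule integral_mono)
    show "integrable P (%w. abs (?c w))" "integrable P (%w. ?c w + 2 * ?l)" using i by simp_all
    \<comment> \<open>only the compensator can make the compensated measure negative\<close>
    show "abs (?c w) <= ?c w + 2 * ?l" for w by (simp add: cmp_def abs_real_def)
   qed
   also have "... = 2 * ?l" using i cmp_moments(3)[OF KC] by (simp add: prob_space)
   finally show ?thesis using strip_enn2real[OF C su(1,3)] by (simp add: mult.commute)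
  qed
  have mm[measurable]: "wp u : Bor P" "wp s : Bor P" "pp C u : Bor P" "pp C s : Bor P"
   using su arc_measurable_P[OF wp_arc, of u] arc_measurable_P[OF wp_arc, of s] arc_measurable_P[OF pp_arc[OF C], of u] arc_measurable_P[OF pp_arc[OF C], of s] by auto
  note sw[THEN sqi_measurable, measurable] sc[THEN sqi_measurable, measurable] hP[measurable]
  have "(\<E> w. (h w * (wp u w - wp s w)) * (1 * (pp C u w - pp C s w))) = (\<E> w. (h w * ?w w) * ?c w)"
  proof (rule integral_cong_AE)
   show "AE w in P. (h w * (wp u w - wp s w)) * (1 * (pp C u w - pp C s w)) = (h w * ?w w) * ?c w"
    using wp_AE pp_increment[OF C su(1,3,4)] by eventually_elim simp
  qed measurable
  also have "abs ... <= (\<E> w. K * (abs (?w w) * abs (?c w)))"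
  proof (rule order_trans[OF integral_abs_bound], rule integral_mono)
   have "sqi P (%w. h w * ?w w)" using 0(5) by (intro sqi_mult_bounded[OF sw hP]) auto
   from sqi_prod[OF this sc] show "integrable P (%w. abs (h w * ?w w * ?c w))" by (rule integrable_abs)
   show "integrable P (%w. K * (abs (?w w) * abs (?c w)))"
    by (intro integrable_mult_right sqi_prod sqi_abs sw sc)
   fix w assume "w : space P"
   hence "abs (h w) <= K" using 0(5) by auto
   thus "abs (h w * ?w w * ?c w) <= K * (abs (?w w) * abs (?c w))"
    by (simp add: abs_mult mult.assoc mult_right_mono)
  qed
  also have "... = K * ((\<E> w. abs (?w w)) * (\<E> w. abs (?c w)))" by (simp add: ind)
  also have "... <= K * (sqrt (u - s) * (2 * (measure (mark B) C * (u - s))))"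
   using K wb cb su by (intro mult_left_mono mult_mono) auto
  finally show ?thesis by (simp add: mult_ac)
 qed
next
 case (Suc n)
 let ?m = "(s + u) / 2"
 let ?I = "%a b c d. (\<E> w. (h w * (wp b w - wp a w)) * (1 * (pp C d w - pp C c w)))"
 have m: "s <= ?m" "?m <= u" "0 <= ?m" "?m <= T" using Suc.prems by auto
 have hs: "step_coeff B h s u" using Suc.prems by (auto simp: step_coeff_iff bcoef_def)
 have os: "step_coeff B (%_. 1) a b" if "0 <= a" "a <= b" "b <= T" for a b using that by (auto simp: step_coeff_iff bcoef_def)
 note W = wp_mart and N = pp_mart[OF C]
 have o: "step_coeff B (%_. 1) s u" using Suc.prems by (intro os) auto
 note hm = increment_split(2,3)[OF W N hs m(1,2) sqi_zero]
 note om = increment_split(2,3)[OF W N o m(1,2) sqi_zero]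
 have "?I s u s u = ?I s ?m s u + ?I ?m u s u"
  by (rule increment_split(1)[OF W N hs m(1,2) increment_sqi[OF N o]])
 also have "?I s ?m s u = ?I s ?m s ?m + ?I s ?m ?m u"
  using increment_split(1)[OF N W o m(1,2) increment_sqi[OF W hm(1)]] by (simp add: mult.commute)
 also have "?I ?m u s u = ?I ?m u s ?m + ?I ?m u ?m u"
  using increment_split(1)[OF N W o m(1,2) increment_sqi[OF W hm(2)]] by (simp add: mult.commute)
 also have "?I s ?m ?m u = 0" by (rule increment_orthogonal[OF W N hm(1) om(2) order_refl])
 also have "?I ?m u s ?m = 0"
  using increment_orthogonal[OF N W om(1) hm(2) order_refl] by (simp add: mult.commute)
 finally have "?I s u s u = ?I s ?m s ?m + ?I ?m u ?m u" by simp
 hence "abs (?I s u s u) <= abs (?I s ?m s ?m) + abs (?I ?m u ?m u)" by linarith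
 also have "... <= 2 * K * measure (mark B) C * (?m - s) * sqrt ((?m - s) / 2 ^ n) + 2 * K * measure (mark B) C * (u - ?m) * sqrt ((u - ?m) / 2 ^ n)"
  by (intro add_mono Suc.hyps F_mono[OF m(1) Suc.prems(4)]) (use Suc.prems m in blast)+
 also have "... = 2 * K * measure (mark B) C * (u - s) * sqrt ((u - s) / 2 ^ Suc n)"
 proof -
  have e: "?m - s = (u - s) / 2" "u - ?m = (u - s) / 2" by (simp_all add: field_simps)
  have e': "(u - s) / 2 / 2 ^ n = (u - s) / 2 ^ Suc n" by simp
  show ?thesis unfolding e e' distrib_right[symmetric] by simp
 qed
 finally show ?case .
qed

lemma noise_covar:
 assumes C: "C : sets (mark B)" "emeasure (mark B) C < \<infinity>"
 shows "covar wp (pp C) 0"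
 unfolding covar_def
proof (intro allI impI)
 fix s u :: real and h :: "'w => real" and K :: real
 assume h: "0 <= s & s <= u & u <= T & h : Bor (F s) & (\<forall>w\<in>\<Omega>. abs (h w) <= K)"
 let ?I = "\<E> w. (h w * (wp u w - wp s w)) * (1 * (pp C u w - pp C s w))"
 let ?c = "2 * K * measure (mark B) C * (u - s)"
 have "(%n. ?c * sqrt ((u - s) * (1/2) ^ n)) ----> ?c * sqrt ((u - s) * 0)"
  by (intro tendsto_mult tendsto_const tendsto_real_sqrt LIMSEQ_power_zero) simp
 hence "abs ?I <= ?c * sqrt ((u - s) * 0)"
 proof (rule LIMSEQ_le_const, intro exI allI impI)
  fix n show "abs ?I <= ?c * sqrt ((u - s) * (1/2) ^ n)"
  proof -
   have "abs ?I <= ?c * sqrt ((u - s) / 2 ^ n)" by (rule noise_covar_bound[OF C]) (use h in blast)+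
   also have "(u - s) / 2 ^ n = (u - s) * (1/2) ^ n" by (simp only: power_divide power_one mult_1_right times_divide_eq_right)
   finally show ?thesis .
  qed
 qed
 thus "(\<E> w. h w * ((wp u w - wp s w) * (pp C u w - pp C s w))) = 0 * (u - s) * (\<E> w. h w)"
  by (simp add: mult.assoc del: mult_eq_0_iff)
qed

end

section \<open>Both noises as one integrator\<close>

context jbasis begin

text \<open>The marks together with one extra point \<open>None\<close> of unit mass, which stands for the Brownian motion.\<close>

definition mk :: "'e option measure" where
 "mk = measure_of (insert None (Some ` space (mark B))) {A. A <= insert None (Some ` space (mark B)) & Some -` A : sets (mark B)}
   (%A. ind A None + emeasure (mark B) (Some -` A))"

lemma mk_sigma_algebra:
 "sigma_algebra (insert None (Some ` space (mark B))) {A. A <= insert None (Some ` space (mark B)) & Some -` A : sets (mark B)}"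
 unfolding sigma_algebra_iff2
proof (intro conjI ballI allI impI)
 fix A assume A: "A : {A. A <= insert None (Some ` space (mark B)) & Some -` A : sets (mark B)}"
 have "Some -` (insert None (Some ` space (mark B)) - A) = space (mark B) - Some -` A" by auto
 thus "insert None (Some ` space (mark B)) - A : {A. A <= insert None (Some ` space (mark B)) & Some -` A : sets (mark B)}"
  using A by auto
qed (auto simp: vimage_UN)

lemma space_mk [simp]: "space mk = insert None (Some ` space (mark B))"
 unfolding mk_def by (rule space_measure_of) auto

lemma sets_mk: "A : sets mk <-> A <= insert None (Some ` space (mark B)) & Some -` A : sets (mark B)"
 unfolding mk_def by (subst sigma_algebra.sets_measure_of_eq[OF mk_sigma_algebra]) auto

lemma emeasure_mk: "A : sets mk ==> emeasure mk A = ind A None + emeasure (mark B) (Some -` A)"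
proof (rule emeasure_measure_of[OF mk_def])
 show "countably_additive (sets mk) (%A. ind A None + emeasure (mark B) (Some -` A))"
 proof (rule countably_additiveI)
  fix A :: "nat => 'e option set" assume A: "range A <= sets mk" "disjoint_family A"
  have "(\<Sum>i. ind (A i) None :: ennreal) = ind (\<Union>i. A i) None"
   using suminf_emeasure[of A "return (count_space UNIV) None"] A(2) by simp
  moreover have "(\<Sum>i. emeasure (mark B) (Some -` A i)) = emeasure (mark B) (\<Union>i. Some -` A i)"
   using A by (intro suminf_emeasure) (auto simp: sets_mk disjoint_family_on_def)
  ultimately show "(\<Sum>i. ind (A i) None + emeasure (mark B) (Some -` A i)) = ind (\<Union>i. A i) None + emeasure (mark B) (Some -` (\<Union>i. A i))"
   by (simp add: suminf_add[symmetric] vimage_UN)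
 qed
qed (auto simp: positive_def)

lemma mk_sigma_finite: "sigma_finite_measure mk"
proof
 obtain E :: "nat => 'e set" where E: "range E <= sets (mark B)" "(\<Union>i. E i) = space (mark B)" "!!i. emeasure (mark B) (E i) \<noteq> \<infinity>"
  using mark.sigma_finite by metis
 have v: "Some -` insert None (Some ` A) = A" for A :: "'e set" by auto
 have s: "insert None (Some ` E i) : sets mk" for i using E by (auto simp: sets_mk v)
 show "\<exists>A. countable A & A <= sets mk & \<Union>A = space mk & (\<forall>a\<in>A. emeasure mk a \<noteq> \<infinity>)"
  using s E(1,3) by (intro exI[of _ "range (%i. insert None (Some ` E i))"]) (auto simp: emeasure_mk v E(2)[symmetric])
qed

lemma Some_mk [measurable]: "Some : measurable (mark B) mk"
proof (rule measurableI)
 fix A assume "A : sets mk"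
 thus "Some -` A Int space (mark B) : sets (mark B)" by (auto simp: sets_mk)
qed auto

lemma nn_integral_mk:
 assumes "f : Bor mk"
 shows "(\<integral>\<^sup>+m. f m \<partial>mk) = f None + (\<integral>\<^sup>+e. f (Some e) \<partial>mark B)"
 using assms
proof induct
 case (cong f g)
 have "(\<integral>\<^sup>+m. f m \<partial>mk) = (\<integral>\<^sup>+m. g m \<partial>mk)" by (rule nn_integral_cong) (rule cong(3))
 moreover have "(\<integral>\<^sup>+e. f (Some e) \<partial>mark B) = (\<integral>\<^sup>+e. g (Some e) \<partial>mark B)" by (rule nn_integral_cong) (simp add: cong(3))
 ultimately show ?case using cong(3)[of None] cong(4) by simp
next
 case (set A)
 hence "(\<integral>\<^sup>+e. ind A (Some e) \<partial>mark B) = (\<integral>\<^sup>+e. ind (Some -` A) e \<partial>mark B)"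
  by (intro nn_integral_cong) (auto simp: indicator_def)
 with set show ?case by (simp add: emeasure_mk sets_mk)
next
 case (mult u c) thus ?case by (simp add: nn_integral_cmult distrib_left)
next
 case (add u v) thus ?case by (simp add: nn_integral_add ac_simps)
next
 case (seq U)
 have e: "incseq (%i. U i x)" for x using seq(4) by (auto simp: mono_def le_fun_def)
 have "(\<integral>\<^sup>+m. (SUP i. U i m) \<partial>mk) = (SUP i. integral\<^sup>N mk (U i))"
  by (rule nn_integral_monotone_convergence_SUP[OF seq(4,1)])
 also have "... = (SUP i. U i None + (\<integral>\<^sup>+e. U i (Some e) \<partial>mark B))" using seq(3) by simp
 also have "... = (SUP i. U i None) + (SUP i. \<integral>\<^sup>+e. U i (Some e) \<partial>mark B)"
  using e by (intro ennreal_SUP_add) (auto simp: mono_def intro!: nn_integral_mono)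
 also have "(SUP i. \<integral>\<^sup>+e. U i (Some e) \<partial>mark B) = (\<integral>\<^sup>+e. (SUP i. U i (Some e)) \<partial>mark B)"
  using e seq(1) by (intro nn_integral_monotone_convergence_SUP[symmetric]) (auto simp: mono_def le_fun_def)
 finally show ?case by (simp add: SUP_apply image_comp)
qed

lemma measurable_option_case:
 fixes M :: "'x measure"
 assumes Z: "Z : Bor M" and l: "(%(x, e). l x e) : Bor (M \<otimes> mark B)"
 shows "(%(x, m). case_option (Z x) (l x) m) : Bor (M \<otimes> mk)"
proof (rule measurable_piecewise_restrict[of "{UNIV \<times> {None}, UNIV \<times> range Some}"])
 have s: "{None} : sets mk" "Some ` space (mark B) : sets mk"
  by (auto simp: sets_mk inj_vimage_image_eq) (auto simp: vimage_def)
 fix D :: "('x \<times> 'e option) set" assume D: "D : {UNIV \<times> {None}, UNIV \<times> range Some}"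
 have e: "UNIV \<times> {None} Int space (M \<otimes> mk) = space M \<times> {None}"
  "UNIV \<times> range Some Int space (M \<otimes> mk) = space M \<times> Some ` space (mark B)"
  by (auto simp: space_pair_measure)
 from D consider "D = UNIV \<times> {None}" | "D = UNIV \<times> range Some" by auto
 thus "D Int space (M \<otimes> mk) : sets (M \<otimes> mk)"
  by cases (simp_all only: e pair_measureI[OF sets.top s(1)] pair_measureI[OF sets.top s(2)])
 show "(%(x, m). case_option (Z x) (l x) m) : Bor (restrict_space (M \<otimes> mk) D)"
 proof (cases "D = UNIV \<times> {None}")
  case True
  have "(%x. Z (fst x)) : Bor (restrict_space (M \<otimes> mk) D)"
   by (intro measurable_restrict_space1 measurable_compose[OF measurable_fst Z])
  thus ?thesis by (rule measurable_cong[THEN iffD1, rotated]) (auto simp: True space_restrict_space)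
 next
  case False
  hence D: "D = UNIV \<times> range Some" using D by auto
  have "the : measurable (restrict_space mk (range Some)) (mark B)"
  proof (rule measurableI)
   fix A assume A: "A : sets (mark B)"
   have "the -` A Int space (restrict_space mk (range Some)) = Some ` A Int range Some"
    using sets.sets_into_space[OF A] by (auto simp: space_restrict_space image_iff)
   moreover have "Some ` A : sets mk" using sets.sets_into_space[OF A] A by (auto simp: sets_mk inj_vimage_image_eq)
   ultimately show "the -` A Int space (restrict_space mk (range Some)) : sets (restrict_space mk (range Some))"
    by (auto simp: sets_restrict_space)
  qed (auto simp: space_restrict_space)
  moreover have "snd : measurable (restrict_space (M \<otimes> mk) D) (restrict_space mk (range Some))"
   by (rule measurable_restrict_space3) (auto simp: D)
  ultimately have "(%x. the (snd x)) : measurable (restrict_space (M \<otimes> mk) D) (mark B)"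
   by (rule measurable_compose[rotated])
  from measurable_compose[OF measurable_Pair[OF measurable_restrict_space1[OF measurable_fst] this] l]
  show ?thesis by (rule measurable_cong[THEN iffD1, rotated]) (auto simp: D space_restrict_space split: option.split)
 qed
qed (auto simp: space_pair_measure)

lemma measurable_option_parts:
 assumes f: "(%(x, m). f x m) : Bor (M \<otimes> mk)"
 shows "(%x. f x None) : Bor M" "(%(x, e). f x (Some e)) : Bor (M \<otimes> mark B)"
proof -
 have "(%x. (x, None)) : measurable M (M \<otimes> mk)" by (intro measurable_Pair measurable_const) auto
 from measurable_compose[OF this f] show "(%x. f x None) : Bor M" by simp
 have "(%x. (fst x, Some (snd x))) : measurable (M \<otimes> mark B) (M \<otimes> mk)" by measurable
 from measurable_compose[OF this f] show "(%(x, e). f x (Some e)) : Bor (M \<otimes> mark B)" by (simp add: case_prod_beta')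
qed

text \<open>The Brownian motion is integrated at the mark \<open>None\<close>, the Poisson measure at the others.\<close>

definition xi :: "'e option set => real => 'w => real" where
 "xi C t w = (if None : C then 1 else 0) * wp t w + pp (Some -` C) t w"

lemma mk_finite: "C : sets mk ==> emeasure mk C < \<infinity> ==> Some -` C : sets (mark B) & emeasure (mark B) (Some -` C) < \<infinity>"
 by (auto simp: sets_mk emeasure_mk less_top)

lemma mart_lincomb:
 assumes M: "mart M" and N: "mart N"
 shows "mart (%t w. c * M t w + N t w)"
 unfolding mart_def
proof (intro conjI ballI allI impI)
 fix t assume t: "t : {0..T}"
 thus "(%w. c * M t w + N t w) : Bor (F t)" "sqi P (%w. c * M t w + N t w)"
  by (intro borel_measurable_add borel_measurable_times borel_measurable_const mart_measurable[OF M] mart_measurable[OF N]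
   sqi_add sqi_scale mart_sqi[OF M] mart_sqi[OF N]; simp)+
next
 fix s u h assume h: "0 <= s & s <= u & u <= T & h : Bor (F s) & sqi P h"
 have i: "integrable P (%w. h w * (X u w - X s w))" if "mart X" for X
  using h by (intro sqi_prod sqi_diff mart_sqi[OF that]) auto
 have "(\<E> w. h w * (c * M u w + N u w - (c * M s w + N s w)))
  = (\<E> w. c * (h w * (M u w - M s w)) + h w * (N u w - N s w))"
  by (rule Bochner_Integration.integral_cong) (auto simp: algebra_simps)
 also have "... = 0" using i[OF M] i[OF N] h mart_zero[OF M] mart_zero[OF N] by simp
 finally show "(\<E> w. h w * (c * M u w + N u w - (c * M s w + N s w))) = 0" .
qed

lemma covar_lincomb:
 assumes M: "mart M" "mart M'" and N: "mart N" and c: "covar M N a" "covar M' N b"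
 shows "covar (%t w. r * M t w + M' t w) N (r * a + b)"
 unfolding covar_def
proof (intro allI impI)
 fix s u :: real and h :: "'w => real" and K :: real
 assume h: "0 <= s & s <= u & u <= T & h : Bor (F s) & (\<forall>w\<in>\<Omega>. abs (h w) <= K)"
 hence su: "0 <= s" "s <= u" "u <= T" and hb: "bcoef s h" by (auto simp: bcoef_def)
 have i: "integrable P (%w. h w * ((X u w - X s w) * (N u w - N s w)))" if "mart X" for X
  using sqi_prod[OF bcoef_sqi[OF hb sqi_diff[OF mart_sqi[OF that, of u] mart_sqi[OF that, of s]]] sqi_diff[OF mart_sqi[OF N, of u] mart_sqi[OF N, of s]]] su
  by (simp add: mult.assoc)
 have "(\<E> w. h w * ((r * M u w + M' u w - (r * M s w + M' s w)) * (N u w - N s w)))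
  = (\<E> w. r * (h w * ((M u w - M s w) * (N u w - N s w))) + h w * ((M' u w - M' s w) * (N u w - N s w)))"
  by (rule Bochner_Integration.integral_cong) (auto simp: algebra_simps)
 also have "... = r * (a * (u - s) * (\<E> w. h w)) + b * (u - s) * (\<E> w. h w)"
  using i[OF M(1)] i[OF M(2)] covar_D[OF c(1) su hb] covar_D[OF c(2) su hb] by simp
 finally show "(\<E> w. h w * ((r * M u w + M' u w - (r * M s w + M' s w)) * (N u w - N s w))) = (r * a + b) * (u - s) * (\<E> w. h w)"
  by (simp add: algebra_simps)
qed

text \<open>The cross terms vanish by orthogonality of the two noises.\<close>

lemma covar_xi:
 assumes "C : sets mk" "emeasure mk C < \<infinity>" "D : sets mk" "emeasure mk D < \<infinity>"
 shows "covar (xi C) (xi D) (measure mk (C Int D))"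
proof -
 note C = mk_finite[OF assms(1,2)] and D = mk_finite[OF assms(3,4)]
 let ?c = "%C :: 'e option set. if None : C then 1 else 0 :: real"
 have pC: "mart (pp (Some -` C))" and pD: "mart (pp (Some -` D))" using C D by (auto intro: pp_mart)
 have "covar (xi D) wp (?c D * 1 + 0)"
  unfolding xi_def[abs_def] by (intro covar_lincomb wp_mart pD wp_covar covar_commute[OF noise_covar]) (use D in auto)
 moreover have "covar (xi D) (pp (Some -` C)) (?c D * 0 + measure (mark B) (Some -` D Int Some -` C))"
  unfolding xi_def[abs_def] by (intro covar_lincomb wp_mart pC pD noise_covar pp_covar) (use C D in auto)
 moreover have "mart (xi D)" unfolding xi_def[abs_def] by (intro mart_lincomb wp_mart pD)
 ultimately have "covar (xi C) (xi D) (?c C * (?c D * 1 + 0) + (?c D * 0 + measure (mark B) (Some -` D Int Some -` C)))"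
  unfolding xi_def[of C, abs_def] by (intro covar_lincomb wp_mart pC covar_commute[of "xi D"])
 moreover have "measure mk (C Int D) = ?c C * ?c D + measure (mark B) (Some -` D Int Some -` C)"
 proof -
  have "emeasure (mark B) (Some -` D Int Some -` C) < \<infinity>"
   using C D emeasure_mono[of "Some -` D Int Some -` C" "Some -` C" "mark B"] by (auto intro: le_less_trans)
  thus ?thesis
   using assms by (auto simp: measure_def emeasure_mk sets.Int enn2real_plus indicator_def Int_commute)
 qed
 ultimately show ?thesis by simp
qed

end

sublocale jbasis \<subseteq> C: integrator B mk xi
proof (rule integrator.intro[OF jbasis_axioms integrator_axioms.intro[OF mk_sigma_finite _ _ covar_xi]])
 fix C assume C: "C : sets mk" "emeasure mk C < \<infinity>"
 note p = mk_finite[OF C, THEN conjunct1] mk_finite[OF C, THEN conjunct2]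
 show "mart (xi C)" unfolding xi_def[abs_def] by (intro mart_lincomb wp_mart pp_mart p)
 have "arc (%t w. (if None : C then 1 else 0) * wp t w + pp (Some -` C) t w)"
  using arc_add[OF wp_arc pp_arc[OF p]] pp_arc[OF p] by (cases "None : C") simp_all
 thus "arc (xi C)" unfolding xi_def[abs_def] .
qed

section \<open>The Ito and jump integrals\<close>

context jbasis begin

text \<open>A pair of integrands as one integrand on the combined marks.\<close>

abbreviation fld :: "(real => 'w => real) => (real => 'w => 'e => real) => real => 'w => 'e option => real" where
 "fld Z l \<equiv> %t w m. case m of None => Z t w | Some e => l t w e"

lemma L2n_Q:
 assumes F: "unc L : Bor C.Q"
 shows "L2n C.Q (unc L) = (\<integral>\<^sup>+(t, w). ennreal ((L t w None)^2) + (\<integral>\<^sup>+e. ennreal ((L t w (Some e))^2) \<partial>mark B) \<partial>dtP B)"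
proof -
 have "L2n C.Q (unc L) = (\<integral>\<^sup>+x. (\<integral>\<^sup>+m. ennreal ((unc L (x, m))^2) \<partial>mk) \<partial>dtP B)"
  unfolding L2n_def using F by (intro C.nu.nn_integral_fst[symmetric]) measurable
 also have "... = (\<integral>\<^sup>+(t, w). ennreal ((L t w None)^2) + (\<integral>\<^sup>+e. ennreal ((L t w (Some e))^2) \<partial>mark B) \<partial>dtP B)"
 proof (rule nn_integral_cong)
  fix x assume x: "x : space (dtP B)"
  have "(%m. ennreal ((unc L (x, m))^2)) : Bor mk"
   using measurable_Pair2[OF F x] by measurable
  from nn_integral_mk[OF this] show "(\<integral>\<^sup>+m. ennreal ((unc L (x, m))^2) \<partial>mk)
    = (case x of (t, w) => ennreal ((L t w None)^2) + (\<integral>\<^sup>+e. ennreal ((L t w (Some e))^2) \<partial>mark B))"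
   by (simp add: case_prod_beta')
 qed
 finally show ?thesis .
qed

lemma fld_parts_measurable:
 assumes "unc L : Bor (M \<otimes> mk)"
 shows "(%(t, w). L t w None) : Bor M" "(%((t, w), e). L t w (Some e)) : Bor (M \<otimes> mark B)"
 using measurable_option_parts[of "%x. L (fst x) (snd x)" M] assms by (simp_all add: case_prod_beta')

lemma intg_iff: "C.intg L <-> (%t w. L t w None) : H2 B & (%t w e. L t w (Some e)) : H2mu B"
proof -
 have m: "unc L : Bor (pred_sigma B \<otimes> mk) <->
   predictable B (%t w. L t w None) & predictable_field B (%t w e. L t w (Some e))"
 proof
  assume "unc L : Bor (pred_sigma B \<otimes> mk)"
  thus "predictable B (%t w. L t w None) & predictable_field B (%t w e. L t w (Some e))"
   unfolding predictable_def predictable_field_def using fld_parts_measurable[of L] by auto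
 next
  assume "predictable B (%t w. L t w None) & predictable_field B (%t w e. L t w (Some e))"
  hence "(%(x, m). case_option (L (fst x) (snd x) None) (%e. L (fst x) (snd x) (Some e)) m) : Bor (pred_sigma B \<otimes> mk)"
   by (intro measurable_option_case) (simp_all add: predictable_def predictable_field_def case_prod_beta')
  moreover have "case_option (L t w None) (%e. L t w (Some e)) m = L t w m" for t w m by (cases m) auto
  ultimately show "unc L : Bor (pred_sigma B \<otimes> mk)" by (simp add: case_prod_beta')
 qed
 have "L2n C.Q (unc L) = (\<integral>\<^sup>+(t, w). ennreal ((L t w None)^2) \<partial>dtP B)
   + (\<integral>\<^sup>+(t, w). (\<integral>\<^sup>+e. ennreal ((L t w (Some e))^2) \<partial>mark B) \<partial>dtP B)"
  if "unc L : Bor (pred_sigma B \<otimes> mk)"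
 proof -
  note Q = C.pred_Q[OF that]
  have nm: "(%x. \<integral>\<^sup>+e. ennreal ((f (x, e))^2) \<partial>mark B) : Bor (dtP B)"
   if [measurable]: "f : Bor (dtP B \<otimes> mark B)" for f by measurable
  have "(%(t, w). ennreal ((L t w None)^2)) : Bor (dtP B)"
   using fld_parts_measurable(1)[OF Q] by (simp add: case_prod_beta')
  with nm[OF fld_parts_measurable(2)[OF Q]] show ?thesis
   unfolding L2n_Q[OF Q] by (subst nn_integral_add[symmetric]) (auto simp: case_prod_beta')
 qed
 note n = this
 show ?thesis
 proof (cases "unc L : Bor (pred_sigma B \<otimes> mk)")
  case True
  thus ?thesis using m C.pred_Q[OF True] n[OF True] by (simp add: C.intg_def sqi_def H2_def H2mu_def)
 next
  case False
  with m have "\<not> (predictable B (%t w. L t w None) & predictable_field B (%t w e. L t w (Some e)))" by simp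
  thus ?thesis using False by (auto simp: C.intg_def H2_def H2mu_def)
 qed
qed

lemma intg_fld: "Z : H2 B ==> l : H2mu B ==> C.intg (fld Z l)"
 by (simp add: intg_iff)

lemma zero_H2: "(%t w. 0) : H2 B" and zero_H2mu: "(%t w e. 0) : H2mu B"
 by (auto simp: H2_def H2mu_def predictable_def predictable_field_def case_prod_beta')

text \<open>An integral can be computed from any class of coded step fields onto which general step fields project without increasing
 the distance to the integrand.\<close>

lemma is_int_coded:
 assumes L: "C.intg L" and e: "!!c. ok c ==> C.adm (e c)"
  and d: "!!a. C.adm a ==> ok (d a)" "!!a. C.adm a ==> C.dQ (step_field (e (d a))) L <= C.dQ (step_field a) L"
 shows "C.is_int L I <-> arc I & (\<exists>c. (\<forall>n::nat. ok (c n)) & (%n. C.dQ (step_field (e (c n))) L) ----> 0 &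
   (\<forall>t\<in>{0..T}. (%n. L2n P (%w. C.si (e (c n)) t w - I t w)) ----> 0))"
proof
 assume I: "C.is_int L I"
 then obtain a where arc: "arc I" and a: "!!n. C.adm (a n)" "(%n. C.dQ (step_field (a n)) L) ----> 0"
  unfolding C.is_int_def by blast
 note s = e[OF d(1)[OF a(1)]]
 have z: "(%n. C.dQ (step_field (e (d (a n)))) L) ----> 0"
  by (rule null_le[OF a(2)]) (rule d(2)[OF a(1)])
 have "L2n P (%w. C.si (e (d (a n))) t w - I t w) <= C.dQ (step_field (e (d (a n)))) L" if "t : {0..T}" for n t
  using C.is_int_isometry_le[OF C.intg_diff[OF C.intg_step[OF s] L] C.is_int_diff[OF C.intg_step[OF s] C.is_int_step[OF s] L I] that]
  by simp
 hence p: "(%n. L2n P (%w. C.si (e (d (a n))) t w - I t w)) ----> 0" if "t : {0..T}" for t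
  using that by (intro null_le[OF z])
 show "arc I & (\<exists>c. (\<forall>n. ok (c n)) & (%n. C.dQ (step_field (e (c n))) L) ----> 0 &
   (\<forall>t\<in>{0..T}. (%n. L2n P (%w. C.si (e (c n)) t w - I t w)) ----> 0))"
  using arc z d(1) a(1) p by (intro conjI exI[of _ "%n. d (a n)"]) auto
next
 assume R: "arc I & (\<exists>c. (\<forall>n::nat. ok (c n)) & (%n. C.dQ (step_field (e (c n))) L) ----> 0 &
   (\<forall>t\<in>{0..T}. (%n. L2n P (%w. C.si (e (c n)) t w - I t w)) ----> 0))"
 then obtain c where "!!n. ok (c n)" "(%n. C.dQ (step_field (e (c n))) L) ----> 0"
  "\<forall>t\<in>{0..T}. (%n. L2n P (%w. C.si (e (c n)) t w - I t w)) ----> 0" by blast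
 thus "C.is_int L I" using R e unfolding C.is_int_def by (intro conjI exI[of _ "%n. e (c n)"]) auto
qed

text \<open>Steps of the Brownian motion and of the Poisson measure as steps over the combined marks.\<close>

definition tw :: "(('w => real) \<times> real \<times> real) list => ('w, 'e option) steps" where
 "tw = map (%(h, s, u). (h, s, u, {None}))"

definition tj :: "('w, 'e) steps => ('w, 'e option) steps" where
 "tj = map (%(h, s, u, C). (h, s, u, Some ` C))"

abbreviation wadm where "wadm c \<equiv> \<forall>(h, s, u)\<in>set c. step_coeff B h s u"

abbreviation jadm where
 "jadm c \<equiv> \<forall>(h, s, u, C)\<in>set c. step_coeff B h s u & C : sets (mark B) & emeasure (mark B) C < \<infinity>"

lemma mk_None: "{None} : sets mk" "emeasure mk {None} < \<infinity>"
 and mk_Some: "C : sets (mark B) ==> Some ` C : sets mk" "C : sets (mark B) ==> emeasure mk (Some ` C) = emeasure (mark B) C"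
proof -
 show n: "{None} : sets mk" by (auto simp: sets_mk vimage_def)
 show "emeasure mk {None} < \<infinity>" using emeasure_mk[OF n] by (simp add: vimage_def)
 show s: "Some ` C : sets mk" if "C : sets (mark B)" for C
  using sets.sets_into_space[OF that] that by (auto simp: sets_mk inj_vimage_image_eq)
 show "emeasure mk (Some ` C) = emeasure (mark B) C" if "C : sets (mark B)"
  using emeasure_mk[OF s[OF that]] by (simp add: inj_vimage_image_eq)
qed

lemma tw:
 assumes "wadm c"
 shows "C.adm (tw c)" "step_field (tw c) = fld (step_fun c) (%_ _ _. 0)" "AE w in P. \<forall>t. C.si (tw c) t w = step_int B c t w"
proof -
 show "C.adm (tw c)" using assms mk_None by (fastforce simp: tw_def C.adm_def)
 have "step_field (tw c) t w m = fld (step_fun c) (%_ _ _. 0) t w m" for t w m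
  by (induct c) (auto simp: tw_def step_field_def step_fun_def split: option.splits)
 thus "step_field (tw c) = fld (step_fun c) (%_ _ _. 0)" by (intro ext)
 have x: "xi {None} t w = wp t w" for t w by (simp add: xi_def pp_def vimage_def)
 show "AE w in P. \<forall>t. C.si (tw c) t w = step_int B c t w"
  using wp_AE by eventually_elim (induct c, auto simp: tw_def C.si_def step_int_def x)
qed

lemma tj:
 assumes "jadm c"
 shows "C.adm (tj c)" "step_field (tj c) = fld (%_ _. 0) (step_field c)"
  "AE w in P. \<forall>t\<in>{0..T}. C.si (tj c) t w = step_jump_int B c t w"
proof -
 show "C.adm (tj c)" using assms by (auto simp: tj_def C.adm_def mk_Some)
 have "step_field (tj c) t w m = fld (%_ _. 0) (step_field c) t w m" for t w m
  by (induct c) (auto simp: tj_def step_field_def indicator_def split: option.splits)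
 thus "step_field (tj c) = fld (%_ _. 0) (step_field c)" by (intro ext)
 show "AE w in P. \<forall>t\<in>{0..T}. C.si (tj c) t w = step_jump_int B c t w"
  using assms
 proof (induct c)
  case Nil thus ?case by (simp add: tj_def C.si_def step_jump_int_def)
 next
  case (Cons x c)
  obtain h s u C where x: "x = (h, s, u, C)" by (cases x)
  have C: "step_coeff B h s u" "C : sets (mark B)" "emeasure (mark B) C < \<infinity>" and c: "jadm c" using Cons.prems by (auto simp: x)
  have "AE w in P. w \<notin> pnull C" using AE_not_in[OF pnull[OF C(2,3)]] .
  thus ?case using Cons.hyps[OF c] AE_space
  proof eventually_elim
   fix w assume w: "w \<notin> pnull C" "\<forall>t\<in>{0..T}. C.si (tj c) t w = step_jump_int B c t w" "w : \<Omega>"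
   have "xi (Some ` C) b w - xi (Some ` C) a w = measure (prm B w) (strip a b C) - (b - a) * measure (mark B) C" if "0 <= a" "a <= b" "b <= T" for a b
    using pp_increment_path[OF C(2,3) w(3,1) that] by (simp add: xi_def inj_vimage_image_eq)
   from this[of "min s t" "min u t" for t] show "\<forall>t\<in>{0..T}. C.si (tj (x # c)) t w = step_jump_int B (x # c) t w"
    using w(2) C(1) by (auto simp: tj_def C.si_def step_jump_int_def x step_coeff_iff)
  qed
 qed
qed

lemma is_ito_iff:
 assumes Z: "Z : H2 B"
 shows "is_ito_integral B Z I <-> C.is_int (fld Z (%_ _ _. 0)) I"
proof -
 let ?L = "fld Z (%_ _ _. 0)"
 have L: "C.intg ?L" by (rule intg_fld[OF Z zero_H2mu])
 have q: "C.dQ (step_field (tw c)) ?L = (\<integral>\<^sup>+(t, w). ennreal ((step_fun c t w - Z t w)^2) \<partial>dtP B)" if "wadm c" for c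
  using L2n_Q[OF sqi_measurable[OF C.intg_Q[OF C.intg_diff[OF C.intg_step[OF tw(1)[OF that]] L]]]] tw(2)[OF that]
  by (simp add: fun_eq_iff)
 have p: "L2n P (%w. C.si (tw c) t w - J w) = (\<integral>\<^sup>+w. ennreal ((step_int B c t w - J w)^2) \<partial>P)" if "wadm c" for c t J
  unfolding L2n_def using tw(3)[OF that] by (intro nn_integral_cong_AE) (auto elim: eventually_mono)
 let ?d = "%a. map (%(h, s, u, C). (if None : C then h else (%_. 0), s, u)) a"
 have e: "step_fun (?d a) t w = step_field a t w None" for a t w
  by (induct a) (auto simp: step_fun_def step_field_def)
 have d: "wadm (?d a)" if "C.adm a" for a using that by (fastforce simp: C.adm_def C.adm1_def step_coeff_iff bcoef_def)
 have le: "C.dQ (step_field (tw (?d a))) ?L <= C.dQ (step_field a) ?L" if "C.adm a" for a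
  unfolding tw(2)[OF d[OF that]] by (rule L2n_mono) (auto simp: e split: option.split)
 show ?thesis
  by (rule trans[OF _ is_int_coded[where ok = "%c. wadm c" and e = tw and d = ?d, OF L tw(1) d le, symmetric]], simp only: is_ito_integral_def arc_def conj_assoc, intro conj_cong ex_cong1 refl)
   (simp_all add: q p)
qed

lemma is_jump_iff:
 assumes l: "l : H2mu B"
 shows "is_jump_integral B l I <-> C.is_int (fld (%_ _. 0) l) I"
proof -
 let ?L = "fld (%_ _. 0) l"
 have L: "C.intg ?L" by (rule intg_fld[OF zero_H2 l])
 have q: "C.dQ (step_field (tj c)) ?L
   = (\<integral>\<^sup>+(t, w). (\<integral>\<^sup>+e. ennreal ((step_field c t w e - l t w e)^2) \<partial>mark B) \<partial>dtP B)" if "jadm c" for c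
  using L2n_Q[OF sqi_measurable[OF C.intg_Q[OF C.intg_diff[OF C.intg_step[OF tj(1)[OF that]] L]]]] tj(2)[OF that]
  by (simp add: fun_eq_iff)
 have p: "L2n P (%w. C.si (tj c) t w - J w) = (\<integral>\<^sup>+w. ennreal ((step_jump_int B c t w - J w)^2) \<partial>P)" if "jadm c" "t : {0..T}" for c t J
  unfolding L2n_def using tj(3)[OF that(1)] that(2) by (intro nn_integral_cong_AE) (auto elim: eventually_mono)
 let ?d = "%a. map (%(h, s, u, C). (h, s, u, Some -` C)) a"
 have e: "step_field (?d a) t w m = step_field a t w (Some m)" for a t w m
  by (induct a) (auto simp: step_field_def indicator_def)
 have d: "jadm (?d a)" if "C.adm a" for a using that by (fastforce simp: C.adm_def C.adm1_def dest: mk_finite)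
 have le: "C.dQ (step_field (tj (?d a))) ?L <= C.dQ (step_field a) ?L" if "C.adm a" for a
  unfolding tj(2)[OF d[OF that]] by (rule L2n_mono) (auto simp: e split: option.split)
 show ?thesis
  by (rule trans[OF _ is_int_coded[where ok = "%c. jadm c" and e = tj and d = ?d, OF L tj(1) d le, symmetric]], simp only: is_jump_integral_def arc_def conj_assoc, intro conj_cong ex_cong1 refl)
   (simp_all add: q p)
qed

lemma noise_integral:
 assumes Z: "Z : H2 B" and l: "l : H2mu B"
 shows "C.is_int (fld Z l) (%t w. ito_integral B Z t w + jump_integral B l t w)"
proof -
 let ?W = "fld Z (%_ _ _. 0)" and ?J = "fld (%_ _. 0) l" and ?O = "%_ _ _. 0 :: real"
 have i: "C.intg ?W" "C.intg ?J" "C.intg ?O" by (auto intro!: intg_fld Z l zero_H2 zero_H2mu simp: intg_iff[of ?O])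
 have "is_ito_integral B Z (ito_integral B Z)"
  unfolding ito_integral_def using C.integral_exists[OF i(1)] is_ito_iff[OF Z] by (metis someI_ex)
 hence W: "C.is_int ?W (ito_integral B Z)" using is_ito_iff[OF Z] by blast
 have "is_jump_integral B l (jump_integral B l)"
  unfolding jump_integral_def using C.integral_exists[OF i(2)] is_jump_iff[OF l] by (metis someI_ex)
 hence J: "C.is_int ?J (jump_integral B l)" using is_jump_iff[OF l] by blast
 have O: "C.is_int ?O (%t w. 0)" using C.is_int_step[OF C.adm_Nil] by (simp add: step_field_def[abs_def] C.si_def[abs_def])
 have "C.is_int (%t w m. ?W t w m - (0 - ?J t w m)) (%t w. ito_integral B Z t w - (0 - jump_integral B l t w))"
  by (rule C.is_int_diff[OF i(1) W C.intg_diff[OF i(3,2)] C.is_int_diff[OF i(3) O i(2) J]])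
 moreover have "(%t w m. ?W t w m - (0 - ?J t w m)) = fld Z l" by (auto simp: fun_eq_iff split: option.split)
 ultimately show ?thesis by (simp only: diff_0 diff_minus_eq_add)
qed

end

section \<open>Measurability of the driver along integrands\<close>

lemma suminf_ennreal_tendsto_zero:
 fixes f :: "nat => ennreal"
 assumes "(\<Sum>n. f n) \<noteq> \<top>"
 shows "f ----> 0"
proof -
 have top: "f n \<noteq> \<top>" for n
  using assms sum_le_suminf[of f "{n}"] by (auto simp: top_unique)
 hence f: "f = (%n. ennreal (enn2real (f n)))" by (auto simp: less_top)
 hence "summable (%n. enn2real (f n))"
  using assms by (intro summable_suminf_not_top) auto
 from tendsto_ennrealI[OF summable_LIMSEQ_zero[OF this]] show ?thesis by (subst f) simp
qed

context integrator begin

lemma L2n_section: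
 assumes [measurable]: "f : Bor Q"
 shows "(\<integral>\<^sup>+x. L2n nu (%m. f (x, m)) \<partial>dtP B) = L2n Q f" "(%x. L2n nu (%m. f (x, m))) : Bor (dtP B)"
 unfolding L2n_def by (rule nu.nn_integral_fst; measurable) measurable

lemma sqi_section:
 assumes f: "sqi Q f"
 shows "AE x in dtP B. sqi nu (%m. f (x, m))"
proof -
 have fm: "f : Bor Q" using f by (rule sqi_measurable)
 have "AE x in dtP B. L2n nu (%m. f (x, m)) \<noteq> \<infinity>"
  using f by (intro nn_integral_PInf_AE L2n_section(2)[OF fm]) (simp add: L2n_section(1)[OF fm] sqi_def less_top)
 thus ?thesis using AE_space
  by eventually_elim (auto simp: sqi_def less_top intro: measurable_Pair2[OF fm])
qed

definition disc :: "real => ('w, 'm) steps => ('w, 'm) steps" where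
 "disc r = map (%(h, s, u, C). (%w. real_of_int \<lfloor>r * h w\<rfloor> / r, s, u, C))"

lemma disc_error: "0 < r ==> abs (real_of_int \<lfloor>r * x\<rfloor> / r - x) <= 1 / r"
proof -
 assume r: "0 < r"
 hence "real_of_int \<lfloor>r * x\<rfloor> / r - x = (real_of_int \<lfloor>r * x\<rfloor> - r * x) / r" by (simp add: field_simps)
 moreover have "abs (real_of_int \<lfloor>r * x\<rfloor> - r * x) <= 1" by linarith
 ultimately show ?thesis using r by (simp add: divide_right_mono)
qed

lemma adm_disc:
 assumes "0 < r" "adm c"
 shows "adm (disc r c)"
proof -
 have "bcoef s (%w. real_of_int \<lfloor>r * h w\<rfloor> / r)" if h: "bcoef s h" for s h
 proof -
  obtain K where K: "\<forall>w\<in>\<Omega>. abs (h w) <= K" and m: "h : Bor (F s)" using h by (auto simp: bcoef_def)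
  have "abs (real_of_int \<lfloor>r * h w\<rfloor> / r) <= K + 1 / r" if "w : \<Omega>" for w
   using K[rule_format, OF that] disc_error[OF assms(1), of "h w"] by linarith
  with m show ?thesis unfolding bcoef_def by (intro conjI exI[of _ "K + 1 / r"]) auto
 qed
 thus ?thesis using assms(2) by (auto simp: adm_def disc_def step_coeff_iff)
qed

lemma disc_approx:
 assumes c: "adm c" and e: "0 < \<epsilon>"
 shows "\<exists>r>0. dQ (step_field (disc r c)) (step_field c) <= ennreal \<epsilon>"
proof -
 let ?o = "map (%(h, s, u, C). (%_. 1 :: real, s, u, C)) c"
 have "adm ?o" using c by (fastforce simp: adm_def adm1_def step_coeff_iff bcoef_def)
 hence o: "sqi Q (sf ?o)" by (rule step_isometry(2))
 have d: "abs (step_field (disc r c) t w m - step_field c t w m) <= (1 / r) * step_field ?o t w m" if r: "0 < r" for r t w m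
 proof (induct c)
  case Nil thus ?case by (simp add: disc_def step_field_def)
 next
  case (Cons x c)
  obtain h s u C where x: "x = (h, s, u, C)" by (cases x)
  let ?i = "ind {s<..u} t * ind C m :: real" and ?d = "real_of_int \<lfloor>r * h w\<rfloor> / r"
  have "abs ((?d - h w) * ?i) <= (1 / r) * ?i"
   unfolding abs_mult by (rule order_trans[OF mult_right_mono[OF disc_error[OF r]]]) (auto simp: indicator_def)
  with Cons have "abs ((?d - h w) * ?i + (step_field (disc r c) t w m - step_field c t w m))
    <= (1 / r) * ?i + (1 / r) * step_field (map (%(h, s, u, C). (%_. 1, s, u, C)) c) t w m" by linarith
  thus ?case by (simp add: x disc_def step_field_def algebra_simps)
 qed
 let ?D = "enn2real (L2n Q (sf ?o))"
 have D: "L2n Q (sf ?o) = ennreal ?D" using o by (simp add: sqi_def less_top)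
 define r where "r = sqrt ((?D + 1) / \<epsilon>)"
 have r: "0 < r" "(1 / r)^2 * ?D <= \<epsilon>"
 proof -
  have D0: "0 < ?D + 1" using enn2real_nonneg[of "L2n Q (sf ?o)"] by linarith
  thus "0 < r" using e by (simp add: r_def)
  have "r^2 = (?D + 1) / \<epsilon>" unfolding r_def using e D0 by (intro real_sqrt_pow2) auto
  hence "(1 / r)^2 * ?D = \<epsilon> * (?D / (?D + 1))" by (simp add: power_divide)
  also have "... <= \<epsilon> * 1" using e D0 by (intro mult_left_mono) auto
  finally show "(1 / r)^2 * ?D <= \<epsilon>" by simp
 qed
 have "dQ (step_field (disc r c)) (step_field c) <= L2n Q (%x. (1 / r) * sf ?o x)"
  by (rule L2n_mono, rule order_trans[OF d[OF r(1)] abs_ge_self])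
 also have "... = ennreal ((1 / r)^2 * ?D)"
  unfolding L2n_scale[OF sqi_measurable[OF o]] by (subst D) (simp add: ennreal_mult)
 also have "... <= ennreal \<epsilon>" using r(2) by (rule ennreal_leI)
 finally show ?thesis using r(1) by blast
qed

text \<open>Rounding the weights to a lattice leaves countably many mark functions, since only finitely many mark sets occur in the list.\<close>

lemma disc_countable:
 assumes c: "adm c"
 shows "(%x m. step_field (disc r c) (fst x) (snd x) m) : measurable (dtP B) (count_space UNIV)"
proof -
 let ?d = "%c x. map (%(h, s, u, C). if fst x : {s<..u} then \<lfloor>r * h (snd x)\<rfloor> else 0) c"
 let ?p = "%c v m. \<Sum>(i, h, s, u, C)\<leftarrow>zip v c. real_of_int i / r * ind C m"
 have "?d c : measurable (dtP B) (count_space UNIV)"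
  using c
 proof (induct c)
  case Nil thus ?case by simp
 next
  case (Cons x c)
  obtain h s u C where x: "x = (h, s, u, C)" by (cases x)
  have h [measurable]: "h : Bor P" using Cons.prems by (auto simp: adm_def x step_coeff_iff bcoef_P)
  have "(%x. if fst x : {s<..u} then \<lfloor>r * h (snd x)\<rfloor> else 0) : measurable (dtP B) (count_space UNIV)"
   by measurable
  moreover have "?d c : measurable (dtP B) (count_space UNIV)" using Cons by (simp add: adm_def)
  ultimately have "(%y. ((if fst y : {s<..u} then \<lfloor>r * h (snd y)\<rfloor> else 0), ?d c y)) : measurable (dtP B) (count_space UNIV \<otimes> count_space UNIV)"
   by (rule measurable_Pair)
  note m = this
  have e: "count_space (UNIV :: int set) \<otimes> count_space (UNIV :: int list set) = count_space UNIV"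
   by (subst pair_measure_countable) simp_all
  have "(%(a, b). a # b) : measurable (count_space (UNIV :: (int \<times> int list) set)) (count_space UNIV)" by simp
  from measurable_compose[OF m[unfolded e] this] show ?case by (simp only: x list.map prod.case)
 qed
 moreover have "(%m. step_field (disc r c) (fst x) (snd x) m) = ?p c (?d c x)" for x
 proof (induct c)
  case Nil show ?case by (simp add: disc_def step_field_def)
 next
  case (Cons y c) thus ?case by (cases y) (auto simp: disc_def step_field_def fun_eq_iff)
 qed
 ultimately show ?thesis using measurable_compose[of "?d c" "dtP B" "count_space UNIV" "?p c" "count_space UNIV"] by simp
qed

text \<open>Measurability of an integrand as a map into \<open>L\<^sup>2\<close>, in the form of Bochner's theory.\<close>

lemma strong_approx:
 assumes L: "intg L"
 shows "\<exists>k :: nat => real \<times> 'w => 'm => real. (\<forall>n. k n : measurable (dtP B) (count_space UNIV)) &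
  (\<forall>n. AE x in dtP B. sqi nu (k n x)) & (AE x in dtP B. sqi nu (%m. unc L (x, m)) & (%n. L2n nu (%m. k n x m - unc L (x, m))) ----> 0)"
proof -
 have LQ: "unc L : Bor Q" using intg_Q[OF L] by (rule sqi_measurable)
 have "\<forall>n. \<exists>c. adm c & (\<exists>a r. c = disc r a & adm a) & dQ (step_field c) L <= ennreal (4 * (1/2) ^ n)"
 proof
  fix n
  have p: "0 < (1/2 :: real) ^ n" by simp
  obtain a where a: "adm a" "dQ (step_field a) L <= ennreal ((1/2) ^ n)"
   using approxD[OF step_fields_dense[OF L] p] by auto
  obtain r where r: "0 < r" "dQ (step_field (disc r a)) (step_field a) <= ennreal ((1/2) ^ n)"
   using disc_approx[OF a(1) p] by auto
  have "dQ (step_field (disc r a)) L <= 2 * ennreal ((1/2) ^ n) + 2 * ennreal ((1/2) ^ n)"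
   by (rule order_trans[OF L2n_triangle[OF step_Q[OF adm_disc[OF r(1) a(1)]] step_Q[OF a(1)] LQ]])
     (intro add_mono mult_left_mono a r; simp)
  also have "... = ennreal (4 * (1/2) ^ n)" by (subst ennreal_double) auto
  finally show "\<exists>c. adm c & (\<exists>a r. c = disc r a & adm a) & dQ (step_field c) L <= ennreal (4 * (1/2) ^ n)"
   using adm_disc[OF r(1) a(1)] a(1) by blast
 qed
 from choice[OF this] obtain c where c: "!!n. adm (c n)" "!!n. \<exists>a r. c n = disc r a & adm a"
  "!!n. dQ (step_field (c n)) L <= ennreal (4 * (1/2) ^ n)" by blast
 let ?k = "%n x m. step_field (c n) (fst x) (snd x) m"
 let ?\<phi> = "%n x. L2n nu (%m. ?k n x m - unc L (x, m))"
 have dm: "(%x. sf (c n) x - unc L x) : Bor Q" for n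
  by (intro borel_measurable_diff step_Q c(1) LQ)
 have \<phi>m: "?\<phi> n : Bor (dtP B)" for n using L2n_section(2)[OF dm] by simp
 have "(\<integral>\<^sup>+x. (\<Sum>n. ?\<phi> n x) \<partial>dtP B) = (\<Sum>n. \<integral>\<^sup>+x. ?\<phi> n x \<partial>dtP B)" by (rule nn_integral_suminf[OF \<phi>m])
 also have "... = (\<Sum>n. dQ (step_field (c n)) L)"
  using L2n_section(1)[OF dm] by simp
 also have "... <= (\<Sum>n. ennreal (4 * (1/2) ^ n))" by (intro suminf_le c) auto
 also have "... = ennreal (\<Sum>n. 4 * (1/2) ^ n)" by (rule suminf_ennreal2) (auto intro: summable_mult summable_geometric)
 also have "... < \<infinity>" by simp
 finally have "AE x in dtP B. (\<Sum>n. ?\<phi> n x) \<noteq> \<infinity>" using \<phi>m by (intro nn_integral_PInf_AE) auto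
 hence "AE x in dtP B. (%n. ?\<phi> n x) ----> 0"
  by eventually_elim (rule suminf_ennreal_tendsto_zero, simp)
 with sqi_section[OF intg_Q[OF L]]
 have "AE x in dtP B. sqi nu (%m. unc L (x, m)) & (%n. ?\<phi> n x) ----> 0" by eventually_elim simp
 moreover have "?k n : measurable (dtP B) (count_space UNIV)" for n using c(2)[of n] disc_countable by auto
 moreover have "AE x in dtP B. sqi nu (?k n x)" for n using sqi_section[OF step_isometry(2)[OF c(1)], of n] by simp
 ultimately show ?thesis by (intro exI[of _ ?k] conjI allI)
qed

end

locale bsde = jbasis B for B :: "('w, 'e) basis" +
 fixes g :: "('w, 'e) driver"
 assumes driver: "lipschitz_driver B g" and solvable: "bsde_solvable B g" and monotone: "reflected_monotone B g"
begin

abbreviation G :: "(real => 'w => real) => (real => 'w => 'e option => real) => real \<times> 'w => real" where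
 "G X L \<equiv> %x. g (fst x) (snd x) (X (fst x) (snd x)) (L (fst x) (snd x) None) (%e. L (fst x) (snd x) (Some e))"

lemma L2mu_iff: "k : L2mu B <-> sqi (mark B) k"
 by (auto simp: L2mu_def sqi_def L2n_def)

lemma L2n_norm_mu: "sqi (mark B) k ==> L2n (mark B) k = ennreal ((norm_mu B k)^2)"
 unfolding L2n_eq_integral norm_mu_def by simp

lemma L2n_mk: "f : Bor mk ==> L2n mk f = ennreal ((f None)^2) + L2n (mark B) (%e. f (Some e))"
 unfolding L2n_def by (rule nn_integral_mk) measurable

lemma sqi_mk: "sqi mk f ==> sqi (mark B) (%e. f (Some e))"
 using L2n_mk[of f] measurable_compose[OF Some_mk, of f borel] by (auto simp: sqi_def)

lemma limit_measurable_L2mu: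
 fixes k :: "nat => real \<times> 'w => 'e => real"
 assumes k: "!!n. k n : measurable (dtP B) (count_space UNIV)"
  and kx: "!!n x. x : space (dtP B) ==> x \<notin> N ==> sqi (mark B) (k n x)"
  and l: "!!x. x : space (dtP B) ==> x \<notin> N ==> sqi (mark B) (l x)"
  and lim: "!!x. x : space (dtP B) ==> x \<notin> N ==> (%n. L2n (mark B) (%e. k n x e - l x e)) ----> 0"
  and N: "N : sets (dtP B)"
 shows "(%x. if x : N then (%_. 0) else l x) : measurable (dtP B) (borel_L2mu B)"
 unfolding borel_L2mu_def
proof (rule measurable_measure_of)
 show "(%x. if x : N then (%_. 0) else l x) : space (dtP B) \<rightarrow> L2mu B"
  using l by (auto simp: L2mu_iff)
next
 fix U assume "U : {U. U <= L2mu B & (\<forall>k\<in>U. \<exists>\<epsilon>>0. \<forall>k'\<in>L2mu B. norm_mu B (%e. k' e - k e) < \<epsilon> --> k' : U)}"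
 hence op: "!!v. v : U ==> \<exists>\<epsilon>>0. \<forall>v'\<in>L2mu B. norm_mu B (%e. v' e - v e) < \<epsilon> --> v' : U" by blast
 \<comment> \<open>points at squared distance at least \<open>1/(m+1)\<close> from the complement of the open set \<open>U\<close>\<close>
 define V where "V m = {v. \<forall>v'. sqi (mark B) v' & v' \<notin> U --> ennreal (1 / real (Suc m)) <= L2n (mark B) (%e. v' e - v e)}" for m
 have eq: "l x : U <-> (\<exists>m j. \<forall>n\<ge>j. k n x : V m)" if x: "x : space (dtP B)" "x \<notin> N" for x
 proof
  assume "l x : U"
  then obtain \<epsilon> where \<epsilon>: "0 < \<epsilon>" "!!v'. v' : L2mu B ==> norm_mu B (%e. v' e - l x e) < \<epsilon> ==> v' : U" using op by blast
  have far: "ennreal (\<epsilon>^2) <= L2n (mark B) (%e. v' e - l x e)" if v': "sqi (mark B) v'" "v' \<notin> U" for v'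
  proof -
   have "\<epsilon> <= norm_mu B (%e. v' e - l x e)" using \<epsilon>(2)[of v'] v' by (force simp: L2mu_iff)
   thus ?thesis using \<epsilon>(1) by (simp add: L2n_norm_mu[OF sqi_diff[OF v'(1) l[OF x]]] power_mono ennreal_leI)
  qed
  obtain m where m: "1 / real (Suc m) < \<epsilon>^2 / 4" using nat_approx_posE[of "\<epsilon>^2 / 4"] \<epsilon>(1) by (auto simp del: of_nat_Suc)
  have "\<forall>\<^sub>F n in sequentially. L2n (mark B) (%e. k n x e - l x e) < ennreal (\<epsilon>^2 / 4)"
   using lim[OF x] by (rule order_tendstoD(2)) (use \<epsilon>(1) in simp)
  then obtain j where j: "!!n. n >= j ==> L2n (mark B) (%e. k n x e - l x e) < ennreal (\<epsilon>^2 / 4)" by (auto simp: eventually_sequentially)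
  have "k n x : V m" if n: "n >= j" for n
   unfolding V_def
  proof (intro CollectI allI impI)
   fix v' assume v': "sqi (mark B) v' & v' \<notin> U"
   hence v': "sqi (mark B) v'" "v' \<notin> U" by auto
   define a where "a = (norm_mu B (%e. v' e - k n x e))^2"
   define b where "b = (norm_mu B (%e. k n x e - l x e))^2"
   have a: "L2n (mark B) (%e. v' e - k n x e) = ennreal a" "0 <= a" unfolding a_def by (auto intro: L2n_norm_mu sqi_diff v' kx[OF x])
   have b: "L2n (mark B) (%e. k n x e - l x e) = ennreal b" "0 <= b" unfolding b_def by (auto intro: L2n_norm_mu sqi_diff l[OF x] kx[OF x])
   have "ennreal (\<epsilon>^2) <= 2 * ennreal a + 2 * ennreal b"
    unfolding a(1)[symmetric] b(1)[symmetric]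
    by (rule order_trans[OF far[OF v'] L2n_triangle[OF v'(1)[THEN sqi_measurable] kx[OF x, THEN sqi_measurable] l[OF x, THEN sqi_measurable]]])
   hence "\<epsilon>^2 <= 2 * a + 2 * b" using a(2) b(2) unfolding ennreal_double[OF a(2) b(2)] by (subst (asm) ennreal_le_iff) auto
   moreover have "b < \<epsilon>^2 / 4" using j[OF n] b by (simp add: ennreal_less_iff)
   ultimately have "1 / real (Suc m) <= a" using m by linarith
   thus "ennreal (1 / real (Suc m)) <= L2n (mark B) (%e. v' e - k n x e)" unfolding a(1) by (rule ennreal_leI)
  qed
  thus "\<exists>m j. \<forall>n\<ge>j. k n x : V m" by blast
 next
  assume "\<exists>m j. \<forall>n\<ge>j. k n x : V m"
  then obtain m j where mj: "!!n. n >= j ==> k n x : V m" by blast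
  show "l x : U"
  proof (rule ccontr)
   assume "l x \<notin> U"
   hence "ennreal (1 / real (Suc m)) <= L2n (mark B) (%e. k n x e - l x e)" if "n >= j" for n
    using mj[OF that] l[OF x] L2n_commute[of "mark B" "l x" "k n x"] by (auto simp: V_def)
   hence "ennreal (1 / real (Suc m)) <= 0" by (intro LIMSEQ_le_const[OF lim[OF x]]) blast
   thus False by (simp add: ennreal_eq_0_iff)
  qed
 qed
 let ?A = "{x\<in>space (dtP B). \<exists>m j. \<forall>n\<ge>j. k n x : V m}"
 have [measurable]: "Measurable.pred (dtP B) (%x. k n x : V m)" for n m
  by (rule measurable_compose[OF k]) simp
 have A: "?A : sets (dtP B)" by measurable
 have "(%x. if x : N then (%_. 0) else l x) -` U Int space (dtP B) = (?A - N) \<union> (if (%_. 0) : U then N else {})"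
 proof (rule set_eqI)
  fix x show "x : (%x. if x : N then (%_. 0) else l x) -` U Int space (dtP B) <-> x : (?A - N) \<union> (if (%_. 0) : U then N else {})"
   using eq[of x] sets.sets_into_space[OF N] by (cases "x : N") auto
 qed
 moreover have "(?A - N) \<union> (if (%_. 0) : U then N else {}) : sets (dtP B)"
  by (rule sets.Un[OF sets.Diff[OF A N]]) (simp add: N)
 ultimately show "(%x. if x : N then (%_. 0) else l x) -` U Int space (dtP B) : sets (dtP B)" by (simp only:)
qed auto

text \<open>The driver composed with an integrand is measurable up to a null set, since off a null set the integrand is a limit of
 countably valued maps into \<open>L\<^sup>2\<close>.\<close>

theorem driver_measurable:
 assumes X: "(%x. X (fst x) (snd x)) : Bor (dtP B)" and L: "C.intg L"
 shows "\<exists>f\<in>Bor (dtP B). AE x in dtP B. f x = G X L x"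
proof -
 obtain k :: "nat => real \<times> 'w => 'e option => real" where k: "!!n. k n : measurable (dtP B) (count_space UNIV)"
  "!!n. AE x in dtP B. sqi mk (k n x)"
  "AE x in dtP B. sqi mk (%m. unc L (x, m)) & (%n. L2n mk (%m. k n x m - unc L (x, m))) ----> 0"
  using C.strong_approx[OF L] by blast
 have "AE x in dtP B. (\<forall>n. sqi mk (k n x)) & sqi mk (%m. unc L (x, m)) & (%n. L2n mk (%m. k n x m - unc L (x, m))) ----> 0"
  using k(2,3) by (simp add: AE_all_countable)
 then obtain N where N: "N : null_sets (dtP B)"
  "{x\<in>space (dtP B). \<not> ((\<forall>n. sqi mk (k n x)) & sqi mk (%m. unc L (x, m)) & (%n. L2n mk (%m. k n x m - unc L (x, m))) ----> 0)} <= N"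
  unfolding eventually_ae_filter by auto
 have good: "sqi mk (k n x)" "sqi mk (%m. unc L (x, m))" "(%n. L2n mk (%m. k n x m - unc L (x, m))) ----> 0"
  if "x : space (dtP B)" "x \<notin> N" for n x using N(2) that by auto
 let ?l = "%x e. L (fst x) (snd x) (Some e)"
 have km: "(%x. if x : N then (%_. 0) else ?l x) : measurable (dtP B) (borel_L2mu B)"
 proof (rule limit_measurable_L2mu[where k = "%n x e. k n x (Some e)"])
  show "(%x e. k n x (Some e)) : measurable (dtP B) (count_space UNIV)" for n
   by (rule measurable_compose[OF k(1)]) simp
  fix x assume x: "x : space (dtP B)" "x \<notin> N"
  show "sqi (mark B) (%e. k n x (Some e))" for n by (rule sqi_mk[OF good(1)[OF x]])
  show "sqi (mark B) (?l x)" using sqi_mk[OF good(2)[OF x]] by simp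
  have "L2n (mark B) (%e. k n x (Some e) - ?l x e) <= L2n mk (%m. k n x m - unc L (x, m))" for n
   using L2n_mk[OF sqi_measurable[OF sqi_diff[OF good(1,2)[OF x]]], of n] by simp
  thus "(%n. L2n (mark B) (%e. k n x (Some e) - ?l x e)) ----> 0"
   by (intro tendsto_sandwich[OF _ _ tendsto_const good(3)[OF x]]) simp_all
 qed (use N(1) in auto)
 have Z: "(%x. L (fst x) (snd x) None) : Bor (dtP B)"
  using predictable_dtP[of "%t w. L t w None"] L by (simp add: intg_iff H2_def case_prod_beta')
 have "(%x. (x, (X (fst x) (snd x), L (fst x) (snd x) None), if x : N then (%_. 0) else ?l x))
   : measurable (dtP B) (pred_sigma B \<otimes> (borel \<otimes> borel) \<otimes> borel_L2mu B)"
  by (intro measurable_Pair pred_dtP X Z km)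
 note cm = measurable_compose[OF this]
 have "(%((t, w), (y, z), k). g t w y z k) : Bor (pred_sigma B \<otimes> (borel \<otimes> borel) \<otimes> borel_L2mu B)"
  using driver by (simp add: lipschitz_driver_def)
 from cm[OF this] have a: "(%x. g (fst x) (snd x) (X (fst x) (snd x)) (L (fst x) (snd x) None) (if x : N then (%_. 0) else ?l x)) : Bor (dtP B)"
  by (simp add: case_prod_beta')
 have b: "AE x in dtP B. g (fst x) (snd x) (X (fst x) (snd x)) (L (fst x) (snd x) None) (if x : N then (%_. 0) else ?l x) = G X L x"
  using AE_not_in[OF N(1)] by eventually_elim simp
 show ?thesis by (rule bexI[of "%f. AE x in dtP B. f x = G X L x", OF b a])
qed

text \<open>A measurable version of the driver along \<open>(X, L)\<close>.\<close>

definition DG :: "(real => 'w => real) => (real => 'w => 'e option => real) => real \<times> 'w => real" where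
 "DG X L = (SOME f. f : Bor (dtP B) & (AE x in dtP B. f x = G X L x))"

definition K :: real where
 "K = (SOME K. 0 <= K & (AE (t, w) in dtP B. \<forall>y1 y2 z1 z2. \<forall>k1\<in>L2mu B. \<forall>k2\<in>L2mu B.
    abs (g t w y1 z1 k1 - g t w y2 z2 k2) <= K * (abs (y1 - y2) + abs (z1 - z2) + norm_mu B (%e. k1 e - k2 e))))"

lemma K: "0 <= K" "AE x in dtP B. \<forall>y1 y2 z1 z2. \<forall>k1\<in>L2mu B. \<forall>k2\<in>L2mu B.
    abs (g (fst x) (snd x) y1 z1 k1 - g (fst x) (snd x) y2 z2 k2) <= K * (abs (y1 - y2) + abs (z1 - z2) + norm_mu B (%e. k1 e - k2 e))"
proof -
 have "0 <= K & (AE (t, w) in dtP B. \<forall>y1 y2 z1 z2. \<forall>k1\<in>L2mu B. \<forall>k2\<in>L2mu B.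
    abs (g t w y1 z1 k1 - g t w y2 z2 k2) <= K * (abs (y1 - y2) + abs (z1 - z2) + norm_mu B (%e. k1 e - k2 e)))"
  unfolding K_def by (rule someI_ex) (use driver in "auto simp: lipschitz_driver_def")
 thus "0 <= K" "AE x in dtP B. \<forall>y1 y2 z1 z2. \<forall>k1\<in>L2mu B. \<forall>k2\<in>L2mu B.
    abs (g (fst x) (snd x) y1 z1 k1 - g (fst x) (snd x) y2 z2 k2) <= K * (abs (y1 - y2) + abs (z1 - z2) + norm_mu B (%e. k1 e - k2 e))"
  by (auto simp: case_prod_beta')
qed

abbreviation tmeas :: "(real => 'w => real) => bool" where
 "tmeas X \<equiv> (%x. X (fst x) (snd x)) : Bor (dtP B)"

lemma arc_tmeas: "arc X ==> tmeas X"
 using arc_dtP[of X] by (simp add: case_prod_beta')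

lemma DG: "DG X L : Bor (dtP B)" "AE x in dtP B. DG X L x = G X L x" if "tmeas X" "C.intg L"
proof -
 have "DG X L : Bor (dtP B) & (AE x in dtP B. DG X L x = G X L x)"
  unfolding DG_def by (rule someI_ex[of "%f. f : Bor (dtP B) & (AE x in dtP B. f x = G X L x)"])
   (use driver_measurable[OF that] in blast)
 thus "DG X L : Bor (dtP B)" "AE x in dtP B. DG X L x = G X L x" by auto
qed

lemma DG_Lipschitz:
 assumes X: "tmeas X" "tmeas X'" and L: "C.intg L" "C.intg L'"
 shows "AE x in dtP B. ennreal ((DG X L x - DG X' L' x)^2)
   <= ennreal (3 * K^2) * (ennreal ((X (fst x) (snd x) - X' (fst x) (snd x))^2) + L2n mk (%m. unc L (x, m) - unc L' (x, m)))"
 using DG(2)[OF X(1) L(1)] DG(2)[OF X(2) L(2)] K(2) C.sqi_section[OF C.intg_Q[OF L(1)]] C.sqi_section[OF C.intg_Q[OF L(2)]]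
proof eventually_elim
 case (elim x)
 define y where "y = X (fst x) (snd x) - X' (fst x) (snd x)"
 define z where "z = L (fst x) (snd x) None - L' (fst x) (snd x) None"
 let ?k = "%e. L (fst x) (snd x) (Some e)" and ?k' = "%e. L' (fst x) (snd x) (Some e)"
 define n where "n = norm_mu B (%e. ?k e - ?k' e)"
 have k: "sqi (mark B) ?k" "sqi (mark B) ?k'" using sqi_mk[OF elim(4)] sqi_mk[OF elim(5)] by simp_all
 have "abs (DG X L x - DG X' L' x) <= K * (abs y + abs z + n)"
  using elim(1,2,3) k by (simp add: y_def z_def n_def L2mu_iff)
 hence "abs (DG X L x - DG X' L' x)^2 <= (K * (abs y + abs z + n))^2" by (rule power_mono) simp
 also have "... <= K^2 * (3 * (y^2 + z^2 + n^2))"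
 proof -
  have "(abs y + abs z + n)^2 + ((abs y - abs z)^2 + (abs y - n)^2 + (abs z - n)^2) = 3 * (abs y^2 + abs z^2 + n^2)" by algebra
  hence "(abs y + abs z + n)^2 <= 3 * (y^2 + z^2 + n^2)"
   using zero_le_power2[of "abs y - abs z"] zero_le_power2[of "abs y - n"] zero_le_power2[of "abs z - n"] unfolding power2_abs by linarith
  thus ?thesis by (simp only: power_mult_distrib) (rule mult_left_mono, simp_all)
 qed
 finally have "(DG X L x - DG X' L' x)^2 <= 3 * K^2 * (y^2 + (z^2 + n^2))" by (simp add: algebra_simps)
 moreover have "L2n mk (%m. unc L (x, m) - unc L' (x, m)) = ennreal (z^2) + ennreal (n^2)"
  using L2n_mk[OF sqi_measurable[OF sqi_diff[OF elim(4,5)]]] L2n_norm_mu[OF sqi_diff[OF k]] by (simp add: z_def n_def)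
 ultimately show ?case by (simp add: y_def[symmetric] ennreal_leI flip: ennreal_plus ennreal_mult)
qed

lemma DG_Lipschitz_L2:
 assumes X: "tmeas X" "tmeas X'" and L: "C.intg L" "C.intg L'" and A: "A : sets (dtP B)"
 shows "L2n (dtP B) (%x. (DG X L x - DG X' L' x) * ind A x)
   <= ennreal (3 * K^2) * (L2n (dtP B) (%x. (X (fst x) (snd x) - X' (fst x) (snd x)) * ind A x)
    + L2n C.Q (%x. (unc L x - unc L' x) * ind A (fst x)))"
proof -
 have dm [measurable]: "(%x. (unc L x - unc L' x) * ind A (fst x)) : Bor C.Q"
  by (intro borel_measurable_times borel_measurable_diff sqi_measurable[OF C.intg_Q[OF L(1)]] sqi_measurable[OF C.intg_Q[OF L(2)]]
    measurable_compose[OF measurable_fst borel_measurable_indicator[OF A]])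
 note [measurable] = X A C.L2n_section(2)[OF dm]
 have "L2n (dtP B) (%x. (DG X L x - DG X' L' x) * ind A x)
  <= (\<integral>\<^sup>+x. ennreal (3 * K^2) * (ennreal (((X (fst x) (snd x) - X' (fst x) (snd x)) * ind A x)^2)
     + L2n mk (%m. (unc L (x, m) - unc L' (x, m)) * ind A (fst (x, m)))) \<partial>dtP B)"
  unfolding L2n_def[of "dtP B"]
  by (rule nn_integral_mono_AE) (use DG_Lipschitz[OF X L] in eventually_elim, auto simp: indicator_def L2n_def)
 also have "... = ennreal (3 * K^2) * (L2n (dtP B) (%x. (X (fst x) (snd x) - X' (fst x) (snd x)) * ind A x)
    + L2n C.Q (%x. (unc L x - unc L' x) * ind A (fst x)))"
  using C.L2n_section(1)[OF dm] by (subst nn_integral_cmult, measurable) (subst nn_integral_add, measurable, simp add: L2n_def[of "dtP B"])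
 finally show ?thesis .
qed

lemma zero_intg: "C.intg (%_ _ _. 0)"
 by (simp add: intg_iff zero_H2 zero_H2mu)

lemma DG_sqi:
 assumes X: "tmeas X" "sqi (dtP B) (%x. X (fst x) (snd x))" and L: "C.intg L"
 shows "sqi (dtP B) (DG X L)"
proof -
 let ?D = "DG (%_ _. 0) (%_ _ _. 0)"
 have z: "tmeas (%_ _. 0)" by simp
 have "L2n (dtP B) ?D = L2n (dtP B) (%x. g (fst x) (snd x) 0 0 (%_. 0))"
  using DG(2)[OF z zero_intg] by (intro L2n_cong_AE) (auto elim: eventually_mono)
 also have "... < \<infinity>" using driver by (simp add: lipschitz_driver_def H2_def L2n_def case_prod_beta')
 finally have "sqi (dtP B) ?D" using DG(1)[OF z zero_intg] by (simp add: sqi_def)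
 moreover have "L2n (dtP B) (%x. (DG X L x - ?D x) * ind (space (dtP B)) x) < \<infinity>"
 proof (rule le_less_trans[OF DG_Lipschitz_L2[OF X(1) z L zero_intg sets.top]])
  have "L2n (dtP B) (%x. (X (fst x) (snd x) - 0) * ind (space (dtP B)) x) <= L2n (dtP B) (%x. X (fst x) (snd x))"
   "L2n C.Q (%x. (unc L x - 0) * ind (space (dtP B)) (fst x)) <= L2n C.Q (unc L)"
   by (rule L2n_mono, simp add: indicator_def)+
  moreover have "L2n (dtP B) (%x. X (fst x) (snd x)) < \<infinity>" "L2n C.Q (unc L) < \<infinity>" using X(2) C.intg_Q[OF L] by (simp_all add: sqi_def)
  ultimately show "ennreal (3 * K^2) * (L2n (dtP B) (%x. (X (fst x) (snd x) - 0) * ind (space (dtP B)) x)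
    + L2n C.Q (%x. (unc L x - 0) * ind (space (dtP B)) (fst x))) < \<infinity>"
   by (auto simp: ennreal_mult_less_top intro: le_less_trans)
 qed
 hence "sqi (dtP B) (%x. DG X L x - ?D x)"
  using DG(1)[OF X(1) L] DG(1)[OF z zero_intg] by (simp add: sqi_def L2n_def cong: nn_integral_cong)
 ultimately show ?thesis using sqi_add[of "dtP B" "%x. DG X L x - ?D x" ?D] by simp
qed

lemma AE_time_slices:
 assumes "AE x in dtP B. R x"
 shows "AE w in P. AE s in lborel. s : {0..T} --> R (s, w)"
proof -
 obtain N where N: "N : null_sets (dtP B)" "{x\<in>space (dtP B). \<not> R x} <= N" using assms unfolding eventually_ae_filter by auto
 have "AE s in tm. AE w in P. (s, w) \<notin> N"
  using AE_not_in[OF N(1)] unfolding dtP_def by (rule tmP.AE_pair)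
 hence "AE w in P. AE s in tm. (s, w) \<notin> N"
  using N(1) by (subst (asm) tmP.AE_commute) (auto simp: dtP_def null_sets_def intro!: predE)
 thus ?thesis using AE_space
 proof eventually_elim
  case (elim w)
  hence "AE s in lborel. s : {0..T} --> (s, w) \<notin> N" by (subst (asm) AE_restrict_space_iff) auto
  thus ?case
  proof eventually_elim
   case (elim s)
   show ?case
   proof
    assume "s : {0..T}"
    hence "(s, w) : space (dtP B)" "(s, w) \<notin> N" using elim \<open>w : \<Omega>\<close> by (auto simp: space_dtP)
    thus "R (s, w)" using N(2) by blast
   qed
  qed
 qed
qed

lemma DG_slices:
 assumes f: "sqi (dtP B) f"
 shows "AE w in P. sqi tm (%s. f (s, w))"
  and "(\<integral>\<^sup>+w. L2n tm (%s. f (s, w)) \<partial>P) = L2n (dtP B) f"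
proof -
 have m [measurable]: "f : Bor (tm \<otimes> P)" using f by (simp add: sqi_def dtP_def)
 show i: "(\<integral>\<^sup>+w. L2n tm (%s. f (s, w)) \<partial>P) = L2n (dtP B) f"
  unfolding L2n_def dtP_def by (rule tmP.nn_integral_snd) measurable
 have "AE w in P. L2n tm (%s. f (s, w)) \<noteq> \<infinity>"
 proof (rule nn_integral_PInf_AE)
  show "(%w. L2n tm (%s. f (s, w))) : Bor P"
   unfolding L2n_def by (rule tm.borel_measurable_nn_integral) measurable
  show "(\<integral>\<^sup>+w. L2n tm (%s. f (s, w)) \<partial>P) \<noteq> \<infinity>" using f by (simp add: i sqi_def less_top)
 qed
 thus "AE w in P. sqi tm (%s. f (s, w))"
  using AE_space by eventually_elim (auto simp: sqi_def less_top intro: measurable_Pair1[OF m])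
qed

lemma drift_DG:
 assumes X: "tmeas X" "sqi (dtP B) (%x. X (fst x) (snd x))" and L: "C.intg L"
 shows "AE w in P. sqi tm (%s. DG X L (s, w)) & (\<forall>a b. 0 <= a --> b <= T -->
   drift g X (%t w. L t w None) (%t w e. L t w (Some e)) a b w = (LINT s:{a..b}|lborel. DG X L (s, w)))"
 using AE_time_slices[OF DG(2)[OF X(1) L]] DG_slices(1)[OF DG_sqi[OF assms]]
proof eventually_elim
 case (elim w)
 have m: "(%s. DG X L (s, w)) : Bor tm" using elim(2) by (rule sqi_measurable)
 have "drift g X (%t w. L t w None) (%t w e. L t w (Some e)) a b w = (LINT s:{a..b}|lborel. DG X L (s, w))"
  if ab: "0 <= a" "b <= T" for a b
 proof -
  let ?f = "%s. ind {a..b} s *\<^sub>R DG X L (s, w)" and ?h = "%s. ind {a..b} s *\<^sub>R G X L (s, w)"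
  have "(%s. ind {0..T} s *\<^sub>R DG X L (s, w)) : Bor lborel"
   using m by (subst (asm) borel_measurable_restrict_space_iff) auto
  hence "(%s. ind {a..b} s *\<^sub>R (ind {0..T} s *\<^sub>R DG X L (s, w))) : Bor lborel" by measurable
  moreover have "(%s. ind {a..b} s *\<^sub>R (ind {0..T} s *\<^sub>R DG X L (s, w))) = ?f" using ab by (auto simp: fun_eq_iff indicator_def)
  ultimately have fm: "?f : Bor lborel" by simp
  have ae: "AE s in lborel. ?f s = ?h s" using elim(1) by eventually_elim (use ab in "auto simp: indicator_def")
  have fl: "?f : Bor lebesgue" by (rule measurable_completion[OF fm])
  have ael: "AE s in lebesgue. ?f s = ?h s" by (rule AE_completion[OF ae])
  have "integral\<^sup>L lebesgue ?h = integral\<^sup>L lebesgue ?f"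
   using borel_measurable_AE[OF fl ael] fl ael by (intro integral_cong_AE) (auto elim: eventually_mono)
  also have "... = integral\<^sup>L lborel ?f" by (rule integral_completion[OF fm])
  finally show ?thesis by (simp add: drift_def set_lebesgue_integral_def)
 qed
 with elim(2) show ?case by blast
qed

end

section \<open>Stability over a short stochastic interval\<close>

context integrator begin

lemma is_int_zero: assumes L: "intg L" "is_int L I" shows "AE w in P. I 0 w = 0"
proof -
 have "L2n P (I 0) = L2n Q (%x. unc L x * ind {..0} (fst (fst x)))"
  by (rule is_int_isometry[OF L]) (simp add: T_nonneg)
 also have "... = L2n Q (%x. 0)"
  by (rule L2n_cong_AE) (use AE_time_pos in "eventually_elim, auto")
 finally have "L2n P (I 0) = 0" by (simp add: L2n_def)
 thus ?thesis using sqi_measurable[OF is_int_sqi[OF L(2), of 0]] T_nonneg by (subst (asm) L2n_zero_iff) auto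
qed

lemma is_int_stop_sqi:
 assumes L: "intg L" "is_int L I" and \<sigma>: "bst \<sigma>"
 shows "sqi P (%w. I (\<sigma> w) w)"
proof (rule sqi_bound[OF is_int_sqi[OF is_int_stopped[OF L \<sigma>], of T]])
 show "(%w. I (\<sigma> w) w) : Bor P" by (rule arc_at_stop_P[OF is_int_arc[OF L(2)] \<sigma>])
qed (use \<sigma> in "auto simp: T_nonneg bst_def min_absorb2")

lemma is_int_zero_mean:
 assumes L: "intg L" "is_int L I" and \<sigma>: "bst \<sigma>"
 shows "(\<E> w. I (\<sigma> w) w) = 0"
proof -
 have m: "mart (%t w. I (min t (\<sigma> w)) w)" by (rule is_int_mart[OF intg_until[OF L(1) \<sigma>] is_int_stopped[OF L \<sigma>]])
 have "(\<E> w. 1 * (I (min T (\<sigma> w)) w - I (min 0 (\<sigma> w)) w)) = 0"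
  by (rule mart_zero[OF m]) (auto simp: T_nonneg sqi_const[OF finite_measure_axioms])
 moreover have "(\<E> w. I (\<sigma> w) w) = (\<E> w. 1 * (I (min T (\<sigma> w)) w - I (min 0 (\<sigma> w)) w))"
 proof (rule integral_cong_AE)
  show "AE w in P. I (\<sigma> w) w = 1 * (I (min T (\<sigma> w)) w - I (min 0 (\<sigma> w)) w)"
   using is_int_zero[OF L] AE_space by eventually_elim (use \<sigma> in "simp add: bst_def min_absorb1 min_absorb2")
 qed (use mart_sqi[OF m, of T] mart_sqi[OF m, of 0] is_int_stop_sqi[OF L \<sigma>] T_nonneg in "auto simp: sqi_def")
 ultimately show ?thesis by simp
qed

text \<open>Apply the vanishing mean of the stopped integral to \<open>\<sigma>\<close> restricted to a set of its past; this identifies the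
 conditional expectation of the final value.\<close>

lemma optional_stopping:
 assumes L: "intg L" "is_int L I" and \<sigma>: "bst \<sigma>" and Y: "Y : Bor (pre_sigma \<sigma>)" "sqi P Y"
 shows "(\<E> w. Y w * I T w) = (\<E> w. Y w * I (\<sigma> w) w)"
proof -
 have sub: "sets (pre_sigma \<sigma>) <= sets P" using pre_sigma_sub[OF bst_stopping[OF \<sigma>] bst_le[OF \<sigma>]] subalg[of T] by blast
 interpret s: finite_measure_subalgebra P "pre_sigma \<sigma>"
  by unfold_locales (auto simp: subalgebra_def space_pre_sigma sub)
 have iT: "integrable P (I T)" and i\<sigma>: "integrable P (%w. I (\<sigma> w) w)"
  using is_int_sqi[OF L(2), of T] is_int_stop_sqi[OF L \<sigma>] T_nonneg by (auto intro: P_integrable)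
 have e: "AE w in P. real_cond_exp P (pre_sigma \<sigma>) (I T) w = I (\<sigma> w) w"
 proof (rule s.real_cond_exp_charact[OF _ iT i\<sigma> arc_at_stop_pre_sigma[OF is_int_arc[OF L(2)] \<sigma>]])
  fix A assume A: "A : sets (pre_sigma \<sigma>)"
  hence AP: "A : sets P" using sub by blast
  have "(\<E> w. I (if w : A then \<sigma> w else T) w) = 0" by (rule is_int_zero_mean[OF L bst_restrict[OF \<sigma> A]])
  moreover have "(\<E> w. I T w) = 0" by (rule is_int_zero_mean[OF L bst_const]) (auto simp: T_nonneg)
  moreover have "(\<E> w. I (if w : A then \<sigma> w else T) w) = (\<E> w. I T w + (ind A w *\<^sub>R I (\<sigma> w) w - ind A w *\<^sub>R I T w))"
   by (rule Bochner_Integration.integral_cong) (auto simp: indicator_def)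
  moreover have "integrable P (%w. ind A w *\<^sub>R I (\<sigma> w) w)" "integrable P (%w. ind A w *\<^sub>R I T w)"
   by (rule integrable_mult_indicator[OF AP i\<sigma>], rule integrable_mult_indicator[OF AP iT])
  ultimately show "(\<integral>w\<in>A. I T w \<partial>P) = (\<integral>w\<in>A. I (\<sigma> w) w \<partial>P)"
   using iT by (simp add: set_lebesgue_integral_def)
 qed
 have yT: "integrable P (%w. Y w * I T w)" using is_int_sqi[OF L(2), of T] T_nonneg by (intro sqi_prod Y) auto
 have "(\<E> w. Y w * I T w) = (\<E> w. Y w * real_cond_exp P (pre_sigma \<sigma>) (I T) w)"
  by (rule s.real_cond_exp_intg(2)[OF yT Y(1), symmetric]) (use iT in auto)
 also have "... = (\<E> w. Y w * I (\<sigma> w) w)"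
  using e pre_sigma_imp_P[OF \<sigma> Y(1)] i\<sigma> by (intro integral_cong_AE) (auto elim: eventually_mono)
 finally show ?thesis .
qed

lemma increment_orthogonal_past:
 assumes L: "intg L" "is_int L I" and \<sigma>: "bst \<sigma>" "bst \<rho>" "!!w. w : \<Omega> ==> \<sigma> w <= \<rho> w"
  and Y: "Y : Bor (pre_sigma \<sigma>)" "sqi P Y"
 shows "(\<E> w. Y w * (I (\<rho> w) w - I (\<sigma> w) w)) = 0"
proof -
 have "(\<E> w. Y w * I (\<rho> w) w) = (\<E> w. Y w * I (\<sigma> w) w)"
  using optional_stopping[OF L \<sigma>(1) Y] optional_stopping[OF L \<sigma>(2) pre_sigma_mono[OF \<sigma> Y(1)] Y(2)] by simp
 thus ?thesis
  using sqi_prod[OF Y(2) is_int_stop_sqi[OF L \<sigma>(1)]] sqi_prod[OF Y(2) is_int_stop_sqi[OF L \<sigma>(2)]] by (simp add: right_diff_distrib)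
qed

text \<open>The increment is the integral of the integrand restricted to \<open>(\<sigma>, \<rho>]\<close>.\<close>

lemma stopped_increment_isometry:
 assumes L: "intg L" "is_int L I" and \<sigma>: "bst \<sigma>" "bst \<rho>" "!!w. w : \<Omega> ==> \<sigma> w <= \<rho> w"
 shows "L2n P (%w. I (\<rho> w) w - I (\<sigma> w) w) = L2n Q (%x. unc L x * ind {x\<in>space (dtP B). \<sigma> (snd x) < fst x & fst x <= \<rho> (snd x)} (fst x))"
proof -
 note u = intg_until[OF L(1) \<sigma>(2)] is_int_stopped[OF L \<sigma>(2)] intg_until[OF L(1) \<sigma>(1)] is_int_stopped[OF L \<sigma>(1)]
 have "L2n P (%w. I (\<rho> w) w - I (\<sigma> w) w) = L2n P (%w. I (min T (\<rho> w)) w - I (min T (\<sigma> w)) w)"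
  by (rule L2n_cong_AE, rule AE_I2) (use \<sigma> in "simp add: bst_def min_absorb2")
 also have "... = L2n Q (unc (%t w e. upto_stop L \<rho> t w e - upto_stop L \<sigma> t w e))"
  by (rule is_int_isometry_T[OF intg_diff[OF u(1,3)] is_int_diff[OF u]])
 also have "... = L2n Q (%x. unc L x * ind {x\<in>space (dtP B). \<sigma> (snd x) < fst x & fst x <= \<rho> (snd x)} (fst x))"
  by (rule L2n_cong_AE, rule AE_I2) (use \<sigma>(3) in "fastforce simp: space_Q space_dtP indicator_def")
 finally show ?thesis .
qed

end

context bsde begin

text \<open>The martingale part.\<close>

definition M :: "(real => 'w => 'e option => real) => real => 'w => real" where
 "M L t w = ito_integral B (%t w. L t w None) t w + jump_integral B (%t w e. L t w (Some e)) t w"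

lemma M: assumes "C.intg L" shows "C.is_int L (M L)"
proof -
 have "fld (%t w. L t w None) (%t w e. L t w (Some e)) = L" by (auto simp: fun_eq_iff split: option.split)
 thus ?thesis using noise_integral[of "%t w. L t w None" "%t w e. L t w (Some e)"] assms by (simp add: intg_iff M_def[abs_def])
qed

text \<open>The drift part, for a version of the driver.\<close>

definition J :: "(real => 'w => real) => (real => 'w => 'e option => real) => real => 'w => real" where
 "J X L t w = (LINT s:{0..t}|lborel. DG X L (s, w))"

text \<open>A backward equation on \<open>[\<rho>, \<rho>']\<close> says that the following process is constant there.\<close>

definition N :: "(real => 'w => real) => (real => 'w => 'e option => real) => real => 'w => real" where
 "N X L t w = X t w + J X L t w - M L t w"

text \<open>\<open>(X, L)\<close> solves the equation between the two stopping times.\<close>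

definition sol :: "('w => real) => ('w => real) => (real => 'w => real) => (real => 'w => 'e option => real) => bool" where
 "sol \<rho> \<rho>' X L <-> X : D2 B & C.intg L & (AE w in P. \<forall>t\<in>{\<rho> w..\<rho>' w}. N X L t w = N X L (\<rho>' w) w)"

lemma D2_arc: "X : D2 B ==> arc X" by (simp add: D2_def arc_def)

lemma D2_stop_sqi:
 assumes X: "X : D2 B" and \<sigma>: "bst \<sigma>"
 shows "sqi P (%w. X (\<sigma> w) w)"
proof -
 have "L2n P (%w. X (\<sigma> w) w) <= sup_sq B X"
  unfolding L2n_def sup_sq_def by (rule nn_integral_mono, rule SUP_upper2[OF _ order_refl]) (use \<sigma> in "auto simp: bst_def")
 also have "... < \<infinity>" using X by (simp add: D2_def)
 finally show ?thesis using arc_at_stop_P[OF D2_arc[OF X] \<sigma>] by (simp add: sqi_def)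
qed

lemma D2_dtP: assumes X: "X : D2 B" shows "tmeas X" "sqi (dtP B) (%x. X (fst x) (snd x))"
proof -
 show m: "tmeas X" by (rule arc_tmeas[OF D2_arc[OF X]])
 have "L2n (dtP B) (%x. X (fst x) (snd x)) = (\<integral>\<^sup>+t. L2n P (X t) \<partial>tm)"
  using m unfolding L2n_def dtP_def by (subst nn_integral_fst[symmetric]) (auto intro!: measurable_compose[OF _ measurable_ennreal] borel_measurable_power)
 also have "... <= (\<integral>\<^sup>+t. sup_sq B X \<partial>tm)"
 proof (rule nn_integral_mono)
  fix t assume "t : space tm"
  thus "L2n P (X t) <= sup_sq B X"
   unfolding L2n_def sup_sq_def by (intro nn_integral_mono SUP_upper2[of t]) (auto simp: space_restrict_space)
 qed
 also have "... < \<infinity>"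
 proof -
  have "emeasure tm {0..T} < \<top>" unfolding less_top[symmetric] by simp
  thus ?thesis using X by (simp add: D2_def ennreal_mult_less_top)
 qed
 finally show "sqi (dtP B) (%x. X (fst x) (snd x))" using m by (simp add: sqi_def)
qed

lemma D2_diff: "X : D2 B ==> X' : D2 B ==> arc (%t w. X t w - X' t w)"
 by (intro arc_diff D2_arc)

lemma slice_measurable:
 assumes "f : Bor (dtP B)"
 shows "(%w. L2n tm (%s. f (s, w))) : Bor P"
proof -
 have [measurable]: "f : Bor (tm \<otimes> P)" using assms by (simp add: dtP_def)
 show ?thesis unfolding L2n_def by (rule tm.borel_measurable_nn_integral) measurable
qed

lemma sqi_tm_indicator:
 assumes f: "sqi tm f" and A: "A : sets borel"
 shows "sqi tm (%s. ind A s * f s)"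
proof (rule sqi_bound[OF f])
 have "ind A : Bor tm" using A by (intro measurable_restrict_space1) simp
 thus "(%s. ind A s * f s) : Bor tm" by (rule borel_measurable_times[OF _ sqi_measurable[OF f]])
qed (simp add: indicator_def)

text \<open>Integrals over \<open>[a, b]\<close> and over \<open>(a, b]\<close> agree since a single time is a null set.\<close>

lemma J_increment:
 assumes X: "X : D2 B" and L: "C.intg L"
 shows "AE w in P. sqi tm (%s. DG X L (s, w)) & (\<forall>a b. 0 <= a --> a <= b --> b <= T -->
   drift g X (%t w. L t w None) (%t w e. L t w (Some e)) a b w = J X L b w - J X L a w &
   J X L b w - J X L a w = (\<integral>s. ind {a<..b} s * DG X L (s, w) \<partial>tm))"
 using drift_DG[OF D2_dtP[OF X] L]
proof eventually_elim
 case (elim w)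
 let ?f = "%s. DG X L (s, w)"
 have *: "(LINT s:A|lborel. ?f s) = (\<integral>s. ind A s * ?f s \<partial>tm)" if "A : sets borel" "A <= {0..T}" for A
 proof -
  have "(\<integral>s. ind A s * ?f s \<partial>tm) = (\<integral>s. ind {0..T} s *\<^sub>R (ind A s * ?f s) \<partial>lborel)"
   by (subst integral_restrict_space) (auto simp: set_lebesgue_integral_def)
  also have "... = (LINT s:A|lborel. ?f s)"
   unfolding set_lebesgue_integral_def using that by (intro Bochner_Integration.integral_cong) (auto simp: indicator_def)
  finally show ?thesis by simp
 qed
 have ii: "integrable tm (%s. ind A s * ?f s)" if "A : sets borel" for A
  using elim that by (intro sqi_integrable[OF tm.finite_measure_axioms] sqi_tm_indicator) auto
 have "drift g X (%t w. L t w None) (%t w e. L t w (Some e)) a b w = J X L b w - J X L a w &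
   J X L b w - J X L a w = (\<integral>s. ind {a<..b} s * ?f s \<partial>tm)" if ab: "0 <= a" "a <= b" "b <= T" for a b
 proof -
  have "J X L b w = (\<integral>s. ind {0..b} s * ?f s \<partial>tm)" "J X L a w = (\<integral>s. ind {0..a} s * ?f s \<partial>tm)"
   unfolding J_def using ab by (auto intro!: *)
  hence "J X L b w - J X L a w = (\<integral>s. ind {0..b} s * ?f s - ind {0..a} s * ?f s \<partial>tm)" using ii by simp
  also have "... = (\<integral>s. ind {a<..b} s * ?f s \<partial>tm)"
   using ab by (intro Bochner_Integration.integral_cong) (auto simp: indicator_def space_restrict_space)
  finally have 1: "J X L b w - J X L a w = (\<integral>s. ind {a<..b} s * ?f s \<partial>tm)" .
  have "drift g X (%t w. L t w None) (%t w e. L t w (Some e)) a b w = (LINT s:{a..b}|lborel. ?f s)" using elim ab by simp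
  also have "(LINT s:{a..b}|lborel. ?f s) = (LINT s:{a<..b}|lborel. ?f s)"
  proof -
   have "(\<integral>s. ind {a..b} s * ?f s \<partial>tm) = (\<integral>s. ind {a<..b} s * ?f s \<partial>tm)"
   proof (rule integral_cong_AE)
    have "AE s in lborel. s \<noteq> a" by (rule AE_lborel_singleton)
    hence "AE s in tm. s \<noteq> a" by (subst AE_restrict_space_iff) (auto elim: eventually_mono)
    thus "AE s in tm. ind {a..b} s * ?f s = ind {a<..b} s * ?f s"
     by eventually_elim (auto simp: indicator_def)
   qed (use ii in "auto intro: borel_measurable_integrable")
   moreover have "{a..b} <= {0..T}" "{a<..b} <= {0..T}" using ab by auto
   ultimately show ?thesis by (simp add: *)
  qed
  finally have 2: "drift g X (%t w. L t w None) (%t w e. L t w (Some e)) a b w = (LINT s:{a<..b}|lborel. ?f s)" .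
  have "{a<..b} <= {0..T}" using ab by auto
  thus ?thesis using 1 2 by (simp add: *)
 qed
 with elim show ?case by blast
qed

abbreviation E2 :: "('w => real) => real" where "E2 f \<equiv> (\<E> w. (f w)^2)"

lemma pythagoras:
 assumes "sqi P f" "sqi P h" "(\<E> w. f w * h w) = 0"
 shows "E2 (%w. f w + h w) = E2 f + E2 h"
proof -
 have "E2 (%w. f w + h w) = (\<E> w. (f w)^2 + (2 * (f w * h w) + (h w)^2))"
  by (rule Bochner_Integration.integral_cong) (auto simp: power2_sum)
 thus ?thesis using assms sqi_prod[OF assms(1,2)] by (simp add: sqi_integrable_square)
qed

lemma E2_add_le:
 assumes f: "sqi P f" and h: "sqi P h"
 shows "E2 (%w. f w + h w) <= 2 * E2 f + 2 * E2 h"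
proof -
 have "ennreal (E2 (%w. f w + h w)) <= ennreal (2 * E2 f + 2 * E2 h)"
  using L2n_add_le[OF f[THEN sqi_measurable] h[THEN sqi_measurable]]
  unfolding L2n_eq_integral[OF f] L2n_eq_integral[OF h] L2n_eq_integral[OF sqi_add[OF f h]] by (subst (asm) ennreal_double) simp_all
 thus ?thesis by (subst (asm) ennreal_le_iff) simp_all
qed

lemma sol_restrict:
 assumes "sol \<rho> \<rho>' X L" "!!w. w : \<Omega> ==> \<rho> w <= \<sigma> w" "!!w. w : \<Omega> ==> \<sigma>' w <= \<rho>' w"
 shows "sol \<sigma> \<sigma>' X L"
proof -
 have "AE w in P. \<forall>t\<in>{\<rho> w..\<rho>' w}. N X L t w = N X L (\<rho>' w) w" using assms(1) by (simp add: sol_def)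
 hence "AE w in P. \<forall>t\<in>{\<sigma> w..\<sigma>' w}. N X L t w = N X L (\<sigma>' w) w"
  using AE_space
 proof eventually_elim
  case (elim w)
  show ?case
  proof
   fix t assume "t : {\<sigma> w..\<sigma>' w}"
   hence "t : {\<rho> w..\<rho>' w}" "\<sigma>' w : {\<rho> w..\<rho>' w}" using assms(2,3)[OF elim(2)] by auto
   thus "N X L t w = N X L (\<sigma>' w) w" using elim(1) by metis
  qed
 qed
 with assms(1) show ?thesis by (simp add: sol_def)
qed

text \<open>The energy estimate on a short stochastic interval. The difference of two solutions is orthogonal to the later increment of
 the difference of the martingale parts, so the second moments of both are controlled by the terminal difference and the drift;
 on an interval of length at most \<open>h\<close> the Lipschitz drift costs only a multiple of \<open>h\<close> of the same quantities. If the terminal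
 difference is known at \<open>\<rho>\<close>, it may be subtracted first, and the remaining change is a small fraction of it.\<close>

lemma local_stability:
 assumes X: "sol \<rho> \<rho>' X L" and X': "sol \<rho> \<rho>' X' L'" and \<rho>: "bst \<rho>" "bst \<rho>'" "!!w. w : \<Omega> ==> \<rho> w <= \<rho>' w"
  and ab: "!!w t. w : \<Omega> ==> \<rho> w < t ==> t <= \<rho>' w ==> a < t & t <= b" "a <= b" "b - a <= h" "h <= 1" "96 * h * K^2 <= 1"
 shows "E2 (%w. X (\<rho> w) w - X' (\<rho> w) w) <= 4 * E2 (%w. X (\<rho>' w) w - X' (\<rho>' w) w)"
  and "(%w. X (\<rho>' w) w - X' (\<rho>' w) w) : Bor (pre_sigma \<rho>) ==>
   E2 (%w. (X (\<rho> w) w - X' (\<rho> w) w) - (X (\<rho>' w) w - X' (\<rho>' w) w)) <= 1 / 4 * E2 (%w. X (\<rho>' w) w - X' (\<rho>' w) w)"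
proof -
 note D = X[unfolded sol_def] X'[unfolded sol_def]
 have X2: "X : D2 B" "X' : D2 B" and L: "C.intg L" "C.intg L'" using D by auto
 define d where "d t w = X t w - X' t w" for t w
 define m where "m t w = M L t w - M L' t w" for t w
 define q where "q x = DG X L x - DG X' L' x" for x
 let ?L = "%t w e. L t w e - L' t w e"
 let ?A = "{x\<in>space (dtP B). \<rho> (snd x) < fst x & fst x <= \<rho>' (snd x)}"
 have d_arc: "arc d" unfolding d_def[abs_def] by (rule D2_diff[OF X2])
 have d_sq: "sqi P (%w. d (\<sigma> w) w)" if "bst \<sigma>" for \<sigma> unfolding d_def by (intro sqi_diff D2_stop_sqi X2 that)
 have iL: "C.intg ?L" by (rule C.intg_diff[OF L])
 have m_int: "C.is_int ?L m" unfolding m_def[abs_def] by (rule C.is_int_diff[OF L(1) M[OF L(1)] L(2) M[OF L(2)]])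
 have m_sq: "sqi P (%w. m (\<sigma> w) w)" if "bst \<sigma>" for \<sigma> by (rule C.is_int_stop_sqi[OF iL m_int that])
 have q_sq: "sqi (dtP B) q"
  unfolding q_def[abs_def] by (intro sqi_diff DG_sqi D2_dtP X2 L)
 have [measurable]: "\<rho> : Bor P" "\<rho>' : Bor P" by (intro bst_measurable \<rho>)+
 have A [measurable]: "?A : sets (dtP B)" by measurable
 have dD: "sqi (dtP B) (%x. d (fst x) (snd x))" unfolding d_def by (intro sqi_diff D2_dtP X2)
 have dA: "sqi (dtP B) (%x. d (fst x) (snd x) * ind ?A x)"
  using sqi_mult_indicator[OF dD A] by (simp add: mult.commute)
 define v where "v = (\<integral>x. (d (fst x) (snd x) * ind ?A x)^2 \<partial>dtP B)"
 define mm where "mm = E2 (%w. m (\<rho>' w) w - m (\<rho> w) w)"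
 define e where "e = E2 (%w. d (\<rho>' w) w)"
 have h: "0 <= h" using ab by linarith
 have nn: "0 <= v" "0 <= mm" "0 <= e" by (auto simp: v_def mm_def e_def)
 have qA: "L2n (dtP B) (%x. q x * ind ?A x) <= ennreal (3 * K^2 * (v + mm))"
 proof -
  have "L2n (dtP B) (%x. q x * ind ?A x) <= ennreal (3 * K^2) * (ennreal v + ennreal mm)"
   using DG_Lipschitz_L2[OF D2_dtP(1)[OF X2(1)] D2_dtP(1)[OF X2(2)] L A] L2n_eq_integral[OF dA]
    C.stopped_increment_isometry[OF iL m_int \<rho>] L2n_eq_integral[OF sqi_diff[OF m_sq[OF \<rho>(2)] m_sq[OF \<rho>(1)]]]
   by (simp add: q_def d_def v_def mm_def)
  thus ?thesis using nn by (simp add: ennreal_mult'[symmetric] flip: ennreal_plus)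
 qed
 have AEeq: "AE w in P. (\<forall>\<sigma>. \<rho> w <= \<sigma> --> \<sigma> <= \<rho>' w -->
   (d \<sigma> w + (m (\<rho>' w) w - m \<sigma> w) - d (\<rho>' w) w)^2 <= h * (\<integral>s. (q (s, w) * ind ?A (s, w))^2 \<partial>tm)) &
   integrable tm (%s. (q (s, w) * ind ?A (s, w))^2)"
  using J_increment[OF X2(1) L(1)] J_increment[OF X2(2) L(2)] D[THEN conjunct2, THEN conjunct2] AE_space
 proof eventually_elim
  case (elim w)
  note r = bst_ge[OF \<rho>(1) elim(5)] bst_le[OF \<rho>(2) elim(5)]
  have qs: "sqi tm (%s. q (s, w))" unfolding q_def using elim(1,2) by (intro sqi_diff) auto
  have qsA: "sqi tm (%s. q (s, w) * ind ?A (s, w))"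
  proof (rule sqi_bound[OF qs])
   have m1: "(%s. ind {\<rho> w<..\<rho>' w} s * q (s, w)) : Bor tm"
    by (rule sqi_measurable[OF sqi_tm_indicator[OF qs]]) simp
   have m2: "ind {\<rho> w<..\<rho>' w} s * q (s, w) = q (s, w) * ind ?A (s, w)" if "s : space tm" for s
    using that elim(5) by (simp add: indicator_def space_dtP space_restrict_space)
   show "(%s. q (s, w) * ind ?A (s, w)) : Bor tm"
    by (rule iffD1[OF measurable_cong[OF m2] m1])
  qed (auto simp: indicator_def)
  have "(d \<sigma> w + (m (\<rho>' w) w - m \<sigma> w) - d (\<rho>' w) w)^2 <= h * (\<integral>s. (q (s, w) * ind ?A (s, w))^2 \<partial>tm)"
   if \<sigma>: "\<rho> w <= \<sigma>" "\<sigma> <= \<rho>' w" for \<sigma>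
  proof -
   have "N X L \<sigma> w = N X L (\<rho>' w) w" "N X' L' \<sigma> w = N X' L' (\<rho>' w) w" by (rule bspec[OF elim(3)], use \<sigma> in simp) (rule bspec[OF elim(4)], use \<sigma> in simp)
   hence "d \<sigma> w + (m (\<rho>' w) w - m \<sigma> w) - d (\<rho>' w) w
     = (J X L (\<rho>' w) w - J X L \<sigma> w) - (J X' L' (\<rho>' w) w - J X' L' \<sigma> w)"
    by (simp add: N_def d_def m_def algebra_simps)
   also have "... = (\<integral>s. ind {\<sigma><..\<rho>' w} s * DG X L (s, w) \<partial>tm) - (\<integral>s. ind {\<sigma><..\<rho>' w} s * DG X' L' (s, w) \<partial>tm)"
    using elim(1,2) \<sigma> r by simp
   also have "... = (\<integral>s. ind {\<sigma><..\<rho>' w} s * DG X L (s, w) - ind {\<sigma><..\<rho>' w} s * DG X' L' (s, w) \<partial>tm)"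
   proof (rule Bochner_Integration.integral_diff[symmetric])
    have i: "integrable tm (%s. ind {\<sigma><..\<rho>' w} s * f s)" if f: "sqi tm f" for f
     by (rule sqi_integrable[OF tm.finite_measure_axioms sqi_tm_indicator[OF f]]) simp
    show "integrable tm (%s. ind {\<sigma><..\<rho>' w} s * DG X L (s, w))" "integrable tm (%s. ind {\<sigma><..\<rho>' w} s * DG X' L' (s, w))"
     using elim(1,2) by (auto intro: i)
   qed
   also have "... = (\<integral>s. ind {a<..b} s * (ind {\<sigma><..\<rho>' w} s * (q (s, w) * ind ?A (s, w))) \<partial>tm)"
    by (rule Bochner_Integration.integral_cong)
      (use ab(1)[OF elim(5)] \<sigma> elim(5) in "auto simp: indicator_def q_def space_dtP space_restrict_space")
   finally have eq: "d \<sigma> w + (m (\<rho>' w) w - m \<sigma> w) - d (\<rho>' w) w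
    = (\<integral>s. ind {a<..b} s * (ind {\<sigma><..\<rho>' w} s * (q (s, w) * ind ?A (s, w))) \<partial>tm)" (is "?l = (\<integral>s. ?i s * ?q s \<partial>tm)") .
   have qq: "sqi tm ?q" by (rule sqi_tm_indicator[OF qsA]) simp
   have ii: "sqi tm ?i" using sqi_tm_indicator[OF sqi_const[OF tm.finite_measure_axioms, of 1], of "{a<..b}"] by simp
   have "?l^2 <= (\<integral>s. (?i s)^2 \<partial>tm) * (\<integral>s. (?q s)^2 \<partial>tm)"
   proof -
    have "abs ?l^2 <= (sqrt (\<integral>s. (?i s)^2 \<partial>tm) * sqrt (\<integral>s. (?q s)^2 \<partial>tm))^2"
     unfolding eq by (rule power_mono[OF Cauchy_Schwarz_sqi[OF ii qq]]) simp
    thus ?thesis by (simp add: power_mult_distrib)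
   qed
   also have "... <= h * (\<integral>s. (q (s, w) * ind ?A (s, w))^2 \<partial>tm)"
   proof (rule mult_mono)
    have "(\<integral>s. (?i s)^2 \<partial>tm) = (\<integral>s. ind ({a<..b} Int {0..T}) s \<partial>tm)"
     by (rule Bochner_Integration.integral_cong) (auto simp: indicator_def space_restrict_space)
    also have "... = measure tm ({a<..b} Int {0..T})" by (simp add: Int_absorb1)
    also have "... = measure lborel ({a<..b} Int {0..T})" by (simp add: measure_restrict_space)
    also have "... <= measure lborel {a<..b}" by (rule measure_mono_fmeasurable) (use ab(2) in "auto simp: fmeasurable_def")
    also have "... <= h" using ab by simp
    finally show "(\<integral>s. (?i s)^2 \<partial>tm) <= h" .
    show "(\<integral>s. (?q s)^2 \<partial>tm) <= (\<integral>s. (q (s, w) * ind ?A (s, w))^2 \<partial>tm)"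
     by (rule integral_mono[OF sqi_integrable_square[OF qq] sqi_integrable_square[OF qsA]]) (auto simp: indicator_def)
   qed (use h in auto)
   finally show ?thesis .
  qed
  thus ?case using sqi_integrable_square[OF qsA] by blast
 qed
 \<comment> \<open>what the terminal difference and the drift can contribute to the energy\<close>
 let ?R = "2 * e + 6 * h * K^2 * (v + mm)"
 have drift: "sqi P (%w. d (\<sigma> w) w + (m (\<rho>' w) w - m (\<sigma> w) w) - d (\<rho>' w) w)"
  "E2 (%w. d (\<sigma> w) w + (m (\<rho>' w) w - m (\<sigma> w) w) - d (\<rho>' w) w) <= 3 * h * K^2 * (v + mm)"
  if \<sigma>: "bst \<sigma>" "!!w. w : \<Omega> ==> \<rho> w <= \<sigma> w & \<sigma> w <= \<rho>' w" for \<sigma>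
 proof -
  let ?f = "%w. d (\<sigma> w) w + (m (\<rho>' w) w - m (\<sigma> w) w) - d (\<rho>' w) w"
  show s: "sqi P ?f" by (intro sqi_diff sqi_add d_sq m_sq \<sigma> \<rho>)
  have "L2n P ?f <= (\<integral>\<^sup>+w. ennreal h * L2n tm (%s. q (s, w) * ind ?A (s, w)) \<partial>P)"
   unfolding L2n_def
  proof (rule nn_integral_mono_AE)
   show "AE w in P. ennreal ((?f w)^2) <= ennreal h * (\<integral>\<^sup>+s. ennreal ((q (s, w) * ind ?A (s, w))^2) \<partial>tm)"
    using AEeq AE_space
   proof eventually_elim
    case (elim w)
    have "ennreal ((?f w)^2) <= ennreal (h * (\<integral>s. (q (s, w) * ind ?A (s, w))^2 \<partial>tm))"
     using elim(1) \<sigma>(2)[OF elim(2)] by (intro ennreal_leI) blast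
    thus ?case using elim(1) h by (subst nn_integral_eq_integral) (auto simp: ennreal_mult)
   qed
  qed
  also have "... = ennreal h * L2n (dtP B) (%x. q x * ind ?A x)"
  proof -
   have qA': "sqi (dtP B) (%x. q x * ind ?A x)" using sqi_mult_indicator[OF q_sq A] by (simp add: mult.commute)
   show ?thesis using DG_slices(2)[OF qA'] slice_measurable[OF sqi_measurable[OF qA']] by (subst nn_integral_cmult) auto
  qed
  also have "... <= ennreal h * ennreal (3 * K^2 * (v + mm))" by (rule mult_left_mono[OF qA]) simp
  also have "... = ennreal (3 * h * K^2 * (v + mm))" using h nn by (simp add: ennreal_mult'[symmetric] mult_ac)
  finally show "E2 ?f <= 3 * h * K^2 * (v + mm)"
   using h nn unfolding L2n_eq_integral[OF s] by (subst (asm) ennreal_le_iff) auto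
 qed
 have energy: "E2 (%w. d (\<sigma> w) w) + E2 (%w. m (\<rho>' w) w - m (\<sigma> w) w) <= ?R"
  if \<sigma>: "bst \<sigma>" "!!w. w : \<Omega> ==> \<rho> w <= \<sigma> w & \<sigma> w <= \<rho>' w" for \<sigma>
 proof -
  let ?f = "%w. d (\<sigma> w) w + (m (\<rho>' w) w - m (\<sigma> w) w) - d (\<rho>' w) w"
  have "E2 (%w. d (\<sigma> w) w) + E2 (%w. m (\<rho>' w) w - m (\<sigma> w) w) = E2 (%w. d (\<sigma> w) w + (m (\<rho>' w) w - m (\<sigma> w) w))"
   by (intro pythagoras[symmetric] C.increment_orthogonal_past[OF iL m_int] d_sq sqi_diff m_sq \<sigma> \<rho> arc_at_stop_pre_sigma[OF d_arc])
     (use \<sigma> in auto)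
  also have "... = E2 (%w. d (\<rho>' w) w + ?f w)" by simp
  also have "... <= 2 * E2 (%w. d (\<rho>' w) w) + 2 * E2 ?f" by (rule E2_add_le[OF d_sq[OF \<rho>(2)] drift(1)[OF \<sigma>]])
  also have "... <= 2 * e + 2 * (3 * h * K^2 * (v + mm))" unfolding e_def by (intro add_left_mono mult_left_mono drift(2)[OF \<sigma>]) simp_all
  also have "... = ?R" by simp
  finally show ?thesis .
 qed
 \<comment> \<open>integrate the energy estimate over the times of the short interval\<close>
 have v_le: "v <= h * ?R"
 proof -
  have R0: "0 <= ?R" using nn h by simp
  have "ennreal v = (\<integral>\<^sup>+t. (\<integral>\<^sup>+w. ennreal ((d t w * ind ?A (t, w))^2) \<partial>P) \<partial>tm)"
   unfolding v_def L2n_eq_integral[OF dA, symmetric] L2n_def using dA unfolding dtP_def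
   by (subst nn_integral_fst[symmetric]) (auto simp: sqi_def)
  also have "... <= (\<integral>\<^sup>+t. ennreal ?R * ind ({a<..b} Int {0..T}) t \<partial>tm)"
  proof (rule nn_integral_mono)
   fix t assume t: "t : space tm"
   hence t': "0 <= t" "t <= T" by (auto simp: space_restrict_space)
   \<comment> \<open>at time \<open>t\<close> the process is inside the interval, or the indicator vanishes\<close>
   let ?\<sigma> = "%w. min (max t (\<rho> w)) (\<rho>' w)"
   have \<sigma>: "bst ?\<sigma>" by (intro bst_min bst_max bst_const \<rho> t')
   show "(\<integral>\<^sup>+w. ennreal ((d t w * ind ?A (t, w))^2) \<partial>P) <= ennreal ?R * ind ({a<..b} Int {0..T}) t"
   proof (cases "t : {a<..b}")
    case True
    have "(\<integral>\<^sup>+w. ennreal ((d t w * ind ?A (t, w))^2) \<partial>P) <= L2n P (%w. d (?\<sigma> w) w)"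
     unfolding L2n_def by (rule nn_integral_mono) (auto simp: indicator_def max_def min_def)
    also have "... = ennreal (E2 (%w. d (?\<sigma> w) w))" by (rule L2n_eq_integral[OF d_sq[OF \<sigma>]])
    also have "... <= ennreal ?R"
    proof (rule ennreal_leI)
     have "0 <= E2 (%w. m (\<rho>' w) w - m (?\<sigma> w) w)" by simp
     moreover have "E2 (%w. d (?\<sigma> w) w) + E2 (%w. m (\<rho>' w) w - m (?\<sigma> w) w) <= ?R"
      by (rule energy[OF \<sigma>]) (simp add: \<rho>(3))
     ultimately show "E2 (%w. d (?\<sigma> w) w) <= ?R" by linarith
    qed
    finally show ?thesis using True t' by (simp add: indicator_def)
   next
    case False
    have "(\<integral>\<^sup>+w. ennreal ((d t w * ind ?A (t, w))^2) \<partial>P) = (\<integral>\<^sup>+w. 0 \<partial>P)"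
     by (rule nn_integral_cong) (use False ab(1) in "auto simp: indicator_def")
    thus ?thesis by simp
   qed
  qed
  also have "... = ennreal ?R * emeasure tm ({a<..b} Int {0..T})"
   by (rule nn_integral_cmult_indicator) (auto intro: Int_restrict_space)
  also have "... <= ennreal ?R * ennreal h"
  proof (rule mult_left_mono)
   have "emeasure tm ({a<..b} Int {0..T}) = emeasure lborel ({a<..b} Int {0..T})" by (rule emeasure_restrict_space) auto
   also have "... <= emeasure lborel {a<..b}" by (rule emeasure_mono) auto
   also have "... <= ennreal h" using ab by (simp add: ennreal_leI)
   finally show "emeasure tm ({a<..b} Int {0..T}) <= ennreal h" .
  qed simp
  also have "... = ennreal (h * ?R)" using R0 h by (simp add: ennreal_mult'[symmetric] mult.commute)
  finally show ?thesis using R0 h by (subst (asm) ennreal_le_iff) auto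
 qed
 have E0: "0 <= E2 f" for f by simp
 have en: "E2 (%w. d (\<rho> w) w) + mm <= ?R" by (rule energy[OF \<rho>(1), folded mm_def]) (simp add: \<rho>(3))
 have mm_le: "mm <= ?R" using en E0[of "%w. d (\<rho> w) w"] by linarith
 have "h * ?R <= 1 * ?R" using nn h ab(4) by (intro mult_right_mono) auto
 hence "v <= ?R" using v_le unfolding mult_1 by (rule order_trans[rotated])
 from add_mono[OF this mm_le] have "v + mm <= 2 * ?R" by (simp only: mult_2)
 \<comment> \<open>the constant 96 is six times sixteen: the drift is absorbed into the left-hand side\<close>
 moreover have small: "6 * h * K^2 * (v + mm) <= (v + mm) / 16"
  using mult_right_mono[OF ab(5), of "v + mm"] nn by (simp add: mult_ac)
 ultimately have vw: "v + mm <= 8 * e" using nn by argo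
 show 1: "E2 (%w. X (\<rho> w) w - X' (\<rho> w) w) <= 4 * E2 (%w. X (\<rho>' w) w - X' (\<rho>' w) w)"
 proof -
  have "E2 (%w. d (\<rho> w) w) <= 4 * e" using en nn vw small by argo
  thus ?thesis by (simp add: d_def e_def)
 qed
 assume me: "(%w. X (\<rho>' w) w - X' (\<rho>' w) w) : Bor (pre_sigma \<rho>)"
 let ?c = "%w. d (\<rho> w) w - d (\<rho>' w) w"
 have "E2 ?c + mm = E2 (%w. ?c w + (m (\<rho>' w) w - m (\<rho> w) w))"
  unfolding mm_def by (intro pythagoras[symmetric] C.increment_orthogonal_past[OF iL m_int \<rho>] sqi_diff d_sq m_sq \<rho> borel_measurable_diff
     arc_at_stop_pre_sigma[OF d_arc] me[folded d_def])
 also have "... = E2 (%w. d (\<rho> w) w + (m (\<rho>' w) w - m (\<rho> w) w) - d (\<rho>' w) w)" by (simp add: algebra_simps)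
 also have "... <= 3 * h * K^2 * (v + mm)" by (rule drift(2)[OF \<rho>(1)]) (use \<rho>(3) in auto)
 also have "... <= e / 4" using small vw by argo
 finally show "E2 (%w. (X (\<rho> w) w - X' (\<rho> w) w) - (X (\<rho>' w) w - X' (\<rho>' w) w)) <= 1 / 4 * E2 (%w. X (\<rho>' w) w - X' (\<rho>' w) w)"
  using nn(2) by (simp add: d_def e_def)
qed

end

section \<open>Stability and solvability up to stopping times\<close>

context jbasis begin

lemma pre_sigma_measurable_AE:
 assumes \<rho>: "bst \<rho>" and f: "f : Bor (pre_sigma \<rho>)" and eq: "AE w in P. f w = g w"
 shows "g : Bor (pre_sigma \<rho>)"
proof (rule measurableI)
 fix D :: "'a set" assume D: "D : sets borel"
 obtain N where N: "N : null_sets P" "!!w. w : \<Omega> ==> w \<notin> N ==> f w = g w" using AE_null[OF eq] by metis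
 have sub: "A : sets (pre_sigma \<rho>)" if A: "A <= N" for A
 proof (rule sets_pre_sigmaI[OF bst_stopping[OF \<rho>]])
  fix t show "{w\<in>A. \<rho> w <= t} : sets (F t)"
  proof (cases "0 <= t")
   case True thus ?thesis using A by (intro null_in_F[OF N(1)]) auto
  next
   case False
   have "A <= \<Omega>" using A N(1) sets.sets_into_space by blast
   hence e: "{w\<in>A. \<rho> w <= t} = {}" using bst_ge[OF \<rho>] False by force
   show ?thesis unfolding e by simp
  qed
 qed
 have "g -` D Int space (pre_sigma \<rho>) = ((f -` D Int space (pre_sigma \<rho>)) - N) \<union> (g -` D Int \<Omega> Int N)"
  using N(2) by (auto simp: space_pre_sigma)
 also have "... : sets (pre_sigma \<rho>)"
  by (intro sets.Un sets.Diff measurable_sets[OF f D] sub) auto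
 finally show "g -` D Int space (pre_sigma \<rho>) : sets (pre_sigma \<rho>)" .
qed auto

end

context bsde begin

lemma E2_cong_AE: "sqi P f ==> sqi P h ==> AE w in P. f w = h w ==> E2 f = E2 h"
 by (intro integral_cong_AE borel_measurable_power sqi_measurable) (auto elim: eventually_mono)

lemma short_steps: "\<exists>n::nat. 0 < n & T / n <= 1 & 96 * (T / n) * K^2 <= 1"
proof -
 obtain n :: nat where n: "max 1 (max T (96 * T * K^2)) < real n" using reals_Archimedean2 by blast
 hence "0 < n" by (cases n) auto
 with n show ?thesis by (intro exI[of _ n]) (auto simp: field_simps)
qed

text \<open>So many cells of equal length that the energy estimate applies to each.\<close>

definition cells :: nat where
 "cells = (SOME n::nat. 0 < n & T / n <= 1 & 96 * (T / n) * K^2 <= 1)"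

lemma cells: "0 < cells" "T / cells <= 1" "96 * (T / cells) * K^2 <= 1"
 using someI_ex[OF short_steps] by (auto simp: cells_def)

definition node :: "nat => real" where "node i = T / cells * i"

lemma node: "0 <= node i" "node i <= node (Suc i)" "node (Suc i) - node i <= T / cells" "node 0 = 0" "node cells = T"
 "i <= cells ==> node i <= T"
proof -
 have c: "0 <= T / cells" using T_nonneg by simp
 show "0 <= node i" unfolding node_def by (rule mult_nonneg_nonneg[OF c]) simp
 show "node i <= node (Suc i)" unfolding node_def by (rule mult_left_mono[OF _ c]) simp
 show "node (Suc i) - node i <= T / cells" unfolding node_def right_diff_distrib[symmetric] by simp
 show "node 0 = 0" "node cells = T" using cells(1) by (simp_all add: node_def)
 show "node i <= T" if "i <= cells"
  using mult_left_mono[OF _ c, of "real i" "real cells"] that cells(1) by (simp add: node_def)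
qed

text \<open>Chain the energy estimate backwards over the cells; each costs a factor 4.\<close>

lemma global_stability:
 assumes X: "sol S \<tau> X L" "sol S \<tau> X' L'" and S: "bst S" "bst \<tau>" "!!w. w : \<Omega> ==> S w <= \<tau> w"
 shows "E2 (%w. X (S w) w - X' (S w) w) <= 4 ^ cells * E2 (%w. X (\<tau> w) w - X' (\<tau> w) w)"
proof -
 let ?r = "%i w. min (max (S w) (node i)) (\<tau> w)"
 let ?e = "%i. E2 (%w. X (?r i w) w - X' (?r i w) w)"
 have r: "bst (?r i)" if "i <= cells" for i using that by (intro bst_min bst_max bst_const S node)
 have "i <= cells ==> ?e 0 <= 4 ^ i * ?e i" for i
 proof (induct i)
  case 0 show ?case by simp
 next
  case (Suc i)
  have s: "sol (?r i) (?r (Suc i)) X L" "sol (?r i) (?r (Suc i)) X' L'"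
   by (rule sol_restrict[OF X(1)] sol_restrict[OF X(2)]; use S(3) in fastforce)+
  have "?e i <= 4 * ?e (Suc i)"
  proof (rule local_stability(1)[OF s r r, where a = "node i" and b = "node (Suc i)" and h = "T / cells"])
   show "?r i w <= ?r (Suc i) w" for w using node(2)[of i] by (auto simp: min_def max_def)
   show "node i < t & t <= node (Suc i)" if "?r i w < t" "t <= ?r (Suc i) w" for t w
    using that node(2)[of i] by (auto simp: min_def max_def split: if_splits)
  qed (use Suc.prems node cells in auto)
  hence "4 ^ i * ?e i <= 4 ^ i * (4 * ?e (Suc i))" by (rule mult_left_mono) simp
  from order_trans[OF Suc.hyps this] Suc.prems show ?case by (simp only: power_Suc mult_ac Suc_leD)
 qed
 from this[of cells] have "?e 0 <= 4 ^ cells * ?e cells" by simp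
 moreover have "?e 0 = E2 (%w. X (S w) w - X' (S w) w)"
  by (rule Bochner_Integration.integral_cong) (simp_all add: S(3) bst_ge[OF S(1)] node(4) max_absorb1 min_absorb1)
 moreover have "?e cells = E2 (%w. X (\<tau> w) w - X' (\<tau> w) w)"
  by (rule Bochner_Integration.integral_cong) (simp_all add: bst_le[OF S(1)] bst_le[OF S(2)] node(5) max_absorb2 min_absorb2)
 ultimately show ?thesis by simp
qed

definition solves :: "('w => real) => ('w => real) => (real => 'w => real) => (real => 'w => 'e option => real) => bool" where
 "solves \<tau> \<zeta> X L <-> sol (%_. 0) \<tau> X L & (AE w in P. X (\<tau> w) w = \<zeta> w)"

lemma sol_stop_sqi: "sol \<rho> \<rho>' X L ==> bst \<sigma> ==> sqi P (%w. X (\<sigma> w) w)"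
 by (simp add: sol_def D2_stop_sqi)

lemma sol_pre_sigma: "sol \<rho> \<rho>' X L ==> bst \<sigma> ==> (%w. X (\<sigma> w) w) : Bor (pre_sigma \<sigma>)"
 by (auto simp: sol_def intro: arc_at_stop_pre_sigma D2_arc)

text \<open>Solve with a terminal value at \<open>\<rho>'\<close> that is already known at \<open>\<rho>\<close>, and correct it by the error at \<open>\<rho>\<close>. By the
 second energy estimate the errors contract, so the corrected values converge; the limit value has no error.\<close>

lemma solvable_step:
 assumes \<rho>: "bst \<rho>" "bst \<rho>'" "!!w. w : \<Omega> ==> \<rho> w <= \<rho>' w"
  and ab: "!!w t. w : \<Omega> ==> \<rho> w < t ==> t <= \<rho>' w ==> a < t & t <= b" "a <= b" "b - a <= h" "h <= 1" "96 * h * K^2 <= 1"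
  and ex: "!!\<eta>. \<eta> : Bor (pre_sigma \<rho>') ==> sqi P \<eta> ==> \<exists>X L. solves \<rho>' \<eta> X L"
  and \<zeta>: "\<zeta> : Bor (pre_sigma \<rho>)" "sqi P \<zeta>"
 shows "\<exists>X L. solves \<rho> \<zeta> X L"
proof -
 have "\<forall>\<eta>. \<exists>X L. \<eta> : Bor (pre_sigma \<rho>) --> sqi P \<eta> --> solves \<rho>' \<eta> X L"
  using ex pre_sigma_mono[OF \<rho>] by blast
 then obtain X L where XL: "!!\<eta>. \<eta> : Bor (pre_sigma \<rho>) ==> sqi P \<eta> ==> solves \<rho>' \<eta> (X \<eta>) (L \<eta>)" by metis
 \<comment> \<open>correct the terminal value by the error at \<open>\<rho>\<close>\<close>
 define \<eta> where "\<eta> = rec_nat \<zeta> (%_ e w. e w + (\<zeta> w - X e (\<rho> w) w))"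
 have \<eta>S: "\<eta> (Suc k) = (%w. \<eta> k w + (\<zeta> w - X (\<eta> k) (\<rho> w) w))" for k by (simp add: \<eta>_def)
 have good: "\<eta> k : Bor (pre_sigma \<rho>) & sqi P (\<eta> k)" for k
 proof (induct k)
  case 0 thus ?case using \<zeta> by (simp add: \<eta>_def)
 next
  case (Suc k)
  hence s: "sol (%_. 0) \<rho>' (X (\<eta> k)) (L (\<eta> k))" using XL by (simp add: solves_def)
  show ?case unfolding \<eta>S using Suc \<zeta> sol_pre_sigma[OF s \<rho>(1)] sol_stop_sqi[OF s \<rho>(1)]
   by (auto intro!: borel_measurable_add borel_measurable_diff sqi_add sqi_diff)
 qed
 have sv: "sol \<rho> \<rho>' (X e) (L e)" "AE w in P. X e (\<rho>' w) w = e w"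
  if "e : Bor (pre_sigma \<rho>)" "sqi P e" for e
  using XL[OF that] sol_restrict[of "%_. 0" \<rho>' "X e" "L e" \<rho> \<rho>'] bst_ge[OF \<rho>(1)] by (auto simp: solves_def)
 note gk = good[THEN conjunct1] good[THEN conjunct2]
 have close: "E2 (%w. X e (\<rho>' w) w - X e' (\<rho>' w) w) = E2 (%w. e w - e' w)"
  "(%w. X e (\<rho>' w) w - X e' (\<rho>' w) w) : Bor (pre_sigma \<rho>)"
  if e: "e : Bor (pre_sigma \<rho>)" "sqi P e" and e': "e' : Bor (pre_sigma \<rho>)" "sqi P e'" for e e'
 proof -
  have ae: "AE w in P. e w - e' w = X e (\<rho>' w) w - X e' (\<rho>' w) w" using sv(2)[OF e] sv(2)[OF e'] by eventually_elim simp
  show "(%w. X e (\<rho>' w) w - X e' (\<rho>' w) w) : Bor (pre_sigma \<rho>)"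
   by (rule pre_sigma_measurable_AE[OF \<rho>(1) borel_measurable_diff[OF e(1) e'(1)] ae])
  show "E2 (%w. X e (\<rho>' w) w - X e' (\<rho>' w) w) = E2 (%w. e w - e' w)"
   by (rule E2_cong_AE[OF _ _ ae, symmetric]) (intro sqi_diff e e' sol_stop_sqi[OF sv(1)] \<rho>)+
 qed
 define r where "r k w = \<zeta> w - X (\<eta> k) (\<rho> w) w" for k w
 have r_sq: "sqi P (r k)" for k unfolding r_def by (intro sqi_diff \<zeta> sol_stop_sqi[OF sv(1)] gk \<rho>)
 have r_step: "E2 (r (Suc k)) <= 1 / 4 * E2 (r k)" for k
 proof -
  let ?a = "\<eta> (Suc k)" and ?b = "\<eta> k"
  have "E2 (r (Suc k)) = E2 (%w. (X ?a (\<rho> w) w - X ?b (\<rho> w) w) - (X ?a (\<rho>' w) w - X ?b (\<rho>' w) w))"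
  proof -
   have "AE w in P. - r (Suc k) w = (X ?a (\<rho> w) w - X ?b (\<rho> w) w) - (X ?a (\<rho>' w) w - X ?b (\<rho>' w) w)"
    using sv(2)[OF gk, of "Suc k"] sv(2)[OF gk, of k] by eventually_elim (simp add: r_def \<eta>S[of k])
   hence "E2 (%w. - r (Suc k) w) = E2 (%w. (X ?a (\<rho> w) w - X ?b (\<rho> w) w) - (X ?a (\<rho>' w) w - X ?b (\<rho>' w) w))"
    by (intro E2_cong_AE sqi_minus r_sq sqi_diff sol_stop_sqi[OF sv(1)] gk \<rho>)
   thus ?thesis by simp
  qed
  also have "... <= 1 / 4 * E2 (%w. X ?a (\<rho>' w) w - X ?b (\<rho>' w) w)"
   by (rule local_stability(2)[OF sv(1)[OF gk] sv(1)[OF gk] \<rho> ab close(2)[OF gk gk]])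
  also have "E2 (%w. X ?a (\<rho>' w) w - X ?b (\<rho>' w) w) = E2 (r k)"
   unfolding close(1)[OF gk gk] by (simp add: \<eta>S r_def)
  finally show ?thesis .
 qed
 have r_le: "E2 (r k) <= E2 (r 0) * (1/4) ^ k" for k
 proof (induct k)
  case (Suc k) thus ?case using r_step[of k] by simp
 qed simp
 have rl: "L2n P (r k) <= ennreal (E2 (r 0) * (1/4) ^ k)" for k
  unfolding L2n_eq_integral[OF r_sq[of k]] by (rule ennreal_leI[OF r_le])
 have "L2n P (%w. \<eta> (Suc k) w - \<eta> k w) <= ennreal (E2 (r 0) * (1/4) ^ k)" for k
  using rl[of k] by (simp add: \<eta>S r_def[abs_def])
 moreover have "sets (pre_sigma \<rho>) <= sets P"
  using pre_sigma_sub[OF bst_stopping[OF \<rho>(1)] bst_le[OF \<rho>(1)]] subalg[of T] by blast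
 ultimately have "\<exists>z. z : Bor (pre_sigma \<rho>) & (%k. L2n P (%w. \<eta> k w - z w)) ----> 0"
  by (intro L2_geometric_limit[where c = "E2 (r 0)"] gk) (simp_all add: space_pre_sigma)
 then obtain z where z: "z : Bor (pre_sigma \<rho>)" "(%k. L2n P (%w. \<eta> k w - z w)) ----> 0" by blast
 have zP: "z : Bor P" by (rule pre_sigma_imp_P[OF \<rho>(1) z(1)])
 have zs: "sqi P z"
 proof -
  have "\<forall>\<^sub>F k in sequentially. L2n P (%w. \<eta> k w - z w) < 1" using z(2) by (rule order_tendstoD(2)) simp
  then obtain k where "L2n P (%w. \<eta> k w - z w) < 1" by (auto simp: eventually_sequentially)
  hence "sqi P (%w. \<eta> k w - z w)" using sqi_measurable[OF gk(2)] zP by (auto simp: sqi_def intro: less_trans)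
  from sqi_diff[OF gk(2)[of k] this] show ?thesis by simp
 qed
 have le: "L2n P (%w. \<zeta> w - X z (\<rho> w) w) <= 2 * ennreal (E2 (r 0) * (1/4) ^ k) + 2 * (4 * L2n P (%w. \<eta> k w - z w))" for k
 proof (rule order_trans[OF L2n_triangle[where g = "%w. X (\<eta> k) (\<rho> w) w"] add_mono[OF mult_left_mono mult_left_mono]])
  show "L2n P (%w. \<zeta> w - X (\<eta> k) (\<rho> w) w) <= ennreal (E2 (r 0) * (1/4) ^ k)"
   using rl[of k] by (simp add: r_def[abs_def])
  have "E2 (%w. X (\<eta> k) (\<rho> w) w - X z (\<rho> w) w) <= 4 * E2 (%w. X (\<eta> k) (\<rho>' w) w - X z (\<rho>' w) w)"
   by (rule local_stability(1)[OF sv(1) sv(1) \<rho> ab]) (intro gk z zs)+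
  also have "... = 4 * E2 (%w. \<eta> k w - z w)" unfolding close(1)[OF gk z(1) zs] ..
  finally show "L2n P (%w. X (\<eta> k) (\<rho> w) w - X z (\<rho> w) w) <= 4 * L2n P (%w. \<eta> k w - z w)"
   unfolding L2n_eq_integral[OF sqi_diff[OF sol_stop_sqi[OF sv(1)[OF gk] \<rho>(1)] sol_stop_sqi[OF sv(1)[OF z(1) zs] \<rho>(1)]]]
    L2n_eq_integral[OF sqi_diff[OF gk(2) zs]] by (subst ennreal_numeral[symmetric], subst ennreal_mult'[symmetric]) (simp_all add: ennreal_leI)
 qed (use \<zeta> sol_stop_sqi[OF sv(1)[OF gk] \<rho>(1)] sol_stop_sqi[OF sv(1)[OF z(1) zs] \<rho>(1)] in "auto simp: sqi_def")
 have lim: "(%k. 2 * ennreal (E2 (r 0) * (1/4) ^ k) + 2 * (4 * L2n P (%w. \<eta> k w - z w))) ----> 2 * ennreal (E2 (r 0) * 0) + 2 * (4 * 0)"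
  by (intro tendsto_add ennreal_tendsto_cmult tendsto_ennrealI tendsto_mult tendsto_const LIMSEQ_power_zero z(2)) auto
 have "L2n P (%w. \<zeta> w - X z (\<rho> w) w) <= 2 * ennreal (E2 (r 0) * 0) + 2 * (4 * 0)"
  by (rule LIMSEQ_le_const[OF lim]) (use le in blast)
 hence "AE w in P. X z (\<rho> w) w = \<zeta> w"
  using \<zeta>(2) sol_stop_sqi[OF sv(1)[OF z(1) zs] \<rho>(1)] L2n_zero_iff[of "%w. \<zeta> w - X z (\<rho> w) w" P]
  by (auto simp: sqi_def elim: eventually_mono)
 moreover have "sol (%_. 0) \<rho> (X z) (L z)"
  by (rule sol_restrict[OF XL[OF z(1) zs, unfolded solves_def, THEN conjunct1]]) (simp_all add: \<rho>(3))
 ultimately show ?thesis unfolding solves_def by blast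
qed

text \<open>Pathwise, the backward equation with terminal value \<open>z\<close> and increasing part \<open>a\<close> says that \<open>N + a\<close> is constant and that
 the terminal value is attained.\<close>

lemma backward_equation_iff:
 assumes X: "X : D2 B" and L: "C.intg (fld Z l)"
 shows "AE w in P. \<forall>r\<in>{0..T}. \<forall>z a. (\<forall>t\<in>{0..r}. X t w = z + drift g X Z l t r w
   - (ito_integral B Z r w - ito_integral B Z t w) - (jump_integral B l r w - jump_integral B l t w) + a r - a t)
  <-> (\<forall>t\<in>{0..r}. N X (fld Z l) t w + a t = N X (fld Z l) r w + a r) & X r w = z"
 using J_increment[OF X L]
proof eventually_elim
 case (elim w)
 show ?case
 proof (intro ballI allI)
  fix r z a assume r: "r : {0..T}"
  let ?E = "%t. X t w = z + drift g X Z l t r w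
   - (ito_integral B Z r w - ito_integral B Z t w) - (jump_integral B l r w - jump_integral B l t w) + a r - a t"
  let ?N = "%t. N X (fld Z l) t w + a t"
  have *: "?E t <-> ?N t + X r w = ?N r + z" if "t : {0..r}" for t
  proof -
   have "drift g X Z l t r w = J X (fld Z l) r w - J X (fld Z l) t w" using elim r that by simp
   thus ?thesis by (auto simp: N_def M_def algebra_simps)
  qed
  have r': "r : {0..r}" using r by simp
  show "(\<forall>t\<in>{0..r}. ?E t) <-> (\<forall>t\<in>{0..r}. ?N t = ?N r) & X r w = z"
  proof (intro iffI conjI ballI)
   assume A: "\<forall>t\<in>{0..r}. ?E t"
   show z: "X r w = z" using iffD1[OF *[OF r'] bspec[OF A r']] by simp
   show "?N t = ?N r" if "t : {0..r}" for t using iffD1[OF *[OF that] bspec[OF A that]] z by simp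
  next
   fix t assume t: "t : {0..r}" and A: "(\<forall>t\<in>{0..r}. ?N t = ?N r) & X r w = z"
   have "?N t + X r w = ?N r + z" using bspec[OF conjunct1[OF A] t] conjunct2[OF A] by simp
   thus "?E t" by (rule iffD2[OF *[OF t]])
  qed
 qed
qed

lemma bsde_solution_iff:
 assumes \<tau>: "bst \<tau>"
 shows "bsde_solution B g \<tau> \<zeta> X Z l <-> solves \<tau> \<zeta> X (fld Z l)"
proof (cases "X : D2 B & C.intg (fld Z l)")
 case True
 have "(AE w in P. \<forall>t\<in>{0..\<tau> w}. X t w = \<zeta> w + drift g X Z l t (\<tau> w) w
   - (ito_integral B Z (\<tau> w) w - ito_integral B Z t w) - (jump_integral B l (\<tau> w) w - jump_integral B l t w))
  <-> (AE w in P. (\<forall>t\<in>{0..\<tau> w}. N X (fld Z l) t w = N X (fld Z l) (\<tau> w) w) & X (\<tau> w) w = \<zeta> w)"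
  (is "(AE w in P. ?A w) <-> (AE w in P. ?C w)")
 proof (rule eventually_subst)
  show "AE w in P. ?A w = ?C w"
   using backward_equation_iff[OF conjunct1[OF True] conjunct2[OF True]] AE_space
  proof eventually_elim
   case (elim w)
   have "\<tau> w : {0..T}" using \<tau> elim(2) by (simp add: bst_def)
   from spec[OF spec[OF bspec[OF elim(1) this], of "\<zeta> w"], of "%_. 0"] show ?case by simp
  qed
 qed
 with True show ?thesis by (simp add: bsde_solution_def solves_def sol_def intg_iff)
next
 case False
 thus ?thesis by (auto simp: bsde_solution_def solves_def sol_def intg_iff)
qed

lemma fld_parts: "fld (%t w. L t w None) (%t w e. L t w (Some e)) = L"
 by (auto simp: fun_eq_iff split: option.split)

text \<open>Descend from the terminal time \<open>T\<close>, where solvability is given, through the stopping times \<open>max \<tau> (node i)\<close>; consecutive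
 ones differ by at most a cell.\<close>

theorem solvable_at_stop:
 assumes \<tau>: "bst \<tau>" and \<zeta>: "\<zeta> : Bor (pre_sigma \<tau>)" "sqi P \<zeta>"
 shows "\<exists>X L. solves \<tau> \<zeta> X L"
proof -
 let ?r = "%i w. max (\<tau> w) (node i)"
 have r: "bst (?r i)" if "i <= cells" for i using that by (intro bst_max bst_const \<tau> node)
 have "\<exists>X L. solves (?r i) \<zeta> X L" if "i <= cells" "\<zeta> : Bor (pre_sigma (?r i))" "sqi P \<zeta>" for i \<zeta>
  using that
 proof (induct i arbitrary: \<zeta> rule: inc_induct)
  case base
  have T: "bst (%_. T)" by (rule bst_const) (auto simp: T_nonneg)
  have "\<zeta> : Bor (F T)" by (rule pre_sigma_imp_FT[OF r base(1)]) simp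
  then obtain X Z l where "bsde_solution B g (%_. T) \<zeta> X Z l"
   using solvable base(2) unfolding bsde_solvable_def by (auto simp: sqi_def L2n_def)
  hence s: "sol (%_. 0) (%_. T) X (fld Z l)" "AE w in P. X T w = \<zeta> w" using bsde_solution_iff[OF T] by (auto simp: solves_def)
  have "sol (%_. 0) (?r cells) X (fld Z l)" by (rule sol_restrict[OF s(1)]) (auto simp: node(5) bst_le[OF \<tau>])
  moreover have "AE w in P. X (?r cells w) w = \<zeta> w"
   using s(2) AE_space by eventually_elim (simp add: node(5) bst_le[OF \<tau>] max_absorb2)
  ultimately show ?case unfolding solves_def by blast
 next
  case (step i)
  show ?case
  proof (rule solvable_step[OF r r, where a = "node i" and b = "node (Suc i)" and h = "T / cells"])
   show "?r i w <= ?r (Suc i) w" for w using node(2)[of i] by (auto simp: max_def)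
   show "node i < t & t <= node (Suc i)" if "?r i w < t" "t <= ?r (Suc i) w" for t w
    using that node(2)[of i] by (auto simp: max_def split: if_splits)
   show "\<exists>X L. solves (?r (Suc i)) \<eta> X L" if "\<eta> : Bor (pre_sigma (?r (Suc i)))" "sqi P \<eta>" for \<eta>
    by (rule step(3)[OF that])
  qed (use step node cells in auto)
 qed
 note ex = this[of 0]
 have r0: "?r 0 w = \<tau> w" if "w : \<Omega>" for w using bst_ge[OF \<tau> that] by (simp add: node(4))
 have "\<zeta> : Bor (pre_sigma (?r 0))"
  by (rule pre_sigma_mono[OF \<tau> r _ \<zeta>(1)]) simp_all
 from ex[OF _ this \<zeta>(2)] obtain X L where "solves (?r 0) \<zeta> X L" by blast
 hence s: "sol (%_. 0) (?r 0) X L" "AE w in P. X (?r 0 w) w = \<zeta> w" unfolding solves_def by blast+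
 have "sol (%_. 0) \<tau> X L" by (rule sol_restrict[OF s(1)]) auto
 moreover have "AE w in P. X (\<tau> w) w = \<zeta> w" using s(2) AE_space by eventually_elim (simp add: r0)
 ultimately show ?thesis unfolding solves_def by blast
qed

text \<open>Uniqueness, by stability with equal terminal values, identifies the solution chosen in the definition.\<close>

lemma g_expectation_eq:
 assumes S: "bst S" "bst \<tau>" "!!w. w : \<Omega> ==> S w <= \<tau> w" and X: "solves \<tau> \<zeta> X L"
 shows "AE w in P. g_expectation B g S \<tau> \<zeta> w = X (S w) w"
proof -
 let ?X = "SOME X. \<exists>Z l. bsde_solution B g \<tau> \<zeta> X Z l"
 have "\<exists>Z l. bsde_solution B g \<tau> \<zeta> X Z l"
  using X bsde_solution_iff[OF S(2), of \<zeta> X "%t w. L t w None" "%t w e. L t w (Some e)"] by (auto simp: fld_parts)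
 hence "\<exists>Z l. bsde_solution B g \<tau> \<zeta> ?X Z l" by (rule someI[of "%X. \<exists>Z l. bsde_solution B g \<tau> \<zeta> X Z l"])
 then obtain L' where X': "solves \<tau> \<zeta> ?X L'" using bsde_solution_iff[OF S(2)] by blast
 have s: "sol S \<tau> X L" "sol S \<tau> ?X L'"
  using X X' bst_ge[OF S(1)] by (auto simp: solves_def intro: sol_restrict[of "%_. 0"])
 note d = sqi_diff[OF sol_stop_sqi[OF s(1) S(2)] sol_stop_sqi[OF s(2) S(2)]] sqi_diff[OF sol_stop_sqi[OF s(1) S(1)] sol_stop_sqi[OF s(2) S(1)]]
 have "AE w in P. X (\<tau> w) w - ?X (\<tau> w) w = 0" using X X' unfolding solves_def by (auto elim: AE_mp)
 hence "E2 (%w. X (\<tau> w) w - ?X (\<tau> w) w) = 0" using E2_cong_AE[OF d(1) sqi_zero] by simp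
 hence "E2 (%w. X (S w) w - ?X (S w) w) <= 0" using global_stability[OF s S] by simp
 hence "L2n P (%w. X (S w) w - ?X (S w) w) = 0" unfolding L2n_eq_integral[OF d(2)] by (simp add: ennreal_neg)
 hence "AE w in P. X (S w) w - ?X (S w) w = 0" using L2n_zero_iff[OF sqi_measurable[OF d(2)]] by simp
 thus ?thesis unfolding g_expectation_def by eventually_elim simp
qed

end

section \<open>Extending a solution beyond a stopping time\<close>

text \<open>Gronwall in integrated form: the increments of \<open>exp (K t) \<integral>\<psi>\<close> dominate those of the
 integral of any \<open>\<phi>\<close> with \<open>\<bar>\<phi>\<bar> \<le> \<psi> + K exp (K s) \<integral>\<psi>\<close>.\<close>

lemma exponential_majorant:
 fixes \<psi> \<phi> :: "real => real"
 assumes \<psi>: "set_integrable lborel {0..T} \<psi>" "!!s. 0 <= \<psi> s" and \<phi>: "set_integrable lborel {0..T} \<phi>"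
  and le: "AE s in lborel. s : {0..T} --> abs (\<phi> s) <= \<psi> s + K * (exp (K * s) * (LINT u:{0..s}|lborel. \<psi> u))"
  and K: "0 <= K" and rt: "0 <= r" "r <= t" "t <= T"
 shows "abs ((LINT s:{0..t}|lborel. \<phi> s) - (LINT s:{0..r}|lborel. \<phi> s))
  <= exp (K * t) * (LINT s:{0..t}|lborel. \<psi> s) - exp (K * r) * (LINT s:{0..r}|lborel. \<psi> s)"
proof -
 let ?I = "%t. LINT s:{0..t}|lborel. \<psi> s"
 have int: "set_integrable lborel A f" if "set_integrable lborel {0..T} f" "A : sets borel" "A <= {0..T}" for f :: "real => real" and A
  using that by (auto intro: set_integrable_subset)
 have split: "(LINT s:{0..b}|lborel. f s) = (LINT s:{0..a}|lborel. f s) + (LINT s:{a<..b}|lborel. f s)"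
  if f: "set_integrable lborel {0..T} f" and ab: "0 <= a" "a <= b" "b <= T" for f :: "real => real" and a b
 proof -
  have "{0..b} = {0..a} \<union> {a<..b}" using ab by auto
  thus ?thesis using ab by (simp only:) (intro set_integral_Un int[OF f]; auto)
 qed
 have sub: "{r<..t} <= {0..T}" using rt by auto
 have nn: "0 <= (LINT s:A|lborel. \<psi> s)" for A unfolding set_lebesgue_integral_def by (simp add: \<psi>(2))
 have mono: "?I s <= ?I t" if "0 <= s" "s <= t" for s
  using split[OF \<psi>(1), of s t] that rt nn[of "{s<..t}"] by auto
 have e: "set_integrable lborel {0..T} (%s. K * exp (K * s))"
  by (rule borel_integrable_atLeastAtMost') (intro continuous_intros)
 define It where "It = ?I t"
 have "abs ((LINT s:{0..t}|lborel. \<phi> s) - (LINT s:{0..r}|lborel. \<phi> s)) = abs (LINT s:{r<..t}|lborel. \<phi> s)"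
  using split[OF \<phi> rt] by simp
 also have "... <= (LINT s:{r<..t}|lborel. abs (\<phi> s))"
  using set_integral_norm_bound[OF int[OF \<phi> _ sub]] by simp
 also have "... <= (LINT s:{r<..t}|lborel. \<psi> s + K * exp (K * s) * It)"
  unfolding set_lebesgue_integral_def
 proof (rule integral_mono_AE)
  show "integrable lborel (%s. ind {r<..t} s *\<^sub>R (abs (\<phi> s)))"
   using set_integrable_abs[OF int[OF \<phi> _ sub]] by (simp add: set_integrable_def)
  have "set_integrable lborel {r<..t} (%s. \<psi> s + K * exp (K * s) * It)"
   by (intro set_integral_add(1) set_integrable_mult_left int[OF \<psi>(1) _ sub] int[OF e _ sub]) simp_all
  thus "integrable lborel (%s. ind {r<..t} s *\<^sub>R (\<psi> s + K * exp (K * s) * It))" by (simp add: set_integrable_def)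
  show "AE s in lborel. ind {r<..t} s *\<^sub>R (abs (\<phi> s)) <= ind {r<..t} s *\<^sub>R (\<psi> s + K * exp (K * s) * It)"
   using le
  proof eventually_elim
   case (elim s)
   have "K * (exp (K * s) * ?I s) <= K * (exp (K * s) * It)" if "s : {r<..t}"
    using that rt K by (intro mult_left_mono mono[folded It_def]) auto
   with elim show ?case using rt by (auto simp: indicator_def mult.assoc)
  qed
 qed
 also have "... = (It - ?I r) + (LINT s:{r<..t}|lborel. K * exp (K * s)) * It"
  using split[OF \<psi>(1) rt] by (subst set_integral_add(2)) (simp_all add: It_def set_integrable_mult_left int[OF \<psi>(1) _ sub] int[OF e _ sub])
 also have "(LINT s:{r<..t}|lborel. K * exp (K * s)) = exp (K * t) - exp (K * r)"
 proof -
  have "(LINT s:{0..b}|lborel. K * exp (K * s)) = exp (K * b) - 1" if "0 <= b" for b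
  proof -
   have "(\<integral>x. (K * exp (K * x)) * ind {0..b} x \<partial>lborel) = exp (K * b) - exp (K * 0)"
    by (rule integral_FTC_Icc_real[OF that]) (auto intro!: derivative_eq_intros continuous_intros)
   thus ?thesis unfolding set_lebesgue_integral_def
    by (simp only: real_scaleR_def mult.commute exp_zero mult_zero_right mult_zero_left)
  qed
  thus ?thesis using split[OF e rt] rt by simp
 qed
 also have "(It - ?I r) + (exp (K * t) - exp (K * r)) * It <= exp (K * t) * ?I t - exp (K * r) * ?I r"
 proof -
  have "1 * (?I t - ?I r) <= exp (K * r) * (?I t - ?I r)" using mono[OF rt(1,2)] K rt by (intro mult_right_mono) auto
  thus ?thesis by (simp add: algebra_simps It_def)
 qed
 finally show ?thesis .
qed

context bsde begin

lemma predictable_fixed: assumes "h : Bor (F 0)" shows "predictable B (%t w. h w)"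
 by (rule predictable_cong[OF _ predictable_add[OF predictable_zero_time[OF assms] predictable_interval[OF _ _ _ assms, of T]]])
   (auto simp: T_nonneg indicator_def)

lemma pred_driver:
 assumes "predictable B X"
 shows "predictable B (%t w. g t w (X t w) 0 (%_. 0))"
proof -
 have "(%_. 0) : space (borel_L2mu B)" unfolding borel_L2mu_def by (subst space_measure_of) (auto simp: L2mu_iff)
 hence m: "(%x. (x, (X (fst x) (snd x), 0), %_. 0)) : measurable (pred_sigma B) (pred_sigma B \<otimes> (borel \<otimes> borel) \<otimes> borel_L2mu B)"
  using assms by (intro measurable_Pair measurable_ident measurable_const) (auto simp: predictable_def case_prod_beta')
 have "(%((t, w), (y, z), k). g t w y z k) : Bor (pred_sigma B \<otimes> (borel \<otimes> borel) \<otimes> borel_L2mu B)"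
  using driver by (simp add: lipschitz_driver_def)
 from measurable_compose[OF m this] show ?thesis by (simp add: predictable_def case_prod_beta')
qed

abbreviation g0 :: "real => 'w => real" where "g0 t w \<equiv> g t w 0 0 (%_. 0)"

lemma g0: "predictable B g0" "sqi (dtP B) (%x. g0 (fst x) (snd x))"
proof -
 show "predictable B g0" using driver by (simp add: lipschitz_driver_def H2_def)
 from predictable_dtP[OF this] show "sqi (dtP B) (%x. g0 (fst x) (snd x))"
  using driver by (simp add: lipschitz_driver_def H2_def sqi_def L2n_def case_prod_beta')
qed

lemma sqi_tm_set_integrable: "sqi tm f ==> set_integrable lborel {0..T} f"
 using sqi_integrable[OF tm.finite_measure_axioms] by (simp add: integrable_restrict_space set_integrable_def)

lemma regular_paths:
 "AE w in P. set_integrable lborel {0..T} (%s. g0 s w) &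
   (AE s in lborel. s : {0..T} --> (\<forall>y. abs (g s w y 0 (%_. 0)) <= abs (g0 s w) + K * abs y))"
proof -
 have "AE x in dtP B. \<forall>y. abs (g (fst x) (snd x) y 0 (%_. 0)) <= abs (g0 (fst x) (snd x)) + K * abs y"
  using K(2)
 proof eventually_elim
  case (elim x)
  have z: "(%_. 0) : L2mu B" by (simp add: L2mu_iff)
  have "abs (g (fst x) (snd x) y 0 (%_. 0) - g0 (fst x) (snd x)) <= K * (abs (y - 0) + abs (0 - 0) + norm_mu B (%e. 0 - 0))" for y
   using elim z by blast
  hence le: "abs (g (fst x) (snd x) y 0 (%_. 0) - g0 (fst x) (snd x)) <= K * abs y" for y by (simp add: norm_mu_def)
  show ?case
  proof
   fix y show "abs (g (fst x) (snd x) y 0 (%_. 0)) <= abs (g0 (fst x) (snd x)) + K * abs y" using le[of y] by linarith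
  qed
 qed
 from AE_time_slices[OF this] DG_slices(1)[OF g0(2)] show ?thesis
  by eventually_elim (simp add: sqi_tm_set_integrable)
qed

text \<open>The outcomes along which the driver at zero is not integrable or its linear growth in \<open>y\<close> fails; changing a process there keeps it predictable
 because the set belongs to \<open>F\<^sub>0\<close>.\<close>

definition bad :: "'w set" where
 "bad = (SOME N. N : null_sets P & N : sets (F 0) & (\<forall>w\<in>\<Omega> - N. set_integrable lborel {0..T} (%s. g0 s w) &
   (AE s in lborel. s : {0..T} --> (\<forall>y. abs (g s w y 0 (%_. 0)) <= abs (g0 s w) + K * abs y))))"

lemma bad: "bad : null_sets P" "bad : sets (F 0)"
 "w : \<Omega> ==> w \<notin> bad ==> set_integrable lborel {0..T} (%s. g0 s w)"
 "w : \<Omega> ==> w \<notin> bad ==> AE s in lborel. s : {0..T} --> (\<forall>y. abs (g s w y 0 (%_. 0)) <= abs (g0 s w) + K * abs y)"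
proof -
 have "\<exists>N. N : null_sets P & N : sets (F 0) & (\<forall>w\<in>\<Omega> - N. set_integrable lborel {0..T} (%s. g0 s w) &
   (AE s in lborel. s : {0..T} --> (\<forall>y. abs (g s w y 0 (%_. 0)) <= abs (g0 s w) + K * abs y)))"
  by (rule AE_null[OF regular_paths]) blast
 from someI_ex[OF this, folded bad_def] show "bad : null_sets P" "bad : sets (F 0)"
  "w : \<Omega> ==> w \<notin> bad ==> set_integrable lborel {0..T} (%s. g0 s w)"
  "w : \<Omega> ==> w \<notin> bad ==> AE s in lborel. s : {0..T} --> (\<forall>y. abs (g s w y 0 (%_. 0)) <= abs (g0 s w) + K * abs y)"
  by blast+
qed

lemma sup_sq_measurable:
 assumes X: "arc X" shows "(%w. SUP t\<in>{0..T}. ennreal ((X t w)^2)) : Bor P"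
proof -
 have "(SUP t\<in>{0..T}. ennreal ((X t w)^2)) = (SUP t\<in>rtimes T. ennreal ((X t w)^2))" if w: "w : \<Omega>" for w
 proof (rule antisym[OF SUP_least SUP_subset_mono[OF rtimes_subset[OF T_nonneg] order_refl]])
  fix t assume t: "t : {0..T}"
  let ?s = "SUP t\<in>rtimes T. ennreal ((X t w)^2)"
  show "ennreal ((X t w)^2) <= ?s"
  proof (cases "?s = \<top>")
   case False
   then obtain c where c: "?s = ennreal c" "0 <= c" by (cases ?s) auto
   have "(X s w)^2 <= c" if "s : rtimes T" for s
    using SUP_upper[of s "rtimes T" "%t. ennreal ((X t w)^2)"] that c by simp
   from rcll_le_dense[OF rcll_mult[OF arcD(2)[OF X w] arcD(2)[OF X w]] _ t, of c] this
   show ?thesis using c by (simp add: power2_eq_square ennreal_leI)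
  next
   case True thus ?thesis by (simp only: top_greatest)
  qed
 qed
 moreover have "(%w. SUP t\<in>rtimes T. ennreal ((X t w)^2)) : Bor P"
  using rtimes_subset[OF T_nonneg] by (intro borel_measurable_SUP countable_rtimes)
   (auto intro!: borel_measurable_power measurable_compose[OF _ measurable_ennreal] arc_measurable_P[OF X])
 ultimately show ?thesis by (subst measurable_cong) auto
qed

text \<open>Domination of the suprema by those of \<open>X\<close> and a single square integrable variable.\<close>

lemma D2_bound:
 assumes W: "arc W" and X: "X : D2 B" and R: "sqi P R"
  and le: "!!t w. w : \<Omega> ==> t : {0..T} ==> \<exists>s\<in>{0..T}. abs (W t w) <= abs (X s w) + abs (R w)"
 shows "W : D2 B"
proof -
 let ?s = "%w. SUP t\<in>{0..T}. ennreal ((X t w)^2)"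
 have "sup_sq B W <= (\<integral>\<^sup>+w. 2 * ?s w + 2 * ennreal ((R w)^2) \<partial>P)"
  unfolding sup_sq_def
 proof (intro nn_integral_mono SUP_least)
  fix w t assume w: "w : \<Omega>" and t: "t : {0..T}"
  obtain s where s: "s : {0..T}" "abs (W t w) <= abs (X s w) + abs (R w)" using le[OF w t] by blast
  have "abs (W t w)^2 <= (abs (X s w) + abs (R w))^2" by (rule power_mono[OF s(2)]) simp
  also have "... <= 2 * abs (X s w)^2 + 2 * abs (R w)^2" by (rule square_add_le)
  finally have "ennreal ((W t w)^2) <= ennreal (2 * (X s w)^2 + 2 * (R w)^2)" by (simp add: ennreal_leI del: ennreal_plus)
  also have "... = 2 * ennreal ((X s w)^2) + 2 * ennreal ((R w)^2)" by (rule ennreal_double[symmetric]) simp_all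
  also have "... <= 2 * ?s w + 2 * ennreal ((R w)^2)" by (intro add_right_mono mult_left_mono SUP_upper s) simp
  finally show "ennreal ((W t w)^2) <= 2 * ?s w + 2 * ennreal ((R w)^2)" .
 qed
 also have "... = 2 * sup_sq B X + 2 * L2n P R"
  using sup_sq_measurable[OF D2_arc[OF X]] sqi_measurable[OF R] unfolding sup_sq_def L2n_def
  by (subst nn_integral_add) (auto simp: nn_integral_cmult)
 also have "... < \<infinity>" using X R by (simp add: D2_def sqi_def ennreal_mult_less_top)
 finally show ?thesis using W by (simp add: D2_def arc_def)
qed

context
 fixes \<tau> H :: "'w => real"
 assumes \<tau>: "bst \<tau>" and H: "H : Bor (pre_sigma \<tau>)" "sqi P H" "!!w. 0 <= H w"
begin

text \<open>After \<open>\<tau>\<close> the driver, taken at any process with modulus at most \<open>H + D\<close> and without noise, is at most \<open>\<psi> + K D\<close>.\<close>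

definition \<psi> :: "real => 'w => real" where
 "\<psi> s w = (if \<tau> w < s & w \<notin> bad then (abs (g0 s w)) + K * H w else 0)"

text \<open>An increasing amount to be subtracted after \<open>\<tau>\<close>, common to all processes that are bounded by \<open>H\<close> at \<open>\<tau>\<close>. It grows so
 fast that it outweighs the drift.\<close>

definition Dec :: "real => 'w => real" where
 "Dec t w = exp (K * t) * (LINT s:{0..t}|lborel. \<psi> s w)"

text \<open>The drift after \<open>\<tau>\<close> of the process that starts at \<open>U\<^sub>\<tau>\<close> and decreases by \<open>Dec\<close>.\<close>

definition \<phi> :: "(real => 'w => real) => real => 'w => real" where
 "\<phi> U s w = (if \<tau> w < s & w \<notin> bad then g s w (U (\<tau> w) w - Dec s w) 0 (%_. 0) else 0)"

definition \<Phi> :: "(real => 'w => real) => real => 'w => real" where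
 "\<Phi> U t w = (LINT s:{0..t}|lborel. \<phi> U s w)"

lemma pred_after: assumes "predictable B X" shows "predictable B (%s w. if \<tau> w < s & w \<notin> bad then X s w else 0)"
proof -
 have "ind (\<Omega> - bad) : Bor (F 0)" using bad(2) sets.Diff[OF sets.top bad(2)] by (simp add: space_F)
 from predictable_mult[OF predictable_mult[OF predictable_fixed[OF this] pred_after_stop[OF \<tau>, of "%_. 1"]] assms]
 show ?thesis by (rule predictable_cong[rotated]) (auto simp: indicator_def)
qed

lemma \<psi>_pred: "predictable B \<psi>"
proof -
 have g: "predictable B (%s w. abs (g0 s w))" using g0(1) unfolding predictable_def by (simp add: case_prod_beta')
 have "predictable B (%s w. if \<tau> w < s & w \<notin> bad then (abs (g0 s w)) + K * (if \<tau> w < s then H w else 0) else 0)"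
  by (intro pred_after predictable_add predictable_mult predictable_const g pred_after_stop \<tau> H)
 thus ?thesis by (rule predictable_cong[rotated]) (auto simp: \<psi>_def)
qed

lemma \<psi>_int: "w : \<Omega> ==> set_integrable lborel {0..T} (%s. \<psi> s w)"
proof (cases "w : bad")
 case False assume w: "w : \<Omega>"
 have i: "set_integrable lborel {0..T} (%s. abs (g0 s w) + K * H w)"
  by (intro set_integral_add(1) set_integrable_abs bad(3)[OF w False] borel_integrable_atLeastAtMost' continuous_on_const)
 have "(%s. ind ({0..T} Int {\<tau> w<..}) s *\<^sub>R (abs (g0 s w) + K * H w)) = (%s. ind {0..T} s *\<^sub>R \<psi> s w)"
  by (auto simp: \<psi>_def indicator_def False fun_eq_iff)
 moreover have "set_integrable lborel ({0..T} Int {\<tau> w<..}) (%s. abs (g0 s w) + K * H w)" by (rule set_integrable_subset[OF i]) auto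
 ultimately show ?thesis by (simp add: set_integrable_def)
qed (simp add: \<psi>_def set_integrable_def)

lemma \<psi>_nonneg: "0 <= \<psi> s w" using K(1) H(3) by (auto simp: \<psi>_def)

lemma Dec_pred: "predictable B Dec" "arc Dec"
proof -
 note I = time_integral_predictable[OF \<psi>_pred \<psi>_int]
 have e: "predictable B (%t w. exp (K * t))" "arc (%t w. exp (K * t))"
  by (auto intro!: continuous_adapted_predictable arcI rcll_continuous continuous_intros)
 show "predictable B Dec" unfolding Dec_def[abs_def] by (intro predictable_mult e I)
 show "arc Dec" unfolding Dec_def[abs_def]
  using arcD[OF I(2)] by (intro arcI borel_measurable_times rcll_mult arcD[OF e(2)]) auto
qed

lemma Dec_before: "t <= \<tau> w ==> Dec t w = 0"
proof -
 assume "t <= \<tau> w"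
 hence "(LINT s:{0..t}|lborel. \<psi> s w) = (LINT s:{0..t}|lborel. 0)" by (intro set_lebesgue_integral_cong) (auto simp: \<psi>_def)
 thus ?thesis by (simp add: Dec_def)
qed

lemma Dec_sqi: "sqi P (Dec T)"
proof -
 have tm\<psi>: "(%x. \<psi> (fst x) (snd x)) : Bor (dtP B)"
  using predictable_dtP[OF \<psi>_pred] by (simp add: case_prod_beta')
 have HD: "sqi (dtP B) (%x. H (snd x))"
 proof -
  have "L2n (dtP B) (%x. H (snd x)) = (\<integral>\<^sup>+t. L2n P H \<partial>tm)"
   using sqi_measurable[OF H(2)] unfolding L2n_def dtP_def by (subst nn_integral_fst[symmetric]) auto
  also have "... < \<infinity>"
  proof -
   have "emeasure tm {0..T} < \<top>" unfolding less_top[symmetric] by simp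
   thus ?thesis using H(2) by (simp add: sqi_def ennreal_mult_less_top)
  qed
  finally show ?thesis using measurable_compose[OF C.snd_dtP sqi_measurable[OF H(2)]] by (simp add: sqi_def)
 qed
 have s: "sqi (dtP B) (%x. \<psi> (fst x) (snd x))"
  by (rule sqi_bound[OF sqi_add[OF sqi_abs[OF g0(2)] sqi_scale[OF HD, of K]] tm\<psi>]) (use K(1) H(3) in "auto simp: \<psi>_def")
 have I: "(%w. LINT s:{0..T}|lborel. \<psi> s w) : Bor P"
  by (rule F_imp_P[OF time_integral_adapted[OF \<psi>_pred, of T]]) (simp add: T_nonneg)
 have "L2n P (%w. LINT s:{0..T}|lborel. \<psi> s w) <= (\<integral>\<^sup>+w. ennreal T * L2n tm (%s. \<psi> s w) \<partial>P)"
  unfolding L2n_def[of P]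
 proof (rule nn_integral_mono_AE)
  show "AE w in P. ennreal ((LINT s:{0..T}|lborel. \<psi> s w)^2) <= ennreal T * L2n tm (%s. \<psi> s w)"
   using DG_slices(1)[OF s] AE_space
  proof eventually_elim
   case (elim w)
   hence q: "sqi tm (%s. \<psi> s w)" by simp
   have "(LINT s:{0..T}|lborel. \<psi> s w) = (\<integral>s. 1 * \<psi> s w \<partial>tm)" by (simp add: set_lebesgue_integral_def integral_restrict_space)
   hence "abs (LINT s:{0..T}|lborel. \<psi> s w)^2 <= (sqrt (\<integral>s. 1^2 \<partial>tm) * sqrt (\<integral>s. (\<psi> s w)^2 \<partial>tm))^2"
    using Cauchy_Schwarz_sqi[OF sqi_const[OF tm.finite_measure_axioms, of 1] q] by (intro power_mono) simp_all
   also have "... = T * (\<integral>s. (\<psi> s w)^2 \<partial>tm)"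
    using T_nonneg by (simp add: power_mult_distrib measure_restrict_space space_restrict_space)
   finally show ?case unfolding L2n_eq_integral[OF q] using T_nonneg by (simp add: ennreal_leI ennreal_mult'[symmetric])
  qed
 qed
 also have "... = ennreal T * L2n (dtP B) (%x. \<psi> (fst x) (snd x))"
  using DG_slices(2)[OF s] slice_measurable[OF sqi_measurable[OF s]] by (subst nn_integral_cmult) auto
 also have "... < \<infinity>" using s by (simp add: sqi_def ennreal_mult_less_top)
 finally have "sqi P (%w. LINT s:{0..T}|lborel. \<psi> s w)" using I by (simp add: sqi_def)
 from sqi_scale[OF this, of "exp (K * T)"] show ?thesis by (simp add: Dec_def[abs_def])
qed

context
 fixes U L A
 assumes U: "U : D2 B" and L: "C.intg L" and UH: "!!w. abs (U (\<tau> w) w) <= H w"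
  and A: "A : S2pi B" "rcll_paths B A" and eq: "AE w in P. \<forall>t\<in>{0..\<tau> w}. N U L t w + A t w = N U L (\<tau> w) w + A (\<tau> w) w"
begin

lemma \<phi>_pred: "predictable B (\<phi> U)"
proof -
 have p: "predictable B (%s w. (if \<tau> w < s then U (\<tau> w) w else 0) - Dec s w)"
  by (intro predictable_diff pred_after_stop[OF \<tau>] Dec_pred arc_at_stop_pre_sigma[OF D2_arc[OF U] \<tau>])
 show ?thesis
  by (rule predictable_cong[OF _ pred_after[OF pred_driver[OF p]]]) (auto simp: \<phi>_def)
qed

lemma \<phi>_bound: "w : \<Omega> ==> AE s in lborel. s : {0..T} --> abs (\<phi> U s w) <= \<psi> s w + K * (exp (K * s) * (LINT u:{0..s}|lborel. \<psi> u w))"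
proof (cases "w : bad")
 case False
 assume w: "w : \<Omega>"
 have D0: "0 <= Dec s w" for s
  unfolding Dec_def set_lebesgue_integral_def by (intro mult_nonneg_nonneg Bochner_Integration.integral_nonneg) (simp_all add: \<psi>_nonneg)
 show ?thesis
  using bad(4)[OF w False]
 proof eventually_elim
  case (elim s)
  show ?case
  proof
   assume s: "s : {0..T}"
   show "abs (\<phi> U s w) <= \<psi> s w + K * (exp (K * s) * (LINT u:{0..s}|lborel. \<psi> u w))"
   proof (cases "\<tau> w < s")
    case True
    have "abs (\<phi> U s w) <= abs (g0 s w) + K * abs (U (\<tau> w) w - Dec s w)" using elim s True False by (simp add: \<phi>_def)
    also have "... <= abs (g0 s w) + K * (H w + Dec s w)"
     using UH[of w] D0[of s] by (intro add_left_mono mult_left_mono[OF _ K(1)]) linarith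
    finally show ?thesis using True False by (simp add: \<psi>_def Dec_def algebra_simps)
   next
    case F: False
    thus ?thesis using D0[of s] K(1) by (simp add: \<phi>_def \<psi>_def Dec_def)
   qed
  qed
 qed
qed (simp add: \<phi>_def \<psi>_def)

lemma \<phi>_int: assumes w: "w : \<Omega>" shows "set_integrable lborel {0..T} (%s. \<phi> U s w)"
 unfolding set_integrable_def
proof (rule Bochner_Integration.integrable_bound)
 have "continuous_on {0..T} (%s. K * (exp (K * s) * (LINT u:{0..s}|lborel. \<psi> u w)))"
  by (intro continuous_intros time_integral_continuous \<psi>_int w)
 from set_integral_add(1)[OF \<psi>_int[OF w] borel_integrable_atLeastAtMost'[OF this]]
 show "integrable lborel (%s. ind {0..T} s *\<^sub>R (\<psi> s w + K * (exp (K * s) * (LINT u:{0..s}|lborel. \<psi> u w))))"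
  by (simp add: set_integrable_def)
 have "(%s. \<phi> U s w) : Bor tm"
  using predictable_dtP[OF \<phi>_pred] w by (auto simp: dtP_def dest: measurable_Pair1)
 thus "(%s. ind {0..T} s *\<^sub>R \<phi> U s w) : Bor lborel"
  by (subst (asm) borel_measurable_restrict_space_iff) auto
 show "AE s in lborel. norm (ind {0..T} s *\<^sub>R \<phi> U s w) <= norm (ind {0..T} s *\<^sub>R (\<psi> s w + K * (exp (K * s) * (LINT u:{0..s}|lborel. \<psi> u w))))"
  using \<phi>_bound[OF w] by eventually_elim (auto simp: indicator_def)
qed

lemma Dec_dominates: "w : \<Omega> ==> 0 <= r ==> r <= t ==> t <= T ==> abs (\<Phi> U t w - \<Phi> U r w) <= Dec t w - Dec r w"
 unfolding \<Phi>_def Dec_def by (intro exponential_majorant[OF \<psi>_int \<psi>_nonneg \<phi>_int \<phi>_bound K(1)])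

lemma \<Phi>_pred: "predictable B (\<Phi> U)" "arc (\<Phi> U)"
 using time_integral_predictable[OF \<phi>_pred \<phi>_int] unfolding \<Phi>_def[abs_def] by blast+

lemma \<Phi>_before: "t <= \<tau> w ==> \<Phi> U t w = 0"
proof -
 assume "t <= \<tau> w"
 hence "\<Phi> U t w = (LINT s:{0..t}|lborel. 0)" unfolding \<Phi>_def by (intro set_lebesgue_integral_cong) (auto simp: \<phi>_def)
 thus ?thesis by simp
qed

abbreviation (input) "U' \<equiv> %t w. U (min t (\<tau> w)) w - Dec t w"
abbreviation (input) "L' \<equiv> C.upto_stop L \<tau>"
abbreviation (input) "A' \<equiv> %t w. A (min t (\<tau> w)) w + (Dec t w - \<Phi> U t w)"

lemma A_arc: "arc A" "predictable B A"
 using A predictable_adapted[of A] by (auto simp: S2pi_def arc_def adapted_def)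

lemma U'_D2: "U' : D2 B"
proof (rule D2_bound[OF _ U Dec_sqi])
 show "arc U'" by (intro arc_diff arc_stopped D2_arc U \<tau> Dec_pred)
 fix t w assume w: "w : \<Omega>" and t: "t : {0..T}"
 have "abs (\<Phi> U t w - \<Phi> U 0 w) <= Dec t w - Dec 0 w" "abs (\<Phi> U T w - \<Phi> U t w) <= Dec T w - Dec t w"
  using t by (intro Dec_dominates w; simp)+
 hence "abs (Dec t w) <= abs (Dec T w)" using Dec_before[of 0 w] bst_ge[OF \<tau> w] by linarith
 hence "abs (U' t w) <= abs (U (min t (\<tau> w)) w) + abs (Dec T w)" by linarith
 thus "\<exists>s\<in>{0..T}. abs (U' t w) <= abs (U s w) + abs (Dec T w)"
  using t bst_ge[OF \<tau> w] by (intro bexI[of _ "min t (\<tau> w)"]) auto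
qed

lemma A'_S2pi: "A' : S2pi B" "arc A'"
proof -
 have Am: "w : \<Omega> ==> A 0 w = 0 & mono_on {0..T} (%t. A t w)" for w using A by (auto simp: S2pi_def)
 have p: "predictable B A'" by (intro predictable_add predictable_diff pred_arc_stopped_predictable A_arc \<tau> Dec_pred \<Phi>_pred)
 show arc: "arc A'" by (intro arc_add arc_diff arc_stopped A_arc \<tau> Dec_pred \<Phi>_pred)
 have z: "A' 0 w = 0 & mono_on {0..T} (%t. A' t w)" if w: "w : \<Omega>" for w
 proof
  note t0 = bst_ge[OF \<tau> w]
  show "A' 0 w = 0" using Am[OF w] t0 by (simp add: Dec_before \<Phi>_before min_absorb1)
  show "mono_on {0..T} (%t. A' t w)"
  proof (rule mono_onI)
   fix r s assume rs: "r : {0..T}" "s : {0..T}" "r <= s"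
   have "A (min r (\<tau> w)) w <= A (min s (\<tau> w)) w" using Am[OF w] rs t0 by (auto intro!: mono_onD[of "{0..T}" "%t. A t w"])
   moreover have "abs (\<Phi> U s w - \<Phi> U r w) <= Dec s w - Dec r w" using rs by (intro Dec_dominates w) auto
   ultimately show "A' r w <= A' s w" by linarith
  qed
 qed
 have AT: "sqi P (A T)" using A arc_measurable_P[OF A_arc(1), of T] T_nonneg by (auto simp: S2pi_def sqi_def L2n_def)
 have "sqi P (A' T)"
 proof (rule sqi_bound[OF sqi_add[OF AT sqi_scale[OF Dec_sqi, of 2]]])
  show "A' T : Bor P" by (rule arc_measurable_P[OF arc]) (simp add: T_nonneg)
  fix w assume w: "w : \<Omega>"
  note t0 = bst_ge[OF \<tau> w] bst_le[OF \<tau> w]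
  have "A 0 w <= A (\<tau> w) w" "A (\<tau> w) w <= A T w"
   by (rule mono_onD[OF conjunct2[OF Am[OF w]]]; use t0 in simp)+
  moreover have "abs (\<Phi> U T w - \<Phi> U 0 w) <= Dec T w - Dec 0 w" by (intro Dec_dominates w) (simp_all add: T_nonneg)
  ultimately show "abs (A' T w) <= abs (A T w + 2 * Dec T w)"
   using Am[OF w] t0 by (simp add: Dec_before \<Phi>_before min_absorb2)
 qed
 thus "A' : S2pi B" using p z by (simp add: S2pi_def sqi_def L2n_def)
qed

lemma J'_eq: "AE w in P. \<forall>t\<in>{0..T}. J U' L' t w = J U L (min t (\<tau> w)) w + \<Phi> U t w"
 using AE_time_slices[OF DG(2)[OF D2_dtP(1)[OF U'_D2] C.intg_until[OF L \<tau>]]] AE_time_slices[OF DG(2)[OF D2_dtP(1)[OF U] L]]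
  J_increment[OF U'_D2 C.intg_until[OF L \<tau>]] J_increment[OF U L] AE_not_in[OF bad(1)] AE_space
proof eventually_elim
 case (elim w)
 note t0 = bst_ge[OF \<tau> elim(6)] bst_le[OF \<tau> elim(6)]
 show ?case
 proof
  fix t assume t: "t : {0..T}"
  have iL: "integrable lborel (%s. ind {0..min t (\<tau> w)} s *\<^sub>R DG U L (s, w))"
   "integrable lborel (%s. ind {0..t} s *\<^sub>R DG U' L' (s, w))" "integrable lborel (%s. ind {0..t} s *\<^sub>R \<phi> U s w)"
   using set_integrable_subset[OF sqi_tm_set_integrable, of "%s. DG U L (s, w)" "{0..min t (\<tau> w)}"]
    set_integrable_subset[OF sqi_tm_set_integrable, of "%s. DG U' L' (s, w)" "{0..t}"]
    set_integrable_subset[OF \<phi>_int[OF elim(6)], of "{0..t}"] elim(3,4) t t0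
   by (auto simp: set_integrable_def)
  have "J U' L' t w = (\<integral>s. ind {0..min t (\<tau> w)} s *\<^sub>R DG U L (s, w) + ind {0..t} s *\<^sub>R \<phi> U s w \<partial>lborel)"
   unfolding J_def set_lebesgue_integral_def
  proof (rule integral_cong_AE)
   show "AE s in lborel. ind {0..t} s *\<^sub>R DG U' L' (s, w) = ind {0..min t (\<tau> w)} s *\<^sub>R DG U L (s, w) + ind {0..t} s *\<^sub>R \<phi> U s w"
    using elim(1,2)
   proof eventually_elim
    case e: (elim s)
    show ?case
    proof (cases "s : {0..t}")
     case True
     show ?thesis
     proof (cases "s <= \<tau> w")
      case True with e \<open>s : {0..t}\<close> t show ?thesis by (simp add: \<phi>_def Dec_before min_absorb1)
     next
      case False with e \<open>s : {0..t}\<close> t elim(5) show ?thesis by (simp add: \<phi>_def min_absorb2)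
     qed
    qed (auto simp: indicator_def)
   qed
  qed (use iL in auto)
  also have "... = J U L (min t (\<tau> w)) w + \<Phi> U t w"
   using iL by (simp add: J_def \<Phi>_def set_lebesgue_integral_def)
  finally show "J U' L' t w = J U L (min t (\<tau> w)) w + \<Phi> U t w" .
 qed
qed

text \<open>After \<open>\<tau>\<close> the extended process only decreases, and its noise vanishes.\<close>

lemma extended_equation: "AE w in P. \<forall>t\<in>{0..T}. N U' L' t w + A' t w = N U' L' T w + A' T w"
 using J'_eq eq C.is_int_unique[OF C.intg_until[OF L \<tau>] M[OF C.intg_until[OF L \<tau>]] C.intg_until[OF L \<tau>] C.is_int_stopped[OF L M[OF L] \<tau>] AE_I2[OF refl]]
  AE_space
proof eventually_elim
 case (elim w)
 note t0 = bst_ge[OF \<tau> elim(4)] bst_le[OF \<tau> elim(4)]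
 have e: "N U' L' t w + A' t w = N U L (\<tau> w) w + A (\<tau> w) w" if t: "t : {0..T}" for t
 proof -
  have "min t (\<tau> w) : {0..\<tau> w}" using t t0 by auto
  from bspec[OF elim(2) this] bspec[OF elim(1) t] bspec[OF elim(3) t] show ?thesis by (simp add: N_def)
 qed
 show ?case using e[of T] by (simp add: e T_nonneg)
qed

end

end

end

section \<open>Comparison up to a stopping time\<close>

text \<open>The Stieltjes measure is that of the path frozen outside \<open>[0, b]\<close>.\<close>

lemma rcll_clamp_right_cont:
 assumes a: "rcll b a" and b: "0 <= b"
 shows "continuous (at_right s) (%s. a (max 0 (min b s)))"
proof -
 have c: "continuous (at_right s) (%s. a (max 0 (min b s)))" if "\<forall>\<^sub>F r in at_right s. a (max 0 (min b r)) = a (max 0 (min b s))"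
  unfolding continuous_within by (rule tendsto_eventually[OF that])
 consider "s < 0" | "0 <= s" "s < b" | "b <= s" by linarith
 thus ?thesis
 proof cases
  case 1
  have "\<forall>\<^sub>F r in at_right s. r < 0" using 1 by (intro order_tendstoD(2)[OF tendsto_ident_at]) auto
  hence "\<forall>\<^sub>F r in at_right s. a (max 0 (min b r)) = a (max 0 (min b s))" by eventually_elim (use 1 b in simp)
  thus ?thesis by (rule c)
 next
  case 2
  have "\<forall>\<^sub>F r in at_right s. r : {s<..<b}" using 2 by (intro eventually_at_right_real)
  hence "\<forall>\<^sub>F r in at_right s. a r = a (max 0 (min b r))" by eventually_elim (use 2 in simp)
  from Lim_transform_eventually[OF rcll_right[OF a 2] this] show ?thesis using 2 by (simp add: continuous_within)
 next
  case 3
  have "\<forall>\<^sub>F r in at_right s. s < r" by (rule eventually_at_right_less)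
  hence "\<forall>\<^sub>F r in at_right s. a (max 0 (min b r)) = a (max 0 (min b s))" by eventually_elim (use 3 b in simp)
  thus ?thesis by (rule c)
 qed
qed

lemma emeasure_stieltjes:
 assumes a: "rcll b a" "mono_on {0..b} a" and r: "0 <= r" "r <= u" "u <= b"
 shows "emeasure (stieltjes b a) {r<..u} = ennreal (a u - a r)"
proof -
 have "emeasure (interval_measure (%s. a (max 0 (min b s)))) {r<..u} = ennreal (a (max 0 (min b u)) - a (max 0 (min b r)))"
  by (intro emeasure_interval_measure_Ioc r rcll_clamp_right_cont a mono_onD[OF a(2)]) (use r in auto)
 thus ?thesis using r by (simp add: stieltjes_def)
qed

context bsde begin

lemma reflected_iff:
 "reflected_solution B g \<xi> Y Z l A <-> Y : D2 B & C.intg (fld Z l) & A : S2pi B & rcll_paths B A &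
   (AE w in P. (\<forall>t\<in>{0..T}. N Y (fld Z l) t w + A t w = N Y (fld Z l) T w + A T w) & (\<forall>t\<in>{0..T}. \<xi> t w <= Y t w) & Y T w = \<xi> T w &
    (LINT t:{0<..T}|stieltjes T (%t. A t w). Lim (at_left t) (%s. Y s w) - Lim (at_left t) (%s. \<xi> s w)) = 0)"
proof (cases "Y : D2 B & C.intg (fld Z l)")
 case True
 have "AE w in P. ((\<forall>t\<in>{0..T}. Y t w = \<xi> T w + drift g Y Z l t T w - (ito_integral B Z T w - ito_integral B Z t w)
    - (jump_integral B l T w - jump_integral B l t w) + A T w - A t w & \<xi> t w <= Y t w) &
    (LINT t:{0<..T}|stieltjes T (%t. A t w). Lim (at_left t) (%s. Y s w) - Lim (at_left t) (%s. \<xi> s w)) = 0)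
  <-> ((\<forall>t\<in>{0..T}. N Y (fld Z l) t w + A t w = N Y (fld Z l) T w + A T w) & (\<forall>t\<in>{0..T}. \<xi> t w <= Y t w) & Y T w = \<xi> T w &
    (LINT t:{0<..T}|stieltjes T (%t. A t w). Lim (at_left t) (%s. Y s w) - Lim (at_left t) (%s. \<xi> s w)) = 0)"
  using backward_equation_iff[OF conjunct1[OF True] conjunct2[OF True]]
 proof eventually_elim
  case (elim w)
  have "T : {0..T}" by (simp add: T_nonneg)
  from spec[OF spec[OF bspec[OF elim this], of "\<xi> T w"], of "%t. A t w"] show ?case by blast
 qed
 from eventually_subst[OF this] show ?thesis using True by (simp add: reflected_solution_def intg_iff conj_ac)
next
 case False
 thus ?thesis by (auto simp: reflected_solution_def intg_iff)
qed

lemma arc_optional: assumes X: "arc X" shows "optional B X"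
 unfolding optional_def
proof (rule measurableI)
 fix D :: "real set" assume D: "D : sets borel"
 let ?G = "{{(t, w) : {0..T} \<times> \<Omega>. X t w : D} |X D. adapted B X & rcll_paths B X & D : sets borel}"
 have G: "?G <= Pow ({0..T} \<times> \<Omega>)" by auto
 have "(%(t, w). X t w) -` D Int space (opt_sigma B) = {(t, w) : {0..T} \<times> \<Omega>. X t w : D}"
  unfolding opt_sigma_def space_measure_of[OF G] by auto
 moreover have "... : ?G" using X D by (auto simp: arc_def)
 ultimately show "(%(t, w). X t w) -` D Int space (opt_sigma B) : sets (opt_sigma B)"
  unfolding opt_sigma_def sets_measure_of[OF G] by auto
qed auto

lemma D2_barrier: "X : D2 B ==> rcll_barrier B X"
 using arc_optional[OF D2_arc, of X] by (simp add: D2_def rcll_barrier_def)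

lemma D2_min:
 assumes X: "X : D2 B" and Y: "Y : D2 B"
 shows "(%t w. min (X t w) (Y t w)) : D2 B"
proof -
 have "sup_sq B (%t w. min (X t w) (Y t w)) <= (\<integral>\<^sup>+w. (SUP t\<in>{0..T}. ennreal ((X t w)^2)) + (SUP t\<in>{0..T}. ennreal ((Y t w)^2)) \<partial>P)"
  unfolding sup_sq_def
 proof (intro nn_integral_mono SUP_least)
  fix w t assume t: "t : {0..T}"
  have "ennreal ((min (X t w) (Y t w))^2) <= ennreal ((X t w)^2) + ennreal ((Y t w)^2)"
   by (simp add: min_def ennreal_leI flip: ennreal_plus)
  also have "... <= (SUP t\<in>{0..T}. ennreal ((X t w)^2)) + (SUP t\<in>{0..T}. ennreal ((Y t w)^2))" by (intro add_mono SUP_upper t)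
  finally show "ennreal ((min (X t w) (Y t w))^2) <= ..." .
 qed
 also have "... = sup_sq B X + sup_sq B Y"
  unfolding sup_sq_def by (rule nn_integral_add) (intro sup_sq_measurable D2_arc X Y)+
 also have "... < \<infinity>" using X Y by (simp add: D2_def)
 finally show ?thesis using arc_min[OF D2_arc[OF X] D2_arc[OF Y]] by (simp add: D2_def arc_def)
qed

lemma zero_S2pi: "(%_ _. 0) : S2pi B" "rcll_paths B (%_ _. 0)"
 by (auto simp: S2pi_def predictable_def rcll_paths_def mono_on_def)

text \<open>Comparison up to a stopping time: extended beyond \<open>\<tau>\<close> by the same decreasing process, both
 processes reflect, the larger one at itself and the smaller one at the minimum of the two.\<close>

theorem comparison:
 assumes \<tau>: "bst \<tau>" and X: "sol (%_. 0) \<tau> X L"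
  and Y: "Y : D2 B" "C.intg R" "A : S2pi B" "rcll_paths B A" "AE w in P. \<forall>t\<in>{0..\<tau> w}. N Y R t w + A t w = N Y R (\<tau> w) w + A (\<tau> w) w"
  and le: "AE w in P. X (\<tau> w) w <= Y (\<tau> w) w"
 shows "AE w in P. \<forall>t\<in>{0..\<tau> w}. X t w <= Y t w"
proof -
 \<comment> \<open>a common bound at \<open>\<tau>\<close> makes the processes decrease by the same amount afterwards\<close>
 define H where "H w = abs (X (\<tau> w) w) + abs (Y (\<tau> w) w)" for w
 have X2: "X : D2 B" and L: "C.intg L" and Xeq: "AE w in P. \<forall>t\<in>{0..\<tau> w}. N X L t w + 0 = N X L (\<tau> w) w + 0"
  using X by (auto simp: sol_def)
 have H: "H : Bor (pre_sigma \<tau>)" "sqi P H" "!!w. 0 <= H w"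
  using arc_at_stop_pre_sigma[OF D2_arc[OF X2] \<tau>] arc_at_stop_pre_sigma[OF D2_arc[OF Y(1)] \<tau>] D2_stop_sqi[OF X2 \<tau>] D2_stop_sqi[OF Y(1) \<tau>]
  by (auto simp: H_def[abs_def] intro!: borel_measurable_add borel_measurable_abs sqi_add sqi_abs)
 let ?D = "Dec \<tau> H"
 define X' where "X' t w = X (min t (\<tau> w)) w - ?D t w" for t w
 define Y' where "Y' t w = Y (min t (\<tau> w)) w - ?D t w" for t w
 define a where "a t w = 0 + (?D t w - \<Phi> \<tau> H X t w)" for t w
 define b where "b t w = A (min t (\<tau> w)) w + (?D t w - \<Phi> \<tau> H Y t w)" for t w
 have hX: "abs (X (\<tau> w) w) <= H w" and hY: "abs (Y (\<tau> w) w) <= H w" for w by (auto simp: H_def)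
 note XX = \<tau> H X2 L hX zero_S2pi Xeq
 note YY = \<tau> H Y(1,2) hY Y(3-5)
 have D2: "X' : D2 B" "Y' : D2 B" unfolding X'_def[abs_def] Y'_def[abs_def] by (rule U'_D2[OF XX], rule U'_D2[OF YY])
 have aS: "a : S2pi B" "arc a" unfolding a_def[abs_def] by (rule A'_S2pi[OF XX])+
 have bS: "b : S2pi B" "arc b" unfolding b_def[abs_def] by (rule A'_S2pi[OF YY])+
 define L' where "L' = C.upto_stop L \<tau>"
 define R' where "R' = C.upto_stop R \<tau>"
 have i: "C.intg L'" "C.intg R'" unfolding L'_def R'_def by (rule C.intg_until[OF L \<tau>], rule C.intg_until[OF Y(2) \<tau>])
 have eqX: "AE w in P. \<forall>t\<in>{0..T}. N X' L' t w + a t w = N X' L' T w + a T w"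
  unfolding X'_def[abs_def] a_def[abs_def] L'_def by (rule extended_equation[OF XX])
 have eqY: "AE w in P. \<forall>t\<in>{0..T}. N Y' R' t w + b t w = N Y' R' T w + b T w"
  unfolding Y'_def[abs_def] b_def[abs_def] R'_def by (rule extended_equation[OF YY])
 let ?m = "%t w. min (X' t w) (Y' t w)"
 have rY: "reflected_solution B g Y' Y' (%t w. R' t w None) (%t w e. R' t w (Some e)) b"
  unfolding reflected_iff fld_parts using D2(2) i bS eqY by (auto simp: arc_def set_lebesgue_integral_def)
 have rX: "reflected_solution B g ?m X' (%t w. L' t w None) (%t w e. L' t w (Some e)) a"
  unfolding reflected_iff fld_parts
 proof (intro conjI D2(1) i aS(1))
  show "rcll_paths B a" using aS(2) by (simp add: arc_def)
  show "AE w in P. (\<forall>t\<in>{0..T}. N X' L' t w + a t w = N X' L' T w + a T w) & (\<forall>t\<in>{0..T}. ?m t w <= X' t w) & X' T w = ?m T w &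
    (LINT t:{0<..T}|stieltjes T (%t. a t w). Lim (at_left t) (%s. X' s w) - Lim (at_left t) (%s. ?m s w)) = 0"
   using eqX le AE_space
  proof eventually_elim
   case (elim w)
   note t0 = bst_ge[OF \<tau> elim(3)] bst_le[OF \<tau> elim(3)]
   \<comment> \<open>\<open>a\<close> is flat up to \<open>\<tau>\<close>, and after \<open>\<tau>\<close> the process sits on its barrier\<close>
   have after: "X' s w = ?m s w" if "\<tau> w <= s" for s using that elim(2) by (simp add: X'_def Y'_def min_absorb2)
   have flat: "a s w = 0" if "s <= \<tau> w" for s using that by (simp add: a_def Dec_before[OF \<tau> H] \<Phi>_before[OF XX])
   have "emeasure (stieltjes T (%t. a t w)) {0<..\<tau> w} = ennreal (a (\<tau> w) w - a 0 w)"
    using aS elim(3) t0 by (intro emeasure_stieltjes arcD(2)) (auto simp: S2pi_def)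
   also have "... = 0" using flat t0 by simp
   finally have n: "{0<..\<tau> w} : null_sets (stieltjes T (%t. a t w))" by (auto simp: null_sets_def stieltjes_def)
   have L0: "Lim (at_left t) (%s. X' s w) = Lim (at_left t) (%s. ?m s w)" if "\<tau> w < t" for t
   proof -
    have "\<forall>\<^sub>F s in at_left t. s : {\<tau> w<..<t}" using that by (rule eventually_at_left_real)
    hence "\<forall>\<^sub>F s in at_left t. X' s w = ?m s w" by eventually_elim (use after in auto)
    thus ?thesis unfolding t2_space_class.Lim_def by (intro arg_cong[where f = The] ext tendsto_cong)
   qed
   have "(LINT t:{0<..T}|stieltjes T (%t. a t w). Lim (at_left t) (%s. X' s w) - Lim (at_left t) (%s. ?m s w)) = 0"
    unfolding set_lebesgue_integral_def
   proof (rule integral_eq_zero_AE, rule AE_I'[OF n], rule subsetI, rule ccontr)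
    fix t assume t: "t : {t\<in>space (stieltjes T (%t. a t w)). \<not> ind {0<..T} t *\<^sub>R (Lim (at_left t) (%s. X' s w) - Lim (at_left t) (%s. ?m s w)) = 0}"
     and "t \<notin> {0<..\<tau> w}"
    hence "t <= 0 \<or> \<tau> w < t" by auto
    hence "ind {0<..T} t = (0::real) \<or> Lim (at_left t) (%s. X' s w) - Lim (at_left t) (%s. ?m s w) = 0"
     unfolding right_minus_eq using L0 by (elim disj_forward) simp_all
    hence "ind {0<..T} t *\<^sub>R (Lim (at_left t) (%s. X' s w) - Lim (at_left t) (%s. ?m s w)) = 0"
     by (elim disjE) (simp_all only: scaleR_zero_left scaleR_zero_right)
    with t show False by blast
   qed
   thus ?case using elim(1) after[OF t0(2)] by (intro conjI) (assumption, simp, assumption+)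
  qed
 qed
 have "AE w in P. \<forall>t\<in>{0..T}. X' t w <= Y' t w"
  by (rule monotone[unfolded reflected_monotone_def, rule_format, of Y' ?m])
    (use D2_barrier[OF D2(2)] D2_barrier[OF D2_min[OF D2]] rX rY in auto)
 thus ?thesis
  using AE_space
 proof eventually_elim
  case (elim w)
  show ?case
  proof
   fix t assume t: "t : {0..\<tau> w}"
   hence "X' t w <= Y' t w" using elim bst_le[OF \<tau> elim(2)] by auto
   thus "X t w <= Y t w" using t by (simp add: X'_def Y'_def min_absorb1)
  qed
 qed
qed

end

section \<open>Essential suprema and hitting times\<close>

text \<open>Essential suprema of nonnegative families exist: exhaust by countable subfamilies, measuring
 them with a bounded strictly increasing transform.\<close>

lemma ess_sup_ennreal:
 fixes \<Phi> :: "('a => ennreal) set"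
 assumes "prob_space M" and \<Phi>: "\<Phi> <= Bor M"
 shows "is_ess_sup M \<Phi> (ess_sup M \<Phi>)"
proof -
 interpret prob_space M by fact
 \<comment> \<open>a strictly increasing map onto \<open>[0, 1]\<close>\<close>
 define h :: "ennreal => real" where "h x = (if x = \<top> then 1 else enn2real x / (1 + enn2real x))" for x
 have h01: "0 <= h x" "h x <= 1" for x
 proof -
  have "0 < 1 + enn2real x" using enn2real_nonneg[of x] by linarith
  thus "0 <= h x" "h x <= 1" by (auto simp: h_def)
 qed
 have h_less: "h x < h y" if "x < y" for x y
 proof -
  obtain a where a: "x = ennreal a" "0 <= a" using \<open>x < y\<close> by (cases x) auto
  show ?thesis
  proof (cases y)
   case (real b)
   hence "a < b" using that a by (simp add: ennreal_less_iff)
   thus ?thesis using a real by (simp add: h_def field_simps)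
  qed (use a in "simp add: h_def")
 qed
 have hm [measurable]: "h : Bor borel" unfolding h_def[abs_def] by measurable
 let ?C = "{C. C <= \<Phi> & countable C}"
 let ?s = "%C. \<integral>\<^sup>+x. ennreal (h (SUP f\<in>C. f x)) \<partial>M"
 have Sm: "(%x. SUP f\<in>C. f x) : Bor M" if "C : ?C" for C using that \<Phi> by (intro borel_measurable_SUP) auto
 have s_mono: "?s C <= ?s D" if "C <= D" for C D
 proof (rule nn_integral_mono, rule ennreal_leI)
  fix x have "(SUP f\<in>C. f x) <= (SUP f\<in>D. f x)" using that by (rule SUP_subset_mono) simp
  thus "h (SUP f\<in>C. f x) <= h (SUP f\<in>D. f x)" using h_less by (cases "(SUP f\<in>C. f x) = (SUP f\<in>D. f x)") (auto simp: less_le)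
 qed
 have "?C \<noteq> {}" by auto
 from ennreal_SUP_countable_SUP[OF this, of ?s] obtain S :: "nat => ennreal"
  where S: "range S <= ?s ` ?C" "(SUP C\<in>?C. ?s C) = (SUP n. S n)" by blast
 have "\<forall>n. \<exists>C. C : ?C & S n = ?s C"
 proof
  fix n have "S n : ?s ` ?C" by (rule subsetD[OF S(1)]) simp
  thus "\<exists>C. C : ?C & S n = ?s C" by (elim imageE) (intro exI conjI)
 qed
 from choice[OF this] obtain c where cc: "\<forall>n. c n : ?C & S n = ?s (c n)" by (elim exE)
 note c = conjunct1[OF spec[OF cc]] conjunct2[OF spec[OF cc]]
 let ?U = "\<Union>n. c n"
 define Z where "Z x = (SUP f\<in>?U. f x)" for x
 have "c n <= \<Phi>" "countable (c n)" for n using c(1)[of n] by simp_all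
 hence U: "?U : ?C" by (simp add: UN_subset_iff)
 have Zm: "Z : Bor M" unfolding Z_def[abs_def] by (rule Sm[OF U])
 have top: "?s D <= ?s ?U" if "D : ?C" for D
 proof -
  have "?s D <= (SUP n. S n)" unfolding S(2)[symmetric] using that by (rule SUP_upper)
  also have "... <= ?s ?U" by (rule SUP_least) (unfold c(2), rule s_mono, blast)
  finally show ?thesis .
 qed
 have "is_ess_sup M \<Phi> Z"
  unfolding is_ess_sup_def
 proof (intro conjI ballI impI Zm)
  fix f assume f: "f : \<Phi>"
  let ?V = "insert f ?U"
  have V: "?V : ?C" using U f by blast
  have VZ: "(SUP f\<in>?V. f x) = sup (f x) (Z x)" for x by (simp add: Z_def)
  have fm: "f : Bor M" using f \<Phi> by blast
  have le: "h (Z x) <= h (sup (f x) (Z x))" for x using h_less[of "Z x" "sup (f x) (Z x)"] by (cases "Z x = sup (f x) (Z x)") (auto simp: less_le)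
  have i: "integrable M (%x. h (Z x))" "integrable M (%x. h (sup (f x) (Z x)))"
   using Zm fm h01 by (auto intro!: integrable_const_bound[of _ 1])
  have "?s ?V <= ?s ?U" by (rule top[OF V])
  hence "ennreal (\<integral>x. h (sup (f x) (Z x)) \<partial>M) <= ennreal (\<integral>x. h (Z x) \<partial>M)"
   using i h01 by (simp add: VZ Z_def[symmetric] nn_integral_eq_integral del: SUP_insert)
  hence "(\<integral>x. h (sup (f x) (Z x)) \<partial>M) <= (\<integral>x. h (Z x) \<partial>M)" using h01 by (subst (asm) ennreal_le_iff) auto
  hence "(\<integral>x. h (sup (f x) (Z x)) - h (Z x) \<partial>M) = 0" using i integral_mono[OF i] le by (simp add: antisym)
  hence "AE x in M. h (sup (f x) (Z x)) - h (Z x) = 0" using i le by (subst (asm) integral_nonneg_eq_0_iff_AE) auto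
  thus "AE x in M. f x <= Z x"
  proof eventually_elim
   case (elim x)
   thus ?case using h_less[of "Z x" "f x"] by (cases "f x <= Z x") (auto simp: sup_absorb1 not_le less_imp_le)
  qed
 next
  fix Z' assume "\<forall>f\<in>\<Phi>. AE x in M. f x <= Z' x"
  hence "AE x in M. \<forall>f\<in>?U. f x <= Z' x" using U by (subst AE_ball_countable) auto
  thus "AE x in M. Z x <= Z' x" by eventually_elim (auto simp: Z_def intro: SUP_least)
 qed
 thus ?thesis unfolding ess_sup_def by (rule someI[of "is_ess_sup M \<Phi>"])
qed

lemma ess_sup_eq:
 assumes "is_ess_sup M \<Phi> Z"
 shows "AE x in M. Z x = ess_sup M \<Phi> x"
proof -
 have Z': "is_ess_sup M \<Phi> (ess_sup M \<Phi>)" unfolding ess_sup_def using assms by (rule someI[of "is_ess_sup M \<Phi>"])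
 have "AE x in M. Z x <= ess_sup M \<Phi> x" "AE x in M. ess_sup M \<Phi> x <= Z x"
  using assms Z' unfolding is_ess_sup_def by blast+
 thus ?thesis by eventually_elim simp
qed

context jbasis begin

lemma optional_at_stop:
 assumes X: "optional B X" and \<tau>: "bst \<tau>"
 shows "(%w. X (\<tau> w) w) : Bor (pre_sigma \<tau>)"
proof -
 have "(%w. (\<tau> w, w)) : measurable (pre_sigma \<tau>) (opt_sigma B)"
  unfolding opt_sigma_def
 proof (rule measurable_measure_of)
  show "(%w. (\<tau> w, w)) : space (pre_sigma \<tau>) \<rightarrow> {0..T} \<times> \<Omega>" using \<tau> by (auto simp: bst_def space_pre_sigma)
  fix G assume "G : {{(t, w) : {0..T} \<times> \<Omega>. X t w : D} |X D. adapted B X & rcll_paths B X & D : sets borel}"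
  then obtain V D where G: "G = {(t, w) : {0..T} \<times> \<Omega>. V t w : D}" and V: "arc V" "D : sets borel" by (auto simp: arc_def)
  have "(%w. (\<tau> w, w)) -` G Int space (pre_sigma \<tau>) = (%w. V (\<tau> w) w) -` D Int space (pre_sigma \<tau>)"
   using \<tau> by (auto simp: G bst_def space_pre_sigma)
  thus "(%w. (\<tau> w, w)) -` G Int space (pre_sigma \<tau>) : sets (pre_sigma \<tau>)"
   using measurable_sets[OF arc_at_stop_pre_sigma[OF V(1) \<tau>] V(2)] by simp
 qed auto
 from measurable_compose[OF this X[unfolded optional_def]] show ?thesis by simp
qed

lemma stop_times_bst: "\<tau> : stop_times B ==> bst (%w. min (\<tau> w) T)" "\<tau> : stop_times B ==> AE w in P. min (\<tau> w) T = \<tau> w"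
 by (auto simp: stop_times_def stop_def bst_def T_nonneg stopping_time_min stopping_time_const elim: eventually_mono)

lemma bst_stop_times: "bst \<tau> ==> \<tau> : stop_times B"
 by (auto simp: stop_times_def stop_def bst_def)

text \<open>A bounded stopping time is one of the candidates in the essential supremum that defines the norm.\<close>

lemma S2_bound:
 assumes X: "optional B X" and \<tau>: "bst \<tau>"
 shows "L2n P (%w. X (\<tau> w) w) <= S2_norm_sq B X"
proof -
 let ?\<Phi> = "{%w. ennreal (abs (X (\<tau> w) w)^2) |\<tau>. \<tau> : stop_times B}"
 have "(%w. X (\<sigma> w) w) : Bor P" if \<sigma>: "\<sigma> : stop_times B" for \<sigma>
 proof (rule F_imp_P[OF F_measurable_AE[OF pre_sigma_imp_FT[OF stop_times_bst(1)[OF \<sigma>] optional_at_stop[OF X stop_times_bst(1)[OF \<sigma>]]] T_nonneg]])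
  show "AE w in P. X (min (\<sigma> w) T) w = X (\<sigma> w) w" using stop_times_bst(2)[OF \<sigma>] by eventually_elim simp
 qed
 hence "?\<Phi> <= Bor P" by auto
 from ess_sup_ennreal[OF prob_space_axioms this] have "\<forall>f\<in>?\<Phi>. AE w in P. f w <= ess_sup P ?\<Phi> w" unfolding is_ess_sup_def by (elim conjE)
 moreover have "(%w. ennreal (abs (X (\<tau> w) w)^2)) : ?\<Phi>" using bst_stop_times[OF \<tau>] by blast
 ultimately have "AE w in P. ennreal (abs (X (\<tau> w) w)^2) <= ess_sup P ?\<Phi> w" by (rule bspec)
 thus ?thesis unfolding L2n_def S2_norm_sq_def by (intro nn_integral_mono_AE) simp
qed

text \<open>The first time after \<open>S\<close> at which \<open>V\<close> falls below \<open>c\<close>, and \<open>T\<close> if there is none.\<close>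

definition hit :: "(real => 'w => real) => ('w => real) => real => 'w => real" where
 "hit V S c w = Inf (insert T {t\<in>{S w..T}. V t w < c})"

text \<open>Debut of an open set by a right continuous process; rational times suffice.\<close>

lemma hit:
 assumes V: "arc V" and S: "bst S"
 shows "bst (hit V S c)" and "w : \<Omega> ==> S w <= hit V S c w"
  and "w : \<Omega> ==> S w <= t ==> t < hit V S c w ==> c <= V t w"
  and "w : \<Omega> ==> V T w <= c ==> V (hit V S c w) w <= c"
proof -
 let ?A = "%w. insert T {t\<in>{S w..T}. V t w < c}"
 have ST: "S w <= t" if "w : \<Omega>" "t : ?A w" for w t using that bst_le[OF S] by auto
 have bb: "bdd_below (?A w)" if "w : \<Omega>" for w using ST[OF that] by (rule bdd_belowI)
 show ge: "S w <= hit V S c w" if "w : \<Omega>" for w unfolding hit_def using ST[OF that] by (intro cInf_greatest) auto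
 have le: "hit V S c w <= t" if "w : \<Omega>" "t : ?A w" for w t unfolding hit_def by (rule cInf_lower[OF that(2) bb[OF that(1)]])
 have leT: "hit V S c w <= T" if "w : \<Omega>" for w by (rule le[OF that]) simp
 show "c <= V t w" if "w : \<Omega>" "S w <= t" "t < hit V S c w" for w t
  using le[of w t] leT[of w] that by (intro leI notI) auto
 have near: "\<exists>s. s : ?A w & s < t" if "w : \<Omega>" "hit V S c w < t" for w t
  using that cInf_less_iff[OF _ bb[OF that(1)], of t] unfolding hit_def by blast
 show "V (hit V S c w) w <= c" if w: "w : \<Omega>" and VT: "V T w <= c" for w
 proof (cases "hit V S c w < T")
  case True
  show ?thesis
  proof (rule ccontr)
   assume "\<not> V (hit V S c w) w <= c"
   hence c: "c < V (hit V S c w) w" by simp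
   have "\<forall>\<^sub>F s in at_right (hit V S c w). c < V s w"
    using rcll_right[OF arcD(2)[OF V w] order_trans[OF bst_ge[OF S w] ge[OF w]] True] c by (rule order_tendstoD(1))
   then obtain b where b: "hit V S c w < b" "!!s. hit V S c w < s ==> s < b ==> c < V s w"
    unfolding eventually_at_right_field by blast
   obtain s where s: "s : ?A w" "s < min b T" using near[OF w, of "min b T"] b(1) True by auto
   hence "V s w < c" "hit V S c w <= s" using le[OF w] by auto
   thus False using b(2)[of s] s(2) c by (cases "hit V S c w = s") auto
  qed
 next
  case False thus ?thesis using VT leT[OF w] by simp
 qed
 show "bst (hit V S c)"
  unfolding bst_def
 proof (intro conjI ballI)
  show "stopping_time F (hit V S c)"
  proof (rule stopping_timeI_less)
   fix t :: real assume t: "0 < t"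
   show "{w\<in>\<Omega>. hit V S c w < t} : sets (F t)"
   proof (cases "T < t")
    case True
    hence "{w\<in>\<Omega>. hit V S c w < t} = \<Omega>" using leT by force
    thus ?thesis using sets.top[of "F t"] by (simp add: space_F)
   next
    case False
    have "{w\<in>\<Omega>. hit V S c w < t} = (\<Union>q\<in>\<rat> Int {0<..<t}. {w\<in>\<Omega>. S w < q} Int {w\<in>\<Omega>. V q w < c})" (is "?l = ?r")
    proof (intro equalityI subsetI)
     fix w assume "w : ?l"
     hence w: "w : \<Omega>" and h: "hit V S c w < t" by auto
     obtain s where s: "s : ?A w" "s < t" using near[OF w h] by blast
     hence sV: "S w <= s" "V s w < c" "s < T" using False by auto
     have "\<forall>\<^sub>F r in at_right s. V r w < c"
      using rcll_right[OF arcD(2)[OF V w] order_trans[OF bst_ge[OF S w] sV(1)] sV(3)] sV(2) by (rule order_tendstoD(2))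
     then obtain b where b: "s < b" "!!r. s < r ==> r < b ==> V r w < c" unfolding eventually_at_right_field by blast
     obtain q where q: "q : \<rat>" "s < q" "q < min b t" using Rats_dense_in_real[of s "min b t"] b(1) s(2) by auto
     thus "w : ?r" using b(2)[of q] sV(1) bst_ge[OF S w] w by (intro UN_I[of q]) auto
    next
     fix w assume "w : ?r"
     then obtain q where q: "q : {0<..<t}" "w : \<Omega>" "S w < q" "V q w < c" by auto
     hence "hit V S c w <= q" using False by (intro le) auto
     with q show "w : ?l" by auto
    qed
    also have "... : sets (F t)"
    proof (intro sets.countable_UN'' sets.Int)
     fix q assume q: "q : \<rat> Int {0<..<t}"
     hence "sets (F q) <= sets (F t)" by (intro sets_F_mono) auto
     moreover have "V q : Bor (F q)" by (rule arcD(1)[OF V]) (use q False in auto)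
     hence "{w\<in>space (F q). V q w < c} : sets (F q)" by measurable
     ultimately show "{w\<in>\<Omega>. V q w < c} : sets (F t)" "{w\<in>\<Omega>. S w < q} : sets (F t)"
      using stop_less_sets[OF bst_stopping[OF S], of q] by (auto simp: space_F)
    qed (auto intro: countable_Int1 countable_rat)
    finally show ?thesis .
   qed
  qed (use ge bst_ge[OF S] in "auto intro: order_trans")
 qed (use ge leT bst_ge[OF S] in "auto intro: order_trans")
qed

end

section \<open>The value of the stopping problem\<close>

context bsde begin

text \<open>The left limits of \<open>x - y\<close> are at least \<open>c\<close> on \<open>(r, u]\<close>, also at \<open>u\<close> where \<open>x\<close> itself may have reached \<open>y\<close>; so the
 condition forces the measure of \<open>(r, u]\<close> to vanish.\<close>

lemma skorokhod_flat:
 assumes x: "rcll T x" and y: "rcll T y" and ge: "!!t. t : {0..T} ==> y t <= x t" and m: "(%t. x t - y t) : Bor tm"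
  and a: "rcll T a" "mono_on {0..T} a" and ru: "0 <= r" "r <= u" "u <= T" and c: "0 < c" "!!t. r <= t ==> t < u ==> c <= x t - y t"
  and zero: "(LINT t:{0<..T}|stieltjes T a. Lim (at_left t) x - Lim (at_left t) y) = 0"
 shows "a u = a r"
proof -
 define v where "v t = Lim (at_left t) x - Lim (at_left t) y" for t
 have v: "((%s. x s - y s) \<longlongrightarrow> v t) (at_left t)" if t: "0 < t" "t <= T" for t
 proof -
  obtain l l' where "(x \<longlongrightarrow> l) (at_left t)" "(y \<longlongrightarrow> l') (at_left t)" using rcll_left[OF x t] rcll_left[OF y t] by blast
  thus ?thesis unfolding v_def by (auto simp: tendsto_Lim intro: tendsto_diff)
 qed
 have low: "b <= v t" if t: "0 < t" "t <= T" "p < t" "!!s. 0 <= s ==> p <= s ==> s < t ==> b <= x s - y s" for b p t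
 proof (rule tendsto_lowerbound[OF v[OF t(1,2)]])
  have "\<forall>\<^sub>F s in at_left t. s : {max 0 p<..<t}" using t by (intro eventually_at_left_real) auto
  thus "\<forall>\<^sub>F s in at_left t. b <= x s - y s" by eventually_elim (use t(4) in auto)
 qed simp
 have v0: "0 <= v t" if "0 < t" "t <= T" for t by (rule low[OF that that(1)]) (use ge that in auto)
 have vc: "c <= v t" if "t : {r<..u}" for t by (rule low[of t r]) (use that ru c(2) in auto)
 obtain k where k: "!!t. t : {0..T} ==> abs (x t - y t) <= k" using rcll_bounded[OF rcll_diff[OF x y]] by blast
 have vk: "v t <= k" if t: "0 < t" "t <= T" for t
 proof (rule tendsto_upperbound[OF v[OF t]])
  have "\<forall>\<^sub>F s in at_left t. s : {0<..<t}" using t by (intro eventually_at_left_real) auto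
  thus "\<forall>\<^sub>F s in at_left t. x s - y s <= k" by eventually_elim (use k t in "force simp: abs_le_iff")
 qed simp
 let ?M = "stieltjes T a"
 have sM: "sets ?M = sets borel" by (simp add: stieltjes_def)
 let ?f = "%t. ind {0<..T} t *\<^sub>R v t"
 have fm: "?f : Bor borel"
 proof (rule borel_measurable_LIMSEQ_real)
  let ?D = "%s. ind {0..T} s *\<^sub>R (x s - y s)"
  have D: "?D : Bor borel" using m by (subst (asm) borel_measurable_restrict_space_iff) auto
  show "(%t. ind {0<..T} t *\<^sub>R ?D (t - 1 / Suc n)) : Bor borel" for n
   by (rule borel_measurable_scaleR[OF _ measurable_compose[OF _ D]]) simp_all
  fix t
  show "(%n. ind {0<..T} t *\<^sub>R ?D (t - 1 / Suc n)) ----> ?f t"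
  proof (cases "t : {0<..T}")
   case True
   have l: "filterlim (%n. t - 1 / real (Suc n)) (at_left t) sequentially"
    unfolding filterlim_at using tendsto_diff[OF tendsto_const LIMSEQ_inverse_real_of_nat, of t] by (simp add: inverse_eq_divide)
   have "\<forall>\<^sub>F s in at_left t. s : {0<..<t}" using True by (intro eventually_at_left_real) auto
   hence "\<forall>\<^sub>F s in at_left t. x s - y s = ?D s" by eventually_elim (use True in simp)
   from filterlim_compose[OF Lim_transform_eventually[OF v this] l] True show ?thesis by simp
  qed simp
 qed
 have fin: "emeasure ?M {0<..T} < \<infinity>" by (subst emeasure_stieltjes[OF a]) (auto simp: T_nonneg)
 have fM: "?f : Bor ?M" using fm by (simp add: measurable_cong_sets[OF sM refl])
 have int: "integrable ?M ?f"
 proof (rule Bochner_Integration.integrable_bound[OF _ fM])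
  show "integrable ?M (%t. ind {0<..T} t *\<^sub>R k)" using fin sM by auto
  show "AE t in ?M. norm (?f t) <= norm (ind {0<..T} t *\<^sub>R k)"
   using v0 vk by (intro AE_I2) (force simp: indicator_def)
 qed
 have "AE t in ?M. ?f t = 0"
  using zero integral_nonneg_eq_0_iff_AE[OF int] v0 by (auto simp: set_lebesgue_integral_def v_def indicator_def)
 hence "AE t in ?M. t \<notin> {r<..u}"
 proof eventually_elim
  case (elim t)
  show ?case
  proof
   assume t: "t : {r<..u}"
   hence "?f t = v t" using ru by simp
   with elim vc[OF t] c(1) show False by simp
  qed
 qed
 hence "emeasure ?M {r<..u} = 0" using sM by (subst (asm) AE_iff_measurable[of "{r<..u}"]) (auto simp: stieltjes_def)
 hence "a u <= a r" unfolding emeasure_stieltjes[OF a ru] by (simp add: ennreal_eq_0_iff)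
 moreover have "a r <= a u" by (rule mono_onD[OF a(2)]) (use ru in auto)
 ultimately show ?thesis by simp
qed

lemma barrier_D2: assumes "rcll_barrier B \<xi>" shows "\<xi> : D2 B"
proof -
 have "\<xi> t : Bor (F t)" if t: "t : {0..T}" for t
 proof -
  have b: "bst (%_. t)" using t by (intro bst_const) auto
  have "\<xi> t : Bor (pre_sigma (%_. t))" using optional_at_stop[OF _ b, of \<xi>] assms by (simp add: rcll_barrier_def)
  moreover have "sets (pre_sigma (%_. t)) <= sets (F t)"
   using sets_pre_sigmaD[OF bst_stopping[OF b], of _ t] by auto
  ultimately show ?thesis by (auto simp: measurable_def space_F space_pre_sigma)
 qed
 with assms show ?thesis by (simp add: D2_def adapted_def rcll_barrier_def)
qed

lemma g_expectation_cong:
 assumes "AE w in P. \<tau> w = \<tau>' w" "AE w in P. \<zeta> w = \<zeta>' w" "AE w in P. S w = S' w"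
 shows "AE w in P. g_expectation B g S \<tau> \<zeta> w = g_expectation B g S' \<tau>' \<zeta>' w"
proof -
 have "bsde_solution B g \<tau> \<zeta> X Z l = bsde_solution B g \<tau>' \<zeta>' X Z l" for X Z l
  unfolding bsde_solution_def by (intro conj_cong refl eventually_subst) (use assms(1,2) in "eventually_elim, simp")
 hence eq: "bsde_solution B g \<tau> \<zeta> = bsde_solution B g \<tau>' \<zeta>'" by (intro ext)
 show ?thesis using assms(3) unfolding g_expectation_def eq by eventually_elim simp
qed

end

theorem theorem4p7:
 fixes B :: "('w, 'e) basis"
  and g :: "('w, 'e) driver"
  and \<xi> :: "real \<Rightarrow> 'w \<Rightarrow> real" and \<xi>n :: "nat \<Rightarrow> real \<Rightarrow> 'w \<Rightarrow> real"
  and Y :: "real \<Rightarrow> 'w \<Rightarrow> real"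
  and Yn Zn An :: "nat \<Rightarrow> real \<Rightarrow> 'w \<Rightarrow> real"
  and ln :: "nat \<Rightarrow> real \<Rightarrow> 'w \<Rightarrow> 'e \<Rightarrow> real"
  and S :: "'w \<Rightarrow> real"
 assumes basis: "jump_basis B"
  and driver: "lipschitz_driver B g"
  and solvable: "bsde_solvable B g"
  and monotone: "reflected_monotone B g"
  and xi_S2: "\<xi> \<in> S2 B"
  and xi_rusc: "right_usc B \<xi>"
  and barrier: "\<And>n. rcll_barrier B (\<xi>n n)"
  and barrier_decreasing:
   "\<And>n. AE \<omega> in prb B. \<forall>t\<in>{0..hor B}. \<xi>n (Suc n) t \<omega> \<le> \<xi>n n t \<omega>"
  and barrier_ge: "\<And>n. AE \<omega> in prb B. \<forall>t\<in>{0..hor B}. \<xi> t \<omega> \<le> \<xi>n n t \<omega>"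
  and barrier_lim: "AE \<omega> in prb B. \<forall>t\<in>{0..hor B}. (\<lambda>n. \<xi>n n t \<omega>) \<longlonglongrightarrow> \<xi> t \<omega>"
  and barrier_S2_lim: "(\<lambda>n. S2_norm_sq B (\<lambda>t \<omega>. \<xi>n n t \<omega> - \<xi> t \<omega>)) \<longlonglongrightarrow> 0"
  and reflected: "\<And>n. reflected_solution B g (\<xi>n n) (Yn n) (Zn n) (ln n) (An n)"
  and Y_lim: "AE \<omega> in prb B. \<forall>t\<in>{0..hor B}. (\<lambda>n. Yn n t \<omega>) \<longlonglongrightarrow> Y t \<omega>"
  and Y_measurable: "(\<lambda>(t, \<omega>). Y t \<omega>)
   \<in> borel_measurable (restrict_space borel {0..hor B} \<Otimes>\<^sub>M flt B (hor B))"
  and Y_L2_lim: "(\<lambda>n. \<integral>\<^sup>+ (t, \<omega>). ennreal ((Yn n t \<omega> - Y t \<omega>)\<^sup>2) \<partial>dtP B) \<longlonglongrightarrow> 0"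
  and S: "S \<in> stop_times B"
 shows "AE \<omega> in prb B. ereal (Y (S \<omega>) \<omega>) =
  ess_sup (prb B)
   {\<lambda>\<omega>. ereal (g_expectation B g S \<tau> (\<lambda>\<omega>. \<xi> (\<tau> \<omega>) \<omega>) \<omega>) |\<tau>. \<tau> \<in> stop_from B S} \<omega>"
proof -
 interpret jbasis B by unfold_locales (rule basis)
 interpret bsde B g by unfold_locales (rule driver solvable monotone)+
 let ?R = "%n. fld (Zn n) (ln n)"
 have Yn: "Yn n : D2 B" "C.intg (?R n)" "An n : S2pi B" "rcll_paths B (An n)"
  and path: "AE w in P. (\<forall>t\<in>{0..T}. N (Yn n) (?R n) t w + An n t w = N (Yn n) (?R n) T w + An n T w) &
    (\<forall>t\<in>{0..T}. \<xi>n n t w <= Yn n t w) & Yn n T w = \<xi>n n T w &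
    (LINT t:{0<..T}|stieltjes T (%t. An n t w). Lim (at_left t) (%s. Yn n s w) - Lim (at_left t) (%s. \<xi>n n s w)) = 0" for n
  using reflected[of n] unfolding reflected_iff by blast+
 have \<xi>n: "\<xi>n n : D2 B" for n by (rule barrier_D2[OF barrier])
 have opt: "optional B \<xi>" using xi_S2 by (simp add: S2_def)
 have optd: "optional B (%t w. \<xi>n n t w - \<xi> t w)" for n
 proof -
  have "(%(t, w). \<xi>n n t w) : Bor (opt_sigma B)" using barrier[of n] by (simp add: rcll_barrier_def optional_def)
  from borel_measurable_diff[OF this opt[unfolded optional_def]] show ?thesis by (simp add: optional_def case_prod_beta')
 qed
 have \<xi>: "(%w. \<xi> (\<tau> w) w) : Bor (pre_sigma \<tau>)" "sqi P (%w. \<xi> (\<tau> w) w)" if "bst \<tau>" for \<tau>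
  using optional_at_stop[OF opt that] pre_sigma_imp_P[OF that optional_at_stop[OF opt that]] S2_bound[OF opt that] xi_S2
  by (auto simp: sqi_def S2_def intro: le_less_trans)
 define \<sigma> where "\<sigma> w = min (S w) T" for w
 have \<sigma>: "bst \<sigma>" "AE w in P. S w = \<sigma> w" unfolding \<sigma>_def[abs_def] using stop_times_bst[OF S] by (auto elim: eventually_mono)
 have Ym: "(%w. Y (\<sigma> w) w) : Bor P"
 proof (rule F_imp_P)
  have "(%w. (\<sigma> w, w)) : measurable (F T) (restrict_space borel {0..T} \<otimes> F T)"
  proof (intro measurable_Pair measurable_ident measurable_restrict_space2)
   show "\<sigma> : Bor (F T)"
    by (rule iffD1[OF measurable_cong min_stop_measurable[OF bst_stopping[OF \<sigma>(1)], of T]])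
      (use \<sigma>(1) in "auto simp: bst_def space_F min_absorb2")
  qed (use \<sigma>(1) in "auto simp: bst_def space_F")
  from measurable_compose[OF this Y_measurable] show "(%w. Y (\<sigma> w) w) : Bor (F T)" by simp
 qed
 text \<open>Every candidate lies below \<open>Y\<close>, by comparison with each \<open>Y\<^sup>n\<close>.\<close>
 have upper: "AE w in P. X (\<sigma> w) w <= Y (\<sigma> w) w"
  if \<tau>: "bst \<tau>" "!!w. w : \<Omega> ==> \<sigma> w <= \<tau> w" and X: "solves \<tau> (%w. \<xi> (\<tau> w) w) X L" for \<tau> X L
 proof -
  have "AE w in P. X (\<sigma> w) w <= Yn n (\<sigma> w) w" for n
  proof -
   have "AE w in P. X (\<tau> w) w = \<xi> (\<tau> w) w" using X by (simp add: solves_def)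
   hence le: "AE w in P. X (\<tau> w) w <= Yn n (\<tau> w) w"
    using path[of n] barrier_ge[of n] AE_space
   proof eventually_elim
    case (elim w)
    have t: "\<tau> w : {0..T}" using \<tau>(1) elim(4) by (simp add: bst_def)
    show ?case using elim(1) bspec[OF elim(3) t] bspec[OF conjunct1[OF conjunct2[OF elim(2)]] t] by linarith
   qed
   have eq: "AE w in P. \<forall>t\<in>{0..\<tau> w}. N (Yn n) (?R n) t w + An n t w = N (Yn n) (?R n) (\<tau> w) w + An n (\<tau> w) w"
    using path[of n] AE_space
   proof eventually_elim
    case (elim w)
    note e = bspec[OF conjunct1[OF elim(1)]]
    show ?case
    proof
     fix t assume t: "t : {0..\<tau> w}"
     hence "t : {0..T}" "\<tau> w : {0..T}" using bst_le[OF \<tau>(1) elim(2)] by auto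
     from e[OF this(1)] e[OF this(2)] show "N (Yn n) (?R n) t w + An n t w = N (Yn n) (?R n) (\<tau> w) w + An n (\<tau> w) w"
      by (rule trans[OF _ sym])
    qed
   qed
   have "sol (%_. 0) \<tau> X L" using X by (simp add: solves_def)
   from comparison[of \<tau> X L "Yn n" "?R n" "An n", OF \<tau>(1) this Yn eq le]
   have "AE w in P. \<forall>t\<in>{0..\<tau> w}. X t w <= Yn n t w" .
   thus ?thesis using AE_space by eventually_elim (use \<tau> \<sigma>(1) in "simp add: bst_def")
  qed
  hence "AE w in P. \<forall>n. X (\<sigma> w) w <= Yn n (\<sigma> w) w" by (simp add: AE_all_countable)
  thus ?thesis using Y_lim AE_space
  proof eventually_elim
   case (elim w)
   have "\<sigma> w : {0..T}" using \<sigma>(1) elim(3) by (simp add: bst_def)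
   from LIMSEQ_le_const[OF bspec[OF elim(2) this]] elim(1) show ?case by blast
  qed
 qed
 let ?\<Phi> = "{%w. ereal (g_expectation B g S \<tau> (%w. \<xi> (\<tau> w) w) w) |\<tau>. \<tau> : stop_from B S}"
 text \<open>Conversely \<open>Y\<^sup>n\<close> solves the equation without reflection until it is \<open>1/(n+1)\<close>-close to its
  barrier; the stopping times obtained in this way are asymptotically optimal.\<close>
 define c where "c n = 1 / real (Suc n)" for n
 have c: "0 < c n" for n by (simp add: c_def)
 define \<rho> where "\<rho> n = hit (%t w. Yn n t w - \<xi>n n t w) \<sigma> (c n)" for n
 have V: "arc (%t w. Yn n t w - \<xi>n n t w)" for n by (rule D2_diff[OF Yn(1) \<xi>n])
 have \<rho>: "bst (\<rho> n)" "w : \<Omega> ==> \<sigma> w <= \<rho> n w" for n w unfolding \<rho>_def by (rule hit(1,2)[OF V \<sigma>(1)])+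
 have "\<forall>n. \<exists>X L. solves (\<rho> n) (%w. \<xi> (\<rho> n w) w) X L" by (intro allI solvable_at_stop \<rho> \<xi>)
 then obtain X L where X: "!!n. solves (\<rho> n) (%w. \<xi> (\<rho> n w) w) (X n) (L n)" by metis
 have solX: "sol \<sigma> (\<rho> n) (X n) (L n)" for n
  using X[of n] bst_ge[OF \<sigma>(1)] by (auto simp: solves_def intro: sol_restrict)
 have near: "AE w in P. abs (Yn n (\<rho> n w) w - \<xi>n n (\<rho> n w) w) <= c n & (\<forall>t\<in>{\<sigma> w..\<rho> n w}. N (Yn n) (?R n) t w = N (Yn n) (?R n) (\<rho> n w) w)" for n
  using path[of n] AE_space
 proof eventually_elim
  case (elim w)
  note w = elim(2)
  note p = bspec[OF conjunct1[OF elim(1)]] bspec[OF conjunct1[OF conjunct2[OF elim(1)]]]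
   conjunct1[OF conjunct2[OF conjunct2[OF elim(1)]]] conjunct2[OF conjunct2[OF conjunct2[OF elim(1)]]]
  have t0: "0 <= \<sigma> w" "\<sigma> w <= \<rho> n w" "\<rho> n w <= T" using bst_ge[OF \<sigma>(1) w] \<rho>(2)[OF w] bst_le[OF \<rho>(1) w] by auto
  have le1: "Yn n (\<rho> n w) w - \<xi>n n (\<rho> n w) w <= c n"
   unfolding \<rho>_def by (rule hit(4)[OF V \<sigma>(1) w]) (use p(3) c[of n] in simp)
  have le2: "\<xi>n n (\<rho> n w) w <= Yn n (\<rho> n w) w" by (rule p(2)) (use t0 in auto)
  have Ar: "rcll T (%t. An n t w)" "mono_on {0..T} (%t. An n t w)" using Yn(3,4)[of n] w by (auto simp: rcll_paths_def S2pi_def)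
  have flat: "An n (\<rho> n w) w = An n (\<sigma> w) w"
  proof (rule skorokhod_flat[OF arcD(2)[OF D2_arc[OF Yn(1)] w] arcD(2)[OF D2_arc[OF \<xi>n] w] p(2) _ Ar t0 c _ p(4)])
   show "(%t. Yn n t w - \<xi>n n t w) : Bor tm"
    using arc_dtP[OF V] w by (auto simp: dtP_def dest: measurable_Pair1)
   show "c n <= Yn n t w - \<xi>n n t w" if "\<sigma> w <= t" "t < \<rho> n w" for t
    using hit(3)[OF V \<sigma>(1) w that(1)] that(2) by (simp add: \<rho>_def)
  qed
  have eqN: "\<forall>t\<in>{\<sigma> w..\<rho> n w}. N (Yn n) (?R n) t w = N (Yn n) (?R n) (\<rho> n w) w"
  proof
   fix t assume t: "t : {\<sigma> w..\<rho> n w}"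
   have "An n (\<sigma> w) w <= An n t w" "An n t w <= An n (\<rho> n w) w" by (rule mono_onD[OF Ar(2)]; use t t0 in simp)+
   moreover have "t : {0..T}" "\<rho> n w : {0..T}" using t t0 by auto
   from p(1)[OF this(1)] p(1)[OF this(2)]
   have "N (Yn n) (?R n) t w + An n t w = N (Yn n) (?R n) (\<rho> n w) w + An n (\<rho> n w) w" by (rule trans[OF _ sym])
   ultimately show "N (Yn n) (?R n) t w = N (Yn n) (?R n) (\<rho> n w) w" using flat by linarith
  qed
  have le: "abs (Yn n (\<rho> n w) w - \<xi>n n (\<rho> n w) w) <= c n" using le1 le2 by linarith
  show ?case by (rule conjI[OF eqN le] conjI[OF le eqN])
 qed
 have solY: "sol \<sigma> (\<rho> n) (Yn n) (?R n)" for n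
  using near[of n] Yn(1,2)[of n] unfolding sol_def by (auto elim: eventually_mono)
 let ?d = "%n w. Yn n (\<sigma> w) w - X n (\<sigma> w) w"
 let ?b = "%n. ennreal (4 ^ cells) * (2 * ennreal ((c n)^2) + 2 * S2_norm_sq B (%t w. \<xi>n n t w - \<xi> t w))"
 have dsq: "sqi P (?d n)" for n by (intro sqi_diff sol_stop_sqi[OF solY] sol_stop_sqi[OF solX] \<sigma>)
 have d_le: "L2n P (?d n) <= ?b n" for n
 proof -
  have e: "sqi P (%w. Yn n (\<rho> n w) w - X n (\<rho> n w) w)" by (intro sqi_diff sol_stop_sqi[OF solY] sol_stop_sqi[OF solX] \<rho>)
  have "L2n P (?d n) <= ennreal (4 ^ cells) * L2n P (%w. Yn n (\<rho> n w) w - X n (\<rho> n w) w)"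
   unfolding L2n_eq_integral[OF dsq] L2n_eq_integral[OF e]
   using global_stability[OF solY solX \<sigma>(1) \<rho>] by (subst ennreal_mult'[symmetric]) (simp_all add: ennreal_leI)
  also have "L2n P (%w. Yn n (\<rho> n w) w - X n (\<rho> n w) w) = L2n P (%w. Yn n (\<rho> n w) w - \<xi> (\<rho> n w) w)"
   using X[of n] unfolding solves_def by (intro L2n_cong_AE) (auto elim: eventually_mono)
  also have "... <= 2 * L2n P (%w. Yn n (\<rho> n w) w - \<xi>n n (\<rho> n w) w) + 2 * L2n P (%w. \<xi>n n (\<rho> n w) w - \<xi> (\<rho> n w) w)"
   by (intro L2n_triangle sqi_measurable D2_stop_sqi Yn \<xi>n \<xi> \<rho>)
  also have "... <= 2 * ennreal ((c n)^2) + 2 * S2_norm_sq B (%t w. \<xi>n n t w - \<xi> t w)"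
  proof (intro add_mono mult_left_mono)
   have "L2n P (%w. Yn n (\<rho> n w) w - \<xi>n n (\<rho> n w) w) <= L2n P (%_. c n)"
    using near[of n] c[of n] by (intro L2n_mono_AE) (auto elim: eventually_mono)
   thus "L2n P (%w. Yn n (\<rho> n w) w - \<xi>n n (\<rho> n w) w) <= ennreal ((c n)^2)" by (simp add: L2n_def emeasure_space_1)
   show "L2n P (%w. \<xi>n n (\<rho> n w) w - \<xi> (\<rho> n w) w) <= S2_norm_sq B (%t w. \<xi>n n t w - \<xi> t w)"
    by (rule S2_bound[OF optd \<rho>(1)])
  qed simp_all
  finally show ?thesis by (simp add: mult_left_mono)
 qed
 have lim: "(%n. L2n P (?d n)) ----> 0"
 proof (rule tendsto_sandwich[OF _ _ tendsto_const])
  have c0: "c ----> 0" unfolding c_def[abs_def] using LIMSEQ_inverse_real_of_nat by (simp add: inverse_eq_divide)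
  have "(%n. (c n)^2) ----> 0^2" by (rule tendsto_power[OF c0])
  from tendsto_ennrealI[OF this] have "(%n. ennreal ((c n)^2)) ----> 0" by simp
  hence "?b ----> ennreal (4 ^ cells) * (2 * 0 + 2 * 0)"
   by (intro ennreal_tendsto_cmult tendsto_add barrier_S2_lim) simp_all
  thus "?b ----> 0" by simp
 qed (simp_all add: d_le)
 obtain r where r: "strict_mono r" "AE w in P. (%k. ?d (r k) w) ----> 0"
  using L2n_AE_subseq[of ?d P] dsq lim by (auto simp: sqi_def)
 have lower: "AE w in P. ereal (Y (\<sigma> w) w) <= Z w" if Z: "\<forall>f\<in>?\<Phi>. AE w in P. f w <= Z w" for Z
 proof -
  have "AE w in P. ereal (X n (\<sigma> w) w) <= Z w" for n
  proof -
   have "\<rho> n : stop_from B S"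
    using \<rho>(1)[of n] \<sigma>(2) AE_space \<rho>(2)[of _ n]
    by (auto simp: stop_from_def stop_def bst_def elim!: eventually_elim2)
   hence "(%w. ereal (g_expectation B g S (\<rho> n) (%w. \<xi> (\<rho> n w) w) w)) : ?\<Phi>" by (intro CollectI exI[of _ "\<rho> n"] conjI refl)
   from bspec[OF Z this] have "AE w in P. ereal (g_expectation B g S (\<rho> n) (%w. \<xi> (\<rho> n w) w) w) <= Z w" .
   moreover have "AE w in P. g_expectation B g \<sigma> (\<rho> n) (%w. \<xi> (\<rho> n w) w) w = X n (\<sigma> w) w"
    by (rule g_expectation_eq[OF \<sigma>(1) \<rho>(1) _ X]) (rule \<rho>(2))
   ultimately show ?thesis
    using g_expectation_cong[OF AE_I2[OF refl] AE_I2[OF refl] \<sigma>(2), of "\<rho> n" "%w. \<xi> (\<rho> n w) w"]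
    by eventually_elim simp
  qed
  hence "AE w in P. \<forall>n. ereal (X n (\<sigma> w) w) <= Z w" by (simp add: AE_all_countable)
  thus ?thesis using r(2) Y_lim AE_space
  proof eventually_elim
   case (elim w)
   have "\<sigma> w : {0..T}" using \<sigma>(1) elim(4) by (simp add: bst_def)
   from tendsto_diff[OF LIMSEQ_subseq_LIMSEQ[OF bspec[OF elim(3) this] r(1)] elim(2)]
   have "(%k. X (r k) (\<sigma> w) w) ----> Y (\<sigma> w) w" by (simp add: o_def)
   hence "(%k. ereal (X (r k) (\<sigma> w) w)) ----> ereal (Y (\<sigma> w) w)" by simp
   from LIMSEQ_le_const2[OF this] elim(1) show ?case by blast
  qed
 qed
 have "is_ess_sup P ?\<Phi> (%w. ereal (Y (\<sigma> w) w))"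
  unfolding is_ess_sup_def
 proof (intro conjI ballI impI lower)
  show "(%w. ereal (Y (\<sigma> w) w)) : Bor P" using Ym by measurable
  fix f assume "f : ?\<Phi>"
  then obtain \<tau> where f: "f = (%w. ereal (g_expectation B g S \<tau> (%w. \<xi> (\<tau> w) w) w))" and \<tau>: "\<tau> : stop_from B S" by blast
  hence st: "\<tau> : stop_times B" by (auto simp: stop_from_def stop_times_def elim: eventually_mono)
  let ?t = "%w. max (min (\<tau> w) T) (\<sigma> w)"
  have t: "bst ?t" by (rule bst_max[OF stop_times_bst(1)[OF st] \<sigma>(1)])
  have "AE w in P. S w <= \<tau> w" using \<tau> by (auto simp: stop_from_def elim: eventually_mono)
  hence te: "AE w in P. \<tau> w = ?t w"
   using \<sigma>(2) stop_times_bst(2)[OF st] by eventually_elim simp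
  hence xe: "AE w in P. \<xi> (\<tau> w) w = \<xi> (?t w) w"
  proof eventually_elim
   case (elim w) thus ?case by (rule arg_cong[of _ _ "%t. \<xi> t w"])
  qed
  obtain X' L' where X': "solves ?t (%w. \<xi> (?t w) w) X' L'" using solvable_at_stop[OF t \<xi>[OF t]] by blast
  have ge: "\<sigma> w <= ?t w" for w by simp
  have "AE w in P. X' (\<sigma> w) w <= Y (\<sigma> w) w" by (rule upper[OF t ge X'])
  moreover have "AE w in P. g_expectation B g \<sigma> ?t (%w. \<xi> (?t w) w) w = X' (\<sigma> w) w"
   by (rule g_expectation_eq[OF \<sigma>(1) t ge X'])
  ultimately show "AE w in P. f w <= ereal (Y (\<sigma> w) w)"
   using g_expectation_cong[OF te xe \<sigma>(2)] unfolding f by eventually_elim simp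
 qed (drule (1) bspec)
 from ess_sup_eq[OF this] \<sigma>(2) show ?thesis by eventually_elim simp
qed

end
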